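(* Let $A$ be a separable algebra over a field $\Bbbk$, viewed as a Frobenius algebra with respect to its reduced trace form. The Nakayama Jacobian of every algebra automorphism of $A$ is $1$.
   Context: Algebras are associative and unital over $\Bbbk$. A finite-dimensional algebra $A$ is separable if $K\otimes_\Bbbk A$ is semisimple for every field extension $K/\Bbbk$. For such $A$ there are a finite separable extension $E/\Bbbk$, positive integers $r,m_1,\dots,m_r$, and an isomorphism of $E$-algebras $\phi:E\otimes_\Bbbk A\to\prod_{i=1}^rM_{m_i}(E)$. For $a\in A$ the sum of the traces of the components of $\phi(1\otimes a)$ lies in $\Bbbk$ and is independent of the choices of $E$ and $\phi$; it is the reduced trace $\mathrm{trd}(a)\in\Bbbk$. The reduced trace form $\langle a,b\rangle_{\mathrm{trd}}=\mathrm{trd}(ab)$ on $A$ is non-degenerate, associative and symmetric. The Nakayama Jacobian of an algebra automorphism $u:A\to A$ with respect to a non-degenerate associative bilinear form $\langle-,-\rangle$ on $A$ is the unique element $j\in A$ such that $\langle u(a),u(b)\rangle=\langle j\cdot a,b\rangle$ for all $a,b\in A$; here the form is the reduced trace form. *)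

theory Defs
  imports "HOL-Algebra.Algebra" "HOL-Library.Poly_Mapping"
begin

text \<open>
  HOL-Algebra's locale \<open>algebra\<close> only covers commutative algebras.
\<close>

locale unital_algebra = field k + module k A + A?: ring A
  for k (structure) and A (structure) +
  assumes smult_mult_left:
      "\<lbrakk>c \<in> carrier k; x \<in> carrier A; y \<in> carrier A\<rbrakk>
        \<Longrightarrow> (c \<odot>\<^bsub>A\<^esub> x) \<otimes>\<^bsub>A\<^esub> y = c \<odot>\<^bsub>A\<^esub> (x \<otimes>\<^bsub>A\<^esub> y)"
    and smult_mult_right:
      "\<lbrakk>c \<in> carrier k; x \<in> carrier A; y \<in> carrier A\<rbrakk>
        \<Longrightarrow> x \<otimes>\<^bsub>A\<^esub> (c \<odot>\<^bsub>A\<^esub> y) = c \<odot>\<^bsub>A\<^esub> (x \<otimes>\<^bsub>A\<^esub> y)"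

definition finite_dimensional ::
    "('k, 'x) ring_scheme \<Rightarrow> ('k, 'a, 'y) module_scheme \<Rightarrow> bool" where
  "finite_dimensional k A \<longleftrightarrow>
    (\<exists>S. finite S \<and> S \<subseteq> carrier A \<and>
      (\<forall>x\<in>carrier A. \<exists>c\<in>S \<rightarrow> carrier k. x = (\<Oplus>\<^bsub>A\<^esub>s\<in>S. c s \<odot>\<^bsub>A\<^esub> s)))"

definition algebra_iso ::
    "('k, 'x) ring_scheme \<Rightarrow> ('k, 'a, 'y) module_scheme \<Rightarrow> ('k, 'b, 'z) module_scheme
      \<Rightarrow> ('a \<Rightarrow> 'b) set" where
  "algebra_iso k A B =
    {h \<in> ring_iso A B. \<forall>c\<in>carrier k. \<forall>x\<in>carrier A. h (c \<odot>\<^bsub>A\<^esub> x) = c \<odot>\<^bsub>B\<^esub> h x}"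


definition left_ideal :: "'a set \<Rightarrow> ('a, 'x) ring_scheme \<Rightarrow> bool" where
  "left_ideal I R \<longleftrightarrow>
    additive_subgroup I R \<and> (\<forall>r\<in>carrier R. \<forall>x\<in>I. r \<otimes>\<^bsub>R\<^esub> x \<in> I)"

text \<open>
  The regular left module is semisimple: each of its submodules is a direct summand.
\<close>

definition semisimple_ring :: "('a, 'x) ring_scheme \<Rightarrow> bool" where
  "semisimple_ring R \<longleftrightarrow>
    (\<forall>I. left_ideal I R \<longrightarrow>
      (\<exists>J. left_ideal J R \<and> I \<inter> J = {\<zero>\<^bsub>R\<^esub>} \<and> I <+>\<^bsub>R\<^esub> J = carrier R))"


text \<open>
  An extension of \<open>k\<close> is a field \<open>K\<close> together with a homomorphism \<open>\<iota>\<close> from \<open>k\<close> to \<open>K\<close>.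
  Quantification over field extensions of \<open>k\<close> has to be confined to a type of possible
  elements. The type below is the one in which HOL-Algebra constructs the algebraic closure
  of \<open>k\<close>, so up to isomorphism every algebraic extension of \<open>k\<close> has its carrier in it.
  This loses nothing: a finite-dimensional algebra that becomes semisimple over the algebraic
  closure becomes semisimple over every field extension, and the extensions entering the
  reduced trace are finite.
\<close>

type_synonym 'k ext_elem = "('k list \<times> nat) multiset \<Rightarrow> 'k"

definition field_extension ::
    "('k, 'x) ring_scheme \<Rightarrow> ('e, 'y) ring_scheme \<Rightarrow> ('k \<Rightarrow> 'e) \<Rightarrow> bool" where
  "field_extension k K \<iota> \<longleftrightarrow> field k \<and> field K \<and> \<iota> \<in> ring_hom k K"

text \<open>
  In HOL-Algebra polynomials are lists of coefficients with the leading coefficient first.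
\<close>

definition formal_deriv :: "('a, 'x) ring_scheme \<Rightarrow> 'a list \<Rightarrow> 'a list" where
  "formal_deriv R p =
    ring.normalize R (map (\<lambda>i. add_pow R i (ring.coeff R p i)) (rev [1..<length p]))"

definition separable_poly :: "('a, 'x) ring_scheme \<Rightarrow> 'a set \<Rightarrow> 'a list \<Rightarrow> bool" where
  "separable_poly R F p \<longleftrightarrow> \<one>\<^bsub>F[X]\<^bsub>R\<^esub>\<^esub> gcdof\<^bsub>F[X]\<^bsub>R\<^esub>\<^esub> p (formal_deriv R p)"

definition finite_separable_extension ::
    "('k, 'x) ring_scheme \<Rightarrow> ('e, 'y) ring_scheme \<Rightarrow> ('k \<Rightarrow> 'e) \<Rightarrow> bool" where
  "finite_separable_extension k E \<iota> \<longleftrightarrow>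
    field_extension k E \<iota> \<and>
    ring.finite_dimension E (\<iota> ` carrier k) (carrier E) \<and>
    (\<forall>x\<in>carrier E. separable_poly E (\<iota> ` carrier k) (ring.Irr E (\<iota> ` carrier k) x))"


definition monoid_ring :: "('m, 'x) monoid_scheme \<Rightarrow> ('m \<Rightarrow>\<^sub>0 int) ring" where
  "monoid_ring M =
    \<lparr>carrier = {f. Poly_Mapping.keys f \<subseteq> carrier M},
     monoid.mult = (\<lambda>f g. frag_extend (\<lambda>p. frag_extend (\<lambda>q. frag_of (p \<otimes>\<^bsub>M\<^esub> q)) g) f),
     one = frag_of \<one>\<^bsub>M\<^esub>,
     ring.zero = 0,
     add = (+)\<rparr>"

text \<open>
  The tensor product of \<open>K\<close> and \<open>A\<close> over \<open>k\<close> is the free abelian group on the pairs \<open>(x, a)\<close>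
  modulo the relations of biadditivity and \<open>k\<close>-balancedness, with multiplication induced by
  \<open>(x, a) (y, b) = (x y, a b)\<close>. The free abelian group with this multiplication is the monoid
  ring of the product of the multiplicative monoids. The subgroup generated by the relations is
  already an ideal there. Scalars act on the left factor.
\<close>

definition tensor_relations ::
    "('k, 'x) ring_scheme \<Rightarrow> ('k, 'a, 'y) module_scheme \<Rightarrow> ('e, 'z) ring_scheme \<Rightarrow> ('k \<Rightarrow> 'e)
      \<Rightarrow> ('e \<times> 'a \<Rightarrow>\<^sub>0 int) set" where
  "tensor_relations k A K \<iota> =
    {frag_of (x \<oplus>\<^bsub>K\<^esub> y, a) - frag_of (x, a) - frag_of (y, a) | x y a.
      x \<in> carrier K \<and> y \<in> carrier K \<and> a \<in> carrier A} \<union>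
    {frag_of (x, a \<oplus>\<^bsub>A\<^esub> b) - frag_of (x, a) - frag_of (x, b) | x a b.
      x \<in> carrier K \<and> a \<in> carrier A \<and> b \<in> carrier A} \<union>
    {frag_of (x \<otimes>\<^bsub>K\<^esub> \<iota> c, a) - frag_of (x, c \<odot>\<^bsub>A\<^esub> a) | x c a.
      x \<in> carrier K \<and> c \<in> carrier k \<and> a \<in> carrier A}"

definition tensor_ideal ::
    "('k, 'x) ring_scheme \<Rightarrow> ('k, 'a, 'y) module_scheme \<Rightarrow> ('e, 'z) ring_scheme \<Rightarrow> ('k \<Rightarrow> 'e)
      \<Rightarrow> ('e \<times> 'a \<Rightarrow>\<^sub>0 int) set" where
  "tensor_ideal k A K \<iota> = Idl\<^bsub>monoid_ring (K \<times>\<times> A)\<^esub> (tensor_relations k A K \<iota>)"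

definition pure_tensor ::
    "('k, 'x) ring_scheme \<Rightarrow> ('k, 'a, 'y) module_scheme \<Rightarrow> ('e, 'z) ring_scheme \<Rightarrow> ('k \<Rightarrow> 'e)
      \<Rightarrow> 'e \<Rightarrow> 'a \<Rightarrow> ('e \<times> 'a \<Rightarrow>\<^sub>0 int) set" where
  "pure_tensor k A K \<iota> x a = tensor_ideal k A K \<iota> +>\<^bsub>monoid_ring (K \<times>\<times> A)\<^esub> frag_of (x, a)"

definition scalar_extension ::
    "('k, 'x) ring_scheme \<Rightarrow> ('k, 'a, 'y) module_scheme \<Rightarrow> ('e, 'z) ring_scheme \<Rightarrow> ('k \<Rightarrow> 'e)
      \<Rightarrow> ('e, ('e \<times> 'a \<Rightarrow>\<^sub>0 int) set) module" where
  "scalar_extension k A K \<iota> =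
    (let Q = monoid_ring (K \<times>\<times> A) Quot tensor_ideal k A K \<iota> in
      \<lparr>carrier = carrier Q, monoid.mult = monoid.mult Q, one = one Q,
       ring.zero = ring.zero Q, add = add Q,
       smult = (\<lambda>x t. pure_tensor k A K \<iota> x \<one>\<^bsub>A\<^esub> \<otimes>\<^bsub>Q\<^esub> t)\<rparr>)"


definition separable_algebra ::
    "('k, 'x) ring_scheme \<Rightarrow> ('k, 'a, 'y) module_scheme \<Rightarrow> bool" where
  "separable_algebra k A \<longleftrightarrow>
    unital_algebra k A \<and> finite_dimensional k A \<and>
    (\<forall>(K :: 'k ext_elem ring) \<iota>.
      field_extension k K \<iota> \<longrightarrow> semisimple_ring (scalar_extension k A K \<iota>))"


definition matrix_algebra :: "('e, 'x) ring_scheme \<Rightarrow> nat \<Rightarrow> ('e, nat \<times> nat \<Rightarrow> 'e) module" where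
  "matrix_algebra E n =
    \<lparr>carrier = {..<n} \<times> {..<n} \<rightarrow>\<^sub>E carrier E,
     monoid.mult = (\<lambda>M N. \<lambda>(i, j)\<in>{..<n} \<times> {..<n}. \<Oplus>\<^bsub>E\<^esub>l\<in>{..<n}. M (i, l) \<otimes>\<^bsub>E\<^esub> N (l, j)),
     one = (\<lambda>(i, j)\<in>{..<n} \<times> {..<n}. if i = j then \<one>\<^bsub>E\<^esub> else \<zero>\<^bsub>E\<^esub>),
     ring.zero = (\<lambda>p\<in>{..<n} \<times> {..<n}. \<zero>\<^bsub>E\<^esub>),
     add = (\<lambda>M N. \<lambda>p\<in>{..<n} \<times> {..<n}. M p \<oplus>\<^bsub>E\<^esub> N p),
     smult = (\<lambda>c M. \<lambda>p\<in>{..<n} \<times> {..<n}. c \<otimes>\<^bsub>E\<^esub> M p)\<rparr>"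

definition matrix_trace :: "('e, 'x) ring_scheme \<Rightarrow> nat \<Rightarrow> (nat \<times> nat \<Rightarrow> 'e) \<Rightarrow> 'e" where
  "matrix_trace E n M = (\<Oplus>\<^bsub>E\<^esub>i\<in>{..<n}. M (i, i))"

definition product_algebra ::
    "'i set \<Rightarrow> ('i \<Rightarrow> ('k, 'a, 'x) module_scheme) \<Rightarrow> ('k, 'i \<Rightarrow> 'a) module" where
  "product_algebra I B =
    \<lparr>carrier = (\<Pi>\<^sub>E i\<in>I. carrier (B i)),
     monoid.mult = (\<lambda>x y. \<lambda>i\<in>I. x i \<otimes>\<^bsub>B i\<^esub> y i),
     one = (\<lambda>i\<in>I. \<one>\<^bsub>B i\<^esub>),
     ring.zero = (\<lambda>i\<in>I. \<zero>\<^bsub>B i\<^esub>),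
     add = (\<lambda>x y. \<lambda>i\<in>I. x i \<oplus>\<^bsub>B i\<^esub> y i),
     smult = (\<lambda>c x. \<lambda>i\<in>I. c \<odot>\<^bsub>B i\<^esub> x i)\<rparr>"


definition splitting ::
    "('k, 'x) ring_scheme \<Rightarrow> ('k, 'a, 'y) module_scheme \<Rightarrow> ('e, 'z) ring_scheme \<Rightarrow> ('k \<Rightarrow> 'e)
      \<Rightarrow> nat \<Rightarrow> (nat \<Rightarrow> nat) \<Rightarrow> (('e \<times> 'a \<Rightarrow>\<^sub>0 int) set \<Rightarrow> nat \<Rightarrow> nat \<times> nat \<Rightarrow> 'e) \<Rightarrow> bool" where
  "splitting k A E \<iota> r m \<phi> \<longleftrightarrow>
    finite_separable_extension k E \<iota> \<and> 0 < r \<and> (\<forall>i<r. 0 < m i) \<and>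
    \<phi> \<in> algebra_iso E (scalar_extension k A E \<iota>)
          (product_algebra {..<r} (\<lambda>i. matrix_algebra E (m i)))"

definition reduced_trace ::
    "('k, 'x) ring_scheme \<Rightarrow> ('k, 'a, 'y) module_scheme \<Rightarrow> 'a \<Rightarrow> 'k" where
  "reduced_trace k A a =
    (THE t. t \<in> carrier k \<and>
      (\<exists>(E :: 'k ext_elem ring) \<iota> r m \<phi>. splitting k A E \<iota> r m \<phi> \<and>
        \<iota> t = (\<Oplus>\<^bsub>E\<^esub>i\<in>{..<r}. matrix_trace E (m i) (\<phi> (pure_tensor k A E \<iota> \<one>\<^bsub>E\<^esub> a) i))))"

definition reduced_trace_form ::
    "('k, 'x) ring_scheme \<Rightarrow> ('k, 'a, 'y) module_scheme \<Rightarrow> 'a \<Rightarrow> 'a \<Rightarrow> 'k" where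
  "reduced_trace_form k A a b = reduced_trace k A (a \<otimes>\<^bsub>A\<^esub> b)"


definition nakayama_jacobian ::
    "('a, 'x) ring_scheme \<Rightarrow> ('a \<Rightarrow> 'a \<Rightarrow> 'k) \<Rightarrow> ('a \<Rightarrow> 'a) \<Rightarrow> 'a" where
  "nakayama_jacobian A \<beta> u =
    (THE j. j \<in> carrier A \<and>
      (\<forall>a\<in>carrier A. \<forall>b\<in>carrier A. \<beta> (u a) (u b) = \<beta> (j \<otimes>\<^bsub>A\<^esub> a) b))"

end

theory Submission
  imports Defs
begin

text \<open>
  An automorphism \<open>u\<close> carries a splitting \<open>\<phi>\<close> of \<open>A\<close> to the splitting \<open>\<phi> \<circ> (id \<otimes> u)\<close>, so
  independence of the splitting gives \<open>trd (u a) = trd a\<close>, and \<open>1\<close> satisfies the equation of the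
  Nakayama Jacobian; it is the only solution because the trace form is non-degenerate.

  A splitting is found inside the algebraic closure \<open>L\<close> of \<open>k\<close>. Semisimplicity is used only as von Neumann
  regularity. Take a finite separable subextension \<open>E\<close> whose scalar extension has as many orthogonal idempotents
  as possible. Their corners are division rings, commutative by Jacobson's argument and equal
  to \<open>E\<close> because the scalar extension to \<open>L\<close> has no nilpotent central elements; the idempotents
  then generate matrix units.

  Two splittings, over \<open>E\<close> and \<open>E'\<close>, are compared over the commutative ring \<open>R = E \<otimes> E'\<close>. There both
  give matrix coordinates on \<open>R \<otimes> A\<close>, and an idempotent \<open>e\<close> with \<open>e y e = \<lambda>(y) e\<close> has trace \<open>1\<close> in either
  of them, so the traces agree. This yields independence and rationality of the reduced trace without Galois
  descent.
\<close>

section \<open>Scalar extension\<close>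

text \<open>Two splittings arrive over unrelated fields, and no common overfield of them is built.
  They meet only in \<open>E \<otimes> E'\<close>, which is commutative but may have zero divisors.
  Hence scalar extension and matrix coordinates are set up over commutative rings, and the value
  \<open>1\<close> of the trace of a rank one idempotent has to come from ring identities alone,
  without ranks or eigenvalues. On the existence side the obstacle is inseparability: a splitting
  over the algebraic closure is not enough, because \<open>E\<close> has to be separable over the
  ground field. An element of a primitive corner is therefore first shown to become scalar only
  after raising it to a power \<open>p ^ s\<close>, since the polynomial that kills such a power can
  be chosen separable. Commutativity of the corner and the absence of nilpotents over the closure
  then remove the exponent. All finite extensions are kept inside one algebra over the closure, as
  the elements with coordinates in \<open>E\<close>, so that enlarging \<open>E\<close> moves no
  element.\<close>

definition mmult :: "('m, 'x) monoid_scheme \<Rightarrow> ('m \<Rightarrow>\<^sub>0 int) \<Rightarrow> ('m \<Rightarrow>\<^sub>0 int) \<Rightarrow> ('m \<Rightarrow>\<^sub>0 int)" where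
  "mmult M f g = frag_extend (\<lambda>p. frag_extend (\<lambda>q. frag_of (p \<otimes>\<^bsub>M\<^esub> q)) g) f"

lemma monoid_ring_simps [simp]:
  "carrier (monoid_ring M) = {f. Poly_Mapping.keys f \<subseteq> carrier M}"
  "f \<otimes>\<^bsub>monoid_ring M\<^esub> g = mmult M f g"
  "\<one>\<^bsub>monoid_ring M\<^esub> = frag_of \<one>\<^bsub>M\<^esub>"
  "\<zero>\<^bsub>monoid_ring M\<^esub> = 0"
  "f \<oplus>\<^bsub>monoid_ring M\<^esub> g = f + g"
  by (auto simp: monoid_ring_def mmult_def)

lemma mmult_simps [simp]:
  "mmult M (frag_of p) (frag_of q) = frag_of (p \<otimes>\<^bsub>M\<^esub> q)"
  "mmult M 0 g = 0" "mmult M f 0 = 0"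
  "mmult M (f - f') g = mmult M f g - mmult M f' g"
  "mmult M (f + f') g = mmult M f g + mmult M f' g"
  by (simp_all add: mmult_def frag_extend_diff frag_extend_add frag_extend_eq_0)

lemma mmult_diff_right [simp]: "mmult M f (g - g') = mmult M f g - mmult M f g'"
proof -
  \<comment> \<open>The induction rule wants a set that contains the keys; \<open>UNIV\<close> keeps
    the lemma free of carrier assumptions.\<close>
  have "Poly_Mapping.keys f \<subseteq> UNIV" by simp
  then show ?thesis
    by (induction f rule: frag_induction) (simp_all add: mmult_def frag_extend_diff)
qed

lemma mmult_add_right [simp]: "mmult M f (g + g') = mmult M f g + mmult M f g'"
  using mmult_diff_right[of M f "g + g'" g'] by (simp add: algebra_simps)

lemma mmult_closed:
  assumes "monoid M" "Poly_Mapping.keys f \<subseteq> carrier M" "Poly_Mapping.keys g \<subseteq> carrier M"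
  shows "Poly_Mapping.keys (mmult M f g) \<subseteq> carrier M"
  unfolding mmult_def
  by (rule order_trans[OF keys_frag_extend] | rule UN_least)+
     (use assms in \<open>auto intro: monoid.m_closed\<close>)

lemma mmult_assoc:
  assumes M: "monoid M" and f: "Poly_Mapping.keys f \<subseteq> carrier M"
    and g: "Poly_Mapping.keys g \<subseteq> carrier M" and h: "Poly_Mapping.keys h \<subseteq> carrier M"
  shows "mmult M (mmult M f g) h = mmult M f (mmult M g h)"
  using f
proof (induction f rule: frag_induction)
  case (one x) show ?case using g
  proof (induction g rule: frag_induction)
    case (one y) show ?case using h
      by (induction h rule: frag_induction) (simp_all add: monoid.m_assoc[OF M] \<open>x \<in> carrier M\<close> one)
  qed simp_all
qed simp_all

lemma mmult_one:
  assumes M: "monoid M" and f: "Poly_Mapping.keys f \<subseteq> carrier M"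
  shows "mmult M (frag_of \<one>\<^bsub>M\<^esub>) f = f" "mmult M f (frag_of \<one>\<^bsub>M\<^esub>) = f"
  by (use f in \<open>induction f rule: frag_induction\<close>)
     (simp_all add: monoid.l_one[OF M] monoid.r_one[OF M])

lemma ring_monoid_ring:
  assumes M: "monoid M" shows "ring (monoid_ring M)"
proof (rule ringI)
  show "abelian_group (monoid_ring M)"
  proof (rule abelian_groupI)
    fix x assume "x \<in> carrier (monoid_ring M)"
    then show "\<exists>y\<in>carrier (monoid_ring M). y \<oplus>\<^bsub>monoid_ring M\<^esub> x = \<zero>\<^bsub>monoid_ring M\<^esub>"
      by (intro bexI[of _ "-x"]) (auto simp: keys_minus)
  qed (auto simp: algebra_simps dest: subsetD[OF keys_add])
  show "monoid (monoid_ring M)"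
    by (rule monoidI) (auto simp: mmult_closed[OF M, THEN subsetD] mmult_assoc[OF M] mmult_one[OF M] monoid.one_closed[OF M])
qed auto

lemma monoid_ring_minus:
  assumes M: "monoid M" and f: "Poly_Mapping.keys f \<subseteq> carrier M" "Poly_Mapping.keys g \<subseteq> carrier M"
  shows "f \<ominus>\<^bsub>monoid_ring M\<^esub> g = f - g"
proof -
  interpret ring "monoid_ring M" by (rule ring_monoid_ring[OF M])
  have "\<ominus>\<^bsub>monoid_ring M\<^esub> g = - g"
    by (rule minus_equality) (use f in \<open>auto simp: keys_minus\<close>)
  then show ?thesis by (simp add: a_minus_def)
qed

text \<open>The coefficients form only a commutative ring because the construction is also used with
  \<open>E \<otimes> E'\<close> in the place of \<open>K\<close>, where the traces of two splittings
  are compared. The field case is the locale \<open>scalar_ext\<close>.\<close>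

locale scalar_ext_cring =
  fixes k :: "('k, 'x) ring_scheme" and A :: "('k, 'a, 'y) module_scheme"
    and K :: "('e, 'z) ring_scheme" and \<iota> :: "'k \<Rightarrow> 'e"
  assumes alg: "unital_algebra k A" and cring_K: "cring K" and \<iota>_hom: "\<iota> \<in> ring_hom k K"
begin

sublocale A: unital_algebra k A by (rule alg)
sublocale K: cring K by (rule cring_K)
sublocale \<iota>: ring_hom_ring k K \<iota> by (rule ring_hom_ringI2[OF field.is_ring[OF A.field_axioms] K.ring_axioms \<iota>_hom])

abbreviation "MR \<equiv> monoid_ring (K \<times>\<times> A)"
abbreviation "S \<equiv> scalar_extension k A K \<iota>"
abbreviation "J \<equiv> tensor_ideal k A K \<iota>"
abbreviation pure :: "'e \<Rightarrow> 'a \<Rightarrow> ('e \<times> 'a \<Rightarrow>\<^sub>0 int) set" where "pure \<equiv> pure_tensor k A K \<iota>"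

lemma monoid_prod: "monoid (K \<times>\<times> A)"
  by (intro DirProd_monoid K.monoid_axioms A.A.monoid_axioms)

sublocale MR: ring MR by (rule ring_monoid_ring[OF monoid_prod])

lemma relations_sub: "tensor_relations k A K \<iota> \<subseteq> carrier MR"
proof -
  show ?thesis
    by (auto simp: tensor_relations_def dest!: subsetD[OF keys_diff])
qed

sublocale J: ideal J MR
  unfolding tensor_ideal_def by (rule MR.genideal_ideal[OF relations_sub])

lemma S_simps:
  "carrier S = carrier (MR Quot J)" "monoid.mult S = monoid.mult (MR Quot J)"
  "one S = one (MR Quot J)" "ring.zero S = ring.zero (MR Quot J)" "add S = add (MR Quot J)"
  "x \<odot>\<^bsub>S\<^esub> t = pure x \<one>\<^bsub>A\<^esub> \<otimes>\<^bsub>S\<^esub> t"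
  by (simp_all add: scalar_extension_def Let_def)

lemma ring_S: "ring S"
proof -
  interpret Q: ring "MR Quot J" by (rule J.quotient_is_ring)
  show ?thesis
    by (intro ringI abelian_groupI monoidI; unfold S_simps)
       (assumption | rule Q.a_closed Q.zero_closed Q.a_assoc Q.a_comm Q.l_zero Q.add.l_inv_ex[simplified]
         Q.m_closed Q.one_closed Q.m_assoc Q.l_one Q.r_one Q.l_distr Q.r_distr)+
qed

sublocale S: ring S by (rule ring_S)

definition cls :: "('e \<times> 'a \<Rightarrow>\<^sub>0 int) \<Rightarrow> ('e \<times> 'a \<Rightarrow>\<^sub>0 int) set" where
  "cls f = J +>\<^bsub>MR\<^esub> f"

lemma cls_hom: "cls \<in> ring_hom MR S"
  using J.rcos_ring_hom unfolding ring_hom_def cls_def[abs_def] S_simps .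

sublocale cls: ring_hom_ring MR S cls
  by (rule ring_hom_ringI2[OF MR.ring_axioms ring_S cls_hom])

lemma cls_surj: "carrier S = cls ` carrier MR"
  by (auto simp: S_simps FactRing_def A_RCOSETS_def' cls_def)

lemma cls_eq_iff:
  assumes "f \<in> carrier MR" "g \<in> carrier MR"
  shows "cls f = cls g \<longleftrightarrow> f - g \<in> J"
proof -
  have "f - g = f \<ominus>\<^bsub>MR\<^esub> g" using assms monoid_ring_minus[OF monoid_prod] by auto
  with assms show ?thesis
    unfolding cls_def
    by (metis MR.quotient_eq_iff_same_a_r_cos[OF J.is_ideal])
qed

lemma pure_cls: "pure x a = cls (frag_of (x, a))"
  by (simp add: pure_tensor_def cls_def)

lemma frag_in [simp]: "frag_of (x, a) \<in> carrier MR \<longleftrightarrow> x \<in> carrier K \<and> a \<in> carrier A"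
  by simp

lemma pure_closed [simp, intro]: "x \<in> carrier K \<Longrightarrow> a \<in> carrier A \<Longrightarrow> pure x a \<in> carrier S"
  by (simp only: pure_cls, rule cls.hom_closed) auto

lemma pure_mult:
  assumes "x \<in> carrier K" "a \<in> carrier A" "y \<in> carrier K" "b \<in> carrier A"
  shows "pure x a \<otimes>\<^bsub>S\<^esub> pure y b = pure (x \<otimes>\<^bsub>K\<^esub> y) (a \<otimes>\<^bsub>A\<^esub> b)"
proof -
  have "pure x a \<otimes>\<^bsub>S\<^esub> pure y b = cls (frag_of (x, a) \<otimes>\<^bsub>MR\<^esub> frag_of (y, b))"
    unfolding pure_cls by (rule cls.hom_mult[symmetric]) (use assms in auto)
  then show ?thesis by (simp add: pure_cls)
qed

lemma pure_one: "pure \<one>\<^bsub>K\<^esub> \<one>\<^bsub>A\<^esub> = \<one>\<^bsub>S\<^esub>"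
  using cls.hom_one by (simp add: pure_cls DirProd_def)

lemma rel_in_J: "r \<in> tensor_relations k A K \<iota> \<Longrightarrow> r \<in> J"
  unfolding tensor_ideal_def using MR.genideal_self[OF relations_sub] by auto

lemma cls_add: "f \<in> carrier MR \<Longrightarrow> g \<in> carrier MR \<Longrightarrow> cls (f + g) = cls f \<oplus>\<^bsub>S\<^esub> cls g"
  using cls.hom_add by simp

lemma cls_diff: "f \<in> carrier MR \<Longrightarrow> g \<in> carrier MR \<Longrightarrow> cls (f - g) = cls f \<ominus>\<^bsub>S\<^esub> cls g"
  using monoid_ring_minus[OF monoid_prod, of f g] cls.hom_add[of f "\<ominus>\<^bsub>MR\<^esub> g"] cls.hom_a_inv[of g] MR.a_inv_closed[of g]
  by (simp add: a_minus_def)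

lemma pure_add_left:
  assumes "x \<in> carrier K" "y \<in> carrier K" "a \<in> carrier A"
  shows "pure (x \<oplus>\<^bsub>K\<^esub> y) a = pure x a \<oplus>\<^bsub>S\<^esub> pure y a"
proof -
  have "frag_of (x \<oplus>\<^bsub>K\<^esub> y, a) - (frag_of (x, a) + frag_of (y, a)) \<in> J"
    by (rule rel_in_J) (use assms in \<open>auto simp: tensor_relations_def algebra_simps\<close>)
  then have "cls (frag_of (x \<oplus>\<^bsub>K\<^esub> y, a)) = cls (frag_of (x, a) + frag_of (y, a))"
    using assms by (subst cls_eq_iff) (auto dest!: subsetD[OF keys_add])
  then show ?thesis using assms by (simp add: pure_cls cls_add)
qed

lemma pure_add_right:
  assumes "x \<in> carrier K" "a \<in> carrier A" "b \<in> carrier A"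
  shows "pure x (a \<oplus>\<^bsub>A\<^esub> b) = pure x a \<oplus>\<^bsub>S\<^esub> pure x b"
proof -
  have "frag_of (x, a \<oplus>\<^bsub>A\<^esub> b) - (frag_of (x, a) + frag_of (x, b)) \<in> J"
    by (rule rel_in_J) (use assms in \<open>auto simp: tensor_relations_def algebra_simps\<close>)
  then have "cls (frag_of (x, a \<oplus>\<^bsub>A\<^esub> b)) = cls (frag_of (x, a) + frag_of (x, b))"
    using assms by (subst cls_eq_iff) (auto dest!: subsetD[OF keys_add])
  then show ?thesis using assms by (simp add: pure_cls cls_add)
qed

lemma pure_smult:
  assumes "x \<in> carrier K" "a \<in> carrier A" "c \<in> carrier k"
  shows "pure x (c \<odot>\<^bsub>A\<^esub> a) = pure (x \<otimes>\<^bsub>K\<^esub> \<iota> c) a"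
proof -
  have "frag_of (x \<otimes>\<^bsub>K\<^esub> \<iota> c, a) - frag_of (x, c \<odot>\<^bsub>A\<^esub> a) \<in> J"
    by (rule rel_in_J) (use assms in \<open>auto simp: tensor_relations_def\<close>)
  then have "cls (frag_of (x \<otimes>\<^bsub>K\<^esub> \<iota> c, a)) = cls (frag_of (x, c \<odot>\<^bsub>A\<^esub> a))"
    using assms by (subst cls_eq_iff) auto
  then show ?thesis by (simp add: pure_cls)
qed

text \<open>Pure tensors generate the additive group. The induction step is a difference because
  that is how the free abelian group is generated from its basis; it covers sums and negatives at
  once.\<close>

lemma S_induct [consumes 1, case_names pure zero diff]:
  assumes "t \<in> carrier S"
    and pure: "\<And>x a. x \<in> carrier K \<Longrightarrow> a \<in> carrier A \<Longrightarrow> P (pure x a)"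
    and zero: "P \<zero>\<^bsub>S\<^esub>"
    and diff: "\<And>s t. s \<in> carrier S \<Longrightarrow> t \<in> carrier S \<Longrightarrow> P s \<Longrightarrow> P t \<Longrightarrow> P (s \<ominus>\<^bsub>S\<^esub> t)"
  shows "P t"
proof -
  obtain f where f: "t = cls f" "f \<in> carrier MR" using assms(1) cls_surj by auto
  then have "Poly_Mapping.keys f \<subseteq> carrier (K \<times>\<times> A)" by simp
  then have "P (cls f)"
  proof (rule free_Abelian_group_induct)
    show "P (cls 0)" using cls.hom_zero zero by simp
    show "P (cls (x - y))" if "Poly_Mapping.keys x \<subseteq> carrier (K \<times>\<times> A)"
      "Poly_Mapping.keys y \<subseteq> carrier (K \<times>\<times> A)" "P (cls x)" "P (cls y)" for x y
      using that cls_diff[of x y] diff[of "cls x" "cls y"] cls.hom_closed by simp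
    show "P (cls (frag_of p))" if "p \<in> carrier (K \<times>\<times> A)" for p
      using pure that by (cases p) (auto simp: pure_cls)
  qed
  then show ?thesis using f by simp
qed

lemma pure_central:
  assumes x: "x \<in> carrier K" and t: "t \<in> carrier S"
  shows "pure x \<one>\<^bsub>A\<^esub> \<otimes>\<^bsub>S\<^esub> t = t \<otimes>\<^bsub>S\<^esub> pure x \<one>\<^bsub>A\<^esub>"
  using t
proof (induction t rule: S_induct)
  case (pure y a) then show ?case using x by (simp add: pure_mult K.m_comm)
next
  case zero then show ?case using x by simp
next
  case (diff s t) then show ?case using x
    by (simp add: a_minus_def S.l_distr S.r_distr S.l_minus S.r_minus)
qed

lemma module_S: "module K S"
  apply (rule moduleI)
  apply (rule K.is_cring)
  apply (rule S.abelian_group_axioms)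
  by (auto simp: S_simps(6) pure_add_left S.l_distr S.r_distr pure_one S.m_assoc[symmetric] pure_mult)

lemma smult_pure:
  assumes "x \<in> carrier K" "y \<in> carrier K" "a \<in> carrier A"
  shows "x \<odot>\<^bsub>S\<^esub> pure y a = pure (x \<otimes>\<^bsub>K\<^esub> y) a"
  using assms by (simp add: S_simps(6) pure_mult)

lemma pure_eq_smult: "x \<in> carrier K \<Longrightarrow> a \<in> carrier A \<Longrightarrow> pure x a = x \<odot>\<^bsub>S\<^esub> pure \<one>\<^bsub>K\<^esub> a"
  by (simp add: smult_pure)

end

locale scalar_ext = scalar_ext_cring k A K \<iota>
  for k :: "('k, 'x) ring_scheme" and A :: "('k, 'a, 'y) module_scheme"
    and K :: "('e, 'z) ring_scheme" and \<iota> :: "'k \<Rightarrow> 'e" +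
  assumes ext: "field_extension k K \<iota>"
begin

sublocale K: field K using ext by (simp add: field_extension_def)

lemma unital_algebra_S: "unital_algebra K S"
  apply (rule unital_algebra.intro)
    apply (rule K.field_axioms)
   apply (rule module_S)
  apply (rule ring_S)
  apply (rule unital_algebra_axioms.intro)
  apply (simp add: S_simps(6) S.m_assoc)
  apply (simp add: S_simps(6) S.m_assoc[symmetric] pure_central)
  apply (simp add: S.m_assoc pure_central)
  done

sublocale SA: unital_algebra K S by (rule unital_algebra_S)

end

lemma scalar_extI:
  assumes "unital_algebra k A" "field_extension k K \<iota>" shows "scalar_ext k A K \<iota>"
  using assms by (intro scalar_ext.intro scalar_ext_cring.intro scalar_ext_axioms.intro)
    (auto simp: field_extension_def intro: domain.axioms(1) field.axioms(1))

section \<open>Universal property of the scalar extension\<close>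

context scalar_ext_cring begin

text \<open>The additive extension \<open>G\<close> of \<beta> to the free abelian group kills the
  relations by biadditivity and balancedness, but \<open>J\<close> is the two-sided ideal that they
  generate, so \<open>G\<close> must vanish on all products \<open>r \<rho> s\<close> as well. It
  does, because multiplying a relation by monomials gives a relation of the same kind. The target is
  only an abelian group, so that the lemma yields linear functionals as well as ring
  homomorphisms.\<close>

lemma lift_exists:
  fixes H :: "('h, 'v) ring_scheme" and \<beta> :: "'e \<Rightarrow> 'a \<Rightarrow> 'h"
  assumes H: "abelian_group H"
    and cl: "\<And>x a. \<lbrakk>x \<in> carrier K; a \<in> carrier A\<rbrakk> \<Longrightarrow> \<beta> x a \<in> carrier H"
    and addl: "\<And>x y a. \<lbrakk>x \<in> carrier K; y \<in> carrier K; a \<in> carrier A\<rbrakk> \<Longrightarrow> \<beta> (x \<oplus>\<^bsub>K\<^esub> y) a = \<beta> x a \<oplus>\<^bsub>H\<^esub> \<beta> y a"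
    and addr: "\<And>x a b. \<lbrakk>x \<in> carrier K; a \<in> carrier A; b \<in> carrier A\<rbrakk> \<Longrightarrow> \<beta> x (a \<oplus>\<^bsub>A\<^esub> b) = \<beta> x a \<oplus>\<^bsub>H\<^esub> \<beta> x b"
    and bal: "\<And>x c a. \<lbrakk>x \<in> carrier K; c \<in> carrier k; a \<in> carrier A\<rbrakk> \<Longrightarrow> \<beta> (x \<otimes>\<^bsub>K\<^esub> \<iota> c) a = \<beta> x (c \<odot>\<^bsub>A\<^esub> a)"
  obtains F where "abelian_group_hom S H F" "\<And>x a. \<lbrakk>x \<in> carrier K; a \<in> carrier A\<rbrakk> \<Longrightarrow> F (pure x a) = \<beta> x a"
proof -
  interpret H: abelian_group H by (rule H)
  have img: "case_prod \<beta> ` carrier (K \<times>\<times> A) \<subseteq> carrier (add_monoid H)" using cl by auto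
  obtain G where G: "G \<in> hom (free_Abelian_group (carrier (K \<times>\<times> A))) (add_monoid H)"
    and Gof': "\<And>p. p \<in> carrier (K \<times>\<times> A) \<Longrightarrow> G (frag_of p) = case_prod \<beta> p"
    by (rule comm_group.free_Abelian_group_universal[OF H.a_comm_group img]) auto
  have Gof: "G (frag_of (x, a)) = \<beta> x a" if "x \<in> carrier K" "a \<in> carrier A" for x a
    using Gof'[of "(x, a)"] that by simp
  have Gcl: "G f \<in> carrier H" if "f \<in> carrier MR" for f
    using G that by (auto simp: hom_def)
  have Gadd: "G (f + g) = G f \<oplus>\<^bsub>H\<^esub> G g" if "f \<in> carrier MR" "g \<in> carrier MR" for f g
    using G that by (auto simp: hom_def)
  have dcl: "f - g \<in> carrier MR" if "f \<in> carrier MR" "g \<in> carrier MR" for f g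
    using that by (auto dest!: subsetD[OF keys_diff])
  have Gdiff: "G (f - g) = G f \<ominus>\<^bsub>H\<^esub> G g" if "f \<in> carrier MR" "g \<in> carrier MR" for f g
  proof -
    have "G (f - g) \<oplus>\<^bsub>H\<^esub> G g = G f" using Gadd[OF dcl[OF that] that(2)] by simp
    then show ?thesis using Gcl[OF dcl[OF that]] Gcl that
      by (metis H.add.inv_solve_right' H.minus_eq)
  qed
  have zz: "\<zero>\<^bsub>H\<^esub> \<ominus>\<^bsub>H\<^esub> \<zero>\<^bsub>H\<^esub> = \<zero>\<^bsub>H\<^esub>" by (simp add: H.minus_eq H.r_neg)
  have cancel: "u \<oplus>\<^bsub>H\<^esub> v \<ominus>\<^bsub>H\<^esub> u \<ominus>\<^bsub>H\<^esub> v = \<zero>\<^bsub>H\<^esub>" if "u \<in> carrier H" "v \<in> carrier H" for u v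
  proof -
    have "u \<oplus>\<^bsub>H\<^esub> v \<ominus>\<^bsub>H\<^esub> u = v" using that by (simp add: H.minus_eq H.a_comm[of u v] H.a_assoc H.r_neg)
    then show ?thesis using that by (simp add: H.minus_eq H.r_neg)
  qed
  have Gzero: "G 0 = \<zero>\<^bsub>H\<^esub>" using Gdiff[of 0 0] Gcl[of 0] by (simp add: H.r_neg a_minus_def)
  \<comment> \<open>The largest two-sided ideal of the monoid ring inside the kernel of
    \<open>G\<close>; it suffices to put the generators of \<open>J\<close> into it.\<close>
  define J0 where "J0 = {f \<in> carrier MR. \<forall>r\<in>carrier MR. \<forall>s\<in>carrier MR. G (mmult (K \<times>\<times> A) (mmult (K \<times>\<times> A) r f) s) = \<zero>\<^bsub>H\<^esub>}"
  note mcl = MR.m_closed[unfolded monoid_ring_simps(2)]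
  note massoc = MR.m_assoc[unfolded monoid_ring_simps(2)]
  have acl: "f + g \<in> carrier MR" if "f \<in> carrier MR" "g \<in> carrier MR" for f g
    using MR.a_closed[OF that] by simp
  have "ideal J0 MR"
  proof (rule idealI)
    show "ring MR" by (rule MR.ring_axioms)
    show "subgroup J0 (add_monoid MR)"
    proof (rule MR.add.subgroupI)
      show "J0 \<subseteq> carrier MR" by (auto simp: J0_def)
      have "0 \<in> J0" by (simp add: J0_def Gzero)
      then show "J0 \<noteq> {}" by blast
      show "\<ominus>\<^bsub>MR\<^esub> a \<in> J0" if "a \<in> J0" for a
      proof -
        have a: "a \<in> carrier MR" using that by (simp add: J0_def)
        have e: "\<ominus>\<^bsub>MR\<^esub> a = 0 - a"
          using monoid_ring_minus[OF monoid_prod, of 0 a] a MR.a_inv_closed[OF a] by (simp add: a_minus_def)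
        show ?thesis unfolding e J0_def
        proof (intro CollectI conjI ballI)
          show "0 - a \<in> carrier MR" using a dcl[of 0 a] by simp
          fix r s assume rs: "r \<in> carrier MR" "s \<in> carrier MR"
          then have "G (mmult (K \<times>\<times> A) (mmult (K \<times>\<times> A) r a) s) = \<zero>\<^bsub>H\<^esub>" using that by (simp add: J0_def)
          moreover have "mmult (K \<times>\<times> A) (mmult (K \<times>\<times> A) r a) s \<in> carrier MR" using rs a mcl by blast
          ultimately have "G (0 - mmult (K \<times>\<times> A) (mmult (K \<times>\<times> A) r a) s) = \<zero>\<^bsub>H\<^esub>"
            using Gdiff[of 0 "mmult (K \<times>\<times> A) (mmult (K \<times>\<times> A) r a) s"] Gzero
            by (auto simp: H.minus_eq H.r_neg)
          moreover have "mmult (K \<times>\<times> A) (mmult (K \<times>\<times> A) r (0 - a)) s = 0 - mmult (K \<times>\<times> A) (mmult (K \<times>\<times> A) r a) s"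
            by (simp only: mmult_diff_right mmult_simps)
          ultimately show "G (mmult (K \<times>\<times> A) (mmult (K \<times>\<times> A) r (0 - a)) s) = \<zero>\<^bsub>H\<^esub>" by simp
        qed
      qed
      show "a \<oplus>\<^bsub>MR\<^esub> b \<in> J0" if "a \<in> J0" "b \<in> J0" for a b
        unfolding J0_def monoid_ring_simps(5)
      proof (intro CollectI conjI ballI)
        have ab: "a \<in> carrier MR" "b \<in> carrier MR" using that by (auto simp: J0_def)
        show "a + b \<in> carrier MR" using acl ab .
        fix r s assume rs: "r \<in> carrier MR" "s \<in> carrier MR"
        have "mmult (K \<times>\<times> A) (mmult (K \<times>\<times> A) r a) s \<in> carrier MR"
           "mmult (K \<times>\<times> A) (mmult (K \<times>\<times> A) r b) s \<in> carrier MR" using rs ab mcl by blast+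
        moreover have "G (mmult (K \<times>\<times> A) (mmult (K \<times>\<times> A) r a) s) = \<zero>\<^bsub>H\<^esub>"
           "G (mmult (K \<times>\<times> A) (mmult (K \<times>\<times> A) r b) s) = \<zero>\<^bsub>H\<^esub>" using rs that unfolding J0_def by blast+
        ultimately show "G (mmult (K \<times>\<times> A) (mmult (K \<times>\<times> A) r (a + b)) s) = \<zero>\<^bsub>H\<^esub>"
          using Gadd by simp
      qed
    qed
    fix a x assume a: "a \<in> J0" and x: "x \<in> carrier MR"
    have ac: "a \<in> carrier MR" using a by (simp add: J0_def)
    show "x \<otimes>\<^bsub>MR\<^esub> a \<in> J0" unfolding J0_def monoid_ring_simps(2)
    proof (intro CollectI conjI ballI)
      show "mmult (K \<times>\<times> A) x a \<in> carrier MR" using mcl x ac by blast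
      fix r s assume rs: "r \<in> carrier MR" "s \<in> carrier MR"
      show "G (mmult (K \<times>\<times> A) (mmult (K \<times>\<times> A) r (mmult (K \<times>\<times> A) x a)) s) = \<zero>\<^bsub>H\<^esub>"
        using a mcl[OF rs(1) x] rs unfolding massoc[OF rs(1) x ac, symmetric] J0_def by blast
    qed
    show "a \<otimes>\<^bsub>MR\<^esub> x \<in> J0" unfolding J0_def monoid_ring_simps(2)
    proof (intro CollectI conjI ballI)
      show "mmult (K \<times>\<times> A) a x \<in> carrier MR" using mcl x ac by blast
      fix r s assume rs: "r \<in> carrier MR" "s \<in> carrier MR"
      have "mmult (K \<times>\<times> A) (mmult (K \<times>\<times> A) r (mmult (K \<times>\<times> A) a x)) s
          = mmult (K \<times>\<times> A) (mmult (K \<times>\<times> A) r a) (mmult (K \<times>\<times> A) x s)"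
        using massoc[OF rs(1) ac x] massoc[OF mcl[OF rs(1) ac] x rs(2)] by simp
      then show "G (mmult (K \<times>\<times> A) (mmult (K \<times>\<times> A) r (mmult (K \<times>\<times> A) a x)) s) = \<zero>\<^bsub>H\<^esub>"
        using a mcl[OF x rs(2)] rs unfolding J0_def by auto
    qed
  qed
  moreover have "tensor_relations k A K \<iota> \<subseteq> J0"
  proof
    fix \<rho> assume \<rho>: "\<rho> \<in> tensor_relations k A K \<iota>"
    have \<rho>c: "\<rho> \<in> carrier MR" using relations_sub \<rho> by blast
    have "G (mmult (K \<times>\<times> A) (mmult (K \<times>\<times> A) r \<rho>) s) = \<zero>\<^bsub>H\<^esub>" if r: "r \<in> carrier MR" and s: "s \<in> carrier MR" for r s
    proof -
      \<comment> \<open>With monomials on both sides the product is a relation with new entries,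
        where \<open>G\<close> vanishes by \<open>addl\<close>, \<open>addr\<close> or
        \<open>bal\<close>. Arbitrary factors follow by additivity, first on the right
        (\<open>monor\<close>), then on the left.\<close>
      have mono: "G (mmult (K \<times>\<times> A) (mmult (K \<times>\<times> A) (frag_of p) \<rho>) (frag_of q)) = \<zero>\<^bsub>H\<^esub>"
        if p: "p \<in> carrier (K \<times>\<times> A)" and q: "q \<in> carrier (K \<times>\<times> A)" for p q
      proof -
        obtain x a y b where [simp]: "p = (x, a)" "q = (y, b)" by fastforce
        have xy: "x \<in> carrier K" "y \<in> carrier K" "a \<in> carrier A" "b \<in> carrier A" using p q by auto
        consider (1) u v w where "u \<in> carrier K" "v \<in> carrier K" "w \<in> carrier A"
            "\<rho> = frag_of (u \<oplus>\<^bsub>K\<^esub> v, w) - frag_of (u, w) - frag_of (v, w)"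
          | (2) u v w where "u \<in> carrier K" "v \<in> carrier A" "w \<in> carrier A"
            "\<rho> = frag_of (u, v \<oplus>\<^bsub>A\<^esub> w) - frag_of (u, v) - frag_of (u, w)"
          | (3) u c w where "u \<in> carrier K" "c \<in> carrier k" "w \<in> carrier A"
            "\<rho> = frag_of (u \<otimes>\<^bsub>K\<^esub> \<iota> c, w) - frag_of (u, c \<odot>\<^bsub>A\<^esub> w)"
          using \<rho> unfolding tensor_relations_def
          by (elim UnE CollectE exE conjE) (simp_all only:)
        then show ?thesis
        proof cases
          case 1
          let ?P = "(x \<otimes>\<^bsub>K\<^esub> u \<otimes>\<^bsub>K\<^esub> y, a \<otimes>\<^bsub>A\<^esub> w \<otimes>\<^bsub>A\<^esub> b)" and ?Q = "(x \<otimes>\<^bsub>K\<^esub> v \<otimes>\<^bsub>K\<^esub> y, a \<otimes>\<^bsub>A\<^esub> w \<otimes>\<^bsub>A\<^esub> b)"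
          let ?O = "(x \<otimes>\<^bsub>K\<^esub> u \<otimes>\<^bsub>K\<^esub> y \<oplus>\<^bsub>K\<^esub> x \<otimes>\<^bsub>K\<^esub> v \<otimes>\<^bsub>K\<^esub> y, a \<otimes>\<^bsub>A\<^esub> w \<otimes>\<^bsub>A\<^esub> b)"
          have c: "frag_of ?O \<in> carrier MR" "frag_of ?P \<in> carrier MR" "frag_of ?Q \<in> carrier MR"
            unfolding frag_in using 1 xy by simp_all
          have "mmult (K \<times>\<times> A) (mmult (K \<times>\<times> A) (frag_of p) \<rho>) (frag_of q) = frag_of ?O - frag_of ?P - frag_of ?Q"
            using 1 xy by (simp add: K.l_distr K.r_distr)
          then show ?thesis
            using 1 xy by (simp add: Gdiff[OF dcl[OF c(1,2)] c(3)] Gdiff[OF c(1,2)] Gof addl cancel cl)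
        next
          case 2
          let ?P = "(x \<otimes>\<^bsub>K\<^esub> u \<otimes>\<^bsub>K\<^esub> y, a \<otimes>\<^bsub>A\<^esub> v \<otimes>\<^bsub>A\<^esub> b)" and ?Q = "(x \<otimes>\<^bsub>K\<^esub> u \<otimes>\<^bsub>K\<^esub> y, a \<otimes>\<^bsub>A\<^esub> w \<otimes>\<^bsub>A\<^esub> b)"
          let ?O = "(x \<otimes>\<^bsub>K\<^esub> u \<otimes>\<^bsub>K\<^esub> y, a \<otimes>\<^bsub>A\<^esub> v \<otimes>\<^bsub>A\<^esub> b \<oplus>\<^bsub>A\<^esub> a \<otimes>\<^bsub>A\<^esub> w \<otimes>\<^bsub>A\<^esub> b)"
          have c: "frag_of ?O \<in> carrier MR" "frag_of ?P \<in> carrier MR" "frag_of ?Q \<in> carrier MR"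
            unfolding frag_in using 2 xy by simp_all
          have "mmult (K \<times>\<times> A) (mmult (K \<times>\<times> A) (frag_of p) \<rho>) (frag_of q) = frag_of ?O - frag_of ?P - frag_of ?Q"
            using 2 xy by (simp add: A.A.l_distr A.A.r_distr)
          then show ?thesis
            using 2 xy by (simp add: Gdiff[OF dcl[OF c(1,2)] c(3)] Gdiff[OF c(1,2)] Gof addr cancel cl)
        next
          case 3
          have "x \<otimes>\<^bsub>K\<^esub> (u \<otimes>\<^bsub>K\<^esub> \<iota> c) \<otimes>\<^bsub>K\<^esub> y = (x \<otimes>\<^bsub>K\<^esub> u \<otimes>\<^bsub>K\<^esub> y) \<otimes>\<^bsub>K\<^esub> \<iota> c"
            using 3 xy by (simp add: K.m_ac)
          moreover have "a \<otimes>\<^bsub>A\<^esub> (c \<odot>\<^bsub>A\<^esub> w) \<otimes>\<^bsub>A\<^esub> b = c \<odot>\<^bsub>A\<^esub> (a \<otimes>\<^bsub>A\<^esub> w \<otimes>\<^bsub>A\<^esub> b)"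
            using 3 xy by (simp add: A.smult_mult_left A.smult_mult_right)
          ultimately have e: "mmult (K \<times>\<times> A) (mmult (K \<times>\<times> A) (frag_of p) \<rho>) (frag_of q)
             = frag_of ((x \<otimes>\<^bsub>K\<^esub> u \<otimes>\<^bsub>K\<^esub> y) \<otimes>\<^bsub>K\<^esub> \<iota> c, a \<otimes>\<^bsub>A\<^esub> w \<otimes>\<^bsub>A\<^esub> b) - frag_of (x \<otimes>\<^bsub>K\<^esub> u \<otimes>\<^bsub>K\<^esub> y, c \<odot>\<^bsub>A\<^esub> (a \<otimes>\<^bsub>A\<^esub> w \<otimes>\<^bsub>A\<^esub> b))"
            using 3 xy by simp
          have c: "frag_of ((x \<otimes>\<^bsub>K\<^esub> u \<otimes>\<^bsub>K\<^esub> y) \<otimes>\<^bsub>K\<^esub> \<iota> c, a \<otimes>\<^bsub>A\<^esub> w \<otimes>\<^bsub>A\<^esub> b) \<in> carrier MR"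
            "frag_of (x \<otimes>\<^bsub>K\<^esub> u \<otimes>\<^bsub>K\<^esub> y, c \<odot>\<^bsub>A\<^esub> (a \<otimes>\<^bsub>A\<^esub> w \<otimes>\<^bsub>A\<^esub> b)) \<in> carrier MR"
            unfolding frag_in using 3 xy by simp_all
          show ?thesis unfolding e Gdiff[OF c]
            using 3 xy by (simp add: Gof bal cl H.minus_eq H.r_neg)
        qed
      qed
      have monor: "G (mmult (K \<times>\<times> A) (mmult (K \<times>\<times> A) (frag_of p) \<rho>) s) = \<zero>\<^bsub>H\<^esub>"
        if p: "p \<in> carrier (K \<times>\<times> A)" for p
      proof -
        have pr: "mmult (K \<times>\<times> A) (frag_of p) \<rho> \<in> carrier MR" by (rule mcl[OF _ \<rho>c]) (use p in simp)
        have "Poly_Mapping.keys s \<subseteq> carrier (K \<times>\<times> A)" using s by simp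
        then show ?thesis
        proof (rule free_Abelian_group_induct[where P = "\<lambda>s. G (mmult (K \<times>\<times> A) (mmult (K \<times>\<times> A) (frag_of p) \<rho>) s) = \<zero>\<^bsub>H\<^esub>"])
          show "G (mmult (K \<times>\<times> A) (mmult (K \<times>\<times> A) (frag_of p) \<rho>) 0) = \<zero>\<^bsub>H\<^esub>" by (simp only: mmult_simps Gzero)
          show "G (mmult (K \<times>\<times> A) (mmult (K \<times>\<times> A) (frag_of p) \<rho>) (frag_of q)) = \<zero>\<^bsub>H\<^esub>"
            if "q \<in> carrier (K \<times>\<times> A)" for q by (rule mono[OF p that])
          fix f g assume "Poly_Mapping.keys f \<subseteq> carrier (K \<times>\<times> A)" "Poly_Mapping.keys g \<subseteq> carrier (K \<times>\<times> A)"
            and 1: "G (mmult (K \<times>\<times> A) (mmult (K \<times>\<times> A) (frag_of p) \<rho>) f) = \<zero>\<^bsub>H\<^esub>"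
             "G (mmult (K \<times>\<times> A) (mmult (K \<times>\<times> A) (frag_of p) \<rho>) g) = \<zero>\<^bsub>H\<^esub>"
          then have fg: "f \<in> carrier MR" "g \<in> carrier MR" by auto
          show "G (mmult (K \<times>\<times> A) (mmult (K \<times>\<times> A) (frag_of p) \<rho>) (f - g)) = \<zero>\<^bsub>H\<^esub>"
            unfolding mmult_diff_right Gdiff[OF mcl[OF pr fg(1)] mcl[OF pr fg(2)]] 1 by (rule zz)
        qed
      qed
      have "Poly_Mapping.keys r \<subseteq> carrier (K \<times>\<times> A)" using r by simp
      then show ?thesis
      proof (rule free_Abelian_group_induct[where P = "\<lambda>r. G (mmult (K \<times>\<times> A) (mmult (K \<times>\<times> A) r \<rho>) s) = \<zero>\<^bsub>H\<^esub>"])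
        show "G (mmult (K \<times>\<times> A) (mmult (K \<times>\<times> A) 0 \<rho>) s) = \<zero>\<^bsub>H\<^esub>" by (simp only: mmult_simps Gzero)
        show "G (mmult (K \<times>\<times> A) (mmult (K \<times>\<times> A) (frag_of q) \<rho>) s) = \<zero>\<^bsub>H\<^esub>"
          if "q \<in> carrier (K \<times>\<times> A)" for q by (rule monor[OF that])
        fix f g assume "Poly_Mapping.keys f \<subseteq> carrier (K \<times>\<times> A)" "Poly_Mapping.keys g \<subseteq> carrier (K \<times>\<times> A)"
          and 1: "G (mmult (K \<times>\<times> A) (mmult (K \<times>\<times> A) f \<rho>) s) = \<zero>\<^bsub>H\<^esub>"
           "G (mmult (K \<times>\<times> A) (mmult (K \<times>\<times> A) g \<rho>) s) = \<zero>\<^bsub>H\<^esub>"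
        then have fg: "f \<in> carrier MR" "g \<in> carrier MR" by auto
        show "G (mmult (K \<times>\<times> A) (mmult (K \<times>\<times> A) (f - g) \<rho>) s) = \<zero>\<^bsub>H\<^esub>"
          unfolding mmult_simps Gdiff[OF mcl[OF mcl[OF fg(1) \<rho>c] s] mcl[OF mcl[OF fg(2) \<rho>c] s]] 1 by (rule zz)
      qed
    qed
    with \<rho>c show "\<rho> \<in> J0" unfolding J0_def by (intro CollectI conjI ballI)
  qed
  ultimately have "J \<subseteq> J0" unfolding tensor_ideal_def by (rule MR.genideal_minimal)
  have GJ: "G f = \<zero>\<^bsub>H\<^esub>" if "f \<in> J" for f
  proof -
    have f: "f \<in> J0" using that \<open>J \<subseteq> J0\<close> by blast
    then have "G (mmult (K \<times>\<times> A) (mmult (K \<times>\<times> A) \<one>\<^bsub>MR\<^esub> f) \<one>\<^bsub>MR\<^esub>) = \<zero>\<^bsub>H\<^esub>"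
      using MR.one_closed unfolding J0_def by blast
    moreover have "f \<in> carrier MR" using f by (simp add: J0_def)
    ultimately show ?thesis using MR.l_one[of f] MR.r_one[of f] by simp
  qed
  \<comment> \<open>\<open>F\<close> evaluates \<open>G\<close> on a chosen representative;
    \<open>Fcls\<close> shows that the choice does not matter, as \<open>G\<close> vanishes on
    \<open>J\<close>.\<close>
  define F where "F t = G (SOME f. f \<in> carrier MR \<and> cls f = t)" for t
  have Fcls: "F (cls f) = G f" if f: "f \<in> carrier MR" for f
  proof -
    define g where "g = (SOME g. g \<in> carrier MR \<and> cls g = cls f)"
    have g: "g \<in> carrier MR \<and> cls g = cls f" unfolding g_def by (rule someI[of _ f]) (use f in simp)
    then have "g - f \<in> J" using cls_eq_iff f by blast
    then have "G g \<ominus>\<^bsub>H\<^esub> G f = \<zero>\<^bsub>H\<^esub>" using GJ Gdiff g f by metis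
    then have "G g = G f" using Gcl f g by (metis H.add.inv_equality H.a_inv_closed H.minus_eq H.minus_minus)
    then show ?thesis by (simp add: F_def g_def)
  qed
  show ?thesis
  proof (rule that)
    show "F (pure x a) = \<beta> x a" if "x \<in> carrier K" "a \<in> carrier A" for x a
      using Fcls[of "frag_of (x, a)"] Gof that by (simp add: pure_cls)
    have "F \<in> carrier S \<rightarrow> carrier H" using cls_surj Fcls Gcl by (auto simp del: monoid_ring_simps)
    moreover have "F (s \<oplus>\<^bsub>S\<^esub> t) = F s \<oplus>\<^bsub>H\<^esub> F t" if st: "s \<in> carrier S" "t \<in> carrier S" for s t
    proof -
      obtain f g where fg: "s = cls f" "f \<in> carrier MR" "t = cls g" "g \<in> carrier MR" using st unfolding cls_surj by (elim imageE)
      show ?thesis unfolding fg(1,3) cls_add[OF fg(2,4), symmetric] Fcls[OF fg(2)] Fcls[OF fg(4)]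
          Fcls[OF acl[OF fg(2,4)]] by (rule Gadd[OF fg(2,4)])
    qed
    ultimately have "F \<in> hom (add_monoid S) (add_monoid H)" by (auto simp: hom_def)
    then show "abelian_group_hom S H F"
      by (intro abelian_group_homI S.abelian_group_axioms H group_hom.intro group_hom_axioms.intro S.a_group H.a_group)
  qed
qed

lemma additive_eqI:
  assumes F: "abelian_group_hom S H F" and G: "abelian_group_hom S H G"
    and eq: "\<And>x a. \<lbrakk>x \<in> carrier K; a \<in> carrier A\<rbrakk> \<Longrightarrow> F (pure x a) = G (pure x a)"
    and t: "t \<in> carrier S"
  shows "F t = G t"
proof -
  interpret F: abelian_group_hom S H F by (rule F)
  interpret G: abelian_group_hom S H G by (rule G)
  show ?thesis using t
    by (induction t rule: S_induct) (simp_all add: eq a_minus_def)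
qed

text \<open>The additive map that \<open>lift_exists\<close> gives for
  \<open>f x \<otimes> g a\<close> is multiplicative because the images of \<open>K\<close> and
  \<open>A\<close> commute: on pure tensors, \<open>g a\<close> has to be moved past
  \<open>f y\<close>. Additivity in each factor does the rest.\<close>

lemma ring_lift_exists:
  fixes H :: "('h, 'v) ring_scheme"
  assumes H: "ring H" and f: "f \<in> ring_hom K H" and g: "g \<in> ring_hom A H"
    and comm: "\<And>x a. \<lbrakk>x \<in> carrier K; a \<in> carrier A\<rbrakk> \<Longrightarrow> g a \<otimes>\<^bsub>H\<^esub> f x = f x \<otimes>\<^bsub>H\<^esub> g a"
    and bal: "\<And>c a. \<lbrakk>c \<in> carrier k; a \<in> carrier A\<rbrakk> \<Longrightarrow> g (c \<odot>\<^bsub>A\<^esub> a) = f (\<iota> c) \<otimes>\<^bsub>H\<^esub> g a"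
  obtains F where "F \<in> ring_hom S H" "\<And>x a. \<lbrakk>x \<in> carrier K; a \<in> carrier A\<rbrakk> \<Longrightarrow> F (pure x a) = f x \<otimes>\<^bsub>H\<^esub> g a"
proof -
  interpret H: ring H by (rule H)
  interpret f: ring_hom_ring K H f by (rule ring_hom_ringI2[OF K.ring_axioms H f])
  interpret g: ring_hom_ring A H g by (rule ring_hom_ringI2[OF A.A.ring_axioms H g])
  obtain F where F: "abelian_group_hom S H F"
    and Fp: "\<And>x a. \<lbrakk>x \<in> carrier K; a \<in> carrier A\<rbrakk> \<Longrightarrow> F (pure x a) = f x \<otimes>\<^bsub>H\<^esub> g a"
    by (rule lift_exists[of H "\<lambda>x a. f x \<otimes>\<^bsub>H\<^esub> g a"])
       (auto simp: H.abelian_group_axioms H.l_distr H.r_distr H.m_assoc bal)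
  interpret F: abelian_group_hom S H F by (rule F)
  have mult: "F (s \<otimes>\<^bsub>S\<^esub> t) = F s \<otimes>\<^bsub>H\<^esub> F t" if s: "s \<in> carrier S" and t: "t \<in> carrier S" for s t
    using s
  proof (induction s rule: S_induct)
    case (pure x a)
    show ?case using t
    proof (induction t rule: S_induct)
      case (pure y b)
      have "f x \<otimes>\<^bsub>H\<^esub> g a \<otimes>\<^bsub>H\<^esub> (f y \<otimes>\<^bsub>H\<^esub> g b) = f x \<otimes>\<^bsub>H\<^esub> (g a \<otimes>\<^bsub>H\<^esub> f y) \<otimes>\<^bsub>H\<^esub> g b"
        using pure \<open>x \<in> carrier K\<close> \<open>a \<in> carrier A\<close> by (simp add: H.m_assoc)
      also have "\<dots> = f x \<otimes>\<^bsub>H\<^esub> f y \<otimes>\<^bsub>H\<^esub> (g a \<otimes>\<^bsub>H\<^esub> g b)"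
        using pure \<open>x \<in> carrier K\<close> \<open>a \<in> carrier A\<close> by (simp add: H.m_assoc comm)
      finally show ?case using pure \<open>x \<in> carrier K\<close> \<open>a \<in> carrier A\<close> by (simp add: pure_mult Fp)
    next
      case (diff u v)
      then show ?case using pure by (simp add: a_minus_def S.r_distr S.r_minus H.r_distr H.r_minus)
    qed (use pure in simp)
  next
    case (diff u v)
    then show ?case using t by (simp add: a_minus_def S.l_distr S.l_minus H.l_distr H.l_minus)
  qed (use t in simp)
  show ?thesis
  proof (rule that)
    show "F \<in> ring_hom S H"
      by (rule ring_hom_memI) (use mult Fp[of "\<one>\<^bsub>K\<^esub>" "\<one>\<^bsub>A\<^esub>"] pure_one in auto)
  qed (rule Fp)
qed

end

section \<open>Linear algebra over a field\<close>

lemma (in abelian_monoid) finsum_remove: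
  assumes "finite I" "i \<in> I" "f \<in> I \<rightarrow> carrier G"
  shows "finsum G f I = f i \<oplus> finsum G f (I - {i})"
proof -
  have "finsum G f (insert i (I - {i})) = f i \<oplus> finsum G f (I - {i})"
    by (rule finsum_insert) (use assms in auto)
  with assms show ?thesis by (simp add: insert_absorb)
qed

lemma (in abelian_monoid) finsum_all_zero:
  assumes "\<And>i. i \<in> I \<Longrightarrow> f i = \<zero>" shows "finsum G f I = \<zero>"
  using add.finprod_one_eqI[of I f] assms by simp

lemma (in abelian_group) diff_zero_imp_eq:
  assumes "x \<oplus> \<ominus> y = \<zero>" "x \<in> carrier G" "y \<in> carrier G"
  shows "x = y"
  using minus_equality[of x "\<ominus> y"] assms by simp

lemma (in abelian_group) finsum_minus:
  assumes "f \<in> I \<rightarrow> carrier G"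
  shows "finsum G (\<lambda>i. \<ominus> f i) I = \<ominus> finsum G f I"
  using assms
proof (induction I rule: infinite_finite_induct)
  case (insert x F)
  then have "f \<in> F \<rightarrow> carrier G" "f x \<in> carrier G" by auto
  moreover from this have "(\<lambda>i. \<ominus> f i) \<in> F \<rightarrow> carrier G" by auto
  ultimately show ?case using insert by (simp add: minus_add)
qed (simp_all add: minus_equality[of \<zero> \<zero>])

lemma (in abelian_group_hom) hom_finsum:
  assumes "f \<in> I \<rightarrow> carrier G"
  shows "h (finsum G f I) = finsum H (\<lambda>i. h (f i)) I"
  using assms
proof (induction I rule: infinite_finite_induct)
  case (insert x F)
  then have "f \<in> F \<rightarrow> carrier G" "f x \<in> carrier G" by auto
  moreover from this have "(\<lambda>i. h (f i)) \<in> F \<rightarrow> carrier H" using hom_closed by blast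
  ultimately show ?case using insert by simp
qed simp_all

lemma (in abelian_monoid) finsum_swap:
  assumes "finite I" "finite J" "\<And>i j. i \<in> I \<Longrightarrow> j \<in> J \<Longrightarrow> f i j \<in> carrier G"
  shows "(\<Oplus>i\<in>I. \<Oplus>j\<in>J. f i j) = (\<Oplus>j\<in>J. \<Oplus>i\<in>I. f i j)"
  using assms(1,3)
proof (induction I rule: finite_induct)
  case empty then show ?case by (simp add: finsum_all_zero)
next
  case (insert x F)
  then have "(\<Oplus>i\<in>F. \<Oplus>j\<in>J. f i j) = (\<Oplus>j\<in>J. \<Oplus>i\<in>F. f i j)" by auto
  moreover have "(\<Oplus>i\<in>insert x F. \<Oplus>j\<in>J. f i j) = (\<Oplus>j\<in>J. f x j) \<oplus> (\<Oplus>i\<in>F. \<Oplus>j\<in>J. f i j)"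
    using insert by (intro finsum_insert) (auto intro!: finsum_closed)
  moreover have "(\<Oplus>j\<in>J. \<Oplus>i\<in>insert x F. f i j) = (\<Oplus>j\<in>J. f x j \<oplus> (\<Oplus>i\<in>F. f i j))"
    using insert by (intro finsum_cong') (auto intro!: finsum_insert finsum_closed)
  moreover have "\<dots> = (\<Oplus>j\<in>J. f x j) \<oplus> (\<Oplus>j\<in>J. \<Oplus>i\<in>F. f i j)"
    using insert by (intro finsum_addf) (auto intro!: finsum_closed)
  ultimately show ?case by simp
qed

lemma (in ring) finsum_subring_closed:
  assumes "subring H R" "\<And>i. i \<in> I \<Longrightarrow> f i \<in> H"
  shows "finsum R f I \<in> H"
  using assms(2)
proof (induction I rule: infinite_finite_induct)
  case (insert x F)
  then have "f \<in> F \<rightarrow> carrier R" "f x \<in> carrier R" using subringE(1)[OF assms(1)] by auto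
  with insert show ?case using subringE(7)[OF assms(1)] by simp
qed (simp_all add: subringE(2)[OF assms(1)])

text \<open>Gaussian elimination for a homogeneous system with unknowns indexed by \<open>I\<close>,
  one equation of \<open>B\<close> at a time. Having the entries and the solution in a subfield is
  what keeps the later dependence relations rational over \<open>E\<close>.\<close>

lemma (in field) dependent_family:
  assumes E: "subfield E R" and "finite B" "finite I" "card B < card I"
    and M: "\<And>i b. i \<in> I \<Longrightarrow> b \<in> B \<Longrightarrow> M i b \<in> E"
  shows "\<exists>c. (\<forall>i\<in>I. c i \<in> E) \<and> (\<exists>i\<in>I. c i \<noteq> \<zero>) \<and> (\<forall>b\<in>B. (\<Oplus>i\<in>I. c i \<otimes> M i b) = \<zero>)"
  using assms(2-5)
proof (induction B arbitrary: I M rule: finite_induct)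
  case empty
  then obtain i where "i \<in> I" by fastforce
  then show ?case using subringE(3)[OF subfieldE(1)[OF E]] one_not_zero by (intro exI[of _ "\<lambda>_. \<one>"]) auto
next
  case (insert b B)
  note Esub = subfieldE(1)[OF E]
  have Ec: "\<And>x. x \<in> E \<Longrightarrow> x \<in> carrier R" using subfieldE(3)[OF E] by blast
  show ?case
  proof (cases "\<forall>i\<in>I. M i b = \<zero>")
    case True
    obtain c where c: "\<forall>i\<in>I. c i \<in> E" "\<exists>i\<in>I. c i \<noteq> \<zero>" "\<forall>b\<in>B. (\<Oplus>i\<in>I. c i \<otimes> M i b) = \<zero>"
      using insert.IH[of I M] insert.prems insert.hyps by auto
    have "(\<Oplus>i\<in>I. c i \<otimes> M i b) = \<zero>" using True c(1) Ec by (intro finsum_all_zero) auto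
    with c show ?thesis by auto
  next
    case False
    then obtain j where j: "j \<in> I" "M j b \<noteq> \<zero>" by auto
    define q where "q i = M i b \<otimes> inv (M j b)" for i
    have Mj: "M j b \<in> carrier R" using Ec insert.prems(3) j by auto
    have invE: "inv (M j b) \<in> E" using subfield_m_inv(1)[OF E, of "M j b"] j insert.prems(3)[OF j(1)] by auto
    have qE: "q i \<in> E" if "i \<in> I" for i
      unfolding q_def using subringE(6)[OF Esub] insert.prems(3)[OF that] invE by auto
    \<comment> \<open>\<open>j\<close> is the pivot: subtracting \<open>q i\<close> times the row of
      \<open>j\<close> clears equation \<open>b\<close>, so the induction hypothesis is needed only
      for \<open>B\<close> and \<open>I - {j}\<close>. The value of the unknown \<open>j\<close> is
      recovered in \<open>d\<close>.\<close>
    define N where "N i b' = M i b' \<ominus> q i \<otimes> M j b'" for i b'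
    have NE: "N i b' \<in> E" if "i \<in> I" "b' \<in> insert b B" for i b'
      unfolding N_def a_minus_def using that subringE(5-7)[OF Esub] qE insert.prems(3) j by auto
    have "card B < card (I - {j})" using insert.prems insert.hyps j by simp
    then obtain c where c: "\<forall>i\<in>I-{j}. c i \<in> E" "\<exists>i\<in>I-{j}. c i \<noteq> \<zero>" "\<forall>b\<in>B. (\<Oplus>i\<in>I-{j}. c i \<otimes> N i b) = \<zero>"
      using insert.IH[of "I - {j}" N] insert.prems(1) NE by auto
    define d where "d = c(j := \<ominus> (\<Oplus>i\<in>I-{j}. c i \<otimes> q i))"
    have cqE: "(\<Oplus>i\<in>I-{j}. c i \<otimes> q i) \<in> E"
      by (rule finsum_subring_closed[OF Esub]) (use subringE(6)[OF Esub] c(1) qE in auto)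
    have dE: "\<forall>i\<in>I. d i \<in> E"
      using c(1) cqE subringE(5)[OF Esub] by (auto simp: d_def)
    have eq: "(\<Oplus>i\<in>I. d i \<otimes> M i b') = \<zero>" if b': "b' \<in> insert b B" for b'
    proof -
      have cc: "c i \<in> carrier R" "q i \<in> carrier R" "M i b' \<in> carrier R" "N i b' \<in> carrier R" if "i \<in> I - {j}" for i
        using that c(1) qE insert.prems(3) NE b' Ec by auto
      have Mjb: "M j b' \<in> carrier R" using insert.prems(3) j b' Ec by auto
      have "(\<Oplus>i\<in>I. d i \<otimes> M i b') = d j \<otimes> M j b' \<oplus> (\<Oplus>i\<in>I-{j}. d i \<otimes> M i b')"
        by (rule finsum_remove) (use insert.prems j dE Ec b' in auto)
      also have "(\<Oplus>i\<in>I-{j}. d i \<otimes> M i b') = (\<Oplus>i\<in>I-{j}. c i \<otimes> M i b')"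
        by (rule finsum_cong') (use cc in \<open>auto simp: d_def\<close>)
      also have "\<dots> = (\<Oplus>i\<in>I-{j}. c i \<otimes> N i b' \<oplus> c i \<otimes> q i \<otimes> M j b')"
      proof (rule finsum_cong')
        fix i assume i: "i \<in> I - {j}"
        have "N i b' \<oplus> q i \<otimes> M j b' = M i b'" unfolding N_def a_minus_def using cc[OF i] Mjb
          by (simp add: a_assoc l_neg)
        then show "c i \<otimes> M i b' = c i \<otimes> N i b' \<oplus> c i \<otimes> q i \<otimes> M j b'"
          using cc[OF i] Mjb by (metis m_assoc m_closed r_distr)
      qed (use cc Mjb in auto)
      also have "\<dots> = (\<Oplus>i\<in>I-{j}. c i \<otimes> N i b') \<oplus> (\<Oplus>i\<in>I-{j}. c i \<otimes> q i \<otimes> M j b')"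
        by (rule finsum_addf) (use cc Mjb in auto)
      also have "(\<Oplus>i\<in>I-{j}. c i \<otimes> q i \<otimes> M j b') = (\<Oplus>i\<in>I-{j}. c i \<otimes> q i) \<otimes> M j b'"
        by (rule finsum_ldistr[symmetric]) (use insert.prems cc Mjb in auto)
      also have "(\<Oplus>i\<in>I-{j}. c i \<otimes> N i b') = \<zero>"
      proof (cases "b' \<in> B")
        case True then show ?thesis using c(3) by blast
      next
        case False
        then have [simp]: "b' = b" using b' by simp
        have "N i b = \<zero>" if "i \<in> I - {j}" for i
          unfolding N_def q_def a_minus_def using cc[OF that] Mj j
          by (simp add: m_assoc field_Units r_neg)
        then show ?thesis by (intro finsum_all_zero) (use cc in auto)
      qed
      also have "d j = \<ominus> (\<Oplus>i\<in>I-{j}. c i \<otimes> q i)" by (simp add: d_def)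
      finally show ?thesis using Ec[OF cqE] Mjb by (simp add: l_minus l_neg)
    qed
    have "\<exists>i\<in>I. d i \<noteq> \<zero>" using c(2) by (auto simp: d_def)
    with dE show ?thesis using eq by (intro exI[of _ d] conjI ballI) auto
  qed
qed

text \<open>A spanning set of least cardinality is a basis, and its coordinate functions are linear
  because coordinates are unique.\<close>

lemma dual_basis:
  fixes k :: "('k, 'x) ring_scheme" and M :: "('k, 'a, 'y) module_scheme"
  assumes k: "field k" and M: "module k M" and fd: "finite_dimensional k M"
  obtains B h where "finite B" "B \<subseteq> carrier M"
    "\<And>b x. b \<in> B \<Longrightarrow> x \<in> carrier M \<Longrightarrow> h b x \<in> carrier k"
    "\<And>b x y. b \<in> B \<Longrightarrow> x \<in> carrier M \<Longrightarrow> y \<in> carrier M \<Longrightarrow> h b (x \<oplus>\<^bsub>M\<^esub> y) = h b x \<oplus>\<^bsub>k\<^esub> h b y"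
    "\<And>b c x. b \<in> B \<Longrightarrow> c \<in> carrier k \<Longrightarrow> x \<in> carrier M \<Longrightarrow> h b (c \<odot>\<^bsub>M\<^esub> x) = c \<otimes>\<^bsub>k\<^esub> h b x"
    "\<And>x. x \<in> carrier M \<Longrightarrow> (\<Oplus>\<^bsub>M\<^esub>b\<in>B. h b x \<odot>\<^bsub>M\<^esub> b) = x"
    "\<And>b b'. b \<in> B \<Longrightarrow> b' \<in> B \<Longrightarrow> h b b' = (if b = b' then \<one>\<^bsub>k\<^esub> else \<zero>\<^bsub>k\<^esub>)"
proof -
  interpret field k by (rule k)
  have abk: "abelian_group k" by (rule abelian_group_axioms)
  interpret module k M by (rule M)
  define spans where "spans T \<longleftrightarrow> finite T \<and> T \<subseteq> carrier M \<and>
      (\<forall>x\<in>carrier M. \<exists>c\<in>T \<rightarrow> carrier k. x = (\<Oplus>\<^bsub>M\<^esub>s\<in>T. c s \<odot>\<^bsub>M\<^esub> s))" for T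
  obtain T0 where T0: "spans T0" using fd unfolding finite_dimensional_def spans_def by metis
  have "\<exists>B. spans B \<and> (\<forall>T. spans T \<longrightarrow> card B \<le> card T)" by (rule ex_has_least_nat[of spans T0 card]) (rule T0)
  then obtain B where B: "spans B" and Bmin: "\<And>T. spans T \<Longrightarrow> card B \<le> card T" by metis
  have Bfin: "finite B" and Bc: "\<And>b. b \<in> B \<Longrightarrow> b \<in> carrier M" using B by (auto simp: spans_def)
  \<comment> \<open>A relation with \<open>c s\<close> nonzero would express \<open>s\<close>
    through the other elements, so that \<open>B - {s}\<close> would still span, against
    minimality.\<close>
  have indep: "c s = \<zero>\<^bsub>k\<^esub>" if c: "c \<in> B \<rightarrow> carrier k" and z: "(\<Oplus>\<^bsub>M\<^esub>s\<in>B. c s \<odot>\<^bsub>M\<^esub> s) = \<zero>\<^bsub>M\<^esub>" and s: "s \<in> B" for c s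
  proof (rule ccontr)
    assume nz: "c s \<noteq> \<zero>\<^bsub>k\<^esub>"
    have cs: "c s \<in> carrier k" using c s by auto
    have ics: "inv\<^bsub>k\<^esub> c s \<in> carrier k" using nz cs by (simp add: field_Units)
    define e where "e t = \<ominus>\<^bsub>k\<^esub> (inv\<^bsub>k\<^esub> c s \<otimes>\<^bsub>k\<^esub> c t)" for t
    have ec: "e t \<in> carrier k" if "t \<in> B" for t using that c ics by (auto simp: e_def)
    let ?R = "\<Oplus>\<^bsub>M\<^esub>t\<in>B-{s}. c t \<odot>\<^bsub>M\<^esub> t"
    have Rc: "?R \<in> carrier M" using c Bc by (auto intro!: M.finsum_closed)
    have "c s \<odot>\<^bsub>M\<^esub> s \<oplus>\<^bsub>M\<^esub> ?R = \<zero>\<^bsub>M\<^esub>"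
    proof -
      have "(\<lambda>t. c t \<odot>\<^bsub>M\<^esub> t) \<in> B \<rightarrow> carrier M" using c Bc by auto
      from M.finsum_remove[OF Bfin s this] z show ?thesis by simp
    qed
    then have "c s \<odot>\<^bsub>M\<^esub> s = \<ominus>\<^bsub>M\<^esub> ?R" using Rc cs Bc[OF s] by (metis M.minus_equality smult_closed)
    then have "inv\<^bsub>k\<^esub> c s \<odot>\<^bsub>M\<^esub> (c s \<odot>\<^bsub>M\<^esub> s) = inv\<^bsub>k\<^esub> c s \<odot>\<^bsub>M\<^esub> (\<ominus>\<^bsub>M\<^esub> ?R)" by simp
    then have "s = \<ominus>\<^bsub>M\<^esub> (inv\<^bsub>k\<^esub> c s \<odot>\<^bsub>M\<^esub> ?R)"
      using ics cs Bc[OF s] nz Rc by (simp add: smult_assoc1[symmetric] field_Units smult_r_minus)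
    also have "inv\<^bsub>k\<^esub> c s \<odot>\<^bsub>M\<^esub> ?R = (\<Oplus>\<^bsub>M\<^esub>t\<in>B-{s}. inv\<^bsub>k\<^esub> c s \<odot>\<^bsub>M\<^esub> (c t \<odot>\<^bsub>M\<^esub> t))"
      by (rule finsum_smult_ldistr) (use Bfin ics c Bc in \<open>auto simp: Pi_iff\<close>)
    also have "\<ominus>\<^bsub>M\<^esub> \<dots> = (\<Oplus>\<^bsub>M\<^esub>t\<in>B-{s}. \<ominus>\<^bsub>M\<^esub> (inv\<^bsub>k\<^esub> c s \<odot>\<^bsub>M\<^esub> (c t \<odot>\<^bsub>M\<^esub> t)))"
      by (rule M.finsum_minus[symmetric]) (use ics c Bc in \<open>auto simp: Pi_iff\<close>)
    also have "\<dots> = (\<Oplus>\<^bsub>M\<^esub>t\<in>B-{s}. e t \<odot>\<^bsub>M\<^esub> t)"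
      by (rule M.finsum_cong') (use ics c Bc ec in \<open>auto simp: e_def smult_l_minus smult_assoc1 Pi_iff\<close>)
    finally have s_eq: "s = (\<Oplus>\<^bsub>M\<^esub>t\<in>B-{s}. e t \<odot>\<^bsub>M\<^esub> t)" .
    have "spans (B - {s})" unfolding spans_def
    proof (intro conjI ballI)
      fix x assume "x \<in> carrier M"
      then obtain d where d: "d \<in> B \<rightarrow> carrier k" "x = (\<Oplus>\<^bsub>M\<^esub>t\<in>B. d t \<odot>\<^bsub>M\<^esub> t)"
        using B by (auto simp: spans_def)
      have ds: "d s \<in> carrier k" using d s by auto
      have "x = d s \<odot>\<^bsub>M\<^esub> s \<oplus>\<^bsub>M\<^esub> (\<Oplus>\<^bsub>M\<^esub>t\<in>B-{s}. d t \<odot>\<^bsub>M\<^esub> t)"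
        unfolding d(2) by (rule M.finsum_remove[OF Bfin s]) (use d Bc in \<open>auto simp: Pi_iff\<close>)
      also have "d s \<odot>\<^bsub>M\<^esub> s = d s \<odot>\<^bsub>M\<^esub> (\<Oplus>\<^bsub>M\<^esub>t\<in>B-{s}. e t \<odot>\<^bsub>M\<^esub> t)" using s_eq by simp
      also have "\<dots> = (\<Oplus>\<^bsub>M\<^esub>t\<in>B-{s}. d s \<odot>\<^bsub>M\<^esub> (e t \<odot>\<^bsub>M\<^esub> t))"
        by (rule finsum_smult_ldistr) (use Bfin ds ec Bc in \<open>auto simp: Pi_iff\<close>)
      also have "\<dots> \<oplus>\<^bsub>M\<^esub> (\<Oplus>\<^bsub>M\<^esub>t\<in>B-{s}. d t \<odot>\<^bsub>M\<^esub> t) = (\<Oplus>\<^bsub>M\<^esub>t\<in>B-{s}. d s \<odot>\<^bsub>M\<^esub> (e t \<odot>\<^bsub>M\<^esub> t) \<oplus>\<^bsub>M\<^esub> d t \<odot>\<^bsub>M\<^esub> t)"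
        by (rule M.finsum_addf[symmetric]) (use d ds ec Bc in \<open>auto simp: Pi_iff\<close>)
      also have "\<dots> = (\<Oplus>\<^bsub>M\<^esub>t\<in>B-{s}. (d s \<otimes>\<^bsub>k\<^esub> e t \<oplus>\<^bsub>k\<^esub> d t) \<odot>\<^bsub>M\<^esub> t)"
        by (rule M.finsum_cong') (use d ds ec Bc in \<open>auto simp: smult_l_distr smult_assoc1 Pi_iff\<close>)
      finally show "\<exists>c\<in>B - {s} \<rightarrow> carrier k. x = (\<Oplus>\<^bsub>M\<^esub>t\<in>B - {s}. c t \<odot>\<^bsub>M\<^esub> t)"
        using d ds ec by (intro bexI[of _ "\<lambda>t. d s \<otimes>\<^bsub>k\<^esub> e t \<oplus>\<^bsub>k\<^esub> d t"]) auto
    qed (use Bfin Bc in \<open>auto simp: Pi_iff\<close>)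
    from Bmin[OF this] show False using Bfin s by (metis card_Diff1_less not_le)
  qed
  have uniq: "c s = d s" if c: "c \<in> B \<rightarrow> carrier k" and d: "d \<in> B \<rightarrow> carrier k"
      and e: "(\<Oplus>\<^bsub>M\<^esub>s\<in>B. c s \<odot>\<^bsub>M\<^esub> s) = (\<Oplus>\<^bsub>M\<^esub>s\<in>B. d s \<odot>\<^bsub>M\<^esub> s)" and s: "s \<in> B" for c d s
  proof -
    have "(\<Oplus>\<^bsub>M\<^esub>s\<in>B. (c s \<oplus>\<^bsub>k\<^esub> \<ominus>\<^bsub>k\<^esub> d s) \<odot>\<^bsub>M\<^esub> s) = (\<Oplus>\<^bsub>M\<^esub>s\<in>B. c s \<odot>\<^bsub>M\<^esub> s \<oplus>\<^bsub>M\<^esub> \<ominus>\<^bsub>M\<^esub> (d s \<odot>\<^bsub>M\<^esub> s))"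
      by (rule M.finsum_cong') (use c d Bc in \<open>auto simp: smult_l_distr smult_l_minus Pi_iff\<close>)
    also have "\<dots> = (\<Oplus>\<^bsub>M\<^esub>s\<in>B. c s \<odot>\<^bsub>M\<^esub> s) \<oplus>\<^bsub>M\<^esub> (\<Oplus>\<^bsub>M\<^esub>s\<in>B. \<ominus>\<^bsub>M\<^esub> (d s \<odot>\<^bsub>M\<^esub> s))"
      by (rule M.finsum_addf) (use c d Bc in \<open>auto simp: Pi_iff\<close>)
    also have "(\<Oplus>\<^bsub>M\<^esub>s\<in>B. \<ominus>\<^bsub>M\<^esub> (d s \<odot>\<^bsub>M\<^esub> s)) = \<ominus>\<^bsub>M\<^esub> (\<Oplus>\<^bsub>M\<^esub>s\<in>B. d s \<odot>\<^bsub>M\<^esub> s)"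
      by (rule M.finsum_minus) (use d Bc in \<open>auto simp: Pi_iff\<close>)
    also have "(\<Oplus>\<^bsub>M\<^esub>s\<in>B. c s \<odot>\<^bsub>M\<^esub> s) \<oplus>\<^bsub>M\<^esub> \<dots> = \<zero>\<^bsub>M\<^esub>"
      unfolding e by (rule M.r_neg) (use d Bc in \<open>auto intro!: M.finsum_closed\<close>)
    finally have "c s \<oplus>\<^bsub>k\<^esub> \<ominus>\<^bsub>k\<^esub> d s = \<zero>\<^bsub>k\<^esub>"
      by (intro indep[of "\<lambda>s. c s \<oplus>\<^bsub>k\<^esub> \<ominus>\<^bsub>k\<^esub> d s"]) (use c d s in \<open>auto simp: Pi_iff\<close>)
    moreover have "c s \<in> carrier k" "d s \<in> carrier k" using c d s by auto
    ultimately show ?thesis using abelian_group.diff_zero_imp_eq[OF abk] by blast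
  qed
  have "\<forall>x\<in>carrier M. \<exists>c. c\<in>B \<rightarrow> carrier k \<and> x = (\<Oplus>\<^bsub>M\<^esub>s\<in>B. c s \<odot>\<^bsub>M\<^esub> s)"
    using B unfolding spans_def by blast
  then obtain cf where cf: "\<And>x. x \<in> carrier M \<Longrightarrow> cf x \<in> B \<rightarrow> carrier k"
     and cf_eq: "\<And>x. x \<in> carrier M \<Longrightarrow> x = (\<Oplus>\<^bsub>M\<^esub>s\<in>B. cf x s \<odot>\<^bsub>M\<^esub> s)" by metis
  show ?thesis
  proof (rule that[of B "\<lambda>b x. cf x b"])
    show "finite B" "B \<subseteq> carrier M" using Bfin Bc by auto
    show "cf x b \<in> carrier k" if "b \<in> B" "x \<in> carrier M" for b x using cf[OF that(2)] that(1) by auto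
    show "(\<Oplus>\<^bsub>M\<^esub>b\<in>B. cf x b \<odot>\<^bsub>M\<^esub> b) = x" if "x \<in> carrier M" for x using cf_eq[OF that] by simp
    show "cf (x \<oplus>\<^bsub>M\<^esub> y) b = cf x b \<oplus>\<^bsub>k\<^esub> cf y b" if b: "b \<in> B" and x: "x \<in> carrier M" and y: "y \<in> carrier M" for b x y
    proof (rule uniq[OF cf[of "x \<oplus>\<^bsub>M\<^esub> y"] _ _ b])
      show "x \<oplus>\<^bsub>M\<^esub> y \<in> carrier M" using x y by simp
      show "(\<lambda>b. cf x b \<oplus>\<^bsub>k\<^esub> cf y b) \<in> B \<rightarrow> carrier k" using cf[OF x] cf[OF y] by auto
      have "(\<Oplus>\<^bsub>M\<^esub>s\<in>B. (cf x s \<oplus>\<^bsub>k\<^esub> cf y s) \<odot>\<^bsub>M\<^esub> s) = (\<Oplus>\<^bsub>M\<^esub>s\<in>B. cf x s \<odot>\<^bsub>M\<^esub> s \<oplus>\<^bsub>M\<^esub> cf y s \<odot>\<^bsub>M\<^esub> s)"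
        by (rule M.finsum_cong') (use cf[OF x] cf[OF y] Bc in \<open>auto simp: smult_l_distr Pi_iff\<close>)
      also have "\<dots> = (\<Oplus>\<^bsub>M\<^esub>s\<in>B. cf x s \<odot>\<^bsub>M\<^esub> s) \<oplus>\<^bsub>M\<^esub> (\<Oplus>\<^bsub>M\<^esub>s\<in>B. cf y s \<odot>\<^bsub>M\<^esub> s)"
        by (rule M.finsum_addf) (use cf[OF x] cf[OF y] Bc in \<open>auto simp: Pi_iff\<close>)
      finally show "(\<Oplus>\<^bsub>M\<^esub>s\<in>B. cf (x \<oplus>\<^bsub>M\<^esub> y) s \<odot>\<^bsub>M\<^esub> s) = (\<Oplus>\<^bsub>M\<^esub>s\<in>B. (cf x s \<oplus>\<^bsub>k\<^esub> cf y s) \<odot>\<^bsub>M\<^esub> s)"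
        using cf_eq[OF x] cf_eq[OF y] cf_eq[of "x \<oplus>\<^bsub>M\<^esub> y"] x y by simp
    qed
    show "cf (c \<odot>\<^bsub>M\<^esub> x) b = c \<otimes>\<^bsub>k\<^esub> cf x b" if b: "b \<in> B" and c: "c \<in> carrier k" and x: "x \<in> carrier M" for b c x
    proof (rule uniq[OF cf[of "c \<odot>\<^bsub>M\<^esub> x"] _ _ b])
      show "c \<odot>\<^bsub>M\<^esub> x \<in> carrier M" using x c by simp
      show "(\<lambda>b. c \<otimes>\<^bsub>k\<^esub> cf x b) \<in> B \<rightarrow> carrier k" using cf[OF x] c by auto
      have "(\<Oplus>\<^bsub>M\<^esub>s\<in>B. (c \<otimes>\<^bsub>k\<^esub> cf x s) \<odot>\<^bsub>M\<^esub> s) = (\<Oplus>\<^bsub>M\<^esub>s\<in>B. c \<odot>\<^bsub>M\<^esub> (cf x s \<odot>\<^bsub>M\<^esub> s))"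
        by (rule M.finsum_cong') (use cf[OF x] c Bc in \<open>auto simp: smult_assoc1 Pi_iff\<close>)
      also have "\<dots> = c \<odot>\<^bsub>M\<^esub> (\<Oplus>\<^bsub>M\<^esub>s\<in>B. cf x s \<odot>\<^bsub>M\<^esub> s)"
        by (rule finsum_smult_ldistr[symmetric]) (use cf[OF x] c Bc Bfin in \<open>auto simp: Pi_iff\<close>)
      finally show "(\<Oplus>\<^bsub>M\<^esub>s\<in>B. cf (c \<odot>\<^bsub>M\<^esub> x) s \<odot>\<^bsub>M\<^esub> s) = (\<Oplus>\<^bsub>M\<^esub>s\<in>B. (c \<otimes>\<^bsub>k\<^esub> cf x s) \<odot>\<^bsub>M\<^esub> s)"
        using cf_eq[OF x] cf_eq[of "c \<odot>\<^bsub>M\<^esub> x"] x c by simp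
    qed
    show "cf b' b = (if b = b' then \<one>\<^bsub>k\<^esub> else \<zero>\<^bsub>k\<^esub>)" if b: "b \<in> B" and b': "b' \<in> B" for b b'
    proof (rule uniq[OF cf[OF Bc[OF b']] _ _ b])
      show "(\<lambda>b. if b = b' then \<one>\<^bsub>k\<^esub> else \<zero>\<^bsub>k\<^esub>) \<in> B \<rightarrow> carrier k" by auto
      have "(\<Oplus>\<^bsub>M\<^esub>s\<in>B. (if s = b' then \<one>\<^bsub>k\<^esub> else \<zero>\<^bsub>k\<^esub>) \<odot>\<^bsub>M\<^esub> s) = (\<Oplus>\<^bsub>M\<^esub>s\<in>B. if b' = s then s else \<zero>\<^bsub>M\<^esub>)"
        by (rule M.finsum_cong') (use Bc in \<open>auto simp: Pi_iff\<close>)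
      also have "\<dots> = b'" by (rule M.finsum_singleton[OF b' Bfin]) (use Bc in \<open>auto simp: Pi_iff\<close>)
      finally show "(\<Oplus>\<^bsub>M\<^esub>s\<in>B. cf b' s \<odot>\<^bsub>M\<^esub> s) = (\<Oplus>\<^bsub>M\<^esub>s\<in>B. (if s = b' then \<one>\<^bsub>k\<^esub> else \<zero>\<^bsub>k\<^esub>) \<odot>\<^bsub>M\<^esub> s)"
        using cf_eq[OF Bc[OF b']] by simp
    qed
  qed
qed

section \<open>Regular rings and division rings\<close>

lemma (in abelian_group) add_diff_cancel_left':
  assumes "v \<in> carrier G" "w \<in> carrier G" shows "(v \<oplus> w) \<ominus> v = w"
  using assms by (simp add: minus_eq a_comm[of v w] a_assoc r_neg)

lemma (in abelian_group) add_left_imp_zero: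
  assumes "v \<in> carrier G" "w \<in> carrier G" "v = w \<oplus> v" shows "w = \<zero>"
  using add_diff_cancel_left'[of v w] assms a_comm[of v w] by (simp add: minus_eq r_neg)

text \<open>Split \<open>R\<close> into the left ideal \<open>R x\<close> and a complement
  \<open>J\<close>, and write the unit as \<open>f + g\<close> with \<open>f = r x\<close>. Then
  \<open>x g = x - x f\<close> lies in \<open>R x\<close> and in \<open>J\<close>, hence is zero,
  and \<open>x = x f = x r x\<close>.\<close>

lemma semisimple_imp_regular:
  assumes R: "ring R" and ss: "semisimple_ring R" and x: "x \<in> carrier R"
  shows "\<exists>r\<in>carrier R. x \<otimes>\<^bsub>R\<^esub> r \<otimes>\<^bsub>R\<^esub> x = x"
proof -
  interpret ring R by (rule R)
  define I where "I = {y \<otimes>\<^bsub>R\<^esub> x | y. y \<in> carrier R}"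
  have "left_ideal I R" unfolding left_ideal_def
  proof (intro conjI ballI)
    show "additive_subgroup I R"
    proof (rule additive_subgroupI, rule add.subgroupI)
      show "I \<subseteq> carrier R" using x by (auto simp: I_def)
      show "I \<noteq> {}" using x by (auto simp: I_def)
      show "\<ominus>\<^bsub>R\<^esub> a \<in> I" if a: "a \<in> I" for a
      proof -
        obtain y where "y \<in> carrier R" "a = y \<otimes>\<^bsub>R\<^esub> x" using a by (auto simp: I_def)
        then show ?thesis using x unfolding I_def by (intro CollectI exI[of _ "\<ominus>\<^bsub>R\<^esub> y"]) (simp add: l_minus)
      qed
      show "a \<oplus>\<^bsub>R\<^esub> b \<in> I" if ab: "a \<in> I" "b \<in> I" for a b
      proof -
        obtain y z where "y \<in> carrier R" "a = y \<otimes>\<^bsub>R\<^esub> x" "z \<in> carrier R" "b = z \<otimes>\<^bsub>R\<^esub> x"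
          using ab by (auto simp: I_def)
        then show ?thesis using x unfolding I_def by (intro CollectI exI[of _ "y \<oplus>\<^bsub>R\<^esub> z"]) (simp add: l_distr)
      qed
    qed
    show "r \<otimes>\<^bsub>R\<^esub> a \<in> I" if r: "r \<in> carrier R" and a: "a \<in> I" for r a
    proof -
      obtain y where "y \<in> carrier R" "a = y \<otimes>\<^bsub>R\<^esub> x" using a by (auto simp: I_def)
      then show ?thesis using x r unfolding I_def by (intro CollectI exI[of _ "r \<otimes>\<^bsub>R\<^esub> y"]) (simp add: m_assoc)
    qed
  qed
  then obtain J where J: "left_ideal J R" "I \<inter> J = {\<zero>\<^bsub>R\<^esub>}" "I <+>\<^bsub>R\<^esub> J = carrier R"
    using ss unfolding semisimple_ring_def by metis
  have "\<one>\<^bsub>R\<^esub> \<in> I <+>\<^bsub>R\<^esub> J" using J(3) by simp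
  then obtain f g where fg: "f \<in> I" "g \<in> J" "\<one>\<^bsub>R\<^esub> = f \<oplus>\<^bsub>R\<^esub> g" by (auto simp: set_add_def')
  obtain r where r: "r \<in> carrier R" "f = r \<otimes>\<^bsub>R\<^esub> x" using fg(1) by (auto simp: I_def)
  have gc: "g \<in> carrier R"
    using J(1) fg(2) additive_subgroup.a_subset unfolding left_ideal_def by blast
  have xg: "x = x \<otimes>\<^bsub>R\<^esub> f \<oplus>\<^bsub>R\<^esub> x \<otimes>\<^bsub>R\<^esub> g"
  proof -
    have fc: "f \<in> carrier R" using r x by simp
    have "x = x \<otimes>\<^bsub>R\<^esub> (f \<oplus>\<^bsub>R\<^esub> g)" unfolding fg(3)[symmetric] using x by simp
    then show ?thesis using r_distr[OF fc gc x] by simp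
  qed
  then have "x \<otimes>\<^bsub>R\<^esub> g = x \<ominus>\<^bsub>R\<^esub> x \<otimes>\<^bsub>R\<^esub> f"
    using add_diff_cancel_left'[of "x \<otimes>\<^bsub>R\<^esub> f" "x \<otimes>\<^bsub>R\<^esub> g"] x r gc by simp
  also have "\<dots> = (\<one>\<^bsub>R\<^esub> \<ominus>\<^bsub>R\<^esub> x \<otimes>\<^bsub>R\<^esub> r) \<otimes>\<^bsub>R\<^esub> x"
    using x r by (simp add: a_minus_def l_distr l_minus m_assoc)
  finally have "x \<otimes>\<^bsub>R\<^esub> g \<in> I" using x r unfolding I_def by blast
  moreover have "x \<otimes>\<^bsub>R\<^esub> g \<in> J" using J(1) fg(2) x unfolding left_ideal_def by blast
  ultimately have "x \<otimes>\<^bsub>R\<^esub> g = \<zero>\<^bsub>R\<^esub>" using J(2) by blast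
  then have "x = x \<otimes>\<^bsub>R\<^esub> f" using xg x r by simp
  then show ?thesis using x r by (intro bexI[of _ r]) (simp_all add: m_assoc)
qed

section \<open>Binomial theorem and Frobenius map for commuting additive operators\<close>

context abelian_group begin

lemma add_pow_dvd_zero:
  assumes "[p] \<cdot> v = \<zero>" "v \<in> carrier G" "p dvd (n::nat)" shows "[n] \<cdot> v = \<zero>"
proof -
  obtain m where "n = p * m" using assms(3) by auto
  then show ?thesis using add.nat_pow_pow[OF assms(2), of m p] assms(1) by simp
qed

text \<open>Operators on an abelian group take the place of ring elements because in a
  noncommutative ring left and right multiplications commute as operators although the elements do
  not. This is how the derivation \<open>[a, -]\<close> can be raised to the power
  \<open>p\<close>.\<close>

lemma operator_binomial:
  assumes f: "\<And>v. v \<in> carrier G \<Longrightarrow> f v \<in> carrier G" and g: "\<And>v. v \<in> carrier G \<Longrightarrow> g v \<in> carrier G"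
    and fa: "\<And>u v. u \<in> carrier G \<Longrightarrow> v \<in> carrier G \<Longrightarrow> f (u \<oplus> v) = f u \<oplus> f v"
    and ga: "\<And>u v. u \<in> carrier G \<Longrightarrow> v \<in> carrier G \<Longrightarrow> g (u \<oplus> v) = g u \<oplus> g v"
    and fg: "\<And>v. v \<in> carrier G \<Longrightarrow> f (g v) = g (f v)" and v: "v \<in> carrier G"
  shows "((\<lambda>v. f v \<oplus> g v) ^^ n) v = (\<Oplus>j\<in>{..n}. [(n choose j)] \<cdot> (f ^^ j) ((g ^^ (n - j)) v))"
proof (induction n)
  case 0 show ?case using v by simp
next
  case (Suc n)
  have fi: "(f ^^ j) u \<in> carrier G" if "u \<in> carrier G" for j u using that f by (induction j) auto
  have gi: "(g ^^ j) u \<in> carrier G" if "u \<in> carrier G" for j u using that g by (induction j) auto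
  have gf: "g ((f ^^ j) u) = (f ^^ j) (g u)" if "u \<in> carrier G" for j u
    using that by (induction j) (auto simp: fi fg[symmetric])
  interpret F: abelian_group_hom G G f
    by (intro abelian_group_homI abelian_group_axioms group_hom.intro group_hom_axioms.intro a_group)
       (auto simp: hom_def f fa)
  interpret Gh: abelian_group_hom G G g
    by (intro abelian_group_homI abelian_group_axioms group_hom.intro group_hom_axioms.intro a_group)
       (auto simp: hom_def g ga)
  have fp: "f ([m] \<cdot> u) = [m] \<cdot> f u" if "u \<in> carrier G" for u and m :: nat
    using that by (induction m) (simp_all add: f fa)
  have gp: "g ([m] \<cdot> u) = [m] \<cdot> g u" if "u \<in> carrier G" for u and m :: nat
    using that by (induction m) (simp_all add: g ga)
  define t where "t i j = (f ^^ i) ((g ^^ j) v)" for i j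
  have tc: "t i j \<in> carrier G" for i j using fi gi v by (simp add: t_def)
  have ft: "f (t i j) = t (Suc i) j" for i j by (simp add: t_def)
  have gt: "g (t i j) = t i (Suc j)" for i j using gf[of "(g ^^ j) v"] gi v by (simp add: t_def)
  let ?S = "\<Oplus>j\<in>{..n}. [(n choose j)] \<cdot> t j (n - j)"
  have "((\<lambda>v. f v \<oplus> g v) ^^ Suc n) v = f ?S \<oplus> g ?S" using Suc by (simp add: t_def)
  also have "f ?S = (\<Oplus>j\<in>{..n}. f ([(n choose j)] \<cdot> t j (n - j)))" by (rule F.hom_finsum) (simp add: tc)
  also have "\<dots> = (\<Oplus>j\<in>{..n}. [(n choose j)] \<cdot> t (Suc j) (n - j))"
    by (rule finsum_cong') (auto simp: tc fp ft)
  also have "g ?S = (\<Oplus>j\<in>{..n}. g ([(n choose j)] \<cdot> t j (n - j)))" by (rule Gh.hom_finsum) (simp add: tc)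
  also have "\<dots> = (\<Oplus>j\<in>{..n}. [(n choose j)] \<cdot> t j (Suc n - j))"
    by (rule finsum_cong') (auto simp: tc gp gt Suc_diff_le)
  also have "\<dots> = (\<Oplus>j\<in>{..Suc n}. [(n choose j)] \<cdot> t j (Suc n - j))"
    by (subst finsum_Suc) (auto simp: tc binomial_eq_0 intro!: finsum_closed)
  also have "\<dots> = (\<Oplus>i\<in>{..n}. [(n choose Suc i)] \<cdot> t (Suc i) (n - i)) \<oplus> t 0 (Suc n)"
    by (subst finsum_Suc2) (auto simp: tc)
  also have "(\<Oplus>j\<in>{..n}. [(n choose j)] \<cdot> t (Suc j) (n - j)) \<oplus> \<dots>
      = ((\<Oplus>j\<in>{..n}. [(n choose j)] \<cdot> t (Suc j) (n - j)) \<oplus> (\<Oplus>i\<in>{..n}. [(n choose Suc i)] \<cdot> t (Suc i) (n - i))) \<oplus> t 0 (Suc n)"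
    by (rule a_assoc[symmetric]) (auto simp: tc intro!: finsum_closed)
  also have "(\<Oplus>j\<in>{..n}. [(n choose j)] \<cdot> t (Suc j) (n - j)) \<oplus> (\<Oplus>i\<in>{..n}. [(n choose Suc i)] \<cdot> t (Suc i) (n - i))
     = (\<Oplus>j\<in>{..n}. [(n choose j)] \<cdot> t (Suc j) (n - j) \<oplus> [(n choose Suc j)] \<cdot> t (Suc j) (n - j))"
    by (rule finsum_addf[symmetric]) (auto simp: tc)
  also have "\<dots> = (\<Oplus>i\<in>{..n}. [(Suc n choose Suc i)] \<cdot> t (Suc i) (Suc n - Suc i))"
    by (rule finsum_cong') (auto simp: tc add.nat_pow_mult)
  also have "\<dots> \<oplus> t 0 (Suc n) = (\<Oplus>j\<in>{..Suc n}. [(Suc n choose j)] \<cdot> t j (Suc n - j))"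
    by (subst finsum_Suc2) (auto simp: tc)
  finally show ?case by (simp add: t_def)
qed

text \<open>All inner binomial coefficients are divisible by the prime \<open>p\<close> and
  therefore vanish on the group.\<close>

lemma operator_frobenius:
  assumes f: "\<And>v. v \<in> carrier G \<Longrightarrow> f v \<in> carrier G" and g: "\<And>v. v \<in> carrier G \<Longrightarrow> g v \<in> carrier G"
    and fa: "\<And>u v. u \<in> carrier G \<Longrightarrow> v \<in> carrier G \<Longrightarrow> f (u \<oplus> v) = f u \<oplus> f v"
    and ga: "\<And>u v. u \<in> carrier G \<Longrightarrow> v \<in> carrier G \<Longrightarrow> g (u \<oplus> v) = g u \<oplus> g v"
    and fg: "\<And>v. v \<in> carrier G \<Longrightarrow> f (g v) = g (f v)" and v: "v \<in> carrier G"
    and p: "Factorial_Ring.prime p" and char: "\<And>v. v \<in> carrier G \<Longrightarrow> [p] \<cdot> v = \<zero>"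
  shows "((\<lambda>v. f v \<oplus> g v) ^^ p) v = (f ^^ p) v \<oplus> (g ^^ p) v"
proof -
  have fi: "(f ^^ j) u \<in> carrier G" if "u \<in> carrier G" for j u using that f by (induction j) auto
  have gi: "(g ^^ j) u \<in> carrier G" if "u \<in> carrier G" for j u using that g by (induction j) auto
  have p0: "p > 0" using p prime_gt_0_nat by blast
  define t where "t j = [(p choose j)] \<cdot> (f ^^ j) ((g ^^ (p - j)) v)" for j
  have tc: "t j \<in> carrier G" for j using fi gi v by (simp add: t_def)
  have "((\<lambda>v. f v \<oplus> g v) ^^ p) v = finsum G t {..p}"
    unfolding t_def by (rule operator_binomial[OF f g fa ga fg v])
  also have "\<dots> = t p \<oplus> (t 0 \<oplus> finsum G t ({..p} - {p} - {0}))"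
    using p0 tc by (subst finsum_remove[of _ p], simp, simp, simp) (subst finsum_remove[of _ 0], auto)
  also have "finsum G t ({..p} - {p} - {0}) = \<zero>"
  proof (rule finsum_all_zero)
    fix j assume "j \<in> {..p} - {p} - {0}"
    then have "p dvd (p choose j)" using p by (intro dvd_choose_prime) auto
    then show "t j = \<zero>" unfolding t_def by (rule add_pow_dvd_zero[OF char, rotated 2]) (simp_all add: fi gi v)
  qed
  finally show ?thesis using fi gi v by (simp add: t_def)
qed

end

context ring begin

lemma pow_commute:
  assumes "x \<in> carrier R" "y \<in> carrier R" "x \<otimes> y = y \<otimes> x"
  shows "x [^] (n::nat) \<otimes> y = y \<otimes> x [^] n"
proof (induction n)
  case (Suc n)
  have "x [^] Suc n \<otimes> y = x [^] n \<otimes> (x \<otimes> y)" using assms(1,2) by (simp add: m_assoc)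
  also have "\<dots> = (x [^] n \<otimes> y) \<otimes> x" unfolding assms(3) using assms(1,2) by (simp add: m_assoc)
  finally show ?case unfolding Suc using assms(1,2) by (simp add: m_assoc)
qed (use assms in simp)

lemma char_zero_all:
  assumes "[(p::nat)] \<cdot> \<one> = \<zero>" "x \<in> carrier R" shows "[p] \<cdot> x = \<zero>"
  using add_pow_ldistr[of \<one> x p] assms by simp

text \<open>Left multiplications by commuting elements are commuting operators, and evaluating their
  \<open>p\<close>-th iterates at the unit returns the powers.\<close>

lemma freshman_dream:
  assumes x: "x \<in> carrier R" and y: "y \<in> carrier R" and xy: "x \<otimes> y = y \<otimes> x"
    and p: "Factorial_Ring.prime p" and char: "[(p::nat)] \<cdot> \<one> = \<zero>"
  shows "(x \<oplus> y) [^] p = x [^] p \<oplus> y [^] p"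
proof -
  have it: "((\<otimes>) z ^^ n) v = z [^] n \<otimes> v" if "z \<in> carrier R" "v \<in> carrier R" for z v n
  proof (induction n)
    case (Suc n) then show ?case using that by (simp add: m_assoc[symmetric] nat_pow_Suc2[symmetric] del: nat_pow_Suc)
  qed (use that in simp)
  have "((\<lambda>v. x \<otimes> v \<oplus> y \<otimes> v) ^^ p) \<one> = ((\<otimes>) x ^^ p) \<one> \<oplus> ((\<otimes>) y ^^ p) \<one>"
    by (rule operator_frobenius) (use x y xy p char_zero_all[OF char] in \<open>auto simp: r_distr m_assoc[symmetric]\<close>)
  moreover have "((\<lambda>v. x \<otimes> v \<oplus> y \<otimes> v) ^^ n) \<one> = ((\<otimes>) (x \<oplus> y) ^^ n) \<one>" for n
  proof (induction n)
    case (Suc n) then show ?case using it[of "x \<oplus> y" \<one> n] x y by (simp add: l_distr)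
  qed simp
  ultimately show ?thesis using it x y by simp
qed

lemma freshman_dream_pow:
  assumes x: "x \<in> carrier R" and y: "y \<in> carrier R" and xy: "x \<otimes> y = y \<otimes> x"
    and p: "Factorial_Ring.prime p" and char: "[(p::nat)] \<cdot> \<one> = \<zero>"
  shows "(x \<oplus> y) [^] (p ^ s) = x [^] (p ^ s) \<oplus> y [^] (p ^ s)"
proof (induction s)
  case (Suc s)
  have e: "z [^] (p ^ Suc s) = (z [^] (p ^ s)) [^] p" if "z \<in> carrier R" for z
    using nat_pow_pow[OF that, of "p ^ s" p] by (simp add: mult.commute)
  have "x [^] (p ^ s) \<otimes> y [^] (p ^ s) = y [^] (p ^ s) \<otimes> x [^] (p ^ s)"
    using x y pow_commute[OF x nat_pow_closed[OF y] pow_commute[OF y x xy[symmetric], symmetric]] by simp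
  then have "((x \<oplus> y) [^] (p ^ s)) [^] p = (x [^] (p ^ s)) [^] p \<oplus> (y [^] (p ^ s)) [^] p"
    using Suc x y freshman_dream[OF _ _ _ p char] by simp
  then show ?case using x y by (simp only: e a_closed)
qed (use x y in simp)

end

text \<open>
  Jacobson's argument: if \<open>a\<close> is not central but \<open>a\<^sup>p\<close> is, the last non-zero iterates of the nilpotent
  derivation \<open>[a, -]\<close> give an element \<open>v\<close> conjugate to \<open>v + 1\<close>, so no power \<open>v ^ (p ^ s)\<close> is central.
\<close>

lemma division_ring_purely_inseparable_commutative:
  assumes D: "ring D" and nz: "\<one>\<^bsub>D\<^esub> \<noteq> \<zero>\<^bsub>D\<^esub>"
    and inv: "\<And>x. x \<in> carrier D \<Longrightarrow> x \<noteq> \<zero>\<^bsub>D\<^esub> \<Longrightarrow> \<exists>y\<in>carrier D. y \<otimes>\<^bsub>D\<^esub> x = \<one>\<^bsub>D\<^esub> \<and> x \<otimes>\<^bsub>D\<^esub> y = \<one>\<^bsub>D\<^esub>"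
    and p: "Factorial_Ring.prime p" and char: "add_pow D (p::nat) \<one>\<^bsub>D\<^esub> = \<zero>\<^bsub>D\<^esub>"
    and insep: "\<And>x. x \<in> carrier D \<Longrightarrow> \<exists>s. \<forall>y\<in>carrier D. x [^]\<^bsub>D\<^esub> (p ^ s) \<otimes>\<^bsub>D\<^esub> y = y \<otimes>\<^bsub>D\<^esub> x [^]\<^bsub>D\<^esub> (p ^ s)"
    and x: "x \<in> carrier D" and y: "y \<in> carrier D"
  shows "x \<otimes>\<^bsub>D\<^esub> y = y \<otimes>\<^bsub>D\<^esub> x"
proof (rule ccontr)
  interpret ring D by (rule D)
  assume xy: "x \<otimes>\<^bsub>D\<^esub> y \<noteq> y \<otimes>\<^bsub>D\<^esub> x"
  define cen where "cen z \<longleftrightarrow> (\<forall>y\<in>carrier D. z \<otimes>\<^bsub>D\<^esub> y = y \<otimes>\<^bsub>D\<^esub> z)" for z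
  obtain s where s: "cen (x [^]\<^bsub>D\<^esub> (p ^ s))" and smin: "\<And>t. t < s \<Longrightarrow> \<not> cen (x [^]\<^bsub>D\<^esub> (p ^ t))"
  proof -
    have "\<exists>s. cen (x [^]\<^bsub>D\<^esub> (p ^ s))" using insep[OF x] by (simp add: cen_def)
    then show ?thesis using that exists_least_iff[of "\<lambda>s. cen (x [^]\<^bsub>D\<^esub> (p ^ s))"] by auto
  qed
  have "s \<noteq> 0" using s xy x y by (intro notI) (auto simp: cen_def)
  then obtain s' where s': "s = Suc s'" by (cases s) auto
  \<comment> \<open>The last member of the chain of iterated \<open>p\<close>-th powers of
    \<open>x\<close> that is not central; its own \<open>p\<close>-th power is.\<close>
  define a where "a = x [^]\<^bsub>D\<^esub> (p ^ s')"
  have a: "a \<in> carrier D" and an: "\<not> cen a" using x smin s' by (auto simp: a_def)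
  have ap: "cen (a [^]\<^bsub>D\<^esub> p)" using s x by (simp add: a_def nat_pow_pow s' mult.commute)
  obtain y where y: "y \<in> carrier D" "a \<otimes>\<^bsub>D\<^esub> y \<noteq> y \<otimes>\<^bsub>D\<^esub> a" using an by (auto simp: cen_def)
  define \<delta> where "\<delta> v = a \<otimes>\<^bsub>D\<^esub> v \<ominus>\<^bsub>D\<^esub> v \<otimes>\<^bsub>D\<^esub> a" for v
  have \<delta>c: "\<delta> v \<in> carrier D" if "v \<in> carrier D" for v using that a by (simp add: \<delta>_def)
  have \<delta>i: "(\<delta> ^^ n) v \<in> carrier D" if "v \<in> carrier D" for n v using that \<delta>c by (induction n) auto
  have La: "((\<otimes>\<^bsub>D\<^esub>) a ^^ n) v = a [^]\<^bsub>D\<^esub> n \<otimes>\<^bsub>D\<^esub> v" if v: "v \<in> carrier D" for n v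
  proof (induction n)
    case (Suc n) then show ?case using v a nat_pow_Suc2[OF a, of n] by (simp add: m_assoc[symmetric])
  qed (use v in simp)
  have Ra: "((\<lambda>v. v \<otimes>\<^bsub>D\<^esub> a) ^^ n) v = v \<otimes>\<^bsub>D\<^esub> a [^]\<^bsub>D\<^esub> n" if v: "v \<in> carrier D" for n v
  proof (induction n)
    case (Suc n) then show ?case using v a by (simp add: m_assoc)
  qed (use v in simp)
  \<comment> \<open>Left multiplication by \<open>a\<close> is the sum of the commuting operators
    \<delta> and right multiplication by \<open>a\<close>. Taking \<open>p\<close>-th powers gives
    \<open>a ^ p y = (\<delta> ^^ p) y + y a ^ p\<close>, so \<delta> is nilpotent on
    \<open>y\<close> because \<open>a ^ p\<close> is central.\<close>
  have "((\<lambda>v. \<delta> v \<oplus>\<^bsub>D\<^esub> v \<otimes>\<^bsub>D\<^esub> a) ^^ p) y = (\<delta> ^^ p) y \<oplus>\<^bsub>D\<^esub> ((\<lambda>v. v \<otimes>\<^bsub>D\<^esub> a) ^^ p) y"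
  proof (rule operator_frobenius[OF _ _ _ _ _ y(1) p char_zero_all[OF char]])
    fix u v assume uv: "u \<in> carrier D" "v \<in> carrier D"
    show "\<delta> (u \<oplus>\<^bsub>D\<^esub> v) = \<delta> u \<oplus>\<^bsub>D\<^esub> \<delta> v"
      using uv a by (simp add: \<delta>_def a_minus_def l_distr r_distr minus_add a_ac)
    show "(u \<oplus>\<^bsub>D\<^esub> v) \<otimes>\<^bsub>D\<^esub> a = u \<otimes>\<^bsub>D\<^esub> a \<oplus>\<^bsub>D\<^esub> v \<otimes>\<^bsub>D\<^esub> a" using uv a by (simp add: l_distr)
  next
    fix v assume v: "v \<in> carrier D"
    show "\<delta> (v \<otimes>\<^bsub>D\<^esub> a) = \<delta> v \<otimes>\<^bsub>D\<^esub> a"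
      using v a by (simp add: \<delta>_def a_minus_def l_distr l_minus m_assoc)
    show "\<delta> v \<in> carrier D" by (rule \<delta>c[OF v])
    show "v \<otimes>\<^bsub>D\<^esub> a \<in> carrier D" using v a by simp
  qed
  moreover have "((\<lambda>v. \<delta> v \<oplus>\<^bsub>D\<^esub> v \<otimes>\<^bsub>D\<^esub> a) ^^ n) y = ((\<otimes>\<^bsub>D\<^esub>) a ^^ n) y" for n
  proof (induction n)
    case (Suc n)
    have "\<delta> v \<oplus>\<^bsub>D\<^esub> v \<otimes>\<^bsub>D\<^esub> a = a \<otimes>\<^bsub>D\<^esub> v" if "v \<in> carrier D" for v
      using that a by (simp add: \<delta>_def a_minus_def a_assoc l_neg)
    then show ?case using Suc La[OF y(1), of n] a y by simp
  qed simp
  ultimately have "a [^]\<^bsub>D\<^esub> p \<otimes>\<^bsub>D\<^esub> y = (\<delta> ^^ p) y \<oplus>\<^bsub>D\<^esub> y \<otimes>\<^bsub>D\<^esub> a [^]\<^bsub>D\<^esub> p"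
    using La Ra y by simp
  moreover have "a [^]\<^bsub>D\<^esub> p \<otimes>\<^bsub>D\<^esub> y = y \<otimes>\<^bsub>D\<^esub> a [^]\<^bsub>D\<^esub> p" using ap y by (simp add: cen_def)
  ultimately have \<delta>p: "(\<delta> ^^ p) y = \<zero>\<^bsub>D\<^esub>"
    using \<delta>i[OF y(1), of p] y a by - (rule add_left_imp_zero[of "y \<otimes>\<^bsub>D\<^esub> a [^]\<^bsub>D\<^esub> p"], auto)
  obtain r where r: "(\<delta> ^^ r) y = \<zero>\<^bsub>D\<^esub>" and rmin: "\<And>t. t < r \<Longrightarrow> (\<delta> ^^ t) y \<noteq> \<zero>\<^bsub>D\<^esub>"
    using \<delta>p exists_least_iff[of "\<lambda>r. (\<delta> ^^ r) y = \<zero>\<^bsub>D\<^esub>"] by auto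
  have "r \<noteq> 0"
  proof
    assume "r = 0"
    then have "y = \<zero>\<^bsub>D\<^esub>" using r by simp
    then show False using y a by simp
  qed
  moreover have "r \<noteq> 1"
  proof
    assume "r = 1"
    then have "\<delta> y = \<zero>\<^bsub>D\<^esub>" using r by simp
    then have "a \<otimes>\<^bsub>D\<^esub> y = y \<otimes>\<^bsub>D\<^esub> a"
      using y a by - (rule diff_zero_imp_eq, simp_all add: \<delta>_def a_minus_def)
    then show False using y by simp
  qed
  ultimately obtain t where t: "r = Suc (Suc t)" by (cases r; cases "r - 1") auto
  \<comment> \<open>As \<open>r\<close> is minimal, \<open>w\<close> is the last nonzero iterate and
    \<open>\<delta> w = 0\<close>. So \<open>w\<close> commutes with \<open>a\<close>, and so does
    its inverse \<open>v\<close>.\<close>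
  define z w where "z = (\<delta> ^^ t) y" and "w = \<delta> z"
  have z: "z \<in> carrier D" and w: "w \<in> carrier D" using \<delta>i y \<delta>c by (auto simp: z_def w_def)
  have wn: "w \<noteq> \<zero>\<^bsub>D\<^esub>" using rmin[of "Suc t"] t by (simp add: w_def z_def)
  have "\<delta> w = \<zero>\<^bsub>D\<^esub>" using r t by (simp add: w_def z_def)
  then have aw: "a \<otimes>\<^bsub>D\<^esub> w = w \<otimes>\<^bsub>D\<^esub> a"
    using w a by - (rule diff_zero_imp_eq, simp_all add: \<delta>_def a_minus_def)
  obtain v where v: "v \<in> carrier D" "v \<otimes>\<^bsub>D\<^esub> w = \<one>\<^bsub>D\<^esub>" "w \<otimes>\<^bsub>D\<^esub> v = \<one>\<^bsub>D\<^esub>" using inv[OF w wn] by blast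
  have av: "a \<otimes>\<^bsub>D\<^esub> v = v \<otimes>\<^bsub>D\<^esub> a"
  proof -
    have "v \<otimes>\<^bsub>D\<^esub> a = v \<otimes>\<^bsub>D\<^esub> (a \<otimes>\<^bsub>D\<^esub> w) \<otimes>\<^bsub>D\<^esub> v" using v a w by (simp add: m_assoc)
    also have "\<dots> = (v \<otimes>\<^bsub>D\<^esub> w) \<otimes>\<^bsub>D\<^esub> a \<otimes>\<^bsub>D\<^esub> v" unfolding aw using v(1) a w by (simp add: m_assoc)
    finally show ?thesis using v a by simp
  qed
  \<comment> \<open>Since \<open>v\<close> commutes with \<open>a\<close>, the derivation sends
    \<open>z v\<close> to \<open>w v = 1\<close>, hence \<open>z v a\<close> to \<open>a\<close>.
    This says \<open>a c = (c + 1) a\<close>: conjugation by \<open>a\<close> adds \<open>1\<close>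
    to \<open>c\<close>.\<close>
  define c where "c = z \<otimes>\<^bsub>D\<^esub> v \<otimes>\<^bsub>D\<^esub> a"
  have c: "c \<in> carrier D" using z v a by (simp add: c_def)
  have "c \<otimes>\<^bsub>D\<^esub> a \<oplus>\<^bsub>D\<^esub> a = a \<otimes>\<^bsub>D\<^esub> c"
  proof -
    have "a \<otimes>\<^bsub>D\<^esub> z = w \<oplus>\<^bsub>D\<^esub> z \<otimes>\<^bsub>D\<^esub> a" using a z by (simp add: w_def \<delta>_def a_minus_def a_assoc l_neg)
    then have "a \<otimes>\<^bsub>D\<^esub> c = (w \<oplus>\<^bsub>D\<^esub> z \<otimes>\<^bsub>D\<^esub> a) \<otimes>\<^bsub>D\<^esub> v \<otimes>\<^bsub>D\<^esub> a"
      using a z v w by (simp add: c_def m_assoc[symmetric])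
    also have "\<dots> = (w \<otimes>\<^bsub>D\<^esub> v) \<otimes>\<^bsub>D\<^esub> a \<oplus>\<^bsub>D\<^esub> z \<otimes>\<^bsub>D\<^esub> (a \<otimes>\<^bsub>D\<^esub> v) \<otimes>\<^bsub>D\<^esub> a"
      using a z v(1) w by (simp add: l_distr m_assoc)
    also have "\<dots> = a \<oplus>\<^bsub>D\<^esub> c \<otimes>\<^bsub>D\<^esub> a" unfolding av v(3) c_def using a z v(1) by (simp add: m_assoc)
    finally show ?thesis using a c by (simp add: a_comm)
  qed
  then have ac: "a \<otimes>\<^bsub>D\<^esub> c = (c \<oplus>\<^bsub>D\<^esub> \<one>\<^bsub>D\<^esub>) \<otimes>\<^bsub>D\<^esub> a" using a c by (simp add: l_distr)
  have acn: "a \<otimes>\<^bsub>D\<^esub> c [^]\<^bsub>D\<^esub> n = (c \<oplus>\<^bsub>D\<^esub> \<one>\<^bsub>D\<^esub>) [^]\<^bsub>D\<^esub> n \<otimes>\<^bsub>D\<^esub> a" for n :: nat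
  proof (induction n)
    case (Suc n)
    have "a \<otimes>\<^bsub>D\<^esub> c [^]\<^bsub>D\<^esub> Suc n = (a \<otimes>\<^bsub>D\<^esub> c [^]\<^bsub>D\<^esub> n) \<otimes>\<^bsub>D\<^esub> c" using a c by (simp add: m_assoc)
    also have "\<dots> = (c \<oplus>\<^bsub>D\<^esub> \<one>\<^bsub>D\<^esub>) [^]\<^bsub>D\<^esub> n \<otimes>\<^bsub>D\<^esub> (a \<otimes>\<^bsub>D\<^esub> c)" unfolding Suc using a c by (simp add: m_assoc)
    also have "\<dots> = (c \<oplus>\<^bsub>D\<^esub> \<one>\<^bsub>D\<^esub>) [^]\<^bsub>D\<^esub> Suc n \<otimes>\<^bsub>D\<^esub> a" unfolding ac using a c by (simp add: m_assoc)
    finally show ?case .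
  qed (use a in simp)
  \<comment> \<open>Frobenius turns \<open>a c ^ q = (c + 1) ^ q a\<close> into
    \<open>a c ^ q = (c ^ q + 1) a\<close>, and centrality of \<open>c ^ q\<close> leaves
    \<open>a = 0\<close>.\<close>
  obtain m where m: "cen (c [^]\<^bsub>D\<^esub> (p ^ m))" using insep[OF c] by (auto simp: cen_def)
  define q where "q = p ^ m"
  have cq: "c [^]\<^bsub>D\<^esub> q \<in> carrier D" using c by simp
  have "a \<otimes>\<^bsub>D\<^esub> c [^]\<^bsub>D\<^esub> q = (c [^]\<^bsub>D\<^esub> q \<oplus>\<^bsub>D\<^esub> \<one>\<^bsub>D\<^esub>) \<otimes>\<^bsub>D\<^esub> a"
    using acn[of q] freshman_dream_pow[OF c one_closed _ p char, of m] c by (simp add: q_def)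
  also have "\<dots> = a \<otimes>\<^bsub>D\<^esub> c [^]\<^bsub>D\<^esub> q \<oplus>\<^bsub>D\<^esub> a" using m a cq by (simp add: l_distr cen_def q_def)
  finally have "a = \<zero>\<^bsub>D\<^esub>" using a cq
    by - (rule add_left_imp_zero[of "a \<otimes>\<^bsub>D\<^esub> c [^]\<^bsub>D\<^esub> q"], simp_all add: a_comm)
  then show False using y by simp
qed

section \<open>Separable splitting fields of a regular algebra\<close>

text \<open>
  In exponential characteristic \<open>p\<close> a finite extension \<open>E\<close> of \<open>k\<^sub>0\<close> is separable iff
  \<open>E = k\<^sub>0[E\<^sup>p]\<close>. This form of separability passes through towers without any field theory.
\<close>

definition fin_sep :: "('l, 'u) ring_scheme \<Rightarrow> 'l set \<Rightarrow> nat \<Rightarrow> 'l set \<Rightarrow> bool" where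
  "fin_sep L k\<^sub>0 p E \<longleftrightarrow> subfield E L \<and> k\<^sub>0 \<subseteq> E \<and> ring.finite_dimension L k\<^sub>0 E \<and>
    (\<forall>W. subring W L \<and> k\<^sub>0 \<subseteq> W \<and> (\<forall>x\<in>E. x [^]\<^bsub>L\<^esub> p \<in> W) \<longrightarrow> E \<subseteq> W)"

text \<open>\<open>L\<close> plays the algebraic closure of \<open>k\<^sub>0\<close>,
  \<open>C\<close> the algebra extended to \<open>L\<close>, and \<open>h\<close> its coordinates
  for the spanning family \<open>v\<close>, all rational over \<open>k\<^sub>0\<close>. The
  extension of the algebra to a subfield \<open>E\<close> is represented inside \<open>C\<close> by
  the elements with coordinates in \<open>E\<close>. \<open>mult_rat\<close> says that they are
  closed under products over every intermediate ring, and \<open>regular\<close> that they form a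
  regular ring over \<open>L\<close> and over each admissible \<open>E\<close>.\<close>

locale split_core =
  fixes L :: "('l, 'u) ring_scheme" and C :: "('l, 'c, 'w) module_scheme"
    and k\<^sub>0 :: "'l set" and B :: "'b set" and h :: "'b \<Rightarrow> 'c \<Rightarrow> 'l" and v :: "'b \<Rightarrow> 'c" and p :: nat
  assumes closed: "algebraically_closed L" and algC: "unital_algebra L C"
    and k0: "subfield k\<^sub>0 L" and alg: "\<And>x. x \<in> carrier L \<Longrightarrow> (ring.algebraic L over k\<^sub>0) x"
    and finB: "finite B"
    and h_closed: "\<And>b x. \<lbrakk>b \<in> B; x \<in> carrier C\<rbrakk> \<Longrightarrow> h b x \<in> carrier L"
    and h_add: "\<And>b x y. \<lbrakk>b \<in> B; x \<in> carrier C; y \<in> carrier C\<rbrakk> \<Longrightarrow> h b (x \<oplus>\<^bsub>C\<^esub> y) = h b x \<oplus>\<^bsub>L\<^esub> h b y"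
    and h_smult: "\<And>b c x. \<lbrakk>b \<in> B; c \<in> carrier L; x \<in> carrier C\<rbrakk> \<Longrightarrow> h b (c \<odot>\<^bsub>C\<^esub> x) = c \<otimes>\<^bsub>L\<^esub> h b x"
    and v_closed: "\<And>b. b \<in> B \<Longrightarrow> v b \<in> carrier C"
    and expand: "\<And>x. x \<in> carrier C \<Longrightarrow> (\<Oplus>\<^bsub>C\<^esub>b\<in>B. h b x \<odot>\<^bsub>C\<^esub> v b) = x"
    and v_rat: "\<And>b b'. \<lbrakk>b \<in> B; b' \<in> B\<rbrakk> \<Longrightarrow> h b (v b') \<in> k\<^sub>0"
    and one_rat: "\<And>b. b \<in> B \<Longrightarrow> h b \<one>\<^bsub>C\<^esub> \<in> k\<^sub>0"
    and mult_rat: "\<And>W x y b. \<lbrakk>subring W L; k\<^sub>0 \<subseteq> W; x \<in> carrier C; y \<in> carrier C;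
        \<forall>b\<in>B. h b x \<in> W; \<forall>b\<in>B. h b y \<in> W; b \<in> B\<rbrakk> \<Longrightarrow> h b (x \<otimes>\<^bsub>C\<^esub> y) \<in> W"
    and nontriv: "\<one>\<^bsub>C\<^esub> \<noteq> \<zero>\<^bsub>C\<^esub>"
    and p: "p = 1 \<or> (Factorial_Ring.prime p \<and> add_pow L p \<one>\<^bsub>L\<^esub> = \<zero>\<^bsub>L\<^esub>)"
    and regular: "\<And>E x. \<lbrakk>E = carrier L \<or> fin_sep L k\<^sub>0 p E; x \<in> carrier C; \<forall>b\<in>B. h b x \<in> E\<rbrakk>
        \<Longrightarrow> \<exists>r\<in>carrier C. (\<forall>b\<in>B. h b r \<in> E) \<and> x \<otimes>\<^bsub>C\<^esub> r \<otimes>\<^bsub>C\<^esub> x = x"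
begin

sublocale L: algebraically_closed L by (rule closed)
sublocale C: ring C using algC by (simp add: unital_algebra_def)
sublocale M: module L C using algC by (simp add: unital_algebra_def)
sublocale algC: unital_algebra L C by (rule algC)

abbreviation "fs \<equiv> fin_sep L k\<^sub>0 p"

definition CE :: "'l set \<Rightarrow> 'c set" where "CE E = {x \<in> carrier C. \<forall>b\<in>B. h b x \<in> E}"

lemma fsD:
  assumes "fs E"
  shows "subfield E L" "subring E L" "k\<^sub>0 \<subseteq> E" "E \<subseteq> carrier L" "L.finite_dimension k\<^sub>0 E"
  using assms subfieldE(1,3) by (auto simp: fin_sep_def)

lemma subring_L: "subring (carrier L) L" by (rule L.carrier_is_subring)

lemma CE_carrier: "x \<in> CE E \<Longrightarrow> x \<in> carrier C" by (simp add: CE_def)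

lemma CE_mono: "E \<subseteq> F \<Longrightarrow> CE E \<subseteq> CE F" by (auto simp: CE_def)

lemma h_zero: "b \<in> B \<Longrightarrow> h b \<zero>\<^bsub>C\<^esub> = \<zero>\<^bsub>L\<^esub>"
  using h_smult[of b "\<zero>\<^bsub>L\<^esub>" "\<zero>\<^bsub>C\<^esub>"] h_closed[of b "\<zero>\<^bsub>C\<^esub>"] by simp

lemma h_minus: "b \<in> B \<Longrightarrow> x \<in> carrier C \<Longrightarrow> h b (\<ominus>\<^bsub>C\<^esub> x) = \<ominus>\<^bsub>L\<^esub> h b x"
  using h_smult[of b "\<ominus>\<^bsub>L\<^esub> \<one>\<^bsub>L\<^esub>" x] h_closed[of b x] M.smult_l_minus[of "\<one>\<^bsub>L\<^esub>" x] by (simp add: L.l_minus)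

lemma CE_ops:
  assumes W: "subring W L" "k\<^sub>0 \<subseteq> W"
  shows "\<one>\<^bsub>C\<^esub> \<in> CE W" "\<zero>\<^bsub>C\<^esub> \<in> CE W"
    "\<And>x y. x \<in> CE W \<Longrightarrow> y \<in> CE W \<Longrightarrow> x \<oplus>\<^bsub>C\<^esub> y \<in> CE W"
    "\<And>x. x \<in> CE W \<Longrightarrow> \<ominus>\<^bsub>C\<^esub> x \<in> CE W"
    "\<And>x y. x \<in> CE W \<Longrightarrow> y \<in> CE W \<Longrightarrow> x \<ominus>\<^bsub>C\<^esub> y \<in> CE W"
    "\<And>x y. x \<in> CE W \<Longrightarrow> y \<in> CE W \<Longrightarrow> x \<otimes>\<^bsub>C\<^esub> y \<in> CE W"
    "\<And>c x. c \<in> W \<Longrightarrow> x \<in> CE W \<Longrightarrow> c \<odot>\<^bsub>C\<^esub> x \<in> CE W"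
    "\<And>b. b \<in> B \<Longrightarrow> v b \<in> CE W"
    "\<And>x n. x \<in> CE W \<Longrightarrow> x [^]\<^bsub>C\<^esub> (n::nat) \<in> CE W"
proof -
  note Ws = subringE[OF W(1)]
  have Wc: "c \<in> W \<Longrightarrow> c \<in> carrier L" for c using Ws(1) by blast
  show one: "\<one>\<^bsub>C\<^esub> \<in> CE W" using W(2) one_rat by (auto simp: CE_def)
  show "\<zero>\<^bsub>C\<^esub> \<in> CE W" using Ws(2) by (auto simp: CE_def h_zero)
  show add: "x \<oplus>\<^bsub>C\<^esub> y \<in> CE W" if "x \<in> CE W" "y \<in> CE W" for x y
    using that Ws(7) by (auto simp: CE_def h_add)
  show minus: "\<ominus>\<^bsub>C\<^esub> x \<in> CE W" if "x \<in> CE W" for x using that Ws(5) by (auto simp: CE_def h_minus)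
  show "x \<ominus>\<^bsub>C\<^esub> y \<in> CE W" if "x \<in> CE W" "y \<in> CE W" for x y
    unfolding a_minus_def using that add minus by blast
  show mult: "x \<otimes>\<^bsub>C\<^esub> y \<in> CE W" if "x \<in> CE W" "y \<in> CE W" for x y
    using that mult_rat[OF W, of x y] by (auto simp: CE_def)
  show "c \<odot>\<^bsub>C\<^esub> x \<in> CE W" if "c \<in> W" "x \<in> CE W" for c x
    using that Ws(6) Wc by (auto simp: CE_def h_smult)
  show "v b \<in> CE W" if "b \<in> B" for b using that W(2) v_rat v_closed by (auto simp: CE_def)
  show "x [^]\<^bsub>C\<^esub> n \<in> CE W" if "x \<in> CE W" for x and n :: nat
    by (induction n) (use that one mult in auto)
qed

lemmas CE_fs = CE_ops[OF fsD(2,3)]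

lemma eq_by_coords:
  assumes "x \<in> carrier C" "y \<in> carrier C" "\<And>b. b \<in> B \<Longrightarrow> h b x = h b y"
  shows "x = y"
proof -
  have "x = (\<Oplus>\<^bsub>C\<^esub>b\<in>B. h b x \<odot>\<^bsub>C\<^esub> v b)" using expand assms by simp
  also have "\<dots> = (\<Oplus>\<^bsub>C\<^esub>b\<in>B. h b y \<odot>\<^bsub>C\<^esub> v b)"
    by (rule C.finsum_cong') (use assms h_closed v_closed in auto)
  finally show ?thesis using expand assms by simp
qed

text \<open>Some coordinate of \<open>e\<close> is a nonzero element of \<open>E\<close>, and the
  same coordinate of the multiple is \<open>c\<close> times it; divide.\<close>

lemma scalar_rational:
  assumes E: "fs E" and e: "e \<in> CE E" "e \<noteq> \<zero>\<^bsub>C\<^esub>" and c: "c \<in> carrier L" and a: "c \<odot>\<^bsub>C\<^esub> e \<in> CE E"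
  shows "c \<in> E"
proof -
  obtain b where b: "b \<in> B" "h b e \<noteq> \<zero>\<^bsub>L\<^esub>"
    using eq_by_coords[of e "\<zero>\<^bsub>C\<^esub>"] e h_zero CE_carrier by auto
  have ec: "e \<in> carrier C" using e CE_carrier by blast
  have hE: "h b e \<in> E" using e b by (auto simp: CE_def)
  have "c \<otimes>\<^bsub>L\<^esub> h b e \<in> E" using a b c ec by (auto simp: CE_def h_smult)
  then have "h b e \<otimes>\<^bsub>L\<^esub> c \<in> E" using c h_closed b ec by (simp add: L.m_comm)
  then show ?thesis using L.subfield_m_inv_simprule[OF fsD(1)[OF E], of "h b e" c] hE b c by auto
qed

lemma smult_eq_zero:
  assumes "c \<in> carrier L" "x \<in> carrier C" "c \<odot>\<^bsub>C\<^esub> x = \<zero>\<^bsub>C\<^esub>" "x \<noteq> \<zero>\<^bsub>C\<^esub>" shows "c = \<zero>\<^bsub>L\<^esub>"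
proof (rule ccontr)
  assume n: "c \<noteq> \<zero>\<^bsub>L\<^esub>"
  then have u: "c \<in> Units L" using assms(1) by (simp add: L.field_Units)
  have "x = (inv\<^bsub>L\<^esub> c \<otimes>\<^bsub>L\<^esub> c) \<odot>\<^bsub>C\<^esub> x" using u assms(2) by (simp add: L.Units_l_inv)
  also have "\<dots> = inv\<^bsub>L\<^esub> c \<odot>\<^bsub>C\<^esub> (c \<odot>\<^bsub>C\<^esub> x)" by (rule M.smult_assoc1) (use u assms(1,2) in auto)
  finally show False using assms u by simp
qed

lemma fs_k0: "fs k\<^sub>0"
  using k0 subfieldE(1)[OF k0] L.dimension_one[OF k0] L.finite_dimensionI by (auto simp: fin_sep_def)

text \<open>The hypothesis \<open>sep\<close> says that \<alpha> lies in
  \<open>E[\<alpha> ^ p]\<close>, that is, that \<alpha> is separable over \<open>E\<close>. A ring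
  \<open>W\<close> that contains \<open>k\<^sub>0\<close> and the \<open>p\<close>-th powers of the
  larger field contains \<open>E\<close> because \<open>E\<close> is separable, then \<alpha> by
  \<open>sep\<close>, hence everything.\<close>

lemma fs_adjoin:
  assumes E: "fs E" and a: "\<alpha> \<in> carrier L"
    and sep: "\<And>W. subring W L \<Longrightarrow> E \<subseteq> W \<Longrightarrow> \<alpha> [^]\<^bsub>L\<^esub> p \<in> W \<Longrightarrow> \<alpha> \<in> W"
  obtains F where "fs F" "E \<subseteq> F" "\<alpha> \<in> F"
proof -
  let ?F = "L.simple_extension E \<alpha>"
  note Ed = fsD[OF E]
  have algE: "(L.algebraic over E) \<alpha>" by (rule L.algebraic_mono[OF Ed(3) alg[OF a]])
  have sf: "subfield ?F L" using L.simple_extension_is_subfield[OF Ed(1) a] algE by simp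
  have EF: "E \<subseteq> ?F" by (rule L.simple_extension_incl[OF Ed(4) a])
  have aF: "\<alpha> \<in> ?F" by (rule L.simple_extension_mem[OF Ed(2) a])
  have fd: "L.finite_dimension k\<^sub>0 ?F"
    using L.telescopic_base_dim(1)[OF k0 Ed(1) Ed(5)] L.finite_dimension_simple_extension[OF Ed(1) a] algE by simp
  have "?F \<subseteq> W" if W: "subring W L" "k\<^sub>0 \<subseteq> W" "\<forall>x\<in>?F. x [^]\<^bsub>L\<^esub> p \<in> W" for W
  proof -
    have EW: "E \<subseteq> W" using E W EF unfolding fin_sep_def by blast
    have "\<alpha> \<in> W" using sep[OF W(1) EW] W(3) aF by blast
    then show ?thesis using L.simple_extension_subring_incl[OF W(1) EW] by blast
  qed
  then have "fs ?F" unfolding fin_sep_def using sf fd EF Ed(3) by blast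
  then show ?thesis using that EF aF by blast
qed

text \<open>Primitivity is required over every admissible extension \<open>F\<close> of
  \<open>E\<close> at once, so that roots can be adjoined without the idempotent breaking
  up.\<close>

definition prim :: "'l set \<Rightarrow> 'c \<Rightarrow> bool" where
  "prim E e \<longleftrightarrow> e \<in> CE E \<and> e \<otimes>\<^bsub>C\<^esub> e = e \<and> e \<noteq> \<zero>\<^bsub>C\<^esub> \<and>
    (\<forall>F f. fs F \<and> E \<subseteq> F \<and> f \<in> CE F \<and> f \<otimes>\<^bsub>C\<^esub> f = f \<and> e \<otimes>\<^bsub>C\<^esub> f = f \<and> f \<otimes>\<^bsub>C\<^esub> e = f \<longrightarrow> f = \<zero>\<^bsub>C\<^esub> \<or> f = e)"

lemma prim_mono: "prim E e \<Longrightarrow> E \<subseteq> F \<Longrightarrow> prim F e"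
  unfolding prim_def using CE_mono by (meson order_trans subsetD)

text \<open>With \<open>x r x = x\<close> from regularity and \<open>y = f r e\<close>, the products
  \<open>y x\<close> and \<open>x y\<close> are nonzero idempotents below \<open>f\<close> and
  \<open>e\<close>, hence equal to them. For \<open>e = f\<close> this makes the corner a division
  ring; for different idempotents it gives the mutually inverse elements from which matrix units are
  made.\<close>

lemma corner_inverse:
  assumes E: "fs E" and e: "prim E e" and f: "prim E f"
    and x: "x \<in> CE E" "e \<otimes>\<^bsub>C\<^esub> x = x" "x \<otimes>\<^bsub>C\<^esub> f = x" "x \<noteq> \<zero>\<^bsub>C\<^esub>"
  obtains y where "y \<in> CE E" "f \<otimes>\<^bsub>C\<^esub> y = y" "y \<otimes>\<^bsub>C\<^esub> e = y" "y \<otimes>\<^bsub>C\<^esub> x = f" "x \<otimes>\<^bsub>C\<^esub> y = e"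
proof -
  have ee: "e \<in> CE E" "e \<otimes>\<^bsub>C\<^esub> e = e"
    and pr: "\<And>g. g \<in> CE E \<Longrightarrow> g \<otimes>\<^bsub>C\<^esub> g = g \<Longrightarrow> e \<otimes>\<^bsub>C\<^esub> g = g \<Longrightarrow> g \<otimes>\<^bsub>C\<^esub> e = g \<Longrightarrow> g = \<zero>\<^bsub>C\<^esub> \<or> g = e"
    using e E unfolding prim_def by blast+
  have ff: "f \<in> CE E" "f \<otimes>\<^bsub>C\<^esub> f = f"
    and pf: "\<And>g. g \<in> CE E \<Longrightarrow> g \<otimes>\<^bsub>C\<^esub> g = g \<Longrightarrow> f \<otimes>\<^bsub>C\<^esub> g = g \<Longrightarrow> g \<otimes>\<^bsub>C\<^esub> f = g \<Longrightarrow> g = \<zero>\<^bsub>C\<^esub> \<or> g = f"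
    using f E unfolding prim_def by blast+
  obtain r where r: "r \<in> CE E" "x \<otimes>\<^bsub>C\<^esub> r \<otimes>\<^bsub>C\<^esub> x = x"
    using regular[of E x] E x(1) by (auto simp: CE_def)
  note c = CE_carrier[OF ff(1)] CE_carrier[OF ee(1)] CE_carrier[OF x(1)] CE_carrier[OF r(1)]
  define y where "y = f \<otimes>\<^bsub>C\<^esub> r \<otimes>\<^bsub>C\<^esub> e"
  have y: "y \<in> CE E" using CE_fs(6)[OF E E] ee ff r by (simp add: y_def)
  note yc = CE_carrier[OF y]
  have ey: "f \<otimes>\<^bsub>C\<^esub> y = y" using ff c by (simp add: y_def C.m_assoc[symmetric])
  have ye: "y \<otimes>\<^bsub>C\<^esub> e = y" using ee c by (simp add: y_def C.m_assoc)
  have xyx: "x \<otimes>\<^bsub>C\<^esub> y \<otimes>\<^bsub>C\<^esub> x = x"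
  proof -
    have "x \<otimes>\<^bsub>C\<^esub> y \<otimes>\<^bsub>C\<^esub> x = (x \<otimes>\<^bsub>C\<^esub> f) \<otimes>\<^bsub>C\<^esub> r \<otimes>\<^bsub>C\<^esub> (e \<otimes>\<^bsub>C\<^esub> x)" using c by (simp add: y_def C.m_assoc)
    then show ?thesis using x r by simp
  qed
  have "y \<otimes>\<^bsub>C\<^esub> x = f"
  proof -
    have "y \<otimes>\<^bsub>C\<^esub> x \<otimes>\<^bsub>C\<^esub> (y \<otimes>\<^bsub>C\<^esub> x) = y \<otimes>\<^bsub>C\<^esub> (x \<otimes>\<^bsub>C\<^esub> y \<otimes>\<^bsub>C\<^esub> x)" using c yc by (simp add: C.m_assoc)
    then have "y \<otimes>\<^bsub>C\<^esub> x \<otimes>\<^bsub>C\<^esub> (y \<otimes>\<^bsub>C\<^esub> x) = y \<otimes>\<^bsub>C\<^esub> x" by (simp add: xyx)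
    moreover have "y \<otimes>\<^bsub>C\<^esub> x \<in> CE E" using CE_fs(6)[OF E E] y x by blast
    moreover have "f \<otimes>\<^bsub>C\<^esub> (y \<otimes>\<^bsub>C\<^esub> x) = y \<otimes>\<^bsub>C\<^esub> x" using c yc ey by (simp add: C.m_assoc[symmetric])
    moreover have "y \<otimes>\<^bsub>C\<^esub> x \<otimes>\<^bsub>C\<^esub> f = y \<otimes>\<^bsub>C\<^esub> x" using c yc x by (simp add: C.m_assoc)
    ultimately have "y \<otimes>\<^bsub>C\<^esub> x = \<zero>\<^bsub>C\<^esub> \<or> y \<otimes>\<^bsub>C\<^esub> x = f" using pf[of "y \<otimes>\<^bsub>C\<^esub> x"] by blast
    moreover have "y \<otimes>\<^bsub>C\<^esub> x \<noteq> \<zero>\<^bsub>C\<^esub>" using xyx x c yc by (auto simp: C.m_assoc)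
    ultimately show ?thesis by blast
  qed
  moreover have "x \<otimes>\<^bsub>C\<^esub> y = e"
  proof -
    have "x \<otimes>\<^bsub>C\<^esub> y \<otimes>\<^bsub>C\<^esub> (x \<otimes>\<^bsub>C\<^esub> y) = (x \<otimes>\<^bsub>C\<^esub> y \<otimes>\<^bsub>C\<^esub> x) \<otimes>\<^bsub>C\<^esub> y" using c yc by (simp add: C.m_assoc)
    then have "x \<otimes>\<^bsub>C\<^esub> y \<otimes>\<^bsub>C\<^esub> (x \<otimes>\<^bsub>C\<^esub> y) = x \<otimes>\<^bsub>C\<^esub> y" by (simp add: xyx)
    moreover have "x \<otimes>\<^bsub>C\<^esub> y \<in> CE E" using CE_fs(6)[OF E E] y x by blast
    moreover have "e \<otimes>\<^bsub>C\<^esub> (x \<otimes>\<^bsub>C\<^esub> y) = x \<otimes>\<^bsub>C\<^esub> y" using c yc x by (simp add: C.m_assoc[symmetric])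
    moreover have "x \<otimes>\<^bsub>C\<^esub> y \<otimes>\<^bsub>C\<^esub> e = x \<otimes>\<^bsub>C\<^esub> y" using c yc ye by (simp add: C.m_assoc)
    ultimately have "x \<otimes>\<^bsub>C\<^esub> y = \<zero>\<^bsub>C\<^esub> \<or> x \<otimes>\<^bsub>C\<^esub> y = e" using pr[of "x \<otimes>\<^bsub>C\<^esub> y"] by blast
    moreover have "x \<otimes>\<^bsub>C\<^esub> y \<noteq> \<zero>\<^bsub>C\<^esub>" using xyx x c yc by auto
    ultimately show ?thesis by blast
  qed
  ultimately show ?thesis using that y ey ye by blast
qed

text \<open>Coefficient lists start with the constant term, so that Horner's rule is structural
  recursion; \<open>evL\<close> therefore reverses them before it calls \<open>L.eval\<close>. The
  unit \<open>e\<close> of the corner takes the place of \<open>1\<close>.\<close>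

fun ev :: "'c \<Rightarrow> 'l list \<Rightarrow> 'c \<Rightarrow> 'c" where
  "ev e [] a = \<zero>\<^bsub>C\<^esub>"
| "ev e (c # cs) a = c \<odot>\<^bsub>C\<^esub> e \<oplus>\<^bsub>C\<^esub> a \<otimes>\<^bsub>C\<^esub> ev e cs a"

abbreviation evL :: "'l list \<Rightarrow> 'l \<Rightarrow> 'l" where "evL cs \<alpha> \<equiv> L.eval (rev cs) \<alpha>"

lemma evL_simps:
  assumes "set cs \<subseteq> carrier L" "c \<in> carrier L" "\<alpha> \<in> carrier L"
  shows "evL (c # cs) \<alpha> = c \<oplus>\<^bsub>L\<^esub> \<alpha> \<otimes>\<^bsub>L\<^esub> evL cs \<alpha>" "evL cs \<alpha> \<in> carrier L"
proof -
  show "evL cs \<alpha> \<in> carrier L" by (rule L.eval_in_carrier) (use assms in auto)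
  then show "evL (c # cs) \<alpha> = c \<oplus>\<^bsub>L\<^esub> \<alpha> \<otimes>\<^bsub>L\<^esub> evL cs \<alpha>"
    using L.eval_append_aux[of "rev cs" c \<alpha>] assms by (simp add: L.m_comm L.a_comm)
qed

text \<open>Synthetic division by \<open>X - \<alpha>\<close>: the coefficients of the quotient are
  the values at \<alpha> of the tails of the list.\<close>

fun quo :: "'l \<Rightarrow> 'l list \<Rightarrow> 'l list" where
  "quo \<alpha> [] = []"
| "quo \<alpha> (c # cs) = (if cs = [] then [] else evL cs \<alpha> # quo \<alpha> cs)"

lemma quo_props:
  shows "length (quo \<alpha> cs) = length cs - 1" "length cs \<ge> 2 \<Longrightarrow> \<alpha> \<in> carrier L \<Longrightarrow> set cs \<subseteq> carrier L \<Longrightarrow> last (quo \<alpha> cs) = last cs"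
  by (induction cs) (auto simp: Suc_le_eq evL_simps neq_Nil_conv)

lemma evL_closed:
  assumes "subring E L" "set cs \<subseteq> E" "\<alpha> \<in> E" shows "evL cs \<alpha> \<in> E"
  using assms(2)
proof (induction cs)
  case (Cons c cs)
  have "set cs \<subseteq> carrier L" "c \<in> carrier L" "\<alpha> \<in> carrier L" using Cons assms subringE(1)[OF assms(1)] by auto
  then show ?case using Cons assms(3) subringE(6,7)[OF assms(1)] by (simp only: evL_simps) auto
qed (use subringE(2)[OF assms(1)] in simp)

lemma quo_closed:
  assumes "subring E L" "set cs \<subseteq> E" "\<alpha> \<in> E" shows "set (quo \<alpha> cs) \<subseteq> E"
  using assms(2) by (induction cs) (auto simp: evL_closed[OF assms(1) _ assms(3)])

lemma ev_closed:
  assumes "subring W L" "k\<^sub>0 \<subseteq> W" "set cs \<subseteq> W" "e \<in> CE W" "a \<in> CE W" shows "ev e cs a \<in> CE W"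
  using assms(3) by (induction cs) (auto simp: CE_ops[OF assms(1,2)] assms(4,5))

lemma ev_carrier:
  assumes "set cs \<subseteq> carrier L" "e \<in> carrier C" "a \<in> carrier C" shows "ev e cs a \<in> carrier C"
  using assms by (induction cs) auto

text \<open>Induction along Horner's rule: \<open>a\<close> commutes with
  \<open>a - \<alpha> e\<close>, so the linear factor can be pulled out of each tail, and what
  remains is the value at \<alpha> times \<open>e\<close>.\<close>

lemma ev_quo:
  assumes cs: "set cs \<subseteq> carrier L" and a: "a \<in> carrier C" and e: "e \<in> carrier C" and al: "\<alpha> \<in> carrier L"
    and ae: "e \<otimes>\<^bsub>C\<^esub> a = a" "a \<otimes>\<^bsub>C\<^esub> e = a" and ee: "e \<otimes>\<^bsub>C\<^esub> e = e"
  shows "ev e cs a = (a \<ominus>\<^bsub>C\<^esub> \<alpha> \<odot>\<^bsub>C\<^esub> e) \<otimes>\<^bsub>C\<^esub> ev e (quo \<alpha> cs) a \<oplus>\<^bsub>C\<^esub> evL cs \<alpha> \<odot>\<^bsub>C\<^esub> e"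
  using cs
proof (induction cs)
  case Nil then show ?case using a e al by simp
next
  case (Cons c cs)
  have c: "c \<in> carrier L" and cs: "set cs \<subseteq> carrier L" using Cons by auto
  show ?case
  proof (cases "cs = []")
    case True then show ?thesis using a e al c by simp
  next
    case False
    let ?q = "ev e (quo \<alpha> cs) a" and ?v = "evL cs \<alpha>" and ?u = "a \<ominus>\<^bsub>C\<^esub> \<alpha> \<odot>\<^bsub>C\<^esub> e"
    have q: "?q \<in> carrier C"
      by (rule ev_carrier) (use quo_closed[OF subring_L] cs al a e in auto)
    have vL: "?v \<in> carrier L" using evL_simps(2)[OF cs al al] .
    have u: "?u \<in> carrier C" using a e al by simp
    have au: "a \<otimes>\<^bsub>C\<^esub> ?u = ?u \<otimes>\<^bsub>C\<^esub> a"
      using a e al ae by (simp add: a_minus_def C.l_distr C.r_distr C.l_minus C.r_minus algC.smult_mult_left algC.smult_mult_right)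
    have uv: "?u \<otimes>\<^bsub>C\<^esub> (?v \<odot>\<^bsub>C\<^esub> e) = a \<otimes>\<^bsub>C\<^esub> (?v \<odot>\<^bsub>C\<^esub> e) \<ominus>\<^bsub>C\<^esub> (\<alpha> \<otimes>\<^bsub>L\<^esub> ?v) \<odot>\<^bsub>C\<^esub> e"
    proof -
      have "?v \<odot>\<^bsub>C\<^esub> (\<alpha> \<odot>\<^bsub>C\<^esub> e) = \<alpha> \<odot>\<^bsub>C\<^esub> (?v \<odot>\<^bsub>C\<^esub> e)"
        using vL al e by (simp add: M.smult_assoc1[symmetric] L.m_comm)
      then show ?thesis
        using a e al vL ee by (simp add: a_minus_def C.l_distr C.l_minus algC.smult_mult_left
          algC.smult_mult_right M.smult_assoc1 M.smult_r_distr M.smult_r_minus)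
    qed
    have "?u \<otimes>\<^bsub>C\<^esub> ev e (quo \<alpha> (c # cs)) a \<oplus>\<^bsub>C\<^esub> evL (c # cs) \<alpha> \<odot>\<^bsub>C\<^esub> e
        = (?u \<otimes>\<^bsub>C\<^esub> (?v \<odot>\<^bsub>C\<^esub> e) \<oplus>\<^bsub>C\<^esub> ?u \<otimes>\<^bsub>C\<^esub> (a \<otimes>\<^bsub>C\<^esub> ?q)) \<oplus>\<^bsub>C\<^esub> (c \<odot>\<^bsub>C\<^esub> e \<oplus>\<^bsub>C\<^esub> (\<alpha> \<otimes>\<^bsub>L\<^esub> ?v) \<odot>\<^bsub>C\<^esub> e)"
      using False u a q vL c e al cs by (simp add: C.r_distr evL_simps M.smult_l_distr del: rev.simps)
    also have "?u \<otimes>\<^bsub>C\<^esub> (a \<otimes>\<^bsub>C\<^esub> ?q) = a \<otimes>\<^bsub>C\<^esub> (?u \<otimes>\<^bsub>C\<^esub> ?q)"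
      using u a q au by (simp add: C.m_assoc[symmetric])
    also have "(?u \<otimes>\<^bsub>C\<^esub> (?v \<odot>\<^bsub>C\<^esub> e) \<oplus>\<^bsub>C\<^esub> a \<otimes>\<^bsub>C\<^esub> (?u \<otimes>\<^bsub>C\<^esub> ?q)) \<oplus>\<^bsub>C\<^esub> (c \<odot>\<^bsub>C\<^esub> e \<oplus>\<^bsub>C\<^esub> (\<alpha> \<otimes>\<^bsub>L\<^esub> ?v) \<odot>\<^bsub>C\<^esub> e)
       = c \<odot>\<^bsub>C\<^esub> e \<oplus>\<^bsub>C\<^esub> (a \<otimes>\<^bsub>C\<^esub> (?u \<otimes>\<^bsub>C\<^esub> ?q) \<oplus>\<^bsub>C\<^esub> (?u \<otimes>\<^bsub>C\<^esub> (?v \<odot>\<^bsub>C\<^esub> e) \<oplus>\<^bsub>C\<^esub> (\<alpha> \<otimes>\<^bsub>L\<^esub> ?v) \<odot>\<^bsub>C\<^esub> e))"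
      using u a q vL c e al by (simp add: C.a_ac)
    also have "?u \<otimes>\<^bsub>C\<^esub> (?v \<odot>\<^bsub>C\<^esub> e) \<oplus>\<^bsub>C\<^esub> (\<alpha> \<otimes>\<^bsub>L\<^esub> ?v) \<odot>\<^bsub>C\<^esub> e = a \<otimes>\<^bsub>C\<^esub> (?v \<odot>\<^bsub>C\<^esub> e)"
      unfolding uv using a e al vL by (simp add: a_minus_def C.a_assoc C.l_neg)
    also have "a \<otimes>\<^bsub>C\<^esub> (?u \<otimes>\<^bsub>C\<^esub> ?q) \<oplus>\<^bsub>C\<^esub> a \<otimes>\<^bsub>C\<^esub> (?v \<odot>\<^bsub>C\<^esub> e) = a \<otimes>\<^bsub>C\<^esub> ev e cs a"
      unfolding Cons.IH[OF cs] using a u q vL e by (simp add: C.r_distr)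
    finally show ?thesis by simp
  qed
qed

text \<open>The same division inside \<open>L\<close>; it shows that roots of the quotient by a root
  are roots of the original polynomial.\<close>

lemma evL_quo:
  assumes cs: "set cs \<subseteq> carrier L" and al: "\<alpha> \<in> carrier L" and be: "\<beta> \<in> carrier L"
  shows "evL cs \<beta> = (\<beta> \<ominus>\<^bsub>L\<^esub> \<alpha>) \<otimes>\<^bsub>L\<^esub> evL (quo \<alpha> cs) \<beta> \<oplus>\<^bsub>L\<^esub> evL cs \<alpha>"
  using cs
proof (induction cs)
  case Nil then show ?case using al be by simp
next
  case (Cons c cs)
  have c: "c \<in> carrier L" and cs: "set cs \<subseteq> carrier L" using Cons by auto
  show ?case
  proof (cases "cs = []")
    case True then show ?thesis using al be c by (simp add: evL_simps del: rev.simps)  simp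
  next
    case False
    let ?q = "evL (quo \<alpha> cs) \<beta>" and ?v = "evL cs \<alpha>" and ?u = "\<beta> \<ominus>\<^bsub>L\<^esub> \<alpha>"
    have qc: "set (quo \<alpha> cs) \<subseteq> carrier L" using quo_closed[OF subring_L cs al] .
    have q: "?q \<in> carrier L" using evL_simps(2)[OF qc al be] .
    have vL: "?v \<in> carrier L" using evL_simps(2)[OF cs al al] .
    have u: "?u \<in> carrier L" using be al by simp
    have uv: "?u \<otimes>\<^bsub>L\<^esub> ?v \<oplus>\<^bsub>L\<^esub> \<alpha> \<otimes>\<^bsub>L\<^esub> ?v = \<beta> \<otimes>\<^bsub>L\<^esub> ?v"
      using be al vL by (simp add: a_minus_def L.l_distr L.l_minus L.a_assoc L.l_neg)
    have "?u \<otimes>\<^bsub>L\<^esub> evL (quo \<alpha> (c # cs)) \<beta> \<oplus>\<^bsub>L\<^esub> evL (c # cs) \<alpha>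
       = ?u \<otimes>\<^bsub>L\<^esub> (?v \<oplus>\<^bsub>L\<^esub> \<beta> \<otimes>\<^bsub>L\<^esub> ?q) \<oplus>\<^bsub>L\<^esub> (c \<oplus>\<^bsub>L\<^esub> \<alpha> \<otimes>\<^bsub>L\<^esub> ?v)"
      using False by (simp add: evL_simps[OF qc vL be] evL_simps[OF cs c al] del: rev.simps)
    also have "\<dots> = (?u \<otimes>\<^bsub>L\<^esub> ?v \<oplus>\<^bsub>L\<^esub> \<beta> \<otimes>\<^bsub>L\<^esub> (?u \<otimes>\<^bsub>L\<^esub> ?q)) \<oplus>\<^bsub>L\<^esub> (c \<oplus>\<^bsub>L\<^esub> \<alpha> \<otimes>\<^bsub>L\<^esub> ?v)"
      using u vL q be by (simp add: L.r_distr L.m_lcomm)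
    also have "\<dots> = c \<oplus>\<^bsub>L\<^esub> (\<beta> \<otimes>\<^bsub>L\<^esub> (?u \<otimes>\<^bsub>L\<^esub> ?q) \<oplus>\<^bsub>L\<^esub> (?u \<otimes>\<^bsub>L\<^esub> ?v \<oplus>\<^bsub>L\<^esub> \<alpha> \<otimes>\<^bsub>L\<^esub> ?v))"
      using u vL q be al c by (simp add: L.a_ac)
    also have "\<dots> = c \<oplus>\<^bsub>L\<^esub> \<beta> \<otimes>\<^bsub>L\<^esub> evL cs \<beta>"
      unfolding uv Cons.IH[OF cs] using u vL q be by (simp add: L.r_distr)
    also have "\<dots> = evL (c # cs) \<beta>" using evL_simps(1)[OF cs c be] by simp
    finally show ?thesis by simp
  qed
qed

lemma root_exists:
  assumes cs: "set cs \<subseteq> carrier L" "length cs \<ge> 2" "last cs \<noteq> \<zero>\<^bsub>L\<^esub>"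
  obtains \<alpha> where "\<alpha> \<in> carrier L" "evL cs \<alpha> = \<zero>\<^bsub>L\<^esub>"
proof -
  have ne: "cs \<noteq> []" using cs by auto
  have P: "rev cs \<in> carrier (poly_ring L)"
    using cs ne by (simp add: univ_poly_carrier[symmetric] polynomial_def hd_rev)
  have "size (L.roots (rev cs)) = length cs - 1"
    using L.roots_over_carrier[OF P] by (simp add: L.splitted_def)
  then have "L.roots (rev cs) \<noteq> {#}" using cs by auto
  then obtain \<alpha> where "\<alpha> \<in># L.roots (rev cs)" by auto
  then have "L.is_root (rev cs) \<alpha>" using L.roots_mem_iff_is_root[OF P] by simp
  then show ?thesis using that by (auto simp: L.is_root_def)
qed

text \<open>Induction on the length of a polynomial that kills \<open>a\<close>. A root \<alpha>
  lies in an admissible extension \<open>F\<close> by the separability hypothesis on roots, and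
  \<open>e\<close> is still primitive over \<open>F\<close>. Either \<open>a - \<alpha> e\<close>
  vanishes, or it is invertible in the corner and the quotient by \<open>X - \<alpha>\<close>
  already kills \<open>a\<close>. The hypothesis passes to the quotient because its roots are roots
  of \<open>cs\<close>.\<close>

lemma eliminate:
  assumes "fs E" "prim E e" "a \<in> CE E" "e \<otimes>\<^bsub>C\<^esub> a = a" "a \<otimes>\<^bsub>C\<^esub> e = a"
    "cs \<noteq> []" "set cs \<subseteq> E" "last cs \<noteq> \<zero>\<^bsub>L\<^esub>" "ev e cs a = \<zero>\<^bsub>C\<^esub>"
    "\<And>\<alpha> W. \<alpha> \<in> carrier L \<Longrightarrow> evL cs \<alpha> = \<zero>\<^bsub>L\<^esub> \<Longrightarrow> subring W L \<Longrightarrow> E \<subseteq> W \<Longrightarrow> \<alpha> [^]\<^bsub>L\<^esub> p \<in> W \<Longrightarrow> \<alpha> \<in> W"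
  shows "\<exists>\<alpha>\<in>carrier L. a = \<alpha> \<odot>\<^bsub>C\<^esub> e"
  using assms
proof (induction "length cs" arbitrary: E cs rule: less_induct)
  case less
  note E = less.prems(1) and pe = less.prems(2)
  note Ed = fsD[OF E]
  have eE: "e \<in> CE E" and ee: "e \<otimes>\<^bsub>C\<^esub> e = e" and en: "e \<noteq> \<zero>\<^bsub>C\<^esub>" using pe by (auto simp: prim_def)
  have ec: "e \<in> carrier C" and ac: "a \<in> carrier C" using eE less.prems(3) CE_carrier by auto
  have csL: "set cs \<subseteq> carrier L" using less.prems(7) Ed(4) by blast
  show ?case
  proof (cases "length cs \<ge> 2")
    case False
    then obtain c where cs: "cs = [c]" using less.prems(6) by (cases cs) (auto simp: Suc_le_eq)
    then have "c \<odot>\<^bsub>C\<^esub> e = \<zero>\<^bsub>C\<^esub>" using less.prems(9) csL ec ac by simp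
    then have "c = \<zero>\<^bsub>L\<^esub>" using smult_eq_zero[of c e] cs csL ec en by auto
    then show ?thesis using less.prems(8) cs by simp
  next
    case True
    obtain \<alpha> where al: "\<alpha> \<in> carrier L" "evL cs \<alpha> = \<zero>\<^bsub>L\<^esub>" using root_exists[OF csL True less.prems(8)] by blast
    obtain F where F: "fs F" "E \<subseteq> F" "\<alpha> \<in> F"
      using fs_adjoin[OF E al(1) less.prems(10)[OF al]] by blast
    note Fd = fsD[OF F(1)]
    have csF: "set cs \<subseteq> F" using less.prems(7) F by blast
    have qF: "set (quo \<alpha> cs) \<subseteq> F" by (rule quo_closed[OF Fd(2) csF F(3)])
    have eF: "e \<in> CE F" and aF: "a \<in> CE F" using CE_mono[OF F(2)] eE less.prems(3) by auto
    let ?u = "a \<ominus>\<^bsub>C\<^esub> \<alpha> \<odot>\<^bsub>C\<^esub> e" and ?q = "ev e (quo \<alpha> cs) a"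
    have uF: "?u \<in> CE F" using CE_fs[OF F(1) F(1)] eF aF F(3) by simp
    have qC: "?q \<in> CE F" by (rule ev_closed[OF Fd(2,3) qF eF aF])
    note uc = CE_carrier[OF uF] and qc = CE_carrier[OF qC]
    have uq: "?u \<otimes>\<^bsub>C\<^esub> ?q = \<zero>\<^bsub>C\<^esub>"
      using ev_quo[OF csL ac ec al(1) less.prems(4,5) ee] less.prems(9) al(2) ec uc qc by simp
    show ?thesis
    proof (cases "?u = \<zero>\<^bsub>C\<^esub>")
      case True
      then have "a = \<alpha> \<odot>\<^bsub>C\<^esub> e" using C.diff_zero_imp_eq[of a "\<alpha> \<odot>\<^bsub>C\<^esub> e"] ac ec al(1) by (simp add: a_minus_def)
      then show ?thesis using al by blast
    next
      case un: False
      have eu: "e \<otimes>\<^bsub>C\<^esub> ?u = ?u" "?u \<otimes>\<^bsub>C\<^esub> e = ?u"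
        using ec ac al(1) less.prems(4,5) ee
        by (simp_all add: a_minus_def C.l_distr C.r_distr C.l_minus C.r_minus algC.smult_mult_left algC.smult_mult_right)
      obtain y where y: "y \<in> CE F" "y \<otimes>\<^bsub>C\<^esub> ?u = e"
        using corner_inverse[OF F(1) prim_mono[OF pe F(2)] prim_mono[OF pe F(2)] uF eu un] by blast
      have yc: "y \<in> carrier C" using y CE_carrier by blast
      have "e \<otimes>\<^bsub>C\<^esub> ?q = y \<otimes>\<^bsub>C\<^esub> (?u \<otimes>\<^bsub>C\<^esub> ?q)" using y(2) yc uc qc by (simp add: C.m_assoc[symmetric])
      then have "e \<otimes>\<^bsub>C\<^esub> ?q = \<zero>\<^bsub>C\<^esub>" using uq yc by simp
      moreover have "e \<otimes>\<^bsub>C\<^esub> ev e ds a = ev e ds a" if "set ds \<subseteq> carrier L" for ds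
        using that
      proof (induction ds)
        case (Cons d ds)
        then have "d \<in> carrier L" "ev e ds a \<in> carrier C" using ev_carrier ec ac by auto
        then show ?case using ec ac ee less.prems(4) Cons
          by (simp add: C.r_distr algC.smult_mult_right C.m_assoc[symmetric])
      qed (use ec in simp)
      ultimately have q0: "?q = \<zero>\<^bsub>C\<^esub>" using qF Fd(4) by auto
      show ?thesis
      proof (rule less.hyps[of "quo \<alpha> cs" F])
        show "length (quo \<alpha> cs) < length cs" using quo_props(1)[of \<alpha> cs] True by simp
        show "quo \<alpha> cs \<noteq> []" using quo_props(1)[of \<alpha> cs] True by auto
        show "last (quo \<alpha> cs) \<noteq> \<zero>\<^bsub>L\<^esub>" using quo_props(2)[OF True al(1) csL] less.prems(8) by simp
        fix \<beta> W assume b: "\<beta> \<in> carrier L" "evL (quo \<alpha> cs) \<beta> = \<zero>\<^bsub>L\<^esub>" "subring W L" "F \<subseteq> W" "\<beta> [^]\<^bsub>L\<^esub> p \<in> W"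
        have "evL cs \<beta> = \<zero>\<^bsub>L\<^esub>" using evL_quo[OF csL al(1) b(1)] al b by simp
        then show "\<beta> \<in> W" using less.prems(10)[OF b(1) _ b(3)] b(4,5) F(2) by blast
      qed (use F(1) prim_mono[OF pe F(2)] aF less.prems(4,5) qF q0 in auto)
    qed
  qed
qed

end

lemma (in abelian_monoid) finsum_prime_powers:
  fixes p :: nat
  assumes p: "p \<ge> 2" and f: "\<And>i. f i \<in> carrier G"
    and z: "\<And>i. i \<notin> (\<lambda>t. p ^ t) ` {..n} \<Longrightarrow> f i = \<zero>"
  shows "(\<Oplus>i\<in>{..<Suc (p ^ n)}. f i) = (\<Oplus>t\<in>{..n}. f (p ^ t))"
proof -
  have "(\<lambda>t. p ^ t) ` {..n} \<subseteq> {..<Suc (p ^ n)}" using p by (auto simp: less_Suc_eq_le power_increasing)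
  then have "(\<Oplus>i\<in>{..<Suc (p ^ n)}. f i) = (\<Oplus>i\<in>(\<lambda>t. p ^ t) ` {..n}. f i)"
    by (intro add.finprod_mono_neutral_cong_right) (use z f in auto)
  also have "\<dots> = (\<Oplus>t\<in>{..n}. f (p ^ t))"
    by (rule finsum_reindex) (use f p in \<open>auto simp: inj_on_def\<close>)
  finally show ?thesis .
qed

lemma (in abelian_monoid) finsum_lessThan_Suc_shift:
  assumes "\<And>i. f i \<in> carrier G"
  shows "(\<Oplus>i\<in>{..<Suc m}. f i) = f 0 \<oplus> (\<Oplus>i\<in>{..<m}. f (Suc i))"
proof -
  have "{..<Suc m} = insert 0 (Suc ` {..<m})" by (auto simp: lessThan_Suc_eq_insert_0)
  then have "(\<Oplus>i\<in>{..<Suc m}. f i) = f 0 \<oplus> (\<Oplus>i\<in>Suc ` {..<m}. f i)"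
    using assms by (simp add: finsum_insert)
  also have "(\<Oplus>i\<in>Suc ` {..<m}. f i) = (\<Oplus>i\<in>{..<m}. f (Suc i))"
    by (rule finsum_reindex) (use assms in auto)
  finally show ?thesis .
qed

section \<open>Algebraic elements of a primitive corner\<close>

context split_core begin

lemma h_hom: "b \<in> B \<Longrightarrow> abelian_group_hom C L (h b)"
  by (intro abelian_group_homI C.abelian_group_axioms L.abelian_group_axioms group_hom.intro
       group_hom_axioms.intro C.a_group L.a_group) (auto simp: hom_def h_closed h_add)

text \<open>Coordinates turn a relation among the \<open>x i\<close> into a homogeneous system with
  one equation for each element of \<open>B\<close>.\<close>

lemma dependent:
  assumes E: "fs E" and I: "finite I" "card B < card I" and x: "\<And>i. i \<in> I \<Longrightarrow> x i \<in> CE E"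
  obtains c where "\<And>i. i \<in> I \<Longrightarrow> c i \<in> E" "\<exists>i\<in>I. c i \<noteq> \<zero>\<^bsub>L\<^esub>" "(\<Oplus>\<^bsub>C\<^esub>i\<in>I. c i \<odot>\<^bsub>C\<^esub> x i) = \<zero>\<^bsub>C\<^esub>"
proof -
  have M: "h b (x i) \<in> E" if "i \<in> I" "b \<in> B" for i b using x that by (auto simp: CE_def)
  obtain c where c: "\<forall>i\<in>I. c i \<in> E" "\<exists>i\<in>I. c i \<noteq> \<zero>\<^bsub>L\<^esub>" "\<forall>b\<in>B. (\<Oplus>\<^bsub>L\<^esub>i\<in>I. c i \<otimes>\<^bsub>L\<^esub> h b (x i)) = \<zero>\<^bsub>L\<^esub>"
    using L.dependent_family[OF fsD(1)[OF E] finB I, of "\<lambda>i b. h b (x i)"] M by auto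
  have cL: "c i \<in> carrier L" if "i \<in> I" for i using c that fsD(4)[OF E] by auto
  have xC: "x i \<in> carrier C" if "i \<in> I" for i using x that CE_carrier by auto
  have "(\<Oplus>\<^bsub>C\<^esub>i\<in>I. c i \<odot>\<^bsub>C\<^esub> x i) = \<zero>\<^bsub>C\<^esub>"
  proof (rule eq_by_coords)
    show "(\<Oplus>\<^bsub>C\<^esub>i\<in>I. c i \<odot>\<^bsub>C\<^esub> x i) \<in> carrier C" using cL xC by (auto intro!: C.finsum_closed)
    fix b assume b: "b \<in> B"
    interpret hb: abelian_group_hom C L "h b" by (rule h_hom[OF b])
    have "h b (\<Oplus>\<^bsub>C\<^esub>i\<in>I. c i \<odot>\<^bsub>C\<^esub> x i) = (\<Oplus>\<^bsub>L\<^esub>i\<in>I. h b (c i \<odot>\<^bsub>C\<^esub> x i))"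
      by (rule hb.hom_finsum) (use cL xC in auto)
    also have "\<dots> = (\<Oplus>\<^bsub>L\<^esub>i\<in>I. c i \<otimes>\<^bsub>L\<^esub> h b (x i))"
      by (rule L.finsum_cong') (use cL xC b in \<open>auto simp: h_smult h_closed\<close>)
    finally show "h b (\<Oplus>\<^bsub>C\<^esub>i\<in>I. c i \<odot>\<^bsub>C\<^esub> x i) = h b \<zero>\<^bsub>C\<^esub>" using c(3) b h_zero by simp
  qed simp
  then show ?thesis using that c by blast
qed

text \<open>Powers of \<open>a\<close> inside the corner: the zeroth power is \<open>e\<close>, not
  the unit of \<open>C\<close>.\<close>

definition pw :: "'c \<Rightarrow> 'c \<Rightarrow> nat \<Rightarrow> 'c" where
  "pw e a i = (if i = 0 then e else a [^]\<^bsub>C\<^esub> i)"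

lemma ev_map:
  assumes e: "e \<in> carrier C" and a: "a \<in> carrier C" and ae: "a \<otimes>\<^bsub>C\<^esub> e = a" and c: "\<And>i. c i \<in> carrier L"
  shows "ev e (map c [0..<m]) a = (\<Oplus>\<^bsub>C\<^esub>i\<in>{..<m}. c i \<odot>\<^bsub>C\<^esub> pw e a i)"
  using c
proof (induction m arbitrary: c)
  case (Suc m)
  have pc: "pw e a i \<in> carrier C" for i using e a by (simp add: pw_def)
  have ap: "a \<otimes>\<^bsub>C\<^esub> pw e a i = pw e a (Suc i)" for i
    using e a ae C.nat_pow_Suc2[OF a, of i] by (auto simp: pw_def)
  have "[0..<Suc m] = 0 # map Suc [0..<m]" by (simp add: upt_conv_Cons map_Suc_upt del: upt_Suc)
  then have "ev e (map c [0..<Suc m]) a = c 0 \<odot>\<^bsub>C\<^esub> e \<oplus>\<^bsub>C\<^esub> a \<otimes>\<^bsub>C\<^esub> ev e (map (\<lambda>i. c (Suc i)) [0..<m]) a"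
    by (simp add: comp_def del: upt_Suc)
  also have "ev e (map (\<lambda>i. c (Suc i)) [0..<m]) a = (\<Oplus>\<^bsub>C\<^esub>i\<in>{..<m}. c (Suc i) \<odot>\<^bsub>C\<^esub> pw e a i)"
    by (rule Suc.IH) (rule Suc.prems)
  also have "a \<otimes>\<^bsub>C\<^esub> \<dots> = (\<Oplus>\<^bsub>C\<^esub>i\<in>{..<m}. a \<otimes>\<^bsub>C\<^esub> (c (Suc i) \<odot>\<^bsub>C\<^esub> pw e a i))"
    by (rule C.finsum_rdistr) (use a Suc.prems pc in auto)
  also have "\<dots> = (\<Oplus>\<^bsub>C\<^esub>i\<in>{..<m}. c (Suc i) \<odot>\<^bsub>C\<^esub> pw e a (Suc i))"
    by (rule C.finsum_cong') (use a Suc.prems pc in \<open>auto simp: algC.smult_mult_right ap\<close>)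
  also have "c 0 \<odot>\<^bsub>C\<^esub> e \<oplus>\<^bsub>C\<^esub> \<dots> = (\<Oplus>\<^bsub>C\<^esub>i\<in>{..<Suc m}. c i \<odot>\<^bsub>C\<^esub> pw e a i)"
    by (subst C.finsum_lessThan_Suc_shift) (use Suc.prems pc in \<open>auto simp: pw_def\<close>)
  finally show ?case .
qed simp

lemma evL_map:
  assumes a: "\<alpha> \<in> carrier L" and c: "\<And>i. c i \<in> carrier L"
  shows "evL (map c [0..<m]) \<alpha> = (\<Oplus>\<^bsub>L\<^esub>i\<in>{..<m}. c i \<otimes>\<^bsub>L\<^esub> \<alpha> [^]\<^bsub>L\<^esub> i)"
  using c
proof (induction m arbitrary: c)
  case (Suc m)
  have "[0..<Suc m] = 0 # map Suc [0..<m]" by (simp add: upt_conv_Cons map_Suc_upt del: upt_Suc)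
  then have "evL (map c [0..<Suc m]) \<alpha> = evL (c 0 # map (\<lambda>i. c (Suc i)) [0..<m]) \<alpha>"
    by (simp add: comp_def del: upt_Suc)
  also have "\<dots> = c 0 \<oplus>\<^bsub>L\<^esub> \<alpha> \<otimes>\<^bsub>L\<^esub> evL (map (\<lambda>i. c (Suc i)) [0..<m]) \<alpha>"
    by (rule evL_simps(1)) (use Suc.prems a in auto)
  also have "evL (map (\<lambda>i. c (Suc i)) [0..<m]) \<alpha> = (\<Oplus>\<^bsub>L\<^esub>i\<in>{..<m}. c (Suc i) \<otimes>\<^bsub>L\<^esub> \<alpha> [^]\<^bsub>L\<^esub> i)"
    by (rule Suc.IH) (rule Suc.prems)
  also have "\<alpha> \<otimes>\<^bsub>L\<^esub> \<dots> = (\<Oplus>\<^bsub>L\<^esub>i\<in>{..<m}. \<alpha> \<otimes>\<^bsub>L\<^esub> (c (Suc i) \<otimes>\<^bsub>L\<^esub> \<alpha> [^]\<^bsub>L\<^esub> i))"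
    by (rule L.finsum_rdistr) (use a Suc.prems in auto)
  also have "\<dots> = (\<Oplus>\<^bsub>L\<^esub>i\<in>{..<m}. c (Suc i) \<otimes>\<^bsub>L\<^esub> \<alpha> [^]\<^bsub>L\<^esub> (Suc i))"
    by (rule L.finsum_cong') (use a Suc.prems in \<open>auto simp: L.m_ac\<close>)
  also have "c 0 \<oplus>\<^bsub>L\<^esub> \<dots> = (\<Oplus>\<^bsub>L\<^esub>i\<in>{..<Suc m}. c i \<otimes>\<^bsub>L\<^esub> \<alpha> [^]\<^bsub>L\<^esub> i)"
    by (subst L.finsum_lessThan_Suc_shift) (use Suc.prems a in auto)
  finally show ?case .
qed simp

text \<open>For \<open>p = 1\<close> the separability condition on roots is trivial, so any
  polynomial that kills \<open>a\<close> can be eliminated; one exists by linear dependence of the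
  first \<open>card B + 1\<close> powers. Its coefficient list is cut off after the last nonzero
  coefficient, at \<open>m\<close>, because \<open>eliminate\<close> wants a nonzero leading
  coefficient.\<close>

lemma char_one_algebraic:
  assumes p1: "p = 1" and E: "fs E" and pe: "prim E e" and a: "a \<in> CE E" "e \<otimes>\<^bsub>C\<^esub> a = a" "a \<otimes>\<^bsub>C\<^esub> e = a"
  shows "\<exists>\<alpha>\<in>carrier L. a = \<alpha> \<odot>\<^bsub>C\<^esub> e"
proof -
  have eE: "e \<in> CE E" using pe by (simp add: prim_def)
  note ec = CE_carrier[OF eE] and ac = CE_carrier[OF a(1)]
  have pE: "pw e a i \<in> CE E" for i using eE a CE_fs(9)[OF E E] by (simp add: pw_def)
  note pc = CE_carrier[OF pE]
  obtain c where c: "\<And>i. i \<in> {..card B} \<Longrightarrow> c i \<in> E" "\<exists>i\<in>{..card B}. c i \<noteq> \<zero>\<^bsub>L\<^esub>"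
      and cz: "(\<Oplus>\<^bsub>C\<^esub>i\<in>{..card B}. c i \<odot>\<^bsub>C\<^esub> pw e a i) = \<zero>\<^bsub>C\<^esub>"
    using dependent[OF E, of "{..card B}" "pw e a"] pE by auto
  define d where "d i = (if i \<le> card B then c i else \<zero>\<^bsub>L\<^esub>)" for i
  have dE: "d i \<in> E" for i using c(1) subringE(2)[OF fsD(2)[OF E]] by (auto simp: d_def)
  have dL: "d i \<in> carrier L" for i using dE fsD(4)[OF E] by blast
  define m where "m = Max {i. i \<le> card B \<and> c i \<noteq> \<zero>\<^bsub>L\<^esub>}"
  have "m \<in> {i. i \<le> card B \<and> c i \<noteq> \<zero>\<^bsub>L\<^esub>}" unfolding m_def by (rule Max_in) (use c(2) in auto)
  then have m: "m \<le> card B" "c m \<noteq> \<zero>\<^bsub>L\<^esub>" by auto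
  have mx: "c i = \<zero>\<^bsub>L\<^esub>" if "i \<le> card B" "m < i" for i
  proof (rule ccontr)
    assume "c i \<noteq> \<zero>\<^bsub>L\<^esub>"
    then have "i \<le> m" unfolding m_def using that by (intro Max_ge) auto
    then show False using that by simp
  qed
  have "ev e (map d [0..<Suc m]) a = (\<Oplus>\<^bsub>C\<^esub>i\<in>{..<Suc m}. d i \<odot>\<^bsub>C\<^esub> pw e a i)" by (rule ev_map[OF ec ac a(3) dL])
  also have "\<dots> = (\<Oplus>\<^bsub>C\<^esub>i\<in>{..card B}. c i \<odot>\<^bsub>C\<^esub> pw e a i)"
  proof (rule C.add.finprod_mono_neutral_cong_left)
    show "{..<Suc m} \<subseteq> {..card B}" using m by auto
    show "c i \<odot>\<^bsub>C\<^esub> pw e a i = \<zero>\<^bsub>C\<^esub>" if "i \<in> {..card B} - {..<Suc m}" for i using that mx[of i] pc by auto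
    show "(\<lambda>i. c i \<odot>\<^bsub>C\<^esub> pw e a i) \<in> {..card B} \<rightarrow> carrier C" using pc c(1) fsD(4)[OF E] by auto
  qed (use m in \<open>auto simp: d_def\<close>)
  finally have ev0: "ev e (map d [0..<Suc m]) a = \<zero>\<^bsub>C\<^esub>" using cz by simp
  show ?thesis
  proof (rule eliminate[OF E pe a(1,2,3), of "map d [0..<Suc m]"])
    show "set (map d [0..<Suc m]) \<subseteq> E" using dE by auto
    show "last (map d [0..<Suc m]) \<noteq> \<zero>\<^bsub>L\<^esub>" using m by (simp add: d_def)
    show "ev e (map d [0..<Suc m]) a = \<zero>\<^bsub>C\<^esub>" by (rule ev0)
    show "\<alpha> \<in> W" if "\<alpha> \<in> carrier L" "\<alpha> [^]\<^bsub>L\<^esub> p \<in> W" for \<alpha> W using that p1 by simp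
  qed simp
qed

text \<open>Take a linear relation among the powers \<open>a ^ (p ^ i)\<close> only, let
  \<open>s\<close> be its first index with a nonzero coefficient and put
  \<open>b = a ^ (p ^ s)\<close>. The relation becomes a polynomial in \<open>b\<close> with
  exponents \<open>p ^ t\<close> and a nonzero linear coefficient. Its derivative is a nonzero
  constant, so all its roots are separable and \<open>eliminate\<close> applies to
  \<open>b\<close>.\<close>

lemma prime_algebraic:
  assumes pp: "Factorial_Ring.prime p" and E: "fs E" and pe: "prim E e"
    and a: "a \<in> CE E" "e \<otimes>\<^bsub>C\<^esub> a = a" "a \<otimes>\<^bsub>C\<^esub> e = a"
  shows "\<exists>s. \<exists>\<alpha>\<in>carrier L. a [^]\<^bsub>C\<^esub> (p ^ s) = \<alpha> \<odot>\<^bsub>C\<^esub> e"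
proof -
  have p2: "p \<ge> 2" using pp by (rule prime_ge_2_nat)
  have eE: "e \<in> CE E" using pe by (simp add: prim_def)
  note ec = CE_carrier[OF eE] and ac = CE_carrier[OF a(1)]
  obtain c where c: "\<And>i. i \<in> {..card B} \<Longrightarrow> c i \<in> E" "\<exists>i\<in>{..card B}. c i \<noteq> \<zero>\<^bsub>L\<^esub>"
      and cz: "(\<Oplus>\<^bsub>C\<^esub>i\<in>{..card B}. c i \<odot>\<^bsub>C\<^esub> a [^]\<^bsub>C\<^esub> (p ^ i)) = \<zero>\<^bsub>C\<^esub>"
    using dependent[OF E, of "{..card B}" "\<lambda>i. a [^]\<^bsub>C\<^esub> (p ^ i)"] CE_fs(9)[OF E E a(1)] by auto
  define N where "N = {i. i \<le> card B \<and> c i \<noteq> \<zero>\<^bsub>L\<^esub>}"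
  have Nfin: "finite N" and Nne: "N \<noteq> {}" using c(2) by (auto simp: N_def)
  define s m where "s = Min N" and "m = Max N - s"
  have sN: "s \<in> N" "Max N \<in> N" using Min_in Max_in Nfin Nne by (auto simp: s_def)
  have sm: "s + m = Max N" using Min_le[OF Nfin sN(2)] by (simp add: m_def s_def)
  have out: "c i = \<zero>\<^bsub>L\<^esub>" if "i \<le> card B" "i < s \<or> s + m < i" for i
  proof (rule ccontr)
    assume "c i \<noteq> \<zero>\<^bsub>L\<^esub>"
    then have "i \<in> N" using that by (simp add: N_def)
    then have "s \<le> i" "i \<le> Max N" using Nfin by (auto simp: s_def)
    then show False using that sm by auto
  qed
  define b where "b = a [^]\<^bsub>C\<^esub> (p ^ s)"
  have bE: "b \<in> CE E" using CE_fs(9)[OF E E a(1)] by (simp add: b_def)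
  note bc = CE_carrier[OF bE]
  have ppos: "0 < p ^ s" using p2 by simp
  then obtain q where q: "p ^ s = Suc q" using gr0_implies_Suc by blast
  have eb: "e \<otimes>\<^bsub>C\<^esub> b = b" unfolding b_def q using C.nat_pow_Suc2[OF ac, of q] ac ec a(2) by (simp add: C.m_assoc[symmetric])
  have be: "b \<otimes>\<^bsub>C\<^esub> e = b" unfolding b_def q using ac ec a(3) by (simp add: C.m_assoc)
  \<comment> \<open>The dense coefficient list of the polynomial in \<open>b\<close>: the
    coefficient of exponent \<open>p ^ t\<close> is \<open>c (s + t)\<close>, all others are
    zero.\<close>
  define d where "d i = (if i \<in> (\<lambda>t. p ^ t) ` {..m} then c (s + inv_into {..m} (\<lambda>t. p ^ t) i) else \<zero>\<^bsub>L\<^esub>)" for i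
  have inj: "inj_on (\<lambda>t. p ^ t) {..m}" using p2 by (auto simp: inj_on_def)
  have dp: "d (p ^ t) = c (s + t)" if "t \<le> m" for t
    using that inv_into_f_f[OF inj, of t] by (auto simp: d_def)
  have smB: "s + m \<le> card B" using sN(2) sm by (auto simp: N_def)
  have cLs: "c (s + t) \<in> carrier L" if "t \<le> m" for t using c(1)[of "s + t"] that smB fsD(4)[OF E] by auto
  have dE: "d i \<in> E" for i
  proof (cases "i \<in> (\<lambda>t. p ^ t) ` {..m}")
    case True
    then obtain t where "t \<le> m" "i = p ^ t" by auto
    then show ?thesis using dp c(1)[of "s + t"] smB by simp
  next
    case False then show ?thesis using subringE(2)[OF fsD(2)[OF E]] by (simp add: d_def)
  qed
  have dL: "d i \<in> carrier L" for i using dE fsD(4)[OF E] by blast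
  have pc: "pw e b i \<in> carrier C" for i using ec bc by (simp add: pw_def)
  let ?cs = "map d [0..<Suc (p ^ m)]"
  have "ev e ?cs b = (\<Oplus>\<^bsub>C\<^esub>i\<in>{..<Suc (p ^ m)}. d i \<odot>\<^bsub>C\<^esub> pw e b i)" by (rule ev_map[OF ec bc be dL])
  also have "\<dots> = (\<Oplus>\<^bsub>C\<^esub>t\<in>{..m}. d (p ^ t) \<odot>\<^bsub>C\<^esub> pw e b (p ^ t))"
    by (rule C.finsum_prime_powers[OF p2]) (use dL pc in \<open>auto simp: d_def\<close>)
  also have "\<dots> = (\<Oplus>\<^bsub>C\<^esub>t\<in>{..m}. c (s + t) \<odot>\<^bsub>C\<^esub> a [^]\<^bsub>C\<^esub> (p ^ (s + t)))"
    by (rule C.finsum_cong')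
       (use dp p2 ac cLs in \<open>auto simp: pw_def b_def C.nat_pow_pow power_add\<close>)
  also have "\<dots> = (\<Oplus>\<^bsub>C\<^esub>i\<in>(\<lambda>t. s + t) ` {..m}. c i \<odot>\<^bsub>C\<^esub> a [^]\<^bsub>C\<^esub> (p ^ i))"
    by (rule C.finsum_reindex[symmetric]) (use ac cLs in auto)
  also have "\<dots> = (\<Oplus>\<^bsub>C\<^esub>i\<in>{..card B}. c i \<odot>\<^bsub>C\<^esub> a [^]\<^bsub>C\<^esub> (p ^ i))"
  proof (rule C.add.finprod_mono_neutral_cong_left)
    show "(\<lambda>t. s + t) ` {..m} \<subseteq> {..card B}" using smB by auto
    show "c i \<odot>\<^bsub>C\<^esub> a [^]\<^bsub>C\<^esub> (p ^ i) = \<zero>\<^bsub>C\<^esub>" if i: "i \<in> {..card B} - (\<lambda>t. s + t) ` {..m}" for i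
    proof -
      have "i < s \<or> s + m < i"
      proof (rule ccontr)
        assume "\<not> ?thesis"
        then have "i = s + (i - s)" "i - s \<le> m" by auto
        then have "i \<in> (\<lambda>t. s + t) ` {..m}" by blast
        then show False using i by simp
      qed
      then show ?thesis using out[of i] i ac by auto
    qed
    show "(\<lambda>i. c i \<odot>\<^bsub>C\<^esub> a [^]\<^bsub>C\<^esub> (p ^ i)) \<in> {..card B} \<rightarrow> carrier C" using ac c(1) fsD(4)[OF E] by auto
  qed auto
  finally have ev0: "ev e ?cs b = \<zero>\<^bsub>C\<^esub>" using cz by simp
  have "\<exists>\<alpha>\<in>carrier L. b = \<alpha> \<odot>\<^bsub>C\<^esub> e"
  proof (rule eliminate[OF E pe bE eb be, of ?cs])
    show "last ?cs \<noteq> \<zero>\<^bsub>L\<^esub>" using dp[of m] sN(2) sm by (auto simp: N_def)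
    fix \<alpha> W assume al: "\<alpha> \<in> carrier L" "evL ?cs \<alpha> = \<zero>\<^bsub>L\<^esub>" and W: "subring W L" "E \<subseteq> W" "\<alpha> [^]\<^bsub>L\<^esub> p \<in> W"
    note Ws = subringE[OF W(1)]
    \<comment> \<open>The equation of \<alpha> is solved for its linear term: for
      \<open>t > 0\<close> the power \<open>\<alpha> ^ (p ^ t)\<close> is a power of
      \<open>\<alpha> ^ p\<close> and lies in \<open>W\<close>. Hence \<open>c s\<close> times
      \<alpha> lies in \<open>W\<close>, and \<open>c s\<close> is invertible in
      \<open>E\<close>.\<close>
    let ?f = "\<lambda>t. c (s + t) \<otimes>\<^bsub>L\<^esub> \<alpha> [^]\<^bsub>L\<^esub> (p ^ t)"
    have fL: "?f \<in> {..m} \<rightarrow> carrier L" using al cLs by auto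
    have "\<zero>\<^bsub>L\<^esub> = (\<Oplus>\<^bsub>L\<^esub>i\<in>{..<Suc (p ^ m)}. d i \<otimes>\<^bsub>L\<^esub> \<alpha> [^]\<^bsub>L\<^esub> i)" using evL_map[OF al(1), of d "Suc (p ^ m)"] dL al(2) by simp
    also have "\<dots> = (\<Oplus>\<^bsub>L\<^esub>t\<in>{..m}. d (p ^ t) \<otimes>\<^bsub>L\<^esub> \<alpha> [^]\<^bsub>L\<^esub> (p ^ t))"
      by (rule L.finsum_prime_powers[OF p2]) (use dL al in \<open>auto simp: d_def\<close>)
    also have "\<dots> = (\<Oplus>\<^bsub>L\<^esub>t\<in>{..m}. ?f t)" by (rule L.finsum_cong') (use dp fL in auto)
    also have "\<dots> = ?f 0 \<oplus>\<^bsub>L\<^esub> (\<Oplus>\<^bsub>L\<^esub>t\<in>{..m} - {0}. ?f t)" by (rule L.finsum_remove) (use fL in auto)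
    finally have "?f 0 \<oplus>\<^bsub>L\<^esub> (\<Oplus>\<^bsub>L\<^esub>t\<in>{..m} - {0}. ?f t) = \<zero>\<^bsub>L\<^esub>" by (rule sym)
    moreover have RW: "(\<Oplus>\<^bsub>L\<^esub>t\<in>{..m} - {0}. ?f t) \<in> W"
    proof (rule L.finsum_subring_closed[OF W(1)])
      fix t assume t: "t \<in> {..m} - {0}"
      then obtain t' where t': "t = Suc t'" by (cases t) auto
      have "\<alpha> [^]\<^bsub>L\<^esub> (p ^ t) = (\<alpha> [^]\<^bsub>L\<^esub> p) [^]\<^bsub>L\<^esub> (p ^ t')" using al by (simp add: t' L.nat_pow_pow)
      moreover have "x [^]\<^bsub>L\<^esub> (n::nat) \<in> W" if "x \<in> W" for x n by (induction n) (use that Ws in auto)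
      ultimately have "\<alpha> [^]\<^bsub>L\<^esub> (p ^ t) \<in> W" using W(3) by simp
      moreover have "c (s + t) \<in> W" using c(1)[of "s + t"] t smB W(2) by auto
      ultimately show "?f t \<in> W" using Ws(6) by blast
    qed
    moreover have "?f 0 \<in> carrier L" using al cLs[of 0] by simp
    ultimately have "?f 0 = \<ominus>\<^bsub>L\<^esub> (\<Oplus>\<^bsub>L\<^esub>t\<in>{..m} - {0}. ?f t)"
      using Ws(1) by (intro L.minus_equality[symmetric]) auto
    then have caW: "c s \<otimes>\<^bsub>L\<^esub> \<alpha> \<in> W" using Ws(5)[OF RW] al by simp
    have csE: "c s \<in> E - {\<zero>\<^bsub>L\<^esub>}" using sN(1) c(1) by (auto simp: N_def)
    have inv: "inv\<^bsub>L\<^esub> (c s) \<in> W" "inv\<^bsub>L\<^esub> (c s) \<otimes>\<^bsub>L\<^esub> c s = \<one>\<^bsub>L\<^esub>"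
      using L.subfield_m_inv[OF fsD(1)[OF E] csE] W(2) by auto
    have "\<alpha> = inv\<^bsub>L\<^esub> (c s) \<otimes>\<^bsub>L\<^esub> (c s \<otimes>\<^bsub>L\<^esub> \<alpha>)"
      using inv al cLs[of 0] Ws(1) by (simp add: L.m_assoc[symmetric] subset_iff)
    then show "\<alpha> \<in> W" using Ws(6)[OF inv(1) caW] by simp
  qed (use ev0 dE in \<open>auto simp del: ev.simps\<close>)
  then show ?thesis unfolding b_def by blast
qed

end

section \<open>Primitive corners consist of scalars\<close>

context split_core begin

lemma char_C:
  assumes "add_pow L n \<one>\<^bsub>L\<^esub> = \<zero>\<^bsub>L\<^esub>" shows "add_pow C (n::nat) \<one>\<^bsub>C\<^esub> = \<zero>\<^bsub>C\<^esub>"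
proof -
  have "add_pow C n \<one>\<^bsub>C\<^esub> = add_pow L n \<one>\<^bsub>L\<^esub> \<odot>\<^bsub>C\<^esub> \<one>\<^bsub>C\<^esub>"
    by (induction n) (simp_all add: M.smult_l_distr)
  then show ?thesis using assms by simp
qed

definition corner :: "'l set \<Rightarrow> 'c \<Rightarrow> 'c set" where
  "corner E e = {x \<in> CE E. e \<otimes>\<^bsub>C\<^esub> x = x \<and> x \<otimes>\<^bsub>C\<^esub> e = x}"

abbreviation corner_ring :: "'l set \<Rightarrow> 'c \<Rightarrow> ('l, 'c, 'w) module_scheme" where
  "corner_ring E e \<equiv> C\<lparr>carrier := corner E e, one := e\<rparr>"

lemma cornerD:
  assumes "x \<in> corner E e"
  shows "x \<in> CE E" "x \<in> carrier C" "e \<otimes>\<^bsub>C\<^esub> x = x" "x \<otimes>\<^bsub>C\<^esub> e = x"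
  using assms CE_carrier by (auto simp: corner_def)

lemma corner_ops:
  assumes E: "fs E" and e: "e \<in> CE E" "e \<otimes>\<^bsub>C\<^esub> e = e"
  shows "e \<in> corner E e" "\<zero>\<^bsub>C\<^esub> \<in> corner E e"
    "\<And>x y. x \<in> corner E e \<Longrightarrow> y \<in> corner E e \<Longrightarrow> x \<oplus>\<^bsub>C\<^esub> y \<in> corner E e"
    "\<And>x. x \<in> corner E e \<Longrightarrow> \<ominus>\<^bsub>C\<^esub> x \<in> corner E e"
    "\<And>x y. x \<in> corner E e \<Longrightarrow> y \<in> corner E e \<Longrightarrow> x \<otimes>\<^bsub>C\<^esub> y \<in> corner E e"
    "\<And>x. x \<in> CE E \<Longrightarrow> e \<otimes>\<^bsub>C\<^esub> x \<otimes>\<^bsub>C\<^esub> e \<in> corner E e"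
proof -
  note ec = CE_carrier[OF e(1)]
  show "e \<in> corner E e" using e by (simp add: corner_def)
  show "\<zero>\<^bsub>C\<^esub> \<in> corner E e" using CE_fs(2)[OF E E] ec by (simp add: corner_def)
  show "x \<oplus>\<^bsub>C\<^esub> y \<in> corner E e" if "x \<in> corner E e" "y \<in> corner E e" for x y
    using cornerD[OF that(1)] cornerD[OF that(2)] ec CE_fs(3)[OF E E] by (simp add: corner_def C.l_distr C.r_distr)
  show "\<ominus>\<^bsub>C\<^esub> x \<in> corner E e" if "x \<in> corner E e" for x
    using cornerD[OF that(1)] ec CE_fs(4)[OF E E] by (simp add: corner_def C.l_minus C.r_minus)
  show "x \<otimes>\<^bsub>C\<^esub> y \<in> corner E e" if "x \<in> corner E e" "y \<in> corner E e" for x y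
    using cornerD[OF that(1)] cornerD[OF that(2)] ec CE_fs(6)[OF E E]
    by (simp add: corner_def C.m_assoc) (simp add: C.m_assoc[symmetric])
  show "e \<otimes>\<^bsub>C\<^esub> x \<otimes>\<^bsub>C\<^esub> e \<in> corner E e" if "x \<in> CE E" for x
    using that CE_carrier[OF that] ec e CE_fs(6)[OF E E]
    by (simp add: corner_def C.m_assoc) (simp add: C.m_assoc[symmetric])
qed

lemma corner_ring:
  assumes E: "fs E" and e: "e \<in> CE E" "e \<otimes>\<^bsub>C\<^esub> e = e"
  shows "ring (corner_ring E e)"
proof -
  note ops = corner_ops[OF assms] and D = cornerD[of _ E e]
  show ?thesis
  proof (intro ringI abelian_groupI monoidI; simp add: ops D C.a_assoc C.m_assoc C.l_distr C.r_distr)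
    show "x \<oplus>\<^bsub>C\<^esub> y = y \<oplus>\<^bsub>C\<^esub> x" if "x \<in> corner E e" "y \<in> corner E e" for x y
      using D that by (simp add: C.a_comm)
    show "\<exists>y\<in>corner E e. y \<oplus>\<^bsub>C\<^esub> x = \<zero>\<^bsub>C\<^esub>" if "x \<in> corner E e" for x
      using ops(4)[OF that] D that by (intro bexI[of _ "\<ominus>\<^bsub>C\<^esub> x"]) (auto simp: C.l_neg)
  qed
qed

text \<open>Positive exponents only: the zeroth power is \<open>e\<close> in the corner and the unit
  in \<open>C\<close>.\<close>

lemma corner_pow:
  assumes "fs E" "e \<in> CE E" "e \<otimes>\<^bsub>C\<^esub> e = e" "x \<in> corner E e" "0 < n"
  shows "x [^]\<^bsub>corner_ring E e\<^esub> (n::nat) = x [^]\<^bsub>C\<^esub> n" "x [^]\<^bsub>C\<^esub> n \<in> corner E e"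
proof -
  note ops = corner_ops[OF assms(1-3)]
  have "x [^]\<^bsub>corner_ring E e\<^esub> Suc m = x [^]\<^bsub>C\<^esub> Suc m \<and> x [^]\<^bsub>C\<^esub> Suc m \<in> corner E e" for m
  proof (induction m)
    case 0 show ?case using assms(4) cornerD[OF assms(4)] by (simp add: nat_pow_def)
  next
    case (Suc m) then show ?case using assms(4) ops(5) by (simp add: nat_pow_def)
  qed
  then show "x [^]\<^bsub>corner_ring E e\<^esub> n = x [^]\<^bsub>C\<^esub> n" "x [^]\<^bsub>C\<^esub> n \<in> corner E e"
    using assms(5) gr0_implies_Suc by metis+
qed

text \<open>The corner is a division ring by \<open>corner_inverse\<close>, and by
  \<open>prime_algebraic\<close> some power \<open>x ^ (p ^ s)\<close> of each element is a multiple
  of \<open>e\<close>, hence central in the corner. These are the hypotheses of Jacobson's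
  argument.\<close>

lemma corner_commute:
  assumes pp: "Factorial_Ring.prime p" "add_pow L p \<one>\<^bsub>L\<^esub> = \<zero>\<^bsub>L\<^esub>" and E: "fs E" and pe: "prim E e"
    and xy: "x \<in> corner E e" "y \<in> corner E e"
  shows "x \<otimes>\<^bsub>C\<^esub> y = y \<otimes>\<^bsub>C\<^esub> x"
proof -
  have e: "e \<in> CE E" "e \<otimes>\<^bsub>C\<^esub> e = e" and en: "e \<noteq> \<zero>\<^bsub>C\<^esub>" using pe by (auto simp: prim_def)
  note ec = CE_carrier[OF e(1)]
  let ?D = "corner_ring E e"
  have "x \<otimes>\<^bsub>?D\<^esub> y = y \<otimes>\<^bsub>?D\<^esub> x"
  proof (rule division_ring_purely_inseparable_commutative[OF corner_ring[OF E e] _ _ pp(1)])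
    show "\<one>\<^bsub>?D\<^esub> \<noteq> \<zero>\<^bsub>?D\<^esub>" using en by simp
    show "\<exists>y\<in>carrier ?D. y \<otimes>\<^bsub>?D\<^esub> x = \<one>\<^bsub>?D\<^esub> \<and> x \<otimes>\<^bsub>?D\<^esub> y = \<one>\<^bsub>?D\<^esub>"
      if "x \<in> carrier ?D" "x \<noteq> \<zero>\<^bsub>?D\<^esub>" for x
    proof -
      have x: "x \<in> corner E e" "x \<noteq> \<zero>\<^bsub>C\<^esub>" using that by auto
      obtain y where "y \<in> CE E" "e \<otimes>\<^bsub>C\<^esub> y = y" "y \<otimes>\<^bsub>C\<^esub> e = y" "y \<otimes>\<^bsub>C\<^esub> x = e" "x \<otimes>\<^bsub>C\<^esub> y = e"
        using corner_inverse[OF E pe pe cornerD(1,3,4)[OF x(1)] x(2)] by blast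
      then show ?thesis by (intro bexI[of _ y]) (auto simp: corner_def)
    qed
    have "add_pow ?D p e = add_pow C p e" by (simp add: add_pow_def nat_pow_def)
    then show "add_pow ?D p \<one>\<^bsub>?D\<^esub> = \<zero>\<^bsub>?D\<^esub>" using C.char_zero_all[OF char_C[OF pp(2)] ec] by simp
    show "\<exists>s. \<forall>y\<in>carrier ?D. x [^]\<^bsub>?D\<^esub> (p ^ s) \<otimes>\<^bsub>?D\<^esub> y = y \<otimes>\<^bsub>?D\<^esub> x [^]\<^bsub>?D\<^esub> (p ^ s)"
      if "x \<in> carrier ?D" for x
    proof -
      have x: "x \<in> corner E e" using that by simp
      obtain s \<alpha> where s: "\<alpha> \<in> carrier L" "x [^]\<^bsub>C\<^esub> (p ^ s) = \<alpha> \<odot>\<^bsub>C\<^esub> e"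
        using prime_algebraic[OF pp(1) E pe cornerD(1,3,4)[OF x]] by blast
      have "x [^]\<^bsub>?D\<^esub> (p ^ s) = \<alpha> \<odot>\<^bsub>C\<^esub> e"
        using corner_pow(1)[OF E e x, of "p ^ s"] s(2) prime_gt_0_nat[OF pp(1)] by simp
      then show ?thesis using s(1) ec cornerD[of _ E e]
        by (intro exI[of _ s]) (auto simp: algC.smult_mult_left algC.smult_mult_right)
    qed
  qed (use xy in auto)
  then show ?thesis by simp
qed

lemma root_of_power:
  assumes pp: "Factorial_Ring.prime p" and c: "c \<in> carrier L"
  obtains \<gamma> where "\<gamma> \<in> carrier L" "\<gamma> [^]\<^bsub>L\<^esub> p = c"
proof -
  have p0: "p \<ge> 1" "p \<noteq> 0" using prime_gt_0_nat[OF pp] by auto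
  define d where "d i = (if i = 0 then \<ominus>\<^bsub>L\<^esub> c else if i = p then \<one>\<^bsub>L\<^esub> else \<zero>\<^bsub>L\<^esub>)" for i
  have dL: "d i \<in> carrier L" for i using c by (simp add: d_def)
  obtain \<gamma> where g: "\<gamma> \<in> carrier L" "evL (map d [0..<Suc p]) \<gamma> = \<zero>\<^bsub>L\<^esub>"
    by (rule root_exists[of "map d [0..<Suc p]"]) (use c p0 in \<open>auto simp: d_def\<close>)
  have "\<zero>\<^bsub>L\<^esub> = (\<Oplus>\<^bsub>L\<^esub>i\<in>{..<Suc p}. d i \<otimes>\<^bsub>L\<^esub> \<gamma> [^]\<^bsub>L\<^esub> i)" using evL_map[OF g(1), of d "Suc p"] dL g(2) by simp
  also have "\<dots> = d p \<otimes>\<^bsub>L\<^esub> \<gamma> [^]\<^bsub>L\<^esub> p \<oplus>\<^bsub>L\<^esub> (\<Oplus>\<^bsub>L\<^esub>i\<in>{..<Suc p}-{p}. d i \<otimes>\<^bsub>L\<^esub> \<gamma> [^]\<^bsub>L\<^esub> i)"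
    by (rule L.finsum_remove) (use g dL in auto)
  also have "(\<Oplus>\<^bsub>L\<^esub>i\<in>{..<Suc p}-{p}. d i \<otimes>\<^bsub>L\<^esub> \<gamma> [^]\<^bsub>L\<^esub> i)
     = d 0 \<otimes>\<^bsub>L\<^esub> \<gamma> [^]\<^bsub>L\<^esub> (0::nat) \<oplus>\<^bsub>L\<^esub> (\<Oplus>\<^bsub>L\<^esub>i\<in>{..<Suc p}-{p}-{0}. d i \<otimes>\<^bsub>L\<^esub> \<gamma> [^]\<^bsub>L\<^esub> i)"
    by (rule L.finsum_remove) (use g dL p0 in auto)
  also have "(\<Oplus>\<^bsub>L\<^esub>i\<in>{..<Suc p}-{p}-{0}. d i \<otimes>\<^bsub>L\<^esub> \<gamma> [^]\<^bsub>L\<^esub> i) = \<zero>\<^bsub>L\<^esub>"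
    by (rule L.finsum_all_zero) (use g in \<open>auto simp: d_def\<close>)
  also have "d p \<otimes>\<^bsub>L\<^esub> \<gamma> [^]\<^bsub>L\<^esub> p \<oplus>\<^bsub>L\<^esub> (d 0 \<otimes>\<^bsub>L\<^esub> \<gamma> [^]\<^bsub>L\<^esub> (0::nat) \<oplus>\<^bsub>L\<^esub> \<zero>\<^bsub>L\<^esub>) = \<gamma> [^]\<^bsub>L\<^esub> p \<oplus>\<^bsub>L\<^esub> \<ominus>\<^bsub>L\<^esub> c"
    using g(1) c p0 by (simp add: d_def)
  finally have "\<gamma> [^]\<^bsub>L\<^esub> p \<oplus>\<^bsub>L\<^esub> \<ominus>\<^bsub>L\<^esub> c = \<zero>\<^bsub>L\<^esub>" by (rule sym)
  then have "\<gamma> [^]\<^bsub>L\<^esub> p = c" by (rule L.diff_zero_imp_eq) (use g(1) c in simp_all)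
  then show ?thesis using that g by blast
qed

text \<open>In prime characteristic some power \<open>x ^ (p ^ s)\<close> is a scalar, and
  \<open>s\<close> is lowered to \<open>0\<close> by extracting one \<open>p\<close>-th root at a
  time. The scalar found lies in \<open>L\<close>; it is rational over \<open>E\<close> because
  \<open>x\<close> has coordinates in \<open>E\<close>.\<close>

lemma corner_scalar:
  assumes E: "fs E" and pe: "prim E e" and x: "x \<in> corner E e"
  shows "\<exists>\<alpha>\<in>E. x = \<alpha> \<odot>\<^bsub>C\<^esub> e"
proof -
  have e: "e \<in> CE E" "e \<otimes>\<^bsub>C\<^esub> e = e" and en: "e \<noteq> \<zero>\<^bsub>C\<^esub>" using pe by (auto simp: prim_def)
  note ec = CE_carrier[OF e(1)]
  have rat: "\<alpha> \<in> E" if "\<alpha> \<in> carrier L" "y = \<alpha> \<odot>\<^bsub>C\<^esub> e" "y \<in> corner E e" for y \<alpha>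
    using scalar_rational[OF E e(1) en] that cornerD(1) by blast
  show ?thesis
  proof (cases "p = 1")
    case True
    then show ?thesis using char_one_algebraic[OF _ E pe cornerD(1,3,4)[OF x]] rat x by blast
  next
    case False
    then have pp: "Factorial_Ring.prime p" "add_pow L p \<one>\<^bsub>L\<^esub> = \<zero>\<^bsub>L\<^esub>" using p by auto
    have p0: "p > 0" using prime_gt_0_nat[OF pp(1)] .
    have charC: "add_pow C p \<one>\<^bsub>C\<^esub> = \<zero>\<^bsub>C\<^esub>" by (rule char_C[OF pp(2)])
    text \<open>A \<open>p\<close>-th root of a scalar in the corner is a scalar, as the algebra over \<open>L\<close> would
      otherwise have a nilpotent element that is central in its corner.\<close>
    have step: "\<exists>\<alpha>\<in>carrier L. a = \<alpha> \<odot>\<^bsub>C\<^esub> e"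
      if a: "a \<in> corner E e" and c: "c \<in> carrier L" and ap: "a [^]\<^bsub>C\<^esub> p = c \<odot>\<^bsub>C\<^esub> e" for a c
    proof -
      note aD = cornerD[OF a]
      obtain \<gamma> where g: "\<gamma> \<in> carrier L" "\<gamma> [^]\<^bsub>L\<^esub> p = c" using root_of_power[OF pp(1) c] by blast
      define z where "z = a \<ominus>\<^bsub>C\<^esub> \<gamma> \<odot>\<^bsub>C\<^esub> e"
      have zc: "z \<in> carrier C" using aD g ec by (simp add: z_def)
      have ez: "e \<otimes>\<^bsub>C\<^esub> z = z" "z \<otimes>\<^bsub>C\<^esub> e = z"
        using aD g ec e by (simp_all add: z_def a_minus_def C.l_distr C.r_distr C.l_minus C.r_minus
            algC.smult_mult_left algC.smult_mult_right)
      have gpow: "(\<gamma> \<odot>\<^bsub>C\<^esub> e) [^]\<^bsub>C\<^esub> Suc n = \<gamma> [^]\<^bsub>L\<^esub> Suc n \<odot>\<^bsub>C\<^esub> e" for n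
      proof (induction n)
        case (Suc n)
        have "(\<gamma> \<odot>\<^bsub>C\<^esub> e) [^]\<^bsub>C\<^esub> Suc (Suc n) = (\<gamma> [^]\<^bsub>L\<^esub> Suc n \<odot>\<^bsub>C\<^esub> e) \<otimes>\<^bsub>C\<^esub> (\<gamma> \<odot>\<^bsub>C\<^esub> e)" using Suc by simp
        also have "\<dots> = \<gamma> [^]\<^bsub>L\<^esub> Suc n \<odot>\<^bsub>C\<^esub> (\<gamma> \<odot>\<^bsub>C\<^esub> e)"
          by (subst algC.smult_mult_left) (use g ec e in \<open>simp_all add: algC.smult_mult_right\<close>)
        also have "\<dots> = \<gamma> [^]\<^bsub>L\<^esub> Suc (Suc n) \<odot>\<^bsub>C\<^esub> e" using g ec by (simp add: M.smult_assoc1)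
        finally show ?case .
      qed (use g ec in simp)
      have gp: "(\<gamma> \<odot>\<^bsub>C\<^esub> e) [^]\<^bsub>C\<^esub> p = c \<odot>\<^bsub>C\<^esub> e"
        using gpow[of "p - 1"] p0 g by simp
      have "(z \<oplus>\<^bsub>C\<^esub> \<gamma> \<odot>\<^bsub>C\<^esub> e) [^]\<^bsub>C\<^esub> p = z [^]\<^bsub>C\<^esub> p \<oplus>\<^bsub>C\<^esub> (\<gamma> \<odot>\<^bsub>C\<^esub> e) [^]\<^bsub>C\<^esub> p"
        by (rule C.freshman_dream[OF zc _ _ pp(1) charC])
           (use g ec zc ez in \<open>auto simp: algC.smult_mult_left algC.smult_mult_right\<close>)
      moreover have "z \<oplus>\<^bsub>C\<^esub> \<gamma> \<odot>\<^bsub>C\<^esub> e = a"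
        using aD g ec by (simp add: z_def a_minus_def C.a_assoc C.l_neg)
      ultimately have "c \<odot>\<^bsub>C\<^esub> e = z [^]\<^bsub>C\<^esub> p \<oplus>\<^bsub>C\<^esub> c \<odot>\<^bsub>C\<^esub> e" using ap gp by simp
      then have zp: "z [^]\<^bsub>C\<^esub> p = \<zero>\<^bsub>C\<^esub>"
        using C.add_left_imp_zero[of "c \<odot>\<^bsub>C\<^esub> e" "z [^]\<^bsub>C\<^esub> p"] zc c ec by simp
      \<comment> \<open>Regularity is used over \<open>L\<close> here, as \<gamma> need not lie in
        \<open>E\<close>. The element \<open>w\<close> is a quasi-inverse of \<open>z\<close> cut
        down to the corner.\<close>
      obtain r where r: "r \<in> carrier C" "z \<otimes>\<^bsub>C\<^esub> r \<otimes>\<^bsub>C\<^esub> z = z"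
        using regular[of "carrier L" z] zc h_closed by auto
      define w where "w = e \<otimes>\<^bsub>C\<^esub> r \<otimes>\<^bsub>C\<^esub> e"
      have wc: "w \<in> carrier C" using r ec by (simp add: w_def)
      have ew: "e \<otimes>\<^bsub>C\<^esub> w = w" "w \<otimes>\<^bsub>C\<^esub> e = w"
        using r ec e by (simp_all add: w_def C.m_assoc) (simp add: C.m_assoc[symmetric])
      have zwz: "z \<otimes>\<^bsub>C\<^esub> w \<otimes>\<^bsub>C\<^esub> z = z"
      proof -
        have "z \<otimes>\<^bsub>C\<^esub> w \<otimes>\<^bsub>C\<^esub> z = (z \<otimes>\<^bsub>C\<^esub> e) \<otimes>\<^bsub>C\<^esub> r \<otimes>\<^bsub>C\<^esub> (e \<otimes>\<^bsub>C\<^esub> z)" using zc r ec by (simp add: w_def C.m_assoc)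
        then show ?thesis using ez r by simp
      qed
      have aw: "a \<otimes>\<^bsub>C\<^esub> w = w \<otimes>\<^bsub>C\<^esub> a"
      proof -
        \<comment> \<open>\<open>w\<close> has coordinates in \<open>L\<close>, so
          \<open>corner_commute\<close> does not apply to it directly. But it is an
          \<open>L\<close>-combination of the elements \<open>t b\<close>, which have coordinates in
          \<open>E\<close> and commute with \<open>a\<close>.\<close>
        define t where "t b = e \<otimes>\<^bsub>C\<^esub> v b \<otimes>\<^bsub>C\<^esub> e" for b
        have tD: "t b \<in> corner E e" if "b \<in> B" for b
          unfolding t_def using corner_ops(6)[OF E e] CE_fs(8)[OF E E] that by blast
        have tc: "t b \<in> carrier C" if "b \<in> B" for b using cornerD(2)[OF tD[OF that]] .
        have hr: "h b r \<in> carrier L" if "b \<in> B" for b using h_closed[OF that r(1)] .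
        have "w = e \<otimes>\<^bsub>C\<^esub> (\<Oplus>\<^bsub>C\<^esub>b\<in>B. h b r \<odot>\<^bsub>C\<^esub> v b) \<otimes>\<^bsub>C\<^esub> e" by (simp add: w_def expand[OF r(1)])
        also have "e \<otimes>\<^bsub>C\<^esub> (\<Oplus>\<^bsub>C\<^esub>b\<in>B. h b r \<odot>\<^bsub>C\<^esub> v b) = (\<Oplus>\<^bsub>C\<^esub>b\<in>B. e \<otimes>\<^bsub>C\<^esub> (h b r \<odot>\<^bsub>C\<^esub> v b))"
          by (rule C.finsum_rdistr[OF finB ec]) (use hr v_closed in auto)
        also have "\<dots> \<otimes>\<^bsub>C\<^esub> e = (\<Oplus>\<^bsub>C\<^esub>b\<in>B. e \<otimes>\<^bsub>C\<^esub> (h b r \<odot>\<^bsub>C\<^esub> v b) \<otimes>\<^bsub>C\<^esub> e)"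
          by (rule C.finsum_ldistr[OF finB ec]) (use hr v_closed ec in auto)
        also have "\<dots> = (\<Oplus>\<^bsub>C\<^esub>b\<in>B. h b r \<odot>\<^bsub>C\<^esub> t b)"
          by (rule C.finsum_cong') (use hr v_closed ec tc in \<open>auto simp: t_def algC.smult_mult_left algC.smult_mult_right\<close>)
        finally have w: "w = (\<Oplus>\<^bsub>C\<^esub>b\<in>B. h b r \<odot>\<^bsub>C\<^esub> t b)" .
        have "a \<otimes>\<^bsub>C\<^esub> w = (\<Oplus>\<^bsub>C\<^esub>b\<in>B. a \<otimes>\<^bsub>C\<^esub> (h b r \<odot>\<^bsub>C\<^esub> t b))"
          unfolding w by (rule C.finsum_rdistr[OF finB aD(2)]) (use hr tc in auto)
        also have "\<dots> = (\<Oplus>\<^bsub>C\<^esub>b\<in>B. (h b r \<odot>\<^bsub>C\<^esub> t b) \<otimes>\<^bsub>C\<^esub> a)"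
          by (rule C.finsum_cong') (use hr tc aD corner_commute[OF pp E pe a tD] in
             \<open>auto simp: algC.smult_mult_left algC.smult_mult_right\<close>)
        also have "\<dots> = w \<otimes>\<^bsub>C\<^esub> a"
          unfolding w by (rule C.finsum_ldistr[OF finB aD(2), symmetric]) (use hr tc in auto)
        finally show ?thesis .
      qed
      have zw: "z \<otimes>\<^bsub>C\<^esub> w = w \<otimes>\<^bsub>C\<^esub> z"
        using aw aD g ec wc ew by (simp add: z_def a_minus_def C.l_distr C.r_distr C.l_minus C.r_minus
            algC.smult_mult_left algC.smult_mult_right)
      \<comment> \<open>Since \<open>z\<close> commutes with its quasi-inverse,
        \<open>z = w z z\<close> can be iterated, and for \<open>n = p - 1\<close> the factor
        \<open>z ^ p = 0\<close> appears.\<close>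
      have "z = w [^]\<^bsub>C\<^esub> n \<otimes>\<^bsub>C\<^esub> z [^]\<^bsub>C\<^esub> Suc n" for n
      proof (induction n)
        case (Suc n)
        have wzz: "w \<otimes>\<^bsub>C\<^esub> (z \<otimes>\<^bsub>C\<^esub> z) = z" using zwz zw zc wc by (simp add: C.m_assoc)
        have zz: "z [^]\<^bsub>C\<^esub> Suc n = z \<otimes>\<^bsub>C\<^esub> z [^]\<^bsub>C\<^esub> n" by (rule C.nat_pow_Suc2[OF zc])
        have "z = w [^]\<^bsub>C\<^esub> n \<otimes>\<^bsub>C\<^esub> (w \<otimes>\<^bsub>C\<^esub> (z \<otimes>\<^bsub>C\<^esub> z) \<otimes>\<^bsub>C\<^esub> z [^]\<^bsub>C\<^esub> n)"
          unfolding wzz using Suc zz by simp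
        also have "\<dots> = w [^]\<^bsub>C\<^esub> Suc n \<otimes>\<^bsub>C\<^esub> (z \<otimes>\<^bsub>C\<^esub> (z \<otimes>\<^bsub>C\<^esub> z [^]\<^bsub>C\<^esub> n))" using zc wc by (simp add: C.m_assoc)
        also have "z \<otimes>\<^bsub>C\<^esub> (z \<otimes>\<^bsub>C\<^esub> z [^]\<^bsub>C\<^esub> n) = z [^]\<^bsub>C\<^esub> Suc (Suc n)"
          using C.nat_pow_Suc2[OF zc, of "Suc n"] zz by simp
        finally show ?case .
      qed (use zc wc in simp)
      from this[of "p - 1"] have "z = \<zero>\<^bsub>C\<^esub>" using zp p0 wc by simp
      then have "a = \<gamma> \<odot>\<^bsub>C\<^esub> e"
        using C.diff_zero_imp_eq[of a "\<gamma> \<odot>\<^bsub>C\<^esub> e"] aD g ec by (simp add: z_def a_minus_def)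
      then show ?thesis using g by blast
    qed
    have down: "\<exists>\<alpha>\<in>carrier L. x = \<alpha> \<odot>\<^bsub>C\<^esub> e" if "\<alpha> \<in> carrier L" "x [^]\<^bsub>C\<^esub> (p ^ s) = \<alpha> \<odot>\<^bsub>C\<^esub> e" for s \<alpha>
      using that
    proof (induction s arbitrary: \<alpha>)
      case 0 then show ?case using cornerD(2)[OF x] by auto
    next
      case (Suc s)
      have "(x [^]\<^bsub>C\<^esub> (p ^ s)) [^]\<^bsub>C\<^esub> p = \<alpha> \<odot>\<^bsub>C\<^esub> e"
        using Suc.prems cornerD(2)[OF x] by (simp add: C.nat_pow_pow mult.commute)
      then obtain \<beta> where "\<beta> \<in> carrier L" "x [^]\<^bsub>C\<^esub> (p ^ s) = \<beta> \<odot>\<^bsub>C\<^esub> e"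
        using step[OF corner_pow(2)[OF E e x, of "p ^ s"] Suc.prems(1)] p0 by auto
      then show ?case by (rule Suc.IH)
    qed
    obtain s \<alpha> where "\<alpha> \<in> carrier L" "x [^]\<^bsub>C\<^esub> (p ^ s) = \<alpha> \<odot>\<^bsub>C\<^esub> e"
      using prime_algebraic[OF pp(1) E pe cornerD(1,3,4)[OF x]] by blast
    then show ?thesis using down rat x by blast
  qed
qed

end

section \<open>Complete systems of primitive idempotents and matrix units\<close>

context split_core begin

definition decomp :: "'l set \<Rightarrow> nat \<Rightarrow> (nat \<Rightarrow> 'c) \<Rightarrow> bool" where
  "decomp E N es \<longleftrightarrow> fs E \<and> (\<forall>i<N. es i \<in> CE E \<and> es i \<otimes>\<^bsub>C\<^esub> es i = es i \<and> es i \<noteq> \<zero>\<^bsub>C\<^esub>) \<and>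
    (\<forall>i<N. \<forall>j<N. i \<noteq> j \<longrightarrow> es i \<otimes>\<^bsub>C\<^esub> es j = \<zero>\<^bsub>C\<^esub>) \<and> (\<Oplus>\<^bsub>C\<^esub>i\<in>{..<N}. es i) = \<one>\<^bsub>C\<^esub>"

text \<open>Multiplying a linear relation by \<open>es j\<close> isolates its \<open>j\<close>-th
  coefficient, so orthogonal nonzero idempotents are independent over \<open>E\<close>, and there
  are no more of them than coordinates.\<close>

lemma decomp_bound:
  assumes "decomp E N es" shows "N \<le> card B"
proof (rule ccontr)
  assume n: "\<not> N \<le> card B"
  have E: "fs E" and eE: "\<And>i. i < N \<Longrightarrow> es i \<in> CE E" and ei: "\<And>i. i < N \<Longrightarrow> es i \<otimes>\<^bsub>C\<^esub> es i = es i"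
    and en: "\<And>i. i < N \<Longrightarrow> es i \<noteq> \<zero>\<^bsub>C\<^esub>" and eo: "\<And>i j. i < N \<Longrightarrow> j < N \<Longrightarrow> i \<noteq> j \<Longrightarrow> es i \<otimes>\<^bsub>C\<^esub> es j = \<zero>\<^bsub>C\<^esub>"
    using assms by (auto simp: decomp_def)
  note ec = CE_carrier[OF eE]
  obtain c where c: "\<And>i. i \<in> {..<N} \<Longrightarrow> c i \<in> E" "\<exists>i\<in>{..<N}. c i \<noteq> \<zero>\<^bsub>L\<^esub>"
     and cz: "(\<Oplus>\<^bsub>C\<^esub>i\<in>{..<N}. c i \<odot>\<^bsub>C\<^esub> es i) = \<zero>\<^bsub>C\<^esub>"
    using dependent[OF E, of "{..<N}" es] n eE by auto
  have cL: "c i \<in> carrier L" if "i < N" for i using c(1)[of i] that fsD(4)[OF E] by auto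
  have "c j = \<zero>\<^bsub>L\<^esub>" if j: "j < N" for j
  proof -
    have "(\<Oplus>\<^bsub>C\<^esub>i\<in>{..<N}. (c i \<odot>\<^bsub>C\<^esub> es i) \<otimes>\<^bsub>C\<^esub> es j) = (\<Oplus>\<^bsub>C\<^esub>i\<in>{..<N}. c i \<odot>\<^bsub>C\<^esub> es i) \<otimes>\<^bsub>C\<^esub> es j"
      by (rule C.finsum_ldistr[symmetric]) (use cL ec j in auto)
    then have z: "(\<Oplus>\<^bsub>C\<^esub>i\<in>{..<N}. (c i \<odot>\<^bsub>C\<^esub> es i) \<otimes>\<^bsub>C\<^esub> es j) = \<zero>\<^bsub>C\<^esub>" using cz ec[OF j] by simp
    have "(\<Oplus>\<^bsub>C\<^esub>i\<in>{..<N}. (c i \<odot>\<^bsub>C\<^esub> es i) \<otimes>\<^bsub>C\<^esub> es j)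
       = (c j \<odot>\<^bsub>C\<^esub> es j) \<otimes>\<^bsub>C\<^esub> es j \<oplus>\<^bsub>C\<^esub> (\<Oplus>\<^bsub>C\<^esub>i\<in>{..<N}-{j}. (c i \<odot>\<^bsub>C\<^esub> es i) \<otimes>\<^bsub>C\<^esub> es j)"
      by (rule C.finsum_remove) (use cL ec j in auto)
    also have "(\<Oplus>\<^bsub>C\<^esub>i\<in>{..<N}-{j}. (c i \<odot>\<^bsub>C\<^esub> es i) \<otimes>\<^bsub>C\<^esub> es j) = \<zero>\<^bsub>C\<^esub>"
      by (rule C.finsum_all_zero) (use cL ec j eo in \<open>auto simp: algC.smult_mult_left\<close>)
    finally have "c j \<odot>\<^bsub>C\<^esub> es j = \<zero>\<^bsub>C\<^esub>" unfolding z using cL j ec ei by (simp add: algC.smult_mult_left)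
    then show ?thesis using smult_eq_zero cL j ec en by blast
  qed
  then show False using c(2) by auto
qed

text \<open>An idempotent \<open>f\<close> strictly below \<open>es i\<close> splits it into the
  orthogonal pair of \<open>f\<close> and the difference; the latter is stored at the new index
  \<open>N\<close>.\<close>

lemma refine_decomp:
  assumes d: "decomp E N es" and i: "i < N" and F: "fs F" "E \<subseteq> F" and f: "f \<in> CE F" "f \<otimes>\<^bsub>C\<^esub> f = f"
    "es i \<otimes>\<^bsub>C\<^esub> f = f" "f \<otimes>\<^bsub>C\<^esub> es i = f" "f \<noteq> \<zero>\<^bsub>C\<^esub>" "f \<noteq> es i"
  shows "decomp F (Suc N) (es(i := f, N := es i \<ominus>\<^bsub>C\<^esub> f))"
proof -
  have eE: "\<And>i. i < N \<Longrightarrow> es i \<in> CE E" and ei: "\<And>i. i < N \<Longrightarrow> es i \<otimes>\<^bsub>C\<^esub> es i = es i"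
    and en: "\<And>i. i < N \<Longrightarrow> es i \<noteq> \<zero>\<^bsub>C\<^esub>" and eo: "\<And>i j. i < N \<Longrightarrow> j < N \<Longrightarrow> i \<noteq> j \<Longrightarrow> es i \<otimes>\<^bsub>C\<^esub> es j = \<zero>\<^bsub>C\<^esub>"
    and es: "(\<Oplus>\<^bsub>C\<^esub>i\<in>{..<N}. es i) = \<one>\<^bsub>C\<^esub>"
    using d by (auto simp: decomp_def)
  note ec = CE_carrier[OF eE] and fc = CE_carrier[OF f(1)]
  have eF: "es j \<in> CE F" if "j < N" for j using eE[OF that] CE_mono[OF F(2)] by blast
  let ?g = "es i \<ominus>\<^bsub>C\<^esub> f"
  have gF: "?g \<in> CE F" by (rule CE_fs(5)[OF F(1) F(1) eF[OF i] f(1)])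
  note gc = CE_carrier[OF gF]
  have gg: "?g \<otimes>\<^bsub>C\<^esub> ?g = ?g" and fg: "f \<otimes>\<^bsub>C\<^esub> ?g = \<zero>\<^bsub>C\<^esub>" and gf: "?g \<otimes>\<^bsub>C\<^esub> f = \<zero>\<^bsub>C\<^esub>"
    using ec[OF i] fc f ei[OF i] by (simp_all add: a_minus_def C.l_distr C.r_distr C.l_minus C.r_minus C.r_neg C.l_neg)
  have gn: "?g \<noteq> \<zero>\<^bsub>C\<^esub>" using C.diff_zero_imp_eq[of "es i" f] ec[OF i] fc f(6) by (auto simp: a_minus_def)
  have fe: "f \<otimes>\<^bsub>C\<^esub> es j = \<zero>\<^bsub>C\<^esub>" "es j \<otimes>\<^bsub>C\<^esub> f = \<zero>\<^bsub>C\<^esub>" if "j < N" "j \<noteq> i" for j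
  proof -
    have "f \<otimes>\<^bsub>C\<^esub> es j = f \<otimes>\<^bsub>C\<^esub> (es i \<otimes>\<^bsub>C\<^esub> es j)" using f(4) fc ec i that by (simp add: C.m_assoc[symmetric])
    then show "f \<otimes>\<^bsub>C\<^esub> es j = \<zero>\<^bsub>C\<^esub>" using eo i that fc by simp
    have "es j \<otimes>\<^bsub>C\<^esub> f = (es j \<otimes>\<^bsub>C\<^esub> es i) \<otimes>\<^bsub>C\<^esub> f" using f(3) fc ec i that by (simp add: C.m_assoc)
    then show "es j \<otimes>\<^bsub>C\<^esub> f = \<zero>\<^bsub>C\<^esub>" using eo i that fc by simp
  qed
  have ge: "?g \<otimes>\<^bsub>C\<^esub> es j = \<zero>\<^bsub>C\<^esub>" "es j \<otimes>\<^bsub>C\<^esub> ?g = \<zero>\<^bsub>C\<^esub>" if "j < N" "j \<noteq> i" for j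
    using fe[OF that] eo[of i j] eo[of j i] i that ec fc
    by (simp_all add: a_minus_def C.l_distr C.r_distr C.l_minus C.r_minus)
  let ?es = "es(i := f, N := ?g)"
  have "(\<Oplus>\<^bsub>C\<^esub>j\<in>{..<Suc N}. ?es j) = ?g \<oplus>\<^bsub>C\<^esub> (\<Oplus>\<^bsub>C\<^esub>j\<in>{..<N}. ?es j)"
    unfolding lessThan_Suc by (subst C.finsum_insert) (use fc gc ec i in auto)
  also have "(\<Oplus>\<^bsub>C\<^esub>j\<in>{..<N}. ?es j) = ?es i \<oplus>\<^bsub>C\<^esub> (\<Oplus>\<^bsub>C\<^esub>j\<in>{..<N}-{i}. ?es j)"
    by (rule C.finsum_remove) (use fc gc ec i in auto)
  also have "(\<Oplus>\<^bsub>C\<^esub>j\<in>{..<N}-{i}. ?es j) = (\<Oplus>\<^bsub>C\<^esub>j\<in>{..<N}-{i}. es j)"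
    by (rule C.finsum_cong') (use ec in auto)
  also have "?es i = f" using i by simp
  also have "?g \<oplus>\<^bsub>C\<^esub> (f \<oplus>\<^bsub>C\<^esub> (\<Oplus>\<^bsub>C\<^esub>j\<in>{..<N}-{i}. es j)) = es i \<oplus>\<^bsub>C\<^esub> (\<Oplus>\<^bsub>C\<^esub>j\<in>{..<N}-{i}. es j)"
  proof -
    have "(\<Oplus>\<^bsub>C\<^esub>j\<in>{..<N}-{i}. es j) \<in> carrier C" using ec by auto
    moreover have "?g \<oplus>\<^bsub>C\<^esub> f = es i" using ec[OF i] fc by (simp add: a_minus_def C.a_assoc C.l_neg)
    ultimately show ?thesis using gc fc by (simp add: C.a_assoc[symmetric])
  qed
  also have "\<dots> = (\<Oplus>\<^bsub>C\<^esub>j\<in>{..<N}. es j)" by (rule C.finsum_remove[symmetric]) (use ec i in auto)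
  finally have sum: "(\<Oplus>\<^bsub>C\<^esub>j\<in>{..<Suc N}. ?es j) = \<one>\<^bsub>C\<^esub>" unfolding es .
  have orth: "?es a \<otimes>\<^bsub>C\<^esub> ?es b = \<zero>\<^bsub>C\<^esub>" if "a < Suc N" "b < Suc N" "a \<noteq> b" for a b
    using that i eo fe ge fg gf by (auto simp: less_Suc_eq)
  have el: "?es a \<in> CE F \<and> ?es a \<otimes>\<^bsub>C\<^esub> ?es a = ?es a \<and> ?es a \<noteq> \<zero>\<^bsub>C\<^esub>" if "a < Suc N" for a
    using that i eF ei en f gF gg gn by (auto simp: less_Suc_eq)
  show ?thesis unfolding decomp_def using F(1) el orth sum by blast
qed

text \<open>Take the largest \<open>N\<close> over all admissible \<open>E\<close> at once. If some
  \<open>es i\<close> split over a larger \<open>F\<close>, the refined system over \<open>F\<close>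
  would have \<open>N + 1\<close> members; this is why \<open>prim\<close> can quantify over
  extensions.\<close>

lemma exists_decomp:
  obtains E N es where "decomp E N es" "0 < N" "\<And>i. i < N \<Longrightarrow> prim E (es i)"
proof -
  define T where "T = {N. \<exists>E es. decomp E N es}"
  have "decomp k\<^sub>0 1 (\<lambda>_. \<one>\<^bsub>C\<^esub>)"
    using fs_k0 CE_fs(1)[OF fs_k0 fs_k0] nontriv by (simp add: decomp_def lessThan_Suc)
  then have T1: "1 \<in> T" by (auto simp: T_def)
  have Tfin: "finite T" by (rule finite_subset[of _ "{..card B}"]) (auto simp: T_def dest: decomp_bound)
  define N where "N = Max T"
  have "N \<in> T" unfolding N_def using Max_in[OF Tfin] T1 by blast
  then obtain E es where d: "decomp E N es" by (auto simp: T_def)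
  have N0: "0 < N" using Max_ge[OF Tfin T1] by (simp add: N_def)
  have "prim E (es i)" if i: "i < N" for i
    unfolding prim_def
  proof (intro conjI allI impI)
    show "es i \<in> CE E" "es i \<otimes>\<^bsub>C\<^esub> es i = es i" "es i \<noteq> \<zero>\<^bsub>C\<^esub>" using d i by (auto simp: decomp_def)
    fix F f assume F: "fs F \<and> E \<subseteq> F \<and> f \<in> CE F \<and> f \<otimes>\<^bsub>C\<^esub> f = f \<and> es i \<otimes>\<^bsub>C\<^esub> f = f \<and> f \<otimes>\<^bsub>C\<^esub> es i = f"
    show "f = \<zero>\<^bsub>C\<^esub> \<or> f = es i"
    proof (rule ccontr)
      assume "\<not> (f = \<zero>\<^bsub>C\<^esub> \<or> f = es i)"
      then have "decomp F (Suc N) (es(i := f, N := es i \<ominus>\<^bsub>C\<^esub> f))"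
        using refine_decomp[OF d i] F by auto
      then have "Suc N \<in> T" by (auto simp: T_def)
      then show False using Max_ge[OF Tfin, of "Suc N"] by (simp add: N_def)
    qed
  qed
  then show ?thesis using that d N0 by blast
qed

text \<open>Two of the primitive idempotents belong to the same matrix block if there are mutually
  inverse elements between them. Connecting every idempotent with the representative of its class
  produces the matrix units, and the corner of the representative, which consists of
  \<open>E\<close>-multiples of its unit, supplies the coefficients.\<close>

theorem matrix_units_exist:
  obtains E and r :: nat and m :: "nat \<Rightarrow> nat" and w where "fs E" "0 < r" "\<And>l. l < r \<Longrightarrow> 0 < m l"
    "\<And>l i j. l < r \<Longrightarrow> i < m l \<Longrightarrow> j < m l \<Longrightarrow> w l i j \<in> CE E"
    "\<And>l i. l < r \<Longrightarrow> i < m l \<Longrightarrow> w l i i \<noteq> \<zero>\<^bsub>C\<^esub>"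
    "\<And>l i j l' i' j'. l < r \<Longrightarrow> i < m l \<Longrightarrow> j < m l \<Longrightarrow> l' < r \<Longrightarrow> i' < m l' \<Longrightarrow> j' < m l' \<Longrightarrow>
       w l i j \<otimes>\<^bsub>C\<^esub> w l' i' j' = (if l = l' \<and> j = i' then w l i j' else \<zero>\<^bsub>C\<^esub>)"
    "(\<Oplus>\<^bsub>C\<^esub>l\<in>{..<r}. \<Oplus>\<^bsub>C\<^esub>i\<in>{..<m l}. w l i i) = \<one>\<^bsub>C\<^esub>"
    "\<And>x l i j. x \<in> CE E \<Longrightarrow> l < r \<Longrightarrow> i < m l \<Longrightarrow> j < m l \<Longrightarrow> \<exists>c\<in>E. w l i i \<otimes>\<^bsub>C\<^esub> x \<otimes>\<^bsub>C\<^esub> w l j j = c \<odot>\<^bsub>C\<^esub> w l i j"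
    "\<And>x l i l' j. x \<in> CE E \<Longrightarrow> l < r \<Longrightarrow> i < m l \<Longrightarrow> l' < r \<Longrightarrow> j < m l' \<Longrightarrow> l \<noteq> l' \<Longrightarrow>
       w l i i \<otimes>\<^bsub>C\<^esub> x \<otimes>\<^bsub>C\<^esub> w l' j j = \<zero>\<^bsub>C\<^esub>"
proof -
  obtain E N e where d: "decomp E N e" and N0: "0 < N" and pr: "\<And>i. i < N \<Longrightarrow> prim E (e i)"
    using exists_decomp by blast
  have E: "fs E" and eE: "\<And>i. i < N \<Longrightarrow> e i \<in> CE E" and ei: "\<And>i. i < N \<Longrightarrow> e i \<otimes>\<^bsub>C\<^esub> e i = e i"
    and en: "\<And>i. i < N \<Longrightarrow> e i \<noteq> \<zero>\<^bsub>C\<^esub>" and eo: "\<And>i j. i < N \<Longrightarrow> j < N \<Longrightarrow> i \<noteq> j \<Longrightarrow> e i \<otimes>\<^bsub>C\<^esub> e j = \<zero>\<^bsub>C\<^esub>"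
    and esum: "(\<Oplus>\<^bsub>C\<^esub>i\<in>{..<N}. e i) = \<one>\<^bsub>C\<^esub>"
    using d by (auto simp: decomp_def)
  note ec = CE_carrier[OF eE] and mE = CE_fs(6)[OF E E]
  \<comment> \<open>\<open>x\<close> and \<open>y\<close> are mutually inverse between
    \<open>e i\<close> and \<open>e j\<close>; they amount to an isomorphism of the modules
    generated by the two idempotents.\<close>
  define link where "link i j x y \<longleftrightarrow> x \<in> CE E \<and> y \<in> CE E \<and> e i \<otimes>\<^bsub>C\<^esub> x = x \<and> x \<otimes>\<^bsub>C\<^esub> e j = x \<and>
      e j \<otimes>\<^bsub>C\<^esub> y = y \<and> y \<otimes>\<^bsub>C\<^esub> e i = y \<and> y \<otimes>\<^bsub>C\<^esub> x = e j \<and> x \<otimes>\<^bsub>C\<^esub> y = e i" for i j x y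
  define R where "R i j \<longleftrightarrow> (\<exists>x y. link i j x y)" for i j
  have Rrefl: "R i i" if "i < N" for i
    unfolding R_def link_def using eE[OF that] ei[OF that] by blast
  have Rsym: "R j i" if "R i j" for i j using that unfolding R_def link_def by blast
  have Rtrans: "R i l" if asm: "R i j" "R j l" "i < N" "j < N" "l < N" for i j l
  proof -
    obtain x y x' y' where a: "link i j x y" "link j l x' y'" using asm(1,2) by (auto simp: R_def)
    have c: "x \<in> carrier C" "y \<in> carrier C" "x' \<in> carrier C" "y' \<in> carrier C"
      using a CE_carrier by (auto simp: link_def)
    note ecs = ec[OF that(3)] ec[OF that(4)] ec[OF that(5)]
    have 1: "(y' \<otimes>\<^bsub>C\<^esub> y) \<otimes>\<^bsub>C\<^esub> (x \<otimes>\<^bsub>C\<^esub> x') = y' \<otimes>\<^bsub>C\<^esub> ((y \<otimes>\<^bsub>C\<^esub> x) \<otimes>\<^bsub>C\<^esub> x')" using c by (simp add: C.m_assoc)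
    have 2: "(x \<otimes>\<^bsub>C\<^esub> x') \<otimes>\<^bsub>C\<^esub> (y' \<otimes>\<^bsub>C\<^esub> y) = x \<otimes>\<^bsub>C\<^esub> ((x' \<otimes>\<^bsub>C\<^esub> y') \<otimes>\<^bsub>C\<^esub> y)" using c by (simp add: C.m_assoc)
    have "link i l (x \<otimes>\<^bsub>C\<^esub> x') (y' \<otimes>\<^bsub>C\<^esub> y)"
      unfolding link_def 1 2 using a c ecs mE
      by (simp add: link_def) (simp add: C.m_assoc[symmetric] C.m_assoc)
    then show ?thesis unfolding R_def by blast
  qed
  define rep where "rep i = (LEAST j. j < N \<and> R j i)" for i
  have rep: "rep i < N \<and> R (rep i) i" if "i < N" for i
    unfolding rep_def by (rule LeastI[of _ i]) (use that Rrefl in auto)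
  have repeq: "rep i = rep j" if "R i j" "i < N" "j < N" for i j
  proof -
    have "(\<lambda>l. l < N \<and> R l i) = (\<lambda>l. l < N \<and> R l j)" using that Rtrans Rsym by blast
    then show ?thesis by (simp add: rep_def)
  qed
  have eqrep: "R i j" if "rep i = rep j" "i < N" "j < N" for i j
    using rep[OF that(2)] rep[OF that(3)] that Rtrans Rsym by metis
  have "\<forall>i. \<exists>x y. i < N \<longrightarrow> link i (rep i) x y" using rep Rsym unfolding R_def by blast
  then obtain x y where xy: "\<And>i. i < N \<Longrightarrow> link i (rep i) (x i) (y i)" by metis
  have xyc: "x i \<in> carrier C" "y i \<in> carrier C" "x i \<in> CE E" "y i \<in> CE E" if "i < N" for i
    using xy[OF that] CE_carrier by (auto simp: link_def)
  \<comment> \<open>\<open>x i\<close> leads from \<open>e i\<close> to the representative and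
    \<open>y j\<close> from there to \<open>e j\<close>. As all units of a block are routed through
    one idempotent, they compose without extra factors.\<close>
  define u where "u i j = x i \<otimes>\<^bsub>C\<^esub> y j" for i j
  have uE: "u i j \<in> CE E" if "i < N" "j < N" for i j using that xyc mE by (simp add: u_def)
  have uii: "u i i = e i" if "i < N" for i using xy[OF that] by (simp add: u_def link_def)
  have umult: "u i j \<otimes>\<^bsub>C\<^esub> u j' l = (if j = j' then u i l else \<zero>\<^bsub>C\<^esub>)"
    if n: "i < N" "j < N" "j' < N" "l < N" and r: "rep i = rep j" for i j j' l
  proof -
    have a: "u i j \<otimes>\<^bsub>C\<^esub> u j' l = x i \<otimes>\<^bsub>C\<^esub> (y j \<otimes>\<^bsub>C\<^esub> x j') \<otimes>\<^bsub>C\<^esub> y l"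
      using xyc n by (simp add: u_def C.m_assoc)
    show ?thesis
    proof (cases "j = j'")
      case True
      then have "y j \<otimes>\<^bsub>C\<^esub> x j' = e (rep i)" using xy[OF n(2)] r by (simp add: link_def)
      then show ?thesis using a xy[OF n(1)] True by (simp add: link_def u_def)
    next
      case False
      have "y j \<otimes>\<^bsub>C\<^esub> x j' = (y j \<otimes>\<^bsub>C\<^esub> e j) \<otimes>\<^bsub>C\<^esub> (e j' \<otimes>\<^bsub>C\<^esub> x j')" using xy[OF n(2)] xy[OF n(3)] by (simp add: link_def)
      also have "\<dots> = y j \<otimes>\<^bsub>C\<^esub> (e j \<otimes>\<^bsub>C\<^esub> e j') \<otimes>\<^bsub>C\<^esub> x j'" using xyc n ec by (simp add: C.m_assoc)
      finally have "y j \<otimes>\<^bsub>C\<^esub> x j' = \<zero>\<^bsub>C\<^esub>" using eo[OF n(2,3) False] xyc n by simp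
      then show ?thesis using a False xyc n by simp
    qed
  qed
  have ucoef: "\<exists>c\<in>E. e i \<otimes>\<^bsub>C\<^esub> z \<otimes>\<^bsub>C\<^esub> e j = c \<odot>\<^bsub>C\<^esub> u i j"
    if z: "z \<in> CE E" and n: "i < N" "j < N" and r: "rep i = rep j" for z i j
  proof -
    note zc = CE_carrier[OF z]
    let ?q = "rep i"
    have q: "?q < N" using rep n by blast
    \<comment> \<open>Transport of \<open>z\<close> into the corner of the representative, where
      every element is a scalar in \<open>E\<close>.\<close>
    let ?t = "y i \<otimes>\<^bsub>C\<^esub> z \<otimes>\<^bsub>C\<^esub> x j"
    have yi: "e ?q \<otimes>\<^bsub>C\<^esub> y i = y i" "x i \<otimes>\<^bsub>C\<^esub> y i = e i" "x i \<otimes>\<^bsub>C\<^esub> e ?q = x i" using xy[OF n(1)] by (auto simp: link_def)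
    have xj: "x j \<otimes>\<^bsub>C\<^esub> e ?q = x j" "x j \<otimes>\<^bsub>C\<^esub> y j = e j" "e ?q \<otimes>\<^bsub>C\<^esub> y j = y j" using xy[OF n(2)] r by (auto simp: link_def)
    have "?t \<in> corner E (e ?q)"
      unfolding corner_def using mE z xyc n yi xj zc ec[OF q]
      by (simp add: C.m_assoc) (simp add: C.m_assoc[symmetric])
    then obtain c where c: "c \<in> E" "?t = c \<odot>\<^bsub>C\<^esub> e ?q" using corner_scalar[OF E pr[OF q]] by blast
    have cL: "c \<in> carrier L" using c fsD(4)[OF E] by blast
    have "e i \<otimes>\<^bsub>C\<^esub> z \<otimes>\<^bsub>C\<^esub> e j = x i \<otimes>\<^bsub>C\<^esub> ?t \<otimes>\<^bsub>C\<^esub> y j"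
      unfolding yi(2)[symmetric] xj(2)[symmetric] using xyc n zc by (simp add: C.m_assoc)
    also have "\<dots> = c \<odot>\<^bsub>C\<^esub> (x i \<otimes>\<^bsub>C\<^esub> e ?q \<otimes>\<^bsub>C\<^esub> y j)"
      unfolding c(2) using xyc n cL ec[OF q] by (simp add: algC.smult_mult_left algC.smult_mult_right)
    finally show ?thesis using c(1) yi(3) by (auto simp: u_def)
  qed
  \<comment> \<open>A nonzero element between two primitive idempotents is invertible by
    \<open>corner_inverse\<close> and would put them into the same class.\<close>
  have uoff: "e i \<otimes>\<^bsub>C\<^esub> z \<otimes>\<^bsub>C\<^esub> e j = \<zero>\<^bsub>C\<^esub>"
    if z: "z \<in> CE E" and n: "i < N" "j < N" and r: "rep i \<noteq> rep j" for z i j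
  proof (rule ccontr)
    assume nz: "e i \<otimes>\<^bsub>C\<^esub> z \<otimes>\<^bsub>C\<^esub> e j \<noteq> \<zero>\<^bsub>C\<^esub>"
    let ?x = "e i \<otimes>\<^bsub>C\<^esub> z \<otimes>\<^bsub>C\<^esub> e j"
    note zc = CE_carrier[OF z]
    have 1: "?x \<in> CE E" using mE z eE n by simp
    have 2: "e i \<otimes>\<^bsub>C\<^esub> ?x = ?x" using zc ec n ei by (simp add: C.m_assoc[symmetric])
    have 3: "?x \<otimes>\<^bsub>C\<^esub> e j = ?x" using zc ec n ei by (simp add: C.m_assoc)
    obtain t where "t \<in> CE E" "e j \<otimes>\<^bsub>C\<^esub> t = t" "t \<otimes>\<^bsub>C\<^esub> e i = t" "t \<otimes>\<^bsub>C\<^esub> ?x = e j" "?x \<otimes>\<^bsub>C\<^esub> t = e i"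
      using corner_inverse[OF E pr[OF n(1)] pr[OF n(2)] 1 2 3 nz] by blast
    then have "R i j" unfolding R_def link_def using 1 2 3 by blast
    then show False using repeq n r by blast
  qed
  \<comment> \<open>What follows is bookkeeping: \<rho> numbers the classes and
    \<open>\<sigma> l\<close> the members of class \<open>l\<close>, because blocks and rows have to
    be indexed by initial segments of the natural numbers.\<close>
  define Q where "Q = rep ` {..<N}"
  have Qfin: "finite Q" and Qne: "Q \<noteq> {}" using N0 by (auto simp: Q_def)
  define r where "r = card Q"
  obtain \<rho> where \<rho>: "bij_betw \<rho> {..<r} Q"
    using ex_bij_betw_nat_finite[OF Qfin] unfolding r_def atLeast0LessThan by blast
  define cl where "cl l = {i. i < N \<and> rep i = \<rho> l}" for l
  have clfin: "finite (cl l)" for l by (simp add: cl_def)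
  define m where "m l = card (cl l)" for l
  have "\<forall>l. \<exists>s. bij_betw s {..<m l} (cl l)"
    using ex_bij_betw_nat_finite[OF clfin] unfolding m_def atLeast0LessThan by blast
  then obtain \<sigma> where \<sigma>: "\<And>l. bij_betw (\<sigma> l) {..<m l} (cl l)" by metis
  have sN: "\<sigma> l i < N" and sr: "rep (\<sigma> l i) = \<rho> l" if "i < m l" for l i
    using bij_betwE[OF \<sigma>[of l]] that by (auto simp: cl_def)
  have sinj: "\<sigma> l i = \<sigma> l j \<longleftrightarrow> i = j" if "i < m l" "j < m l" for l i j
    using \<sigma>[of l] that by (auto simp: bij_betw_def inj_on_def)
  have rinj: "\<rho> l = \<rho> l' \<longleftrightarrow> l = l'" if "l < r" "l' < r" for l l'
    using \<rho> that by (auto simp: bij_betw_def inj_on_def)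
  have r0: "0 < r" using Qfin Qne by (simp add: r_def card_gt_0_iff)
  have m0: "0 < m l" if "l < r" for l
  proof -
    have "\<rho> l \<in> Q" using \<rho> that by (auto dest: bij_betwE)
    then obtain i where "i \<in> cl l" by (auto simp: Q_def cl_def)
    then show ?thesis using clfin by (auto simp: m_def card_gt_0_iff)
  qed
  define w where "w l i j = u (\<sigma> l i) (\<sigma> l j)" for l i j
  have wii: "w l i i = e (\<sigma> l i)" if "i < m l" for l i using uii sN[OF that] by (simp add: w_def)
  have s1: "(\<Oplus>\<^bsub>C\<^esub>i\<in>{..<m l}. w l i i) = (\<Oplus>\<^bsub>C\<^esub>i\<in>cl l. e i)" for l
  proof -
    have "(\<Oplus>\<^bsub>C\<^esub>i\<in>{..<m l}. w l i i) = (\<Oplus>\<^bsub>C\<^esub>i\<in>{..<m l}. e (\<sigma> l i))"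
      by (rule C.finsum_cong') (use wii sN ec in auto)
    also have "\<dots> = (\<Oplus>\<^bsub>C\<^esub>i\<in>\<sigma> l ` {..<m l}. e i)"
      by (rule C.finsum_reindex[symmetric]) (use \<sigma>[of l] sN ec in \<open>auto simp: bij_betw_def cl_def\<close>)
    finally show ?thesis using \<sigma>[of l] by (simp add: bij_betw_def)
  qed
  have "(\<Oplus>\<^bsub>C\<^esub>l\<in>{..<r}. \<Oplus>\<^bsub>C\<^esub>i\<in>{..<m l}. w l i i) = (\<Oplus>\<^bsub>C\<^esub>l\<in>{..<r}. \<Oplus>\<^bsub>C\<^esub>i\<in>cl l. e i)"
    by (rule C.finsum_cong') (use s1 ec in \<open>auto simp: cl_def intro!: C.finsum_closed\<close>)
  also have "\<dots> = (\<Oplus>\<^bsub>C\<^esub>i\<in>\<Union>(cl ` {..<r}). e i)"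
  proof (rule C.add.finprod_UN_disjoint[symmetric])
    show "pairwise (\<lambda>i j. disjnt (cl i) (cl j)) {..<r}"
      using rinj by (auto simp: pairwise_def disjnt_def cl_def)
  qed (use clfin ec in \<open>auto simp: cl_def\<close>)
  also have "\<Union>(cl ` {..<r}) = {..<N}"
  proof -
    have "\<exists>l<r. rep i = \<rho> l" if "i < N" for i
    proof -
      have "rep i \<in> \<rho> ` {..<r}" using \<rho> that by (auto simp: bij_betw_def Q_def)
      then show ?thesis by auto
    qed
    then show ?thesis by (auto simp: cl_def)
  qed
  finally have sum: "(\<Oplus>\<^bsub>C\<^esub>l\<in>{..<r}. \<Oplus>\<^bsub>C\<^esub>i\<in>{..<m l}. w l i i) = \<one>\<^bsub>C\<^esub>" using esum by simp
  show ?thesis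
  proof (rule that[of E r m w])
    show "0 < m l" if "l < r" for l by (rule m0[OF that])
    show "0 < r" by (rule r0)
    show "fs E" by (rule E)
    show "w l i j \<in> CE E" if "i < m l" "j < m l" for l i j using uE sN that by (simp add: w_def)
    show "w l i i \<noteq> \<zero>\<^bsub>C\<^esub>" if "i < m l" for l i using wii en sN that by simp
    show "w l i j \<otimes>\<^bsub>C\<^esub> w l' i' j' = (if l = l' \<and> j = i' then w l i j' else \<zero>\<^bsub>C\<^esub>)"
      if n: "l < r" "i < m l" "j < m l" "l' < r" "i' < m l'" "j' < m l'" for l i j l' i' j'
    proof -
      have "\<sigma> l j = \<sigma> l' i' \<longleftrightarrow> l = l' \<and> j = i'"
        using sinj sr[OF n(3)] sr[OF n(5)] rinj[OF n(1,4)] n by metis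
      then show ?thesis
        using umult[OF sN[OF n(2)] sN[OF n(3)] sN[OF n(5)] sN[OF n(6)]] sr[OF n(2)] sr[OF n(3)]
        by (auto simp: w_def)
    qed
    show "(\<Oplus>\<^bsub>C\<^esub>l\<in>{..<r}. \<Oplus>\<^bsub>C\<^esub>i\<in>{..<m l}. w l i i) = \<one>\<^bsub>C\<^esub>" by (rule sum)
    show "\<exists>c\<in>E. w l i i \<otimes>\<^bsub>C\<^esub> z \<otimes>\<^bsub>C\<^esub> w l j j = c \<odot>\<^bsub>C\<^esub> w l i j"
      if "z \<in> CE E" "i < m l" "j < m l" for z l i j
      using ucoef[OF that(1) sN[OF that(2)] sN[OF that(3)]] sr that wii by (simp add: w_def[of l i j])
    show "w l i i \<otimes>\<^bsub>C\<^esub> z \<otimes>\<^bsub>C\<^esub> w l' j j = \<zero>\<^bsub>C\<^esub>"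
      if "z \<in> CE E" "l < r" "i < m l" "l' < r" "j < m l'" "l \<noteq> l'" for z l i l' j
      using uoff[OF that(1) sN[OF that(3)] sN[OF that(5)]] sr that rinj wii by simp
  qed
qed

end

section \<open>Coordinates on a scalar extension\<close>

definition is_dual_basis ::
    "('k, 'x) ring_scheme \<Rightarrow> ('k, 'a, 'y) module_scheme \<Rightarrow> 'a set \<Rightarrow> ('a \<Rightarrow> 'a \<Rightarrow> 'k) \<Rightarrow> bool" where
  "is_dual_basis k M B h \<longleftrightarrow> finite B \<and> B \<subseteq> carrier M \<and>
    (\<forall>b\<in>B. \<forall>x\<in>carrier M. h b x \<in> carrier k) \<and>
    (\<forall>b\<in>B. \<forall>x\<in>carrier M. \<forall>y\<in>carrier M. h b (x \<oplus>\<^bsub>M\<^esub> y) = h b x \<oplus>\<^bsub>k\<^esub> h b y) \<and>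
    (\<forall>b\<in>B. \<forall>c\<in>carrier k. \<forall>x\<in>carrier M. h b (c \<odot>\<^bsub>M\<^esub> x) = c \<otimes>\<^bsub>k\<^esub> h b x) \<and>
    (\<forall>x\<in>carrier M. (\<Oplus>\<^bsub>M\<^esub>b\<in>B. h b x \<odot>\<^bsub>M\<^esub> b) = x) \<and>
    (\<forall>b\<in>B. \<forall>b'\<in>B. h b b' = (if b = b' then \<one>\<^bsub>k\<^esub> else \<zero>\<^bsub>k\<^esub>))"

lemma exists_dual_basis:
  assumes "field k" "module k M" "finite_dimensional k M"
  shows "\<exists>B h. is_dual_basis k M B h"
proof (rule dual_basis[OF assms])
  fix B h
  assume d: "finite B" "B \<subseteq> carrier M"
    "\<And>b x. b \<in> B \<Longrightarrow> x \<in> carrier M \<Longrightarrow> h b x \<in> carrier k"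
    "\<And>b x y. b \<in> B \<Longrightarrow> x \<in> carrier M \<Longrightarrow> y \<in> carrier M \<Longrightarrow> h b (x \<oplus>\<^bsub>M\<^esub> y) = h b x \<oplus>\<^bsub>k\<^esub> h b y"
    "\<And>b c x. b \<in> B \<Longrightarrow> c \<in> carrier k \<Longrightarrow> x \<in> carrier M \<Longrightarrow> h b (c \<odot>\<^bsub>M\<^esub> x) = c \<otimes>\<^bsub>k\<^esub> h b x"
    "\<And>x. x \<in> carrier M \<Longrightarrow> (\<Oplus>\<^bsub>M\<^esub>b\<in>B. h b x \<odot>\<^bsub>M\<^esub> b) = x"
    "\<And>b b'. b \<in> B \<Longrightarrow> b' \<in> B \<Longrightarrow> h b b' = (if b = b' then \<one>\<^bsub>k\<^esub> else \<zero>\<^bsub>k\<^esub>)"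
  have "is_dual_basis k M B h" unfolding is_dual_basis_def by (intro conjI ballI; rule d; assumption?)
  then show ?thesis by blast
qed

text \<open>Used for the coordinate functions of a basis and, with a field extension in the place of
  \<open>A\<close>, for a retraction of that field onto the ground field.\<close>

lemma (in scalar_ext) functional_lift:
  assumes g: "\<And>x. x \<in> carrier A \<Longrightarrow> g x \<in> carrier k"
    and ga: "\<And>x y. x \<in> carrier A \<Longrightarrow> y \<in> carrier A \<Longrightarrow> g (x \<oplus>\<^bsub>A\<^esub> y) = g x \<oplus>\<^bsub>k\<^esub> g y"
    and gs: "\<And>c x. c \<in> carrier k \<Longrightarrow> x \<in> carrier A \<Longrightarrow> g (c \<odot>\<^bsub>A\<^esub> x) = c \<otimes>\<^bsub>k\<^esub> g x"
  obtains G where "abelian_group_hom S K G" "\<And>x a. \<lbrakk>x \<in> carrier K; a \<in> carrier A\<rbrakk> \<Longrightarrow> G (pure x a) = x \<otimes>\<^bsub>K\<^esub> \<iota> (g a)"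
    "\<And>c t. \<lbrakk>c \<in> carrier K; t \<in> carrier S\<rbrakk> \<Longrightarrow> G (c \<odot>\<^bsub>S\<^esub> t) = c \<otimes>\<^bsub>K\<^esub> G t"
proof -
  obtain G where G: "abelian_group_hom S K G" and Gp: "\<And>x a. \<lbrakk>x \<in> carrier K; a \<in> carrier A\<rbrakk> \<Longrightarrow> G (pure x a) = x \<otimes>\<^bsub>K\<^esub> \<iota> (g a)"
    by (rule lift_exists[of K "\<lambda>x a. x \<otimes>\<^bsub>K\<^esub> \<iota> (g a)"])
       (auto simp: K.abelian_group_axioms g ga gs K.l_distr K.r_distr K.m_assoc)
  interpret G: abelian_group_hom S K G by (rule G)
  have "G (c \<odot>\<^bsub>S\<^esub> t) = c \<otimes>\<^bsub>K\<^esub> G t" if c: "c \<in> carrier K" and t: "t \<in> carrier S" for c t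
    using t
  proof (induction t rule: S_induct)
    case (pure x a) then show ?case using c g by (simp add: smult_pure Gp K.m_assoc)
  next
    case zero then show ?case using c by simp
  next
    case (diff s t)
    then show ?case using c
      by (simp add: a_minus_def SA.smult_r_distr SA.smult_r_minus K.r_distr K.r_minus)
  qed
  then show ?thesis using that G Gp by blast
qed

locale scalar_ext_basis = scalar_ext k A K \<iota>
  for k :: "('k, 'x) ring_scheme" and A :: "('k, 'a, 'y) module_scheme"
    and K :: "('e, 'z) ring_scheme" and \<iota> :: "'k \<Rightarrow> 'e" +
  fixes B :: "'a set" and h :: "'a \<Rightarrow> 'a \<Rightarrow> 'k"
  assumes dual: "is_dual_basis k A B h"
begin

lemma B_facts:
  shows "finite B" "b \<in> B \<Longrightarrow> b \<in> carrier A"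
    "b \<in> B \<Longrightarrow> x \<in> carrier A \<Longrightarrow> h b x \<in> carrier k"
    "b \<in> B \<Longrightarrow> x \<in> carrier A \<Longrightarrow> y \<in> carrier A \<Longrightarrow> h b (x \<oplus>\<^bsub>A\<^esub> y) = h b x \<oplus>\<^bsub>k\<^esub> h b y"
    "b \<in> B \<Longrightarrow> c \<in> carrier k \<Longrightarrow> x \<in> carrier A \<Longrightarrow> h b (c \<odot>\<^bsub>A\<^esub> x) = c \<otimes>\<^bsub>k\<^esub> h b x"
    "x \<in> carrier A \<Longrightarrow> (\<Oplus>\<^bsub>A\<^esub>b\<in>B. h b x \<odot>\<^bsub>A\<^esub> b) = x"
    "b \<in> B \<Longrightarrow> b' \<in> B \<Longrightarrow> h b b' = (if b = b' then \<one>\<^bsub>k\<^esub> else \<zero>\<^bsub>k\<^esub>)"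
  using dual unfolding is_dual_basis_def by (blast | simp)+

text \<open>The \<open>K\<close>-linear extensions of the coordinate functions \<open>h b\<close>,
  fixed by choice because \<open>functional_lift\<close> provides them only existentially.\<close>

definition hK :: "'a \<Rightarrow> ('e \<times> 'a \<Rightarrow>\<^sub>0 int) set \<Rightarrow> 'e" where
  "hK = (SOME H. \<forall>b\<in>B. abelian_group_hom S K (H b) \<and>
      (\<forall>x\<in>carrier K. \<forall>a\<in>carrier A. H b (pure x a) = x \<otimes>\<^bsub>K\<^esub> \<iota> (h b a)) \<and>
      (\<forall>c\<in>carrier K. \<forall>t\<in>carrier S. H b (c \<odot>\<^bsub>S\<^esub> t) = c \<otimes>\<^bsub>K\<^esub> H b t))"

lemma hK:
  assumes b: "b \<in> B"
  shows hK_hom: "abelian_group_hom S K (hK b)"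
    and hK_pure: "\<And>x a. \<lbrakk>x \<in> carrier K; a \<in> carrier A\<rbrakk> \<Longrightarrow> hK b (pure x a) = x \<otimes>\<^bsub>K\<^esub> \<iota> (h b a)"
    and hK_smult: "\<And>c t. \<lbrakk>c \<in> carrier K; t \<in> carrier S\<rbrakk> \<Longrightarrow> hK b (c \<odot>\<^bsub>S\<^esub> t) = c \<otimes>\<^bsub>K\<^esub> hK b t"
proof -
  let ?P = "\<lambda>b G. abelian_group_hom S K G \<and>
      (\<forall>x\<in>carrier K. \<forall>a\<in>carrier A. G (pure x a) = x \<otimes>\<^bsub>K\<^esub> \<iota> (h b a)) \<and>
      (\<forall>c\<in>carrier K. \<forall>t\<in>carrier S. G (c \<odot>\<^bsub>S\<^esub> t) = c \<otimes>\<^bsub>K\<^esub> G t)"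
  have "\<exists>G. ?P b G" if "b \<in> B" for b
  proof (rule functional_lift[of "h b"])
    fix G assume "abelian_group_hom S K G" "\<And>x a. \<lbrakk>x \<in> carrier K; a \<in> carrier A\<rbrakk> \<Longrightarrow> G (pure x a) = x \<otimes>\<^bsub>K\<^esub> \<iota> (h b a)"
      "\<And>c t. \<lbrakk>c \<in> carrier K; t \<in> carrier S\<rbrakk> \<Longrightarrow> G (c \<odot>\<^bsub>S\<^esub> t) = c \<otimes>\<^bsub>K\<^esub> G t"
    then show "\<exists>G. ?P b G" by (intro exI[of _ G]) simp
  qed (use B_facts(3-5)[OF that] in auto)
  then have "\<exists>H. \<forall>b\<in>B. ?P b (H b)" by (rule bchoice[OF ballI])
  then have "\<forall>b\<in>B. ?P b (hK b)" unfolding hK_def by (rule someI_ex)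
  then have "?P b (hK b)" using b by (rule bspec)
  then show "abelian_group_hom S K (hK b)" "\<And>x a. \<lbrakk>x \<in> carrier K; a \<in> carrier A\<rbrakk> \<Longrightarrow> hK b (pure x a) = x \<otimes>\<^bsub>K\<^esub> \<iota> (h b a)"
    "\<And>c t. \<lbrakk>c \<in> carrier K; t \<in> carrier S\<rbrakk> \<Longrightarrow> hK b (c \<odot>\<^bsub>S\<^esub> t) = c \<otimes>\<^bsub>K\<^esub> hK b t"
    by blast+
qed

lemma hK_closed: "b \<in> B \<Longrightarrow> t \<in> carrier S \<Longrightarrow> hK b t \<in> carrier K"
  using abelian_group_hom.hom_closed[OF hK_hom] by blast

lemma hK_add: "b \<in> B \<Longrightarrow> s \<in> carrier S \<Longrightarrow> t \<in> carrier S \<Longrightarrow> hK b (s \<oplus>\<^bsub>S\<^esub> t) = hK b s \<oplus>\<^bsub>K\<^esub> hK b t"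
  using abelian_group_hom.hom_add[OF hK_hom] by blast

lemma pure_hom: "x \<in> carrier K \<Longrightarrow> abelian_group_hom A S (pure x)"
  by (intro abelian_group_homI A.M.abelian_group_axioms S.abelian_group_axioms group_hom.intro
       group_hom_axioms.intro A.M.a_group S.a_group) (auto simp: hom_def pure_add_right)

text \<open>Both sides are additive, so pure tensors suffice; there the expansion of
  \<open>a\<close> in \<open>A\<close> is carried over by balancedness.\<close>

lemma S_expand:
  assumes t: "t \<in> carrier S"
  shows "(\<Oplus>\<^bsub>S\<^esub>b\<in>B. hK b t \<odot>\<^bsub>S\<^esub> pure \<one>\<^bsub>K\<^esub> b) = t"
proof -
  let ?F = "\<lambda>t. \<Oplus>\<^bsub>S\<^esub>b\<in>B. hK b t \<odot>\<^bsub>S\<^esub> pure \<one>\<^bsub>K\<^esub> b"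
  have tc: "hK b s \<odot>\<^bsub>S\<^esub> pure \<one>\<^bsub>K\<^esub> b \<in> carrier S" if "b \<in> B" "s \<in> carrier S" for b s
    using that hK_closed B_facts(2) by simp
  have add: "?F (s \<oplus>\<^bsub>S\<^esub> t) = ?F s \<oplus>\<^bsub>S\<^esub> ?F t" if "s \<in> carrier S" "t \<in> carrier S" for s t
  proof -
    have "?F (s \<oplus>\<^bsub>S\<^esub> t) = (\<Oplus>\<^bsub>S\<^esub>b\<in>B. hK b s \<odot>\<^bsub>S\<^esub> pure \<one>\<^bsub>K\<^esub> b \<oplus>\<^bsub>S\<^esub> hK b t \<odot>\<^bsub>S\<^esub> pure \<one>\<^bsub>K\<^esub> b)"
      by (rule S.finsum_cong') (use that tc in \<open>auto simp: hK_add hK_closed B_facts(2) SA.smult_l_distr\<close>)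
    also have "\<dots> = ?F s \<oplus>\<^bsub>S\<^esub> ?F t" by (rule S.finsum_addf) (use that tc in auto)
    finally show ?thesis .
  qed
  have F: "abelian_group_hom S S ?F"
    by (intro abelian_group_homI S.abelian_group_axioms group_hom.intro group_hom_axioms.intro S.a_group)
       (auto simp: hom_def add intro!: S.finsum_closed tc)
  have I: "abelian_group_hom S S (\<lambda>t. t)"
    by (intro abelian_group_homI S.abelian_group_axioms group_hom.intro group_hom_axioms.intro S.a_group)
       (auto simp: hom_def)
  show ?thesis
  proof (rule additive_eqI[OF F I _ t])
    fix x a assume xa: "x \<in> carrier K" "a \<in> carrier A"
    interpret P: abelian_group_hom A S "pure x" by (rule pure_hom[OF xa(1)])
    have "?F (pure x a) = (\<Oplus>\<^bsub>S\<^esub>b\<in>B. pure x (h b a \<odot>\<^bsub>A\<^esub> b))"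
      by (rule S.finsum_cong') (use xa B_facts(2,3) in \<open>auto simp: hK_pure smult_pure pure_smult\<close>)
    also have "\<dots> = pure x (\<Oplus>\<^bsub>A\<^esub>b\<in>B. h b a \<odot>\<^bsub>A\<^esub> b)"
      by (rule P.hom_finsum[symmetric]) (use xa B_facts(2,3) in auto)
    finally show "?F (pure x a) = pure x a" using B_facts(6)[OF xa(2)] by simp
  qed
qed

lemma S_eqI:
  assumes "s \<in> carrier S" "t \<in> carrier S" "\<And>b. b \<in> B \<Longrightarrow> hK b s = hK b t"
  shows "s = t"
proof -
  have "(\<Oplus>\<^bsub>S\<^esub>b\<in>B. hK b s \<odot>\<^bsub>S\<^esub> pure \<one>\<^bsub>K\<^esub> b) = (\<Oplus>\<^bsub>S\<^esub>b\<in>B. hK b t \<odot>\<^bsub>S\<^esub> pure \<one>\<^bsub>K\<^esub> b)"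
    by (rule S.finsum_cong') (use assms hK_closed B_facts(2) in auto)
  then show ?thesis using S_expand[OF assms(1)] S_expand[OF assms(2)] by simp
qed

lemma \<iota>_inj: "c \<in> carrier k \<Longrightarrow> \<iota> c = \<zero>\<^bsub>K\<^esub> \<Longrightarrow> c = \<zero>\<^bsub>k\<^esub>"
  using inj_onD[OF non_trivial_field_hom_is_inj[OF \<iota>.homh A.field_axioms K.field_axioms], of c "\<zero>\<^bsub>k\<^esub>"]
  by simp

lemma pure_inj:
  assumes "a \<in> carrier A" "pure \<one>\<^bsub>K\<^esub> a = \<zero>\<^bsub>S\<^esub>" shows "a = \<zero>\<^bsub>A\<^esub>"
proof -
  have "h b a = \<zero>\<^bsub>k\<^esub>" if b: "b \<in> B" for b
  proof -
    interpret H: abelian_group_hom S K "hK b" by (rule hK_hom[OF b])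
    have "\<iota> (h b a) = \<zero>\<^bsub>K\<^esub>" using hK_pure[OF b K.one_closed assms(1)] assms B_facts(3)[OF b assms(1)] by simp
    then show ?thesis using \<iota>_inj B_facts(3)[OF b assms(1)] by blast
  qed
  then have "(\<Oplus>\<^bsub>A\<^esub>b\<in>B. h b a \<odot>\<^bsub>A\<^esub> b) = \<zero>\<^bsub>A\<^esub>"
    by (intro A.M.finsum_all_zero) (use B_facts(2) in auto)
  then show ?thesis using B_facts(6)[OF assms(1)] by simp
qed

text \<open>After both factors are expanded in the basis, the coordinates of the product are sums of
  products of the given coordinates with structure constants, and those lie in the image of
  \<open>k\<close>.\<close>

lemma hK_mult_subring:
  assumes W: "subring W K" "\<iota> ` carrier k \<subseteq> W" and x: "x \<in> carrier S" "\<forall>b\<in>B. hK b x \<in> W"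
    and y: "y \<in> carrier S" "\<forall>b\<in>B. hK b y \<in> W" and b: "b \<in> B"
  shows "hK b (x \<otimes>\<^bsub>S\<^esub> y) \<in> W"
proof -
  note Ws = subringE[OF W(1)]
  interpret H: abelian_group_hom S K "hK b" by (rule hK_hom[OF b])
  let ?v = "\<lambda>b. pure \<one>\<^bsub>K\<^esub> b"
  have v: "?v b \<in> carrier S" if "b \<in> B" for b using that B_facts(2) by simp
  have hx: "hK b' x \<in> carrier K" and hy: "hK b' y \<in> carrier K" if "b' \<in> B" for b'
    using hK_closed that x y by auto
  have vy: "hK b (?v b' \<otimes>\<^bsub>S\<^esub> y) \<in> W" if b': "b' \<in> B" for b'
  proof -
    have "?v b' \<otimes>\<^bsub>S\<^esub> y = ?v b' \<otimes>\<^bsub>S\<^esub> (\<Oplus>\<^bsub>S\<^esub>c\<in>B. hK c y \<odot>\<^bsub>S\<^esub> ?v c)" by (simp add: S_expand[OF y(1)])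
    also have "\<dots> = (\<Oplus>\<^bsub>S\<^esub>c\<in>B. ?v b' \<otimes>\<^bsub>S\<^esub> (hK c y \<odot>\<^bsub>S\<^esub> ?v c))"
      by (rule S.finsum_rdistr) (use v b' hy B_facts(1) in auto)
    finally have "hK b (?v b' \<otimes>\<^bsub>S\<^esub> y) = hK b (\<Oplus>\<^bsub>S\<^esub>c\<in>B. ?v b' \<otimes>\<^bsub>S\<^esub> (hK c y \<odot>\<^bsub>S\<^esub> ?v c))" by simp
    also have "\<dots> = (\<Oplus>\<^bsub>K\<^esub>c\<in>B. hK b (?v b' \<otimes>\<^bsub>S\<^esub> (hK c y \<odot>\<^bsub>S\<^esub> ?v c)))"
      by (rule H.hom_finsum) (use v b' hy in auto)
    also have "\<dots> \<in> W"
    proof (rule K.finsum_subring_closed[OF W(1)])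
      fix c assume c: "c \<in> B"
      have "hK b (?v b' \<otimes>\<^bsub>S\<^esub> (hK c y \<odot>\<^bsub>S\<^esub> ?v c)) = hK c y \<otimes>\<^bsub>K\<^esub> \<iota> (h b (b' \<otimes>\<^bsub>A\<^esub> c))"
        using b b' c v hy B_facts(2,3) by (simp add: SA.smult_mult_right hK_smult pure_mult hK_pure)
      moreover have "\<iota> (h b (b' \<otimes>\<^bsub>A\<^esub> c)) \<in> W" using W(2) b b' c B_facts(2,3) by auto
      ultimately show "hK b (?v b' \<otimes>\<^bsub>S\<^esub> (hK c y \<odot>\<^bsub>S\<^esub> ?v c)) \<in> W" using Ws(6) y(2) c by simp
    qed
    finally show ?thesis .
  qed
  have "x \<otimes>\<^bsub>S\<^esub> y = (\<Oplus>\<^bsub>S\<^esub>b'\<in>B. hK b' x \<odot>\<^bsub>S\<^esub> ?v b') \<otimes>\<^bsub>S\<^esub> y" by (simp add: S_expand[OF x(1)])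
  also have "\<dots> = (\<Oplus>\<^bsub>S\<^esub>b'\<in>B. (hK b' x \<odot>\<^bsub>S\<^esub> ?v b') \<otimes>\<^bsub>S\<^esub> y)"
    by (rule S.finsum_ldistr) (use v hx y B_facts(1) in auto)
  finally have "hK b (x \<otimes>\<^bsub>S\<^esub> y) = hK b (\<Oplus>\<^bsub>S\<^esub>b'\<in>B. (hK b' x \<odot>\<^bsub>S\<^esub> ?v b') \<otimes>\<^bsub>S\<^esub> y)" by simp
  also have "\<dots> = (\<Oplus>\<^bsub>K\<^esub>b'\<in>B. hK b ((hK b' x \<odot>\<^bsub>S\<^esub> ?v b') \<otimes>\<^bsub>S\<^esub> y))"
    by (rule H.hom_finsum) (use v hx y in auto)
  also have "\<dots> \<in> W"
  proof (rule K.finsum_subring_closed[OF W(1)])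
    fix c assume c: "c \<in> B"
    have "hK b ((hK c x \<odot>\<^bsub>S\<^esub> ?v c) \<otimes>\<^bsub>S\<^esub> y) = hK c x \<otimes>\<^bsub>K\<^esub> hK b (?v c \<otimes>\<^bsub>S\<^esub> y)"
      using b c v hx y by (simp add: SA.smult_mult_left hK_smult)
    then show "hK b ((hK c x \<odot>\<^bsub>S\<^esub> ?v c) \<otimes>\<^bsub>S\<^esub> y) \<in> W" using Ws(6) x(2) c vy by simp
  qed
  finally show ?thesis .
qed

end

section \<open>Matrix units\<close>

lemma (in abelian_monoid) finsum_single:
  assumes "finite I" "i \<in> I" "f i \<in> carrier G" "\<And>j. j \<in> I \<Longrightarrow> j \<noteq> i \<Longrightarrow> f j = \<zero>"
  shows "finsum G f I = f i"
proof -
  have "f \<in> I \<rightarrow> carrier G"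
  proof
    fix j assume "j \<in> I" then show "f j \<in> carrier G" using assms by (cases "j = i") auto
  qed
  then have "finsum G f I = f i \<oplus> finsum G f (I - {i})" using assms by (intro finsum_remove) auto
  also have "finsum G f (I - {i}) = \<zero>" by (rule finsum_all_zero) (use assms in auto)
  finally show ?thesis using assms by simp
qed

lemma (in abelian_monoid) finsum_cong2:
  assumes "\<And>i j. i \<in> I \<Longrightarrow> j \<in> J i \<Longrightarrow> g i j \<in> carrier G"
    and "\<And>i j. i \<in> I \<Longrightarrow> j \<in> J i \<Longrightarrow> f i j = g i j"
  shows "(\<Oplus>i\<in>I. \<Oplus>j\<in>J i. f i j) = (\<Oplus>i\<in>I. \<Oplus>j\<in>J i. g i j)"
proof (rule finsum_cong')
  fix i assume i: "i \<in> I"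
  show "(\<Oplus>j\<in>J i. f i j) = (\<Oplus>j\<in>J i. g i j)" by (rule finsum_cong') (use assms i in auto)
qed (use assms in \<open>auto intro!: finsum_closed\<close>)

lemma abelian_group_homI':
  assumes "abelian_group G" "abelian_group H" "\<And>x. x \<in> carrier G \<Longrightarrow> f x \<in> carrier H"
    "\<And>x y. x \<in> carrier G \<Longrightarrow> y \<in> carrier G \<Longrightarrow> f (x \<oplus>\<^bsub>G\<^esub> y) = f x \<oplus>\<^bsub>H\<^esub> f y"
  shows "abelian_group_hom G H f"
  by (intro abelian_group_homI assms(1,2) group_hom.intro group_hom_axioms.intro abelian_group.a_group)
     (auto simp: hom_def assms)

lemma ring_hom_abelian_group_hom:
  assumes "ring R" "ring S" "f \<in> ring_hom R S" shows "abelian_group_hom R S f"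
  using assms by (intro abelian_group_homI') (auto simp: ring.is_abelian_group ring_hom_def)

text \<open>An internal description of a product of matrix algebras: \<open>w_coef\<close> says that
  the Peirce components inside a block are one-dimensional, \<open>w_off\<close> that those between
  different blocks vanish. The isomorphism obtained from it is \<open>\<Phi>\<close>.\<close>

locale mat_units =
  fixes F :: "('f, 'u) ring_scheme" and S :: "('f, 's, 'v) module_scheme"
    and r :: nat and m :: "nat \<Rightarrow> nat" and w :: "nat \<Rightarrow> nat \<Rightarrow> nat \<Rightarrow> 's"
  assumes algS: "unital_algebra F S"
    and w_closed: "\<And>l i j. l < r \<Longrightarrow> i < m l \<Longrightarrow> j < m l \<Longrightarrow> w l i j \<in> carrier S"
    and w_nonzero: "\<And>l i. l < r \<Longrightarrow> i < m l \<Longrightarrow> w l i i \<noteq> \<zero>\<^bsub>S\<^esub>"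
    and w_mult: "\<And>l i j l' i' j'. l < r \<Longrightarrow> i < m l \<Longrightarrow> j < m l \<Longrightarrow> l' < r \<Longrightarrow> i' < m l' \<Longrightarrow> j' < m l' \<Longrightarrow>
       w l i j \<otimes>\<^bsub>S\<^esub> w l' i' j' = (if l = l' \<and> j = i' then w l i j' else \<zero>\<^bsub>S\<^esub>)"
    and w_sum: "(\<Oplus>\<^bsub>S\<^esub>l\<in>{..<r}. \<Oplus>\<^bsub>S\<^esub>i\<in>{..<m l}. w l i i) = \<one>\<^bsub>S\<^esub>"
    and w_coef: "\<And>x l i j. x \<in> carrier S \<Longrightarrow> l < r \<Longrightarrow> i < m l \<Longrightarrow> j < m l \<Longrightarrow>
       \<exists>c\<in>carrier F. w l i i \<otimes>\<^bsub>S\<^esub> x \<otimes>\<^bsub>S\<^esub> w l j j = c \<odot>\<^bsub>S\<^esub> w l i j"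
    and w_off: "\<And>x l i l' j. x \<in> carrier S \<Longrightarrow> l < r \<Longrightarrow> i < m l \<Longrightarrow> l' < r \<Longrightarrow> j < m l' \<Longrightarrow> l \<noteq> l' \<Longrightarrow>
       w l i i \<otimes>\<^bsub>S\<^esub> x \<otimes>\<^bsub>S\<^esub> w l' j j = \<zero>\<^bsub>S\<^esub>"
begin

sublocale F: field F using algS by (simp add: unital_algebra_def)
sublocale S: ring S using algS by (simp add: unital_algebra_def)
sublocale M: module F S using algS by (simp add: unital_algebra_def)
sublocale A: unital_algebra F S by (rule algS)

lemma w_nonzero': "l < r \<Longrightarrow> i < m l \<Longrightarrow> j < m l \<Longrightarrow> w l i j \<noteq> \<zero>\<^bsub>S\<^esub>"
  using w_mult[of l i j l j i] w_nonzero[of l i] w_closed[of l j i] by auto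

lemma coef_unique:
  assumes "l < r" "i < m l" "j < m l" "c \<in> carrier F" "d \<in> carrier F" "c \<odot>\<^bsub>S\<^esub> w l i j = d \<odot>\<^bsub>S\<^esub> w l i j"
  shows "c = d"
proof (rule ccontr)
  assume "c \<noteq> d"
  let ?x = "w l i j"
  have x: "?x \<in> carrier S" using w_closed assms by simp
  define e where "e = c \<ominus>\<^bsub>F\<^esub> d"
  have "e \<noteq> \<zero>\<^bsub>F\<^esub>" using F.diff_zero_imp_eq[of c d] assms \<open>c \<noteq> d\<close> by (auto simp: e_def a_minus_def)
  then have u: "e \<in> Units F" using assms by (simp add: F.field_Units e_def)
  have z: "e \<odot>\<^bsub>S\<^esub> ?x = \<zero>\<^bsub>S\<^esub>"
    using assms x by (simp add: e_def a_minus_def M.smult_l_distr M.smult_l_minus S.r_neg)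
  have "?x = (inv\<^bsub>F\<^esub> e \<otimes>\<^bsub>F\<^esub> e) \<odot>\<^bsub>S\<^esub> ?x" using u x by (simp add: F.Units_l_inv)
  also have "\<dots> = inv\<^bsub>F\<^esub> e \<odot>\<^bsub>S\<^esub> (e \<odot>\<^bsub>S\<^esub> ?x)" by (rule M.smult_assoc1) (use u x in auto)
  finally show False using w_nonzero' assms u z by auto
qed

text \<open>The matrix entry of \<open>x\<close> at position \<open>(i, j)\<close> of block
  \<open>l\<close>, read off from the Peirce component.\<close>

definition \<kappa> :: "'s \<Rightarrow> nat \<Rightarrow> nat \<Rightarrow> nat \<Rightarrow> 'f" where
  "\<kappa> x l i j = (SOME c. c \<in> carrier F \<and> w l i i \<otimes>\<^bsub>S\<^esub> x \<otimes>\<^bsub>S\<^esub> w l j j = c \<odot>\<^bsub>S\<^esub> w l i j)"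

lemma \<kappa>:
  assumes "x \<in> carrier S" "l < r" "i < m l" "j < m l"
  shows "\<kappa> x l i j \<in> carrier F" "w l i i \<otimes>\<^bsub>S\<^esub> x \<otimes>\<^bsub>S\<^esub> w l j j = \<kappa> x l i j \<odot>\<^bsub>S\<^esub> w l i j"
proof -
  have "\<exists>c. c \<in> carrier F \<and> w l i i \<otimes>\<^bsub>S\<^esub> x \<otimes>\<^bsub>S\<^esub> w l j j = c \<odot>\<^bsub>S\<^esub> w l i j" using w_coef[OF assms] by blast
  from someI_ex[OF this] show "\<kappa> x l i j \<in> carrier F" "w l i i \<otimes>\<^bsub>S\<^esub> x \<otimes>\<^bsub>S\<^esub> w l j j = \<kappa> x l i j \<odot>\<^bsub>S\<^esub> w l i j"
    unfolding \<kappa>_def by auto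
qed

lemma \<kappa>_eqI:
  assumes "x \<in> carrier S" "l < r" "i < m l" "j < m l" "c \<in> carrier F"
    "w l i i \<otimes>\<^bsub>S\<^esub> x \<otimes>\<^bsub>S\<^esub> w l j j = c \<odot>\<^bsub>S\<^esub> w l i j"
  shows "\<kappa> x l i j = c"
  using coef_unique[of l i j "\<kappa> x l i j" c] \<kappa>[OF assms(1-4)] assms by simp

lemma sandwich_hom:
  assumes "a \<in> carrier S" "b \<in> carrier S" shows "abelian_group_hom S S (\<lambda>t. a \<otimes>\<^bsub>S\<^esub> t \<otimes>\<^bsub>S\<^esub> b)"
  by (rule abelian_group_homI') (use assms in \<open>auto simp: S.abelian_group_axioms S.l_distr S.r_distr\<close>)

text \<open>The unit, written as the sum of the diagonal units, is inserted between \<open>a\<close>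
  and \<open>b\<close>. Both the matrix product formula and the injectivity of the entries rest on
  this.\<close>

lemma decompose_one:
  assumes a: "a \<in> carrier S" and b: "b \<in> carrier S"
  shows "a \<otimes>\<^bsub>S\<^esub> b = (\<Oplus>\<^bsub>S\<^esub>l\<in>{..<r}. \<Oplus>\<^bsub>S\<^esub>i\<in>{..<m l}. a \<otimes>\<^bsub>S\<^esub> w l i i \<otimes>\<^bsub>S\<^esub> b)"
proof -
  interpret T: abelian_group_hom S S "\<lambda>t. a \<otimes>\<^bsub>S\<^esub> t \<otimes>\<^bsub>S\<^esub> b" by (rule sandwich_hom[OF a b])
  have "a \<otimes>\<^bsub>S\<^esub> b = a \<otimes>\<^bsub>S\<^esub> (\<Oplus>\<^bsub>S\<^esub>l\<in>{..<r}. \<Oplus>\<^bsub>S\<^esub>i\<in>{..<m l}. w l i i) \<otimes>\<^bsub>S\<^esub> b" using a b by (simp add: w_sum)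
  also have "\<dots> = (\<Oplus>\<^bsub>S\<^esub>l\<in>{..<r}. a \<otimes>\<^bsub>S\<^esub> (\<Oplus>\<^bsub>S\<^esub>i\<in>{..<m l}. w l i i) \<otimes>\<^bsub>S\<^esub> b)"
    by (rule T.hom_finsum) (use w_closed in \<open>auto intro!: S.finsum_closed\<close>)
  also have "\<dots> = (\<Oplus>\<^bsub>S\<^esub>l\<in>{..<r}. \<Oplus>\<^bsub>S\<^esub>i\<in>{..<m l}. a \<otimes>\<^bsub>S\<^esub> w l i i \<otimes>\<^bsub>S\<^esub> b)"
    by (rule S.finsum_cong') (use w_closed a b in \<open>auto intro!: S.finsum_closed T.hom_finsum\<close>)
  finally show ?thesis .
qed

definition \<Phi> :: "'s \<Rightarrow> nat \<Rightarrow> nat \<times> nat \<Rightarrow> 'f" where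
  "\<Phi> x = (\<lambda>l\<in>{..<r}. \<lambda>(i, j)\<in>{..<m l} \<times> {..<m l}. \<kappa> x l i j)"

lemma \<kappa>_mult:
  assumes x: "x \<in> carrier S" and y: "y \<in> carrier S" and l: "l < r" and i: "i < m l" and j: "j < m l"
  shows "\<kappa> (x \<otimes>\<^bsub>S\<^esub> y) l i j = (\<Oplus>\<^bsub>F\<^esub>s\<in>{..<m l}. \<kappa> x l i s \<otimes>\<^bsub>F\<^esub> \<kappa> y l s j)"
proof (rule \<kappa>_eqI)
  let ?a = "w l i i" and ?b = "w l j j"
  have a: "?a \<in> carrier S" and b: "?b \<in> carrier S" using w_closed l i j by auto
  have wij: "w l i j \<in> carrier S" using w_closed l i j by simp
  have kc: "\<kappa> x l i s \<in> carrier F" "\<kappa> y l s j \<in> carrier F" if "s < m l" for s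
    using \<kappa>(1)[OF x l i that] \<kappa>(1)[OF y l that j] .
  let ?t = "\<lambda>l' s. ?a \<otimes>\<^bsub>S\<^esub> x \<otimes>\<^bsub>S\<^esub> w l' s s \<otimes>\<^bsub>S\<^esub> (y \<otimes>\<^bsub>S\<^esub> ?b)"
  have tc: "?t l' s \<in> carrier S" if "l' < r" "s < m l'" for l' s using a b x y w_closed that by simp
  have "?a \<otimes>\<^bsub>S\<^esub> (x \<otimes>\<^bsub>S\<^esub> y) \<otimes>\<^bsub>S\<^esub> ?b = (?a \<otimes>\<^bsub>S\<^esub> x) \<otimes>\<^bsub>S\<^esub> (y \<otimes>\<^bsub>S\<^esub> ?b)" using a b x y by (simp add: S.m_assoc)
  also have "\<dots> = (\<Oplus>\<^bsub>S\<^esub>l'\<in>{..<r}. \<Oplus>\<^bsub>S\<^esub>s\<in>{..<m l'}. ?t l' s)" by (rule decompose_one) (use a b x y in auto)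
  also have "\<dots> = (\<Oplus>\<^bsub>S\<^esub>s\<in>{..<m l}. ?t l s)"
  proof (rule S.finsum_single)
    fix l' assume l': "l' \<in> {..<r}" "l' \<noteq> l"
    show "(\<Oplus>\<^bsub>S\<^esub>s\<in>{..<m l'}. ?t l' s) = \<zero>\<^bsub>S\<^esub>"
    proof (rule S.finsum_all_zero)
      fix s assume "s \<in> {..<m l'}"
      then have "?a \<otimes>\<^bsub>S\<^esub> x \<otimes>\<^bsub>S\<^esub> w l' s s = \<zero>\<^bsub>S\<^esub>" using w_off[OF x l i] l' by auto
      then show "?t l' s = \<zero>\<^bsub>S\<^esub>" using y b by simp
    qed
  qed (use l tc in \<open>auto intro!: S.finsum_closed\<close>)
  also have "\<dots> = (\<Oplus>\<^bsub>S\<^esub>s\<in>{..<m l}. (\<kappa> x l i s \<otimes>\<^bsub>F\<^esub> \<kappa> y l s j) \<odot>\<^bsub>S\<^esub> w l i j)"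
  proof (rule S.finsum_cong')
    fix s assume "s \<in> {..<m l}"
    then have s: "s < m l" by simp
    note ws = w_closed[OF l s s] w_closed[OF l i s] w_closed[OF l s j]
    have "?t l s = (?a \<otimes>\<^bsub>S\<^esub> x \<otimes>\<^bsub>S\<^esub> w l s s) \<otimes>\<^bsub>S\<^esub> (w l s s \<otimes>\<^bsub>S\<^esub> y \<otimes>\<^bsub>S\<^esub> ?b)"
    proof -
      have "w l s s \<otimes>\<^bsub>S\<^esub> (y \<otimes>\<^bsub>S\<^esub> ?b) = (w l s s \<otimes>\<^bsub>S\<^esub> w l s s) \<otimes>\<^bsub>S\<^esub> (y \<otimes>\<^bsub>S\<^esub> ?b)" using w_mult[OF l s s l s s] by simp
      then show ?thesis using a b x y ws by (simp add: S.m_assoc)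
    qed
    also have "\<dots> = (\<kappa> x l i s \<odot>\<^bsub>S\<^esub> w l i s) \<otimes>\<^bsub>S\<^esub> (\<kappa> y l s j \<odot>\<^bsub>S\<^esub> w l s j)"
      using \<kappa>(2)[OF x l i s] \<kappa>(2)[OF y l s j] by simp
    also have "\<dots> = \<kappa> x l i s \<odot>\<^bsub>S\<^esub> (w l i s \<otimes>\<^bsub>S\<^esub> (\<kappa> y l s j \<odot>\<^bsub>S\<^esub> w l s j))"
      by (rule A.smult_mult_left) (use kc[OF s] ws in auto)
    also have "w l i s \<otimes>\<^bsub>S\<^esub> (\<kappa> y l s j \<odot>\<^bsub>S\<^esub> w l s j) = \<kappa> y l s j \<odot>\<^bsub>S\<^esub> w l i j"
      using A.smult_mult_right[OF kc(2)[OF s] ws(2,3)] w_mult[OF l i s l s j] by simp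
    also have "\<kappa> x l i s \<odot>\<^bsub>S\<^esub> (\<kappa> y l s j \<odot>\<^bsub>S\<^esub> w l i j) = (\<kappa> x l i s \<otimes>\<^bsub>F\<^esub> \<kappa> y l s j) \<odot>\<^bsub>S\<^esub> w l i j"
      by (rule M.smult_assoc1[symmetric]) (use kc[OF s] wij in auto)
    finally show "?t l s = (\<kappa> x l i s \<otimes>\<^bsub>F\<^esub> \<kappa> y l s j) \<odot>\<^bsub>S\<^esub> w l i j" .
  qed (use kc wij in auto)
  also have "\<dots> = (\<Oplus>\<^bsub>F\<^esub>s\<in>{..<m l}. \<kappa> x l i s \<otimes>\<^bsub>F\<^esub> \<kappa> y l s j) \<odot>\<^bsub>S\<^esub> w l i j"
  proof -
    interpret T: abelian_group_hom F S "\<lambda>c. c \<odot>\<^bsub>S\<^esub> w l i j"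
      by (rule abelian_group_homI') (use wij in \<open>auto simp: F.abelian_group_axioms S.abelian_group_axioms M.smult_l_distr\<close>)
    show ?thesis by (rule T.hom_finsum[symmetric]) (use kc in auto)
  qed
  finally show "?a \<otimes>\<^bsub>S\<^esub> (x \<otimes>\<^bsub>S\<^esub> y) \<otimes>\<^bsub>S\<^esub> ?b = (\<Oplus>\<^bsub>F\<^esub>s\<in>{..<m l}. \<kappa> x l i s \<otimes>\<^bsub>F\<^esub> \<kappa> y l s j) \<odot>\<^bsub>S\<^esub> w l i j" .
  show "(\<Oplus>\<^bsub>F\<^esub>s\<in>{..<m l}. \<kappa> x l i s \<otimes>\<^bsub>F\<^esub> \<kappa> y l s j) \<in> carrier F" using kc by (auto intro!: F.finsum_closed)
qed (use assms in auto)

lemma \<kappa>_add: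
  assumes x: "x \<in> carrier S" and y: "y \<in> carrier S" and l: "l < r" and i: "i < m l" and j: "j < m l"
  shows "\<kappa> (x \<oplus>\<^bsub>S\<^esub> y) l i j = \<kappa> x l i j \<oplus>\<^bsub>F\<^esub> \<kappa> y l i j"
proof (rule \<kappa>_eqI)
  interpret T: abelian_group_hom S S "\<lambda>t. w l i i \<otimes>\<^bsub>S\<^esub> t \<otimes>\<^bsub>S\<^esub> w l j j" by (rule sandwich_hom) (use w_closed l i j in auto)
  show "w l i i \<otimes>\<^bsub>S\<^esub> (x \<oplus>\<^bsub>S\<^esub> y) \<otimes>\<^bsub>S\<^esub> w l j j = (\<kappa> x l i j \<oplus>\<^bsub>F\<^esub> \<kappa> y l i j) \<odot>\<^bsub>S\<^esub> w l i j"
    using T.hom_add[OF x y] \<kappa>[OF x l i j] \<kappa>[OF y l i j] w_closed[OF l i j] by (simp add: M.smult_l_distr)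
qed (use assms \<kappa>(1) in auto)

lemma \<kappa>_smult:
  assumes c: "c \<in> carrier F" and x: "x \<in> carrier S" and l: "l < r" and i: "i < m l" and j: "j < m l"
  shows "\<kappa> (c \<odot>\<^bsub>S\<^esub> x) l i j = c \<otimes>\<^bsub>F\<^esub> \<kappa> x l i j"
proof (rule \<kappa>_eqI)
  have ww: "w l i i \<in> carrier S" "w l j j \<in> carrier S" "w l i j \<in> carrier S" using w_closed l i j by auto
  have "w l i i \<otimes>\<^bsub>S\<^esub> (c \<odot>\<^bsub>S\<^esub> x) \<otimes>\<^bsub>S\<^esub> w l j j = c \<odot>\<^bsub>S\<^esub> (w l i i \<otimes>\<^bsub>S\<^esub> x \<otimes>\<^bsub>S\<^esub> w l j j)"
    using c x ww by (simp add: A.smult_mult_left A.smult_mult_right)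
  then show "w l i i \<otimes>\<^bsub>S\<^esub> (c \<odot>\<^bsub>S\<^esub> x) \<otimes>\<^bsub>S\<^esub> w l j j = (c \<otimes>\<^bsub>F\<^esub> \<kappa> x l i j) \<odot>\<^bsub>S\<^esub> w l i j"
    using \<kappa>[OF x l i j] c ww by (simp add: M.smult_assoc1)
qed (use assms \<kappa>(1) in auto)

lemma \<kappa>_w:
  assumes l: "l < r" and i: "i < m l" and j: "j < m l" and l': "l' < r" and i': "i' < m l'" and j': "j' < m l'"
  shows "\<kappa> (w l' i' j') l i j = (if l = l' \<and> i = i' \<and> j = j' then \<one>\<^bsub>F\<^esub> else \<zero>\<^bsub>F\<^esub>)"
proof (rule \<kappa>_eqI)
  have wc: "w l i j \<in> carrier S" "w l' i' j' \<in> carrier S" "w l j j \<in> carrier S" using w_closed assms by auto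
  show "w l i i \<otimes>\<^bsub>S\<^esub> w l' i' j' \<otimes>\<^bsub>S\<^esub> w l j j = (if l = l' \<and> i = i' \<and> j = j' then \<one>\<^bsub>F\<^esub> else \<zero>\<^bsub>F\<^esub>) \<odot>\<^bsub>S\<^esub> w l i j"
    using w_mult[OF l i i l' i' j'] w_mult[OF l i _ l j j, of j'] wc assms
    by auto
qed (use assms w_closed in auto)

lemma \<kappa>_hom:
  assumes "l < r" "i < m l" "j < m l" shows "abelian_group_hom S F (\<lambda>x. \<kappa> x l i j)"
  by (rule abelian_group_homI') (use assms \<kappa>(1) \<kappa>_add in \<open>auto simp: F.abelian_group_axioms S.abelian_group_axioms\<close>)

text \<open>Equal entries mean equal Peirce components; summing over the idempotents on the right
  and then over those on the left recovers the elements.\<close>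

lemma \<kappa>_inj:
  assumes x: "x \<in> carrier S" and y: "y \<in> carrier S"
    and eq: "\<And>l i j. l < r \<Longrightarrow> i < m l \<Longrightarrow> j < m l \<Longrightarrow> \<kappa> x l i j = \<kappa> y l i j"
  shows "x = y"
proof -
  have ww: "w l i i \<in> carrier S" if "l < r" "i < m l" for l i using w_closed that by simp
  have 1: "w l i i \<otimes>\<^bsub>S\<^esub> x \<otimes>\<^bsub>S\<^esub> w l' j j = w l i i \<otimes>\<^bsub>S\<^esub> y \<otimes>\<^bsub>S\<^esub> w l' j j"
    if "l < r" "i < m l" "l' < r" "j < m l'" for l i l' j
    using that eq \<kappa>(2)[OF x] \<kappa>(2)[OF y] w_off[OF x] w_off[OF y] by (cases "l = l'") auto
  have 2: "w l i i \<otimes>\<^bsub>S\<^esub> x = w l i i \<otimes>\<^bsub>S\<^esub> y" if l: "l < r" "i < m l" for l i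
  proof -
    have e: "w l i i \<otimes>\<^bsub>S\<^esub> z = (\<Oplus>\<^bsub>S\<^esub>l'\<in>{..<r}. \<Oplus>\<^bsub>S\<^esub>j\<in>{..<m l'}. w l i i \<otimes>\<^bsub>S\<^esub> z \<otimes>\<^bsub>S\<^esub> w l' j j)" if "z \<in> carrier S" for z
    proof -
      have "w l i i \<otimes>\<^bsub>S\<^esub> z \<otimes>\<^bsub>S\<^esub> \<one>\<^bsub>S\<^esub> = (\<Oplus>\<^bsub>S\<^esub>l'\<in>{..<r}. \<Oplus>\<^bsub>S\<^esub>j\<in>{..<m l'}. w l i i \<otimes>\<^bsub>S\<^esub> z \<otimes>\<^bsub>S\<^esub> w l' j j \<otimes>\<^bsub>S\<^esub> \<one>\<^bsub>S\<^esub>)"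
        by (rule decompose_one) (use that ww l in auto)
      also have "\<dots> = (\<Oplus>\<^bsub>S\<^esub>l'\<in>{..<r}. \<Oplus>\<^bsub>S\<^esub>j\<in>{..<m l'}. w l i i \<otimes>\<^bsub>S\<^esub> z \<otimes>\<^bsub>S\<^esub> w l' j j)"
        by (rule S.finsum_cong2) (use that ww l in auto)
      finally show ?thesis using that ww[OF l] by simp
    qed
    have "w l i i \<otimes>\<^bsub>S\<^esub> x = (\<Oplus>\<^bsub>S\<^esub>l'\<in>{..<r}. \<Oplus>\<^bsub>S\<^esub>j\<in>{..<m l'}. w l i i \<otimes>\<^bsub>S\<^esub> x \<otimes>\<^bsub>S\<^esub> w l' j j)" by (rule e[OF x])
    also have "\<dots> = (\<Oplus>\<^bsub>S\<^esub>l'\<in>{..<r}. \<Oplus>\<^bsub>S\<^esub>j\<in>{..<m l'}. w l i i \<otimes>\<^bsub>S\<^esub> y \<otimes>\<^bsub>S\<^esub> w l' j j)"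
      by (rule S.finsum_cong2) (use x y ww l 1[OF l] in auto)
    also have "\<dots> = w l i i \<otimes>\<^bsub>S\<^esub> y" by (rule e[OF y, symmetric])
    finally show ?thesis .
  qed
  have e: "z = (\<Oplus>\<^bsub>S\<^esub>l\<in>{..<r}. \<Oplus>\<^bsub>S\<^esub>i\<in>{..<m l}. w l i i \<otimes>\<^bsub>S\<^esub> z)" if "z \<in> carrier S" for z
  proof -
    have "\<one>\<^bsub>S\<^esub> \<otimes>\<^bsub>S\<^esub> z = (\<Oplus>\<^bsub>S\<^esub>l\<in>{..<r}. \<Oplus>\<^bsub>S\<^esub>i\<in>{..<m l}. \<one>\<^bsub>S\<^esub> \<otimes>\<^bsub>S\<^esub> w l i i \<otimes>\<^bsub>S\<^esub> z)"
      by (rule decompose_one) (use that in auto)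
    also have "\<dots> = (\<Oplus>\<^bsub>S\<^esub>l\<in>{..<r}. \<Oplus>\<^bsub>S\<^esub>i\<in>{..<m l}. w l i i \<otimes>\<^bsub>S\<^esub> z)"
      by (rule S.finsum_cong2) (use that ww in auto)
    finally show ?thesis using that by simp
  qed
  have "x = (\<Oplus>\<^bsub>S\<^esub>l\<in>{..<r}. \<Oplus>\<^bsub>S\<^esub>i\<in>{..<m l}. w l i i \<otimes>\<^bsub>S\<^esub> x)" by (rule e[OF x])
  also have "\<dots> = (\<Oplus>\<^bsub>S\<^esub>l\<in>{..<r}. \<Oplus>\<^bsub>S\<^esub>i\<in>{..<m l}. w l i i \<otimes>\<^bsub>S\<^esub> y)"
    by (rule S.finsum_cong2) (use x y ww 2 in auto)
  also have "\<dots> = y" by (rule e[OF y, symmetric])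
  finally show ?thesis .
qed

lemma \<kappa>_surj:
  assumes c: "\<And>l i j. l < r \<Longrightarrow> i < m l \<Longrightarrow> j < m l \<Longrightarrow> c l i j \<in> carrier F"
  shows "\<exists>x\<in>carrier S. \<forall>l<r. \<forall>i<m l. \<forall>j<m l. \<kappa> x l i j = c l i j"
proof -
  let ?t = "\<lambda>l i j. c l i j \<odot>\<^bsub>S\<^esub> w l i j"
  define x where "x = (\<Oplus>\<^bsub>S\<^esub>l\<in>{..<r}. \<Oplus>\<^bsub>S\<^esub>i\<in>{..<m l}. \<Oplus>\<^bsub>S\<^esub>j\<in>{..<m l}. ?t l i j)"
  have tc: "?t l i j \<in> carrier S" if "l < r" "i < m l" "j < m l" for l i j using c w_closed that by simp
  have s1: "(\<Oplus>\<^bsub>S\<^esub>j\<in>{..<m l}. ?t l i j) \<in> carrier S" if "l < r" "i < m l" for l i using tc that by (auto intro!: S.finsum_closed)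
  have s2: "(\<Oplus>\<^bsub>S\<^esub>i\<in>{..<m l}. \<Oplus>\<^bsub>S\<^esub>j\<in>{..<m l}. ?t l i j) \<in> carrier S" if "l < r" for l using s1 that by (auto intro!: S.finsum_closed)
  have xc: "x \<in> carrier S" unfolding x_def using s2 by (auto intro!: S.finsum_closed)
  have "\<kappa> x l i j = c l i j" if l: "l < r" and i: "i < m l" and j: "j < m l" for l i j
  proof -
    interpret T: abelian_group_hom S F "\<lambda>x. \<kappa> x l i j" by (rule \<kappa>_hom[OF l i j])
    have kt: "\<kappa> (?t l' i' j') l i j = (if l' = l \<and> i' = i \<and> j' = j then c l i j else \<zero>\<^bsub>F\<^esub>)"
      if "l' < r" "i' < m l'" "j' < m l'" for l' i' j'
      using that l i j c w_closed by (auto simp: \<kappa>_smult \<kappa>_w)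
    have "\<kappa> x l i j = (\<Oplus>\<^bsub>F\<^esub>l'\<in>{..<r}. \<kappa> (\<Oplus>\<^bsub>S\<^esub>i'\<in>{..<m l'}. \<Oplus>\<^bsub>S\<^esub>j'\<in>{..<m l'}. ?t l' i' j') l i j)"
      unfolding x_def by (rule T.hom_finsum) (use s2 in auto)
    also have "\<dots> = (\<Oplus>\<^bsub>F\<^esub>l'\<in>{..<r}. \<Oplus>\<^bsub>F\<^esub>i'\<in>{..<m l'}. \<Oplus>\<^bsub>F\<^esub>j'\<in>{..<m l'}. \<kappa> (?t l' i' j') l i j)"
    proof (rule F.finsum_cong')
      fix l' assume "l' \<in> {..<r}"
      then have l': "l' < r" by simp
      have "\<kappa> (\<Oplus>\<^bsub>S\<^esub>i'\<in>{..<m l'}. \<Oplus>\<^bsub>S\<^esub>j'\<in>{..<m l'}. ?t l' i' j') l i j = (\<Oplus>\<^bsub>F\<^esub>i'\<in>{..<m l'}. \<kappa> (\<Oplus>\<^bsub>S\<^esub>j'\<in>{..<m l'}. ?t l' i' j') l i j)"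
        by (rule T.hom_finsum) (use s1 l' in auto)
      also have "\<dots> = (\<Oplus>\<^bsub>F\<^esub>i'\<in>{..<m l'}. \<Oplus>\<^bsub>F\<^esub>j'\<in>{..<m l'}. \<kappa> (?t l' i' j') l i j)"
      proof (rule F.finsum_cong')
        fix i' assume "i' \<in> {..<m l'}"
        then show "\<kappa> (\<Oplus>\<^bsub>S\<^esub>j'\<in>{..<m l'}. ?t l' i' j') l i j = (\<Oplus>\<^bsub>F\<^esub>j'\<in>{..<m l'}. \<kappa> (?t l' i' j') l i j)"
          by (intro T.hom_finsum) (use tc l' in auto)
      qed (use tc l' in \<open>auto intro!: F.finsum_closed\<close>)
      finally show "\<kappa> (\<Oplus>\<^bsub>S\<^esub>i'\<in>{..<m l'}. \<Oplus>\<^bsub>S\<^esub>j'\<in>{..<m l'}. ?t l' i' j') l i j = (\<Oplus>\<^bsub>F\<^esub>i'\<in>{..<m l'}. \<Oplus>\<^bsub>F\<^esub>j'\<in>{..<m l'}. \<kappa> (?t l' i' j') l i j)" .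
    qed (use tc in \<open>auto intro!: F.finsum_closed\<close>)
    also have "\<dots> = (\<Oplus>\<^bsub>F\<^esub>i'\<in>{..<m l}. \<Oplus>\<^bsub>F\<^esub>j'\<in>{..<m l}. \<kappa> (?t l i' j') l i j)"
      by (rule F.finsum_single) (use l kt c i j tc in \<open>auto intro!: F.finsum_closed F.finsum_all_zero\<close>)
    also have "\<dots> = (\<Oplus>\<^bsub>F\<^esub>j'\<in>{..<m l}. \<kappa> (?t l i j') l i j)"
      by (rule F.finsum_single) (use l kt c i j tc in \<open>auto intro!: F.finsum_closed F.finsum_all_zero\<close>)
    also have "\<dots> = \<kappa> (?t l i j) l i j"
      by (rule F.finsum_single) (use l kt c i j tc in auto)
    finally show ?thesis using kt[OF l i j] by simp
  qed
  then show ?thesis using xc by blast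
qed

lemma \<Phi>_iso: "\<Phi> \<in> algebra_iso F S (product_algebra {..<r} (\<lambda>l. matrix_algebra F (m l)))"
proof -
  let ?P = "product_algebra {..<r} (\<lambda>l. matrix_algebra F (m l))"
  have cl: "\<Phi> x \<in> carrier ?P" if "x \<in> carrier S" for x
    using \<kappa>(1)[OF that] by (auto simp: \<Phi>_def product_algebra_def matrix_algebra_def split: if_splits)
  have hom: "\<Phi> \<in> ring_hom S ?P"
  proof (rule ring_hom_memI)
    fix x y assume xy: "x \<in> carrier S" "y \<in> carrier S"
    show "\<Phi> (x \<otimes>\<^bsub>S\<^esub> y) = \<Phi> x \<otimes>\<^bsub>?P\<^esub> \<Phi> y"
    proof (rule ext)+
      fix l :: nat and q :: "nat \<times> nat"
      obtain i j where [simp]: "q = (i, j)" by fastforce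
      show "\<Phi> (x \<otimes>\<^bsub>S\<^esub> y) l q = (\<Phi> x \<otimes>\<^bsub>?P\<^esub> \<Phi> y) l q"
      proof (cases "l < r \<and> i < m l \<and> j < m l")
        case True
        have "(\<Oplus>\<^bsub>F\<^esub>s\<in>{..<m l}. \<Phi> x l (i, s) \<otimes>\<^bsub>F\<^esub> \<Phi> y l (s, j)) = (\<Oplus>\<^bsub>F\<^esub>s\<in>{..<m l}. \<kappa> x l i s \<otimes>\<^bsub>F\<^esub> \<kappa> y l s j)"
          by (rule F.finsum_cong') (use True \<kappa>(1) xy in \<open>auto simp: \<Phi>_def\<close>)
        then show ?thesis using True \<kappa>_mult[OF xy, of l i j]
          by (simp add: \<Phi>_def[of "x \<otimes>\<^bsub>S\<^esub> y"] product_algebra_def matrix_algebra_def)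
      next
        case False then show ?thesis by (auto simp: \<Phi>_def product_algebra_def matrix_algebra_def)
      qed
    qed
    show "\<Phi> (x \<oplus>\<^bsub>S\<^esub> y) = \<Phi> x \<oplus>\<^bsub>?P\<^esub> \<Phi> y"
      by (intro ext) (auto simp: \<Phi>_def product_algebra_def matrix_algebra_def \<kappa>_add xy)
  next
    have k1: "\<kappa> \<one>\<^bsub>S\<^esub> l i j = (if i = j then \<one>\<^bsub>F\<^esub> else \<zero>\<^bsub>F\<^esub>)" if "l < r" "i < m l" "j < m l" for l i j
      by (rule \<kappa>_eqI) (use that w_mult[of l i i l j j] w_closed in auto)
    show "\<Phi> \<one>\<^bsub>S\<^esub> = \<one>\<^bsub>?P\<^esub>"
      by (intro ext) (auto simp: \<Phi>_def product_algebra_def matrix_algebra_def k1)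
  qed (rule cl)
  have inj: "inj_on \<Phi> (carrier S)"
  proof (rule inj_onI)
    fix x y assume xy: "x \<in> carrier S" "y \<in> carrier S" and e: "\<Phi> x = \<Phi> y"
    show "x = y"
    proof (rule \<kappa>_inj[OF xy])
      fix l i j assume "l < r" "i < m l" "j < m l"
      then show "\<kappa> x l i j = \<kappa> y l i j" using fun_cong[OF fun_cong[OF e, of l], of "(i, j)"] by (simp add: \<Phi>_def)
    qed
  qed
  have surj: "z \<in> \<Phi> ` carrier S" if z: "z \<in> carrier ?P" for z
  proof -
    have zc: "z l \<in> {..<m l} \<times> {..<m l} \<rightarrow>\<^sub>E carrier F" if "l < r" for l
      using z that by (auto simp: product_algebra_def matrix_algebra_def PiE_iff)
    obtain x where x: "x \<in> carrier S" "\<forall>l<r. \<forall>i<m l. \<forall>j<m l. \<kappa> x l i j = z l (i, j)"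
      using \<kappa>_surj[of "\<lambda>l i j. z l (i, j)"] zc by (auto simp: PiE_iff)
    have "\<Phi> x = z"
    proof (rule ext)+
      fix l :: nat and q :: "nat \<times> nat"
      obtain i j where [simp]: "q = (i, j)" by fastforce
      show "\<Phi> x l q = z l q"
      proof (cases "l < r")
        case True then show ?thesis using x zc[OF True] by (auto simp: \<Phi>_def PiE_def extensional_def)
      next
        case False then show ?thesis using z by (auto simp: \<Phi>_def product_algebra_def PiE_def extensional_def)
      qed
    qed
    then show ?thesis using x by blast
  qed
  have "bij_betw \<Phi> (carrier S) (carrier ?P)"
    unfolding bij_betw_def using inj surj cl by blast
  moreover have "\<Phi> (c \<odot>\<^bsub>S\<^esub> x) = c \<odot>\<^bsub>?P\<^esub> \<Phi> x" if "c \<in> carrier F" "x \<in> carrier S" for c x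
    by (intro ext) (auto simp: \<Phi>_def product_algebra_def matrix_algebra_def \<kappa>_smult that)
  ultimately show ?thesis unfolding algebra_iso_def ring_iso_def using hom by blast
qed

end

section \<open>Separability of minimal polynomials\<close>

context ring begin

lemma combine_finsum:
  assumes "length Ks = length Us" "set Ks \<subseteq> carrier R" "set Us \<subseteq> carrier R"
  shows "combine Ks Us = (\<Oplus>i\<in>{..<length Us}. Ks ! i \<otimes> Us ! i)"
  using assms
proof (induction Ks Us rule: list_induct2)
  case (Cons k Ks u Us)
  let ?f = "\<lambda>i. if i < length (u # Us) then (k # Ks) ! i \<otimes> (u # Us) ! i else \<zero>"
  have nth: "(k # Ks) ! i \<in> carrier R" "(u # Us) ! i \<in> carrier R" if "i < length (u # Us)" for i
    using Cons.prems nth_mem[of i "k # Ks"] nth_mem[of i "u # Us"] that Cons.hyps by auto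
  have fc: "?f i \<in> carrier R" for i using nth by auto
  have "(\<Oplus>i\<in>{..<length (u # Us)}. (k # Ks) ! i \<otimes> (u # Us) ! i) = (\<Oplus>i\<in>{..<Suc (length Us)}. ?f i)"
    by (rule finsum_cong') (use fc in \<open>auto simp del: nth.simps\<close>)
  also have "\<dots> = ?f 0 \<oplus> (\<Oplus>i\<in>{..<length Us}. ?f (Suc i))" by (rule finsum_lessThan_Suc_shift[OF fc])
  also have "(\<Oplus>i\<in>{..<length Us}. ?f (Suc i)) = (\<Oplus>i\<in>{..<length Us}. Ks ! i \<otimes> Us ! i)"
    by (rule finsum_cong') (use nth[of "Suc _"] in auto)
  finally show ?case using Cons by simp
qed simp

lemma eval_finsum:
  assumes "set q \<subseteq> carrier R" "x \<in> carrier R"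
  shows "eval q x = (\<Oplus>i\<in>{..<length q}. coeff q i \<otimes> x [^] i)"
  using assms(1)
proof (induction q)
  case (Cons a q)
  have c: "coeff q i \<in> carrier R" for i using Cons.prems by simp
  have "(\<Oplus>i\<in>{..<length (a # q)}. coeff (a # q) i \<otimes> x [^] i)
      = coeff (a # q) (length q) \<otimes> x [^] length q \<oplus> (\<Oplus>i\<in>{..<length q}. coeff (a # q) i \<otimes> x [^] i)"
  proof -
    have "{..<length (a # q)} = insert (length q) {..<length q}" by auto
    moreover have "(\<lambda>i. coeff (a # q) i \<otimes> x [^] i) \<in> {..<length q} \<rightarrow> carrier R"
      using c Cons.prems assms(2) by auto
    moreover have "coeff (a # q) (length q) \<otimes> x [^] length q \<in> carrier R"
      using Cons.prems assms(2) by auto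
    ultimately show ?thesis by (simp add: finsum_insert)
  qed
  also have "(\<Oplus>i\<in>{..<length q}. coeff (a # q) i \<otimes> x [^] i) = (\<Oplus>i\<in>{..<length q}. coeff q i \<otimes> x [^] i)"
    by (rule finsum_cong') (use c assms(2) in auto)
  finally show ?case using Cons by simp
qed simp

lemma normalize_Nil_imp_zero: "normalize q = [] \<Longrightarrow> a \<in> set q \<Longrightarrow> a = \<zero>"
  by (induction q) (auto split: if_splits)

lemma subring_add_pow_closed:
  assumes "subring H R" "c \<in> H" shows "[(n::nat)] \<cdot> c \<in> H"
  by (induction n) (use assms subringE[OF assms(1)] in auto)

lemma subring_pow_closed:
  assumes "subring H R" "c \<in> H" shows "c [^] (n::nat) \<in> H"
  by (induction n) (use assms subringE[OF assms(1)] in auto)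

end

lemma (in cring) freshman_dream_finsum:
  assumes "finite I" "f \<in> I \<rightarrow> carrier R" and p: "Factorial_Ring.prime p" "[(p::nat)] \<cdot> \<one> = \<zero>"
  shows "(\<Oplus>i\<in>I. f i) [^] p = (\<Oplus>i\<in>I. f i [^] p)"
  using assms(1,2)
proof (induction I rule: finite_induct)
  case empty
  have "p \<noteq> 0" using p(1) by auto
  then show ?case by (simp add: nat_pow_zero)
next
  case (insert a I)
  then have c: "f \<in> I \<rightarrow> carrier R" "f a \<in> carrier R" by auto
  then have "(f a \<oplus> (\<Oplus>i\<in>I. f i)) [^] p = f a [^] p \<oplus> (\<Oplus>i\<in>I. f i) [^] p"
    by (intro freshman_dream[OF _ _ _ p]) (auto simp: m_comm)
  moreover have "(\<Oplus>i\<in>insert a I. f i [^] p) = f a [^] p \<oplus> (\<Oplus>i\<in>I. f i [^] p)"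
    by (rule finsum_insert) (use insert.hyps c in auto)
  ultimately show ?case using insert c by simp
qed

context field begin

text \<open>By Bezout some multiple of \<open>i\<close> is \<open>1\<close> modulo \<open>p\<close>,
  and both \<open>p\<close> and \<open>i\<close> kill \<open>c\<close>.\<close>

lemma char_not_dvd:
  assumes p: "Factorial_Ring.prime p" "[(p::nat)] \<cdot> \<one> = \<zero>" and c: "c \<in> carrier R" "[i] \<cdot> c = \<zero>" "\<not> p dvd i"
  shows "c = \<zero>"
proof -
  have "gcd i p = 1" using prime_imp_coprime[OF p(1) assms(5)] by (simp add: coprime_iff_gcd_eq_1 gcd.commute)
  moreover have "i \<noteq> 0" using assms(5) by (metis dvd_0_right)
  ultimately obtain a b where ab: "i * a = p * b + 1" using bezout_nat[of i p] by auto
  have "[(i * a)] \<cdot> c = \<zero>"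
    using add.nat_pow_pow[OF c(1), of a i] c(2) by (simp add: add.nat_pow_one)
  moreover have "[(p * b)] \<cdot> c = \<zero>" by (rule add_pow_dvd_zero[OF char_zero_all[OF p(2) c(1)] c(1)]) simp
  ultimately show ?thesis using c(1) add.nat_pow_mult[OF c(1), of "p * b" 1] ab by simp
qed

text \<open>The \<open>F\<close>-span of the \<open>p\<close>-th powers of a basis is a subring
  containing \<open>F\<close> and all \<open>p\<close>-th powers, so by \<open>sep\<close> it is the
  whole field. Spanning with as many elements as a basis has, these powers must be independent. A
  relation with one coefficient equal to \<open>1\<close> is the case that arises: it is the leading
  coefficient of a monic minimal polynomial.\<close>

lemma pow_base_relation_trivial:
  assumes F: "subfield F R" and p: "Factorial_Ring.prime p" "[(p::nat)] \<cdot> \<one> = \<zero>"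
    and sep: "\<And>W. subring W R \<Longrightarrow> F \<subseteq> W \<Longrightarrow> (\<And>y. y \<in> carrier R \<Longrightarrow> y [^] p \<in> W) \<Longrightarrow> carrier R \<subseteq> W"
    and bs: "set bs \<subseteq> carrier R" "independent F bs" "Span F bs = carrier R"
    and d: "\<And>i. i < length bs \<Longrightarrow> d i \<in> F" and rel: "(\<Oplus>i\<in>{..<length bs}. d i \<otimes> (bs ! i) [^] p) = \<zero>"
    and i0: "i\<^sub>0 < length bs"
  shows "d i\<^sub>0 \<noteq> \<one>"
proof
  assume d1: "d i\<^sub>0 = \<one>"
  define N where "N = length bs"
  have i0N: "i\<^sub>0 < N" using i0 by (simp add: N_def)
  define b where "b i = bs ! i" for i
  note Fs = subringE[OF subfieldE(1)[OF F]]
  have Fc: "c \<in> F \<Longrightarrow> c \<in> carrier R" for c using Fs(1) by blast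
  have bc: "b i \<in> carrier R" if "i < N" for i using bs(1) that nth_mem by (auto simp: b_def N_def)
  define P where "P i = b i [^] p" for i
  have Pc: "P i \<in> carrier R" if "i < N" for i using bc[OF that] by (simp add: P_def)
  have A: "\<exists>c. (\<forall>i<N. c i \<in> F) \<and> z = (\<Oplus>i\<in>{..<N}. c i \<otimes> b i)" if z: "z \<in> carrier R" for z
  proof -
    obtain Ks where Ks: "z = combine Ks bs" "length Ks = length bs" "set Ks \<subseteq> F"
      using z bs(3) Span_eq_combine_set_length_version[OF F bs(1)] by blast
    have "z = (\<Oplus>i\<in>{..<N}. Ks ! i \<otimes> b i)"
      unfolding Ks(1) N_def b_def by (rule combine_finsum) (use Ks bs(1) Fc in auto)
    moreover have "\<forall>i<N. Ks ! i \<in> F" using Ks(2,3) nth_mem by (auto simp: N_def)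
    ultimately show ?thesis by (intro exI[of _ "\<lambda>i. Ks ! i"]) blast
  qed
  have Bi: "c i = \<zero>" if c: "\<And>i. i < N \<Longrightarrow> c i \<in> F" and z: "(\<Oplus>i\<in>{..<N}. c i \<otimes> b i) = \<zero>" and i: "i < N" for c i
  proof -
    let ?Ks = "map c [0..<N]"
    have s: "set ?Ks \<subseteq> F" using c by auto
    have "combine ?Ks bs = (\<Oplus>i\<in>{..<length bs}. ?Ks ! i \<otimes> bs ! i)"
      by (rule combine_finsum) (use s bs(1) Fc in \<open>auto simp: N_def\<close>)
    also have "\<dots> = (\<Oplus>i\<in>{..<N}. c i \<otimes> b i)"
      unfolding N_def[symmetric] by (rule finsum_cong') (use c Fc bc in \<open>auto simp: b_def\<close>)
    finally have "combine ?Ks bs = \<zero>" using z by simp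
    then have "set (take (length bs) ?Ks) \<subseteq> {\<zero>}" using independent_imp_trivial_combine[OF F bs(2) s] by blast
    then show ?thesis using i by (auto simp: N_def image_subset_iff)
  qed
  define W where "W = {(\<Oplus>i\<in>{..<N}. c i \<otimes> P i) | c. \<forall>i<N. c i \<in> F}"
  have WI: "(\<Oplus>i\<in>{..<N}. c i \<otimes> P i) \<in> W" if "\<And>i. i < N \<Longrightarrow> c i \<in> F" for c
    unfolding W_def using that by blast
  have WE: "\<exists>c. (\<forall>i<N. c i \<in> F) \<and> z = (\<Oplus>i\<in>{..<N}. c i \<otimes> P i)" if "z \<in> W" for z
    using that by (auto simp: W_def)
  have Wc: "W \<subseteq> carrier R" using Fc Pc by (auto simp: W_def intro!: finsum_closed)
  have Wadd: "y \<oplus> z \<in> W" if "y \<in> W" "z \<in> W" for y z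
  proof -
    obtain c d where c: "\<forall>i<N. c i \<in> F" "y = (\<Oplus>i\<in>{..<N}. c i \<otimes> P i)" and d: "\<forall>i<N. d i \<in> F" "z = (\<Oplus>i\<in>{..<N}. d i \<otimes> P i)"
      using WE[OF \<open>y \<in> W\<close>] WE[OF \<open>z \<in> W\<close>] by auto
    have "(\<Oplus>i\<in>{..<N}. (c i \<oplus> d i) \<otimes> P i) = (\<Oplus>i\<in>{..<N}. c i \<otimes> P i \<oplus> d i \<otimes> P i)"
      by (rule finsum_cong') (use c(1) d(1) Fc Pc in \<open>auto simp: l_distr\<close>)
    also have "\<dots> = y \<oplus> z" unfolding c(2) d(2) by (rule finsum_addf) (use c(1) d(1) Fc Pc in auto)
    finally show ?thesis using WI[of "\<lambda>i. c i \<oplus> d i"] c(1) d(1) Fs(7) by simp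
  qed
  have Wsm: "a \<otimes> y \<in> W" if "a \<in> F" "y \<in> W" for a y
  proof -
    obtain c where c: "\<forall>i<N. c i \<in> F" "y = (\<Oplus>i\<in>{..<N}. c i \<otimes> P i)" using WE[OF \<open>y \<in> W\<close>] by auto
    have ac: "a \<in> carrier R" using Fc that by blast
    have "(\<Oplus>i\<in>{..<N}. (a \<otimes> c i) \<otimes> P i) = (\<Oplus>i\<in>{..<N}. a \<otimes> (c i \<otimes> P i))"
      by (rule finsum_cong') (use c(1) ac Fc Pc in \<open>auto simp: m_assoc\<close>)
    also have "\<dots> = a \<otimes> y" unfolding c(2) by (rule finsum_rdistr[symmetric]) (use c(1) ac Fc Pc in auto)
    finally show ?thesis using WI[of "\<lambda>i. a \<otimes> c i"] c(1) that Fs(6) by simp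
  qed
  have Wpow: "z [^] p \<in> W" if z: "z \<in> carrier R" for z
  proof -
    obtain c where c: "\<forall>i<N. c i \<in> F" "z = (\<Oplus>i\<in>{..<N}. c i \<otimes> b i)" using A[OF z] by blast
    have "z [^] p = (\<Oplus>i\<in>{..<N}. (c i \<otimes> b i) [^] p)"
      unfolding c(2) by (rule freshman_dream_finsum[OF _ _ p]) (use c(1) Fc bc in auto)
    also have "\<dots> = (\<Oplus>i\<in>{..<N}. c i [^] p \<otimes> P i)"
      by (rule finsum_cong') (use c(1) Fc bc in \<open>auto simp: P_def nat_pow_distrib\<close>)
    finally show ?thesis using WI[of "\<lambda>i. c i [^] p"] c(1) subring_pow_closed[OF subfieldE(1)[OF F]] by simp
  qed
  have W1: "\<one> \<in> W" using Wpow[of \<one>] by simp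
  have FW: "F \<subseteq> W"
  proof
    fix a assume "a \<in> F" then show "a \<in> W" using Wsm[of a \<one>] W1 Fc by auto
  qed
  have W0: "\<zero> \<in> W" using FW Fs(2) by blast
  have Wfin: "(\<Oplus>i\<in>I. f i) \<in> W" if "finite I" "\<And>i. i \<in> I \<Longrightarrow> f i \<in> W" for I and f :: "nat \<Rightarrow> 'a"
    using that
  proof (induction I rule: finite_induct)
    case (insert x I)
    then have "f \<in> I \<rightarrow> carrier R" "f x \<in> carrier R" using Wc by auto
    then show ?case using insert Wadd by simp
  qed (simp add: W0)
  have PW: "P i \<otimes> y \<in> W" if i: "i < N" and y: "y \<in> W" for i y
  proof -
    obtain c where c: "\<forall>i<N. c i \<in> F" "y = (\<Oplus>i\<in>{..<N}. c i \<otimes> P i)" using WE[OF y] by auto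
    have "P i \<otimes> y = (\<Oplus>j\<in>{..<N}. P i \<otimes> (c j \<otimes> P j))"
      unfolding c(2) by (rule finsum_rdistr) (use c(1) i Fc Pc in auto)
    also have "\<dots> \<in> W"
    proof (rule Wfin)
      fix j assume "j \<in> {..<N}"
      then have j: "j < N" by simp
      have cj: "c j \<in> F" "c j \<in> carrier R" using c(1) j Fc by auto
      have "P i \<otimes> (c j \<otimes> P j) = c j \<otimes> (b i \<otimes> b j) [^] p"
        using cj(2) Pc[OF i] Pc[OF j] bc[OF i] bc[OF j] by (simp add: nat_pow_distrib P_def m_lcomm)
      then show "P i \<otimes> (c j \<otimes> P j) \<in> W" using Wsm[OF cj(1) Wpow[of "b i \<otimes> b j"]] bc i j by simp
    qed simp
    finally show ?thesis .
  qed
  have Wmult: "z \<otimes> y \<in> W" if z: "z \<in> W" and y: "y \<in> W" for z y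
  proof -
    have yc: "y \<in> carrier R" using y Wc by blast
    obtain c where c: "\<forall>i<N. c i \<in> F" "z = (\<Oplus>i\<in>{..<N}. c i \<otimes> P i)" using WE[OF z] by auto
    have "z \<otimes> y = (\<Oplus>i\<in>{..<N}. (c i \<otimes> P i) \<otimes> y)"
      unfolding c(2) by (rule finsum_ldistr) (use c(1) yc Fc Pc in auto)
    also have "\<dots> \<in> W"
    proof (rule Wfin)
      fix i assume "i \<in> {..<N}"
      then have i: "i < N" by simp
      have "(c i \<otimes> P i) \<otimes> y = c i \<otimes> (P i \<otimes> y)" using c(1) i Fc Pc yc by (simp add: m_assoc)
      then show "(c i \<otimes> P i) \<otimes> y \<in> W" using Wsm[OF _ PW[OF i y]] c(1) i by simp
    qed simp
    finally show ?thesis .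
  qed
  have "subring W R"
  proof (rule subringI)
    show "\<ominus> y \<in> W" if "y \<in> W" for y
    proof -
      have "y \<in> carrier R" using that Wc by blast
      then have "\<ominus> y = (\<ominus> \<one>) \<otimes> y" by (simp add: l_minus)
      then show ?thesis using Wsm[OF Fs(5)[OF Fs(3)] that] by simp
    qed
  qed (use Wc W1 Wmult Wadd in auto)
  then have all: "carrier R \<subseteq> W" using sep FW Wpow by blast
  have dF: "d i \<in> F" if "i < N" for i using d that by (simp add: N_def)
  have rel': "(\<Oplus>i\<in>{..<N}. d i \<otimes> P i) = \<zero>" using rel by (simp add: N_def P_def b_def)
  \<comment> \<open>The relation eliminates the power with index \<open>i\<^sub>0\<close>:
    subtracting \<open>c i\<^sub>0\<close> times the relation leaves an expression of
    \<open>b i\<close> through the other \<open>N - 1\<close> powers.\<close>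
  have "\<exists>c. (\<forall>j<N. c j \<in> F) \<and> c i\<^sub>0 = \<zero> \<and> b i = (\<Oplus>j\<in>{..<N}. c j \<otimes> P j)" if i: "i < N" for i
  proof -
    obtain c where c: "\<forall>j<N. c j \<in> F" "b i = (\<Oplus>j\<in>{..<N}. c j \<otimes> P j)" using WE[of "b i"] all bc[OF i] by blast
    have cc: "c j \<in> carrier R" "d j \<in> carrier R" if "j < N" for j using c(1) dF that Fc by auto
    let ?c = "\<lambda>j. c j \<oplus> (\<ominus> c i\<^sub>0) \<otimes> d j"
    have "(\<Oplus>j\<in>{..<N}. ?c j \<otimes> P j) = (\<Oplus>j\<in>{..<N}. c j \<otimes> P j \<oplus> (\<ominus> c i\<^sub>0) \<otimes> (d j \<otimes> P j))"
      by (rule finsum_cong') (use cc Pc i0N in \<open>auto simp: l_distr m_assoc\<close>)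
    also have "\<dots> = b i \<oplus> (\<Oplus>j\<in>{..<N}. (\<ominus> c i\<^sub>0) \<otimes> (d j \<otimes> P j))"
      unfolding c(2) by (rule finsum_addf) (use cc Pc i0N in auto)
    also have "(\<Oplus>j\<in>{..<N}. (\<ominus> c i\<^sub>0) \<otimes> (d j \<otimes> P j)) = (\<ominus> c i\<^sub>0) \<otimes> (\<Oplus>j\<in>{..<N}. d j \<otimes> P j)"
      by (rule finsum_rdistr[symmetric]) (use cc Pc i0N in auto)
    finally have "(\<Oplus>j\<in>{..<N}. ?c j \<otimes> P j) = b i" using rel' cc i0N bc[OF i] by simp
    moreover have "?c i\<^sub>0 = \<zero>" using cc i0N d1 by (simp add: r_neg)
    moreover have "\<forall>j<N. ?c j \<in> F" using c(1) dF Fs(5-7) i0N by simp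
    ultimately show ?thesis by (intro exI[of _ ?c]) simp
  qed
  then have "\<forall>i. \<exists>c. i < N \<longrightarrow> (\<forall>j<N. c j \<in> F) \<and> c i\<^sub>0 = \<zero> \<and> b i = (\<Oplus>j\<in>{..<N}. c j \<otimes> P j)" by blast
  then have "\<exists>M. \<forall>i. i < N \<longrightarrow> (\<forall>j<N. M i j \<in> F) \<and> M i i\<^sub>0 = \<zero> \<and> b i = (\<Oplus>j\<in>{..<N}. M i j \<otimes> P j)" by (rule choice)
  then obtain M where M: "\<And>i j. i < N \<Longrightarrow> j < N \<Longrightarrow> M i j \<in> F" "\<And>i. i < N \<Longrightarrow> M i i\<^sub>0 = \<zero>"
    "\<And>i. i < N \<Longrightarrow> b i = (\<Oplus>j\<in>{..<N}. M i j \<otimes> P j)" by blast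
  have Mc: "M i j \<in> carrier R" if "i < N" "j < N" for i j using M(1)[OF that] Fc by blast
  \<comment> \<open>\<open>N\<close> vectors with only \<open>N - 1\<close> coordinates are
    dependent; the coefficients \<open>e\<close> then give a nontrivial relation among the basis
    elements themselves.\<close>
  obtain e where e: "\<forall>i\<in>{..<N}. e i \<in> F" "\<exists>i\<in>{..<N}. e i \<noteq> \<zero>" "\<forall>j\<in>{..<N} - {i\<^sub>0}. (\<Oplus>i\<in>{..<N}. e i \<otimes> M i j) = \<zero>"
    using dependent_family[OF F, of "{..<N} - {i\<^sub>0}" "{..<N}" M] M(1) i0N by auto
  have ec: "e i \<in> carrier R" if "i < N" for i using e(1) that Fc by auto
  have "(\<Oplus>i\<in>{..<N}. e i \<otimes> b i) = (\<Oplus>i\<in>{..<N}. \<Oplus>j\<in>{..<N}. e i \<otimes> (M i j \<otimes> P j))"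
  proof (rule finsum_cong')
    fix i assume "i \<in> {..<N}"
    then have i: "i < N" by simp
    show "e i \<otimes> b i = (\<Oplus>j\<in>{..<N}. e i \<otimes> (M i j \<otimes> P j))"
      unfolding M(3)[OF i] by (rule finsum_rdistr) (use ec[OF i] Mc[OF i] Pc in auto)
  qed (use ec Mc Pc in \<open>auto intro!: finsum_closed\<close>)
  also have "\<dots> = (\<Oplus>j\<in>{..<N}. \<Oplus>i\<in>{..<N}. e i \<otimes> (M i j \<otimes> P j))"
    by (rule finsum_swap) (use ec Mc Pc in auto)
  also have "\<dots> = \<zero>"
  proof (rule finsum_all_zero)
    fix j assume "j \<in> {..<N}"
    then have j: "j < N" by simp
    have "(\<Oplus>i\<in>{..<N}. e i \<otimes> (M i j \<otimes> P j)) = (\<Oplus>i\<in>{..<N}. (e i \<otimes> M i j) \<otimes> P j)"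
      by (rule finsum_cong') (use ec Mc Pc j in \<open>auto simp: m_assoc\<close>)
    also have "\<dots> = (\<Oplus>i\<in>{..<N}. e i \<otimes> M i j) \<otimes> P j"
      by (rule finsum_ldistr[symmetric]) (use ec Mc Pc j in auto)
    also have "(\<Oplus>i\<in>{..<N}. e i \<otimes> M i j) = \<zero>"
    proof (cases "j = i\<^sub>0")
      case True then show ?thesis by (intro finsum_all_zero) (use M(2) ec in auto)
    next
      case False then show ?thesis using e(3) j by blast
    qed
    finally show "(\<Oplus>i\<in>{..<N}. e i \<otimes> (M i j \<otimes> P j)) = \<zero>" using Pc j by simp
  qed
  finally have "(\<Oplus>i\<in>{..<N}. e i \<otimes> b i) = \<zero>" .
  then have "e i = \<zero>" if "i < N" for i using Bi[of e i] e(1) that by blast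
  then show False using e(2) by auto
qed

text \<open>If the derivative of the minimal polynomial \<open>f\<close> is nonzero, its degree is
  too small for the irreducible \<open>f\<close> to divide it, so common divisors are units. If it
  were zero, \<open>f\<close> would have only exponents divisible by \<open>p\<close>, which is a
  relation among the \<open>p\<close>-th powers of \<open>1, x, ..., x ^ (n - 1)\<close>. These
  elements extend to a basis, so \<open>pow_base_relation_trivial\<close> forbids it.\<close>

lemma separable_Irr:
  assumes F: "subfield F R" and fd: "finite_dimension F (carrier R)" and x: "x \<in> carrier R"
    and p: "(p = 1 \<and> (\<forall>n>0. [(n::nat)] \<cdot> \<one> \<noteq> \<zero>)) \<or> (Factorial_Ring.prime p \<and> [(p::nat)] \<cdot> \<one> = \<zero>)"
    and sep: "\<And>W. subring W R \<Longrightarrow> F \<subseteq> W \<Longrightarrow> (\<And>y. y \<in> carrier R \<Longrightarrow> y [^] p \<in> W) \<Longrightarrow> carrier R \<subseteq> W"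
  shows "separable_poly R F (Irr F x)"
proof -
  note Fsub = subfieldE(1)[OF F]
  interpret UP: domain "F[X]" by (rule univ_poly_is_domain[OF Fsub])
  have alg: "(algebraic over F) x" by (rule finite_dimension_imp_algebraic[OF F carrier_is_subring fd x])
  define f where "f = Irr F x"
  note irr = IrrE[OF F x alg, folded f_def]
  define n where "n = degree f"
  have n1: "n \<ge> 1" unfolding n_def by (rule pirreducible_degree[OF F irr(1,2)])
  have fF: "set f \<subseteq> F" using irr(1) by (auto simp: univ_poly_carrier[symmetric] polynomial_def)
  have len: "length f = Suc n" using n1 by (simp add: n_def)
  have cF: "coeff f i \<in> F" for i
    using coeff_nth[of i f] coeff_length[of f i] fF nth_mem[of "length f - 1 - i" f] subringE(2)[OF Fsub] len
    by (cases "i < length f") auto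
  have fne: "f \<noteq> []" using len by auto
  have lead: "coeff f n = \<one>" using lead_coeff_simp[OF fne] irr(3) by (simp add: n_def)
  define gl where "gl = map (\<lambda>i. [i] \<cdot> coeff f i) (rev [1..<length f])"
  define g where "g = normalize gl"
  have g_def': "g = formal_deriv R f" by (simp add: g_def gl_def formal_deriv_def)
  have glF: "set gl \<subseteq> F" using subring_add_pow_closed[OF Fsub cF] by (auto simp: gl_def)
  have gP: "g \<in> carrier (F[X])"
    unfolding g_def univ_poly_carrier[symmetric] by (rule normalize_gives_polynomial[OF glF])
  have "g \<noteq> []"
  proof
    assume "g = []"
    then have z: "[i] \<cdot> coeff f i = \<zero>" if "1 \<le> i" "i \<le> n" for i
    proof (intro normalize_Nil_imp_zero[of gl])
      show "[i] \<cdot> coeff f i \<in> set gl" unfolding gl_def set_map set_rev set_upt len using that by (intro imageI) simp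
    qed (simp add: g_def)
    \<comment> \<open>With \<open>p = 1\<close> the characteristic is zero, and the leading
      coefficient of the derivative is \<open>n\<close> times the unit; the work is in prime
      characteristic.\<close>
    show False
    proof (cases "p = 1")
      case True
      then have "\<forall>n>0. [(n::nat)] \<cdot> \<one> \<noteq> \<zero>" using p by auto
      then show False using z[of n] lead n1 by simp
    next
      case False
      then have pp: "Factorial_Ring.prime p" "[p] \<cdot> \<one> = \<zero>" using p by auto
      have p2: "p \<ge> 2" using pp(1) by (rule prime_ge_2_nat)
      have cz: "coeff f i = \<zero>" if "\<not> p dvd i" for i
      proof (cases "1 \<le> i \<and> i \<le> n")
        case True
        then show ?thesis using char_not_dvd[OF pp _ z that] subringE(1)[OF Fsub] cF by blast
      next
        case False
        have "i \<noteq> 0" using that by (metis dvd_0_right)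
        then show ?thesis using False coeff_length[of f i] len by auto
      qed
      have "p dvd n" using cz[of n] lead by auto
      then obtain n' where n': "n = p * n'" by blast
      have n'n: "n' < n" using n' n1 p2 by auto
      let ?Us = "exp_base x n"
      obtain N where dim: "dimension N F (carrier R)" using fd by blast
      have Us: "?Us = map (\<lambda>i. x [^] i) (rev [0..<n])" by (simp add: exp_base_def)
      obtain Vs where Vs: "independent F (Vs @ ?Us)" "Span F (Vs @ ?Us) = carrier R"
        using complete_base[OF F dim, of ?Us] exp_base_independent[OF F x alg] x
        unfolding f_def[symmetric] n_def[symmetric] by (auto simp: Us)
      define bs where "bs = Vs @ ?Us"
      define v where "v = length Vs"
      have lenb: "length bs = v + n" by (simp add: bs_def Us v_def)
      have bsc: "set bs \<subseteq> carrier R" using independent_in_carrier[OF Vs(1)] by (simp add: bs_def)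
      \<comment> \<open>\<open>exp_base\<close> lists the powers of \<open>x\<close> in descending
        order, here after the \<open>v\<close> complementary vectors, so \<open>x ^ j\<close> stands
        at index \<open>v + (n - 1 - j)\<close>.\<close>
      define pos where "pos j = v + (n - 1 - j)" for j
      have bpos: "bs ! pos j = x [^] j" if "j < n" for j
      proof -
        have "n - 1 - j < n" "n - Suc (n - 1 - j) = j" using that by auto
        then show ?thesis unfolding bs_def pos_def v_def nth_append_length_plus by (simp add: Us rev_nth)
      qed
      \<comment> \<open>The coefficients of \<open>f\<close> at the exponents \<open>p * j\<close>,
        moved to the positions of the \<open>x ^ j\<close>. The top index \<open>n'\<close>, with
        \<open>n = p * n'\<close>, is below \<open>n\<close>, so \<open>x ^ n'\<close> still belongs
        to the list.\<close>
      define d where "d i = (if i \<in> pos ` {..n'} then coeff f (p * (n - 1 - (i - v))) else \<zero>)" for i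
      have dpos: "d (pos j) = coeff f (p * j)" if "j \<le> n'" for j
        using that n'n by (auto simp: d_def pos_def)
      have dF: "d i \<in> F" for i using cF subringE(2)[OF Fsub] by (simp add: d_def)
      have dc: "d i \<in> carrier R" for i using dF subringE(1)[OF Fsub] by blast
      have cc: "coeff f i \<in> carrier R" for i using cF subringE(1)[OF Fsub] by blast
      have bc: "bs ! i \<in> carrier R" if "i < length bs" for i using bsc that nth_mem by blast
      have posl: "pos j < length bs" if "j \<le> n'" for j using that n'n by (simp add: pos_def lenb)
      have inj: "inj_on pos {..n'}" using n'n by (auto simp: inj_on_def pos_def)
      have "(\<Oplus>i\<in>{..<length bs}. d i \<otimes> (bs ! i) [^] p) = (\<Oplus>i\<in>pos ` {..n'}. d i \<otimes> (bs ! i) [^] p)"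
      proof (rule add.finprod_mono_neutral_cong_right)
        show "pos ` {..n'} \<subseteq> {..<length bs}" using posl by auto
        show "d i \<otimes> (bs ! i) [^] p = \<zero>" if "i \<in> {..<length bs} - pos ` {..n'}" for i
          using that bc by (auto simp: d_def)
        show "(\<lambda>i. d i \<otimes> (bs ! i) [^] p) \<in> {..<length bs} \<rightarrow> carrier R"
          using dc bc by auto
      qed auto
      also have "\<dots> = (\<Oplus>j\<in>{..n'}. d (pos j) \<otimes> (bs ! pos j) [^] p)"
        by (rule finsum_reindex[OF _ inj]) (use dc bc posl in auto)
      also have "\<dots> = (\<Oplus>j\<in>{..n'}. coeff f (p * j) \<otimes> x [^] (p * j))"
        by (rule finsum_cong') (use dpos bpos n'n cc x in \<open>auto simp: nat_pow_pow mult.commute\<close>)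
      also have "\<dots> = (\<Oplus>i\<in>(\<lambda>j. p * j) ` {..n'}. coeff f i \<otimes> x [^] i)"
        by (rule finsum_reindex[symmetric]) (use cc x p2 in \<open>auto simp: inj_on_def\<close>)
      also have "\<dots> = (\<Oplus>i\<in>{..<length f}. coeff f i \<otimes> x [^] i)"
      proof (rule add.finprod_mono_neutral_cong_left)
        show "(\<lambda>j. p * j) ` {..n'} \<subseteq> {..<length f}" using len n' by (auto simp: less_Suc_eq_le)
        show "coeff f i \<otimes> x [^] i = \<zero>" if i: "i \<in> {..<length f} - (\<lambda>j. p * j) ` {..n'}" for i
        proof -
          have "\<not> p dvd i"
          proof
            assume "p dvd i"
            then obtain j where "i = p * j" by blast
            moreover have "j \<le> n'" using i len n' p2 \<open>i = p * j\<close> by (auto simp: less_Suc_eq_le)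
            ultimately show False using i by blast
          qed
          then show ?thesis using cz x by simp
        qed
      qed (use cc x in auto)
      also have "\<dots> = eval f x" by (rule eval_finsum[symmetric]) (use fF subringE(1)[OF Fsub] x in auto)
      finally have rel: "(\<Oplus>i\<in>{..<length bs}. d i \<otimes> (bs ! i) [^] p) = \<zero>" unfolding irr(4) .
      have "d (pos n') \<noteq> \<one>"
        by (rule pow_base_relation_trivial[OF F pp sep bsc Vs[folded bs_def] dF rel posl[OF order_refl]])
      then show False using dpos[of n'] lead n' by simp
    qed
  qed
  have "length gl = n" unfolding gl_def len by (simp del: upt_Suc)
  then have "length g \<le> n" using normalize_length_le[of gl] by (simp add: g_def)
  then have deg: "degree g < degree f" using \<open>g \<noteq> []\<close> n1 by (cases g) (auto simp: n_def)
  have one: "\<one>\<^bsub>F[X]\<^esub> divides\<^bsub>F[X]\<^esub> q" if "q \<in> carrier (F[X])" for q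
    using that by (auto simp: factor_def intro!: bexI[of _ q])
  show ?thesis
    unfolding separable_poly_def isgcd_def f_def[symmetric] g_def'[symmetric]
  proof (intro conjI ballI impI)
    fix y assume y: "y \<in> carrier (F[X])" and dv: "y divides\<^bsub>F[X]\<^esub> f \<and> y divides\<^bsub>F[X]\<^esub> g"
    obtain c where c: "c \<in> carrier (F[X])" "f = y \<otimes>\<^bsub>F[X]\<^esub> c" using dv by (auto simp: factor_def)
    have "y \<in> Units (F[X]) \<or> c \<in> Units (F[X])" using pirreducibleE(3)[OF Fsub irr(1,2) y c(1) c(2)] .
    then show "y divides\<^bsub>F[X]\<^esub> \<one>\<^bsub>F[X]\<^esub>"
    proof
      assume "y \<in> Units (F[X])"
      then show ?thesis using UP.Units_r_inv[of y] UP.Units_inv_closed[of y] unfolding factor_def by (metis)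
    next
      assume cu: "c \<in> Units (F[X])"
      obtain e where e: "e \<in> carrier (F[X])" "g = y \<otimes>\<^bsub>F[X]\<^esub> e" using dv by (auto simp: factor_def)
      let ?ci = "inv\<^bsub>F[X]\<^esub> c"
      have ci: "?ci \<in> carrier (F[X])" "c \<otimes>\<^bsub>F[X]\<^esub> ?ci = \<one>\<^bsub>F[X]\<^esub>" using cu by (auto simp: UP.Units_r_inv)
      have "f \<otimes>\<^bsub>F[X]\<^esub> (?ci \<otimes>\<^bsub>F[X]\<^esub> e) = y \<otimes>\<^bsub>F[X]\<^esub> (c \<otimes>\<^bsub>F[X]\<^esub> ?ci) \<otimes>\<^bsub>F[X]\<^esub> e"
        unfolding c(2) using y c(1) ci(1) e(1) by (simp add: UP.m_assoc)
      also have "\<dots> = g" unfolding ci(2) using y e by simp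
      finally have "f divides\<^bsub>F[X]\<^esub> g" using ci e by (auto simp: factor_def intro!: bexI[of _ "?ci \<otimes>\<^bsub>F[X]\<^esub> e"])
      then have "f pdivides g" using pdivides_iff_shell[OF F irr(1) gP] by simp
      then have "degree f \<le> degree g" using pdivides_imp_degree_le[OF Fsub irr(1) gP \<open>g \<noteq> []\<close>] by simp
      then show ?thesis using deg by simp
    qed
  qed (use one irr(1) gP in auto)
qed

end

section \<open>Existence of splittings\<close>

lemma (in domain) exists_exponential_char:
  "\<exists>p. (p = 1 \<and> (\<forall>n>0. [(n::nat)] \<cdot> \<one> \<noteq> \<zero>)) \<or> (Factorial_Ring.prime p \<and> [(p::nat)] \<cdot> \<one> = \<zero>)"
proof (cases "\<forall>n>0. [(n::nat)] \<cdot> \<one> \<noteq> \<zero>")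
  case False
  define p where "p = (LEAST n. n > 0 \<and> [(n::nat)] \<cdot> \<one> = \<zero>)"
  have p: "p > 0 \<and> [p] \<cdot> \<one> = \<zero>" unfolding p_def by (rule LeastI_ex) (use False in auto)
  have pmin: "p \<le> n" if "n > 0" "[n] \<cdot> \<one> = \<zero>" for n unfolding p_def by (rule Least_le) (use that in auto)
  have "Factorial_Ring.prime p"
    unfolding prime_nat_iff
  proof (intro conjI allI impI)
    have "p \<noteq> 1" using p one_not_zero by (intro notI) simp
    then show "1 < p" using p by auto
    fix a assume "a dvd p"
    then obtain b where b: "p = a * b" by auto
    have ab: "a > 0" "b > 0" using p b by auto
    have "([a] \<cdot> \<one>) \<otimes> ([b] \<cdot> \<one>) = [p] \<cdot> \<one>"
      using add_pow_ldistr[of \<one> "[b] \<cdot> \<one>" a] add.nat_pow_pow[OF one_closed, of a b] b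
      by (simp add: mult.commute)
    then have "[a] \<cdot> \<one> = \<zero> \<or> [b] \<cdot> \<one> = \<zero>" using p integral[of "[a] \<cdot> \<one>" "[b] \<cdot> \<one>"] by simp
    then have "p \<le> a \<or> p \<le> b" using pmin ab by blast
    then show "a = 1 \<or> a = p"
    proof
      assume "p \<le> a"
      then have "a * b \<le> a * 1" using b by simp
      then have "b = 1" using ab by simp
      then show ?thesis using b by simp
    next
      assume "p \<le> b"
      then have "a * b \<le> 1 * b" using b by simp
      then have "a = 1" using ab by simp
      then show ?thesis by simp
    qed
  qed
  then show ?thesis using p by blast
qed blast

lemma (in ring) subring_of_subring:
  assumes H: "subring H R" and W: "subring W (R\<lparr>carrier := H\<rparr>)" shows "subring W R"
proof (rule subringI)
  note Ws = subringE[OF W, simplified]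
  interpret H: ring "R\<lparr>carrier := H\<rparr>" by (rule subring_is_ring[OF H])
  have Hc: "H \<subseteq> carrier R" using subringE(1)[OF H] .
  show "W \<subseteq> carrier R" using Ws(1) Hc by blast
  show "\<ominus> w \<in> W" if w: "w \<in> W" for w
  proof -
    have wH: "w \<in> H" using w Ws(1) by blast
    let ?m = "\<ominus>\<^bsub>R\<lparr>carrier := H\<rparr>\<^esub> w"
    have m: "?m \<in> H" using H.a_inv_closed[of w] wH by simp
    have "?m \<oplus> w = \<zero>" using H.l_neg[of w] wH by simp
    then have "\<ominus> w = ?m" using m wH Hc by (intro minus_equality) auto
    then show ?thesis using Ws(5)[OF w] by simp
  qed
qed (use subringE[OF W, simplified] in auto)

section \<open>Scalar extension to a subfield\<close>

context scalar_ext_basis begin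

lemma subfield_instance:
  assumes E: "subfield E K" and kE: "\<iota> ` carrier k \<subseteq> E"
  shows "scalar_ext_basis k A (K\<lparr>carrier := E\<rparr>) \<iota> B h"
proof -
  have "field (K\<lparr>carrier := E\<rparr>)" by (rule K.subfield_iff(2)[OF E])
  moreover have "\<iota> \<in> ring_hom k (K\<lparr>carrier := E\<rparr>)"
    using \<iota>.homh kE by (auto simp: ring_hom_def)
  ultimately have "field_extension k (K\<lparr>carrier := E\<rparr>) \<iota>" using ext by (simp add: field_extension_def)
  then show ?thesis by (intro scalar_ext_basis.intro scalar_extI scalar_ext_basis_axioms.intro alg dual)
qed

text \<open>The map induced by the inclusion of \<open>E\<close> preserves coordinates
  (\<open>hJ\<close>), so it is injective and its image consists of the elements with coordinates in
  \<open>E\<close>. This identifies the abstract scalar extension to \<open>E\<close> with the set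
  called \<open>CE E\<close> in \<open>split_core\<close>.\<close>

lemma base_change:
  assumes E: "subfield E K" and kE: "\<iota> ` carrier k \<subseteq> E"
  defines "SE \<equiv> scalar_extension k A (K\<lparr>carrier := E\<rparr>) \<iota>"
  obtains J where "J \<in> ring_hom SE S" "inj_on J (carrier SE)"
    "J ` carrier SE = {x \<in> carrier S. \<forall>b\<in>B. hK b x \<in> E}"
    "\<And>c t. c \<in> E \<Longrightarrow> t \<in> carrier SE \<Longrightarrow> J (c \<odot>\<^bsub>SE\<^esub> t) = c \<odot>\<^bsub>S\<^esub> J t"
proof -
  interpret E: scalar_ext_basis k A "K\<lparr>carrier := E\<rparr>" \<iota> B h by (rule subfield_instance[OF E kE])
  have Ec: "E \<subseteq> carrier K" using subfieldE(3)[OF E] .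
  have SE: "SE = E.S" by (simp add: SE_def)
  obtain J where Jh: "J \<in> ring_hom E.S S"
    and Jp: "\<And>x a. \<lbrakk>x \<in> carrier (K\<lparr>carrier := E\<rparr>); a \<in> carrier A\<rbrakk> \<Longrightarrow> J (E.pure x a) = pure x \<one>\<^bsub>A\<^esub> \<otimes>\<^bsub>S\<^esub> pure \<one>\<^bsub>K\<^esub> a"
  proof (rule E.ring_lift_exists[OF ring_S])
    show "(\<lambda>x. pure x \<one>\<^bsub>A\<^esub>) \<in> ring_hom (K\<lparr>carrier := E\<rparr>) S"
      by (rule ring_hom_memI) (use Ec in \<open>auto simp: pure_mult pure_add_left pure_one subset_iff\<close>)
    show "(\<lambda>a. pure \<one>\<^bsub>K\<^esub> a) \<in> ring_hom A S"
      by (rule ring_hom_memI) (auto simp: pure_mult pure_add_right pure_one)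
  qed (use Ec in \<open>auto simp: pure_mult pure_smult subset_iff\<close>)
  have Jpure: "J (E.pure x a) = pure x a" if "x \<in> E" "a \<in> carrier A" for x a
    using Jp[of x a] that Ec by (auto simp: pure_mult)
  interpret J: abelian_group_hom E.S S J by (rule ring_hom_abelian_group_hom[OF E.ring_S ring_S Jh])
  have hJ: "hK b (J t) = E.hK b t" if b: "b \<in> B" and t: "t \<in> carrier E.S" for b t
  proof -
    interpret H: abelian_group_hom S K "hK b" by (rule hK_hom[OF b])
    interpret HE: abelian_group_hom E.S "K\<lparr>carrier := E\<rparr>" "E.hK b" by (rule E.hK_hom[OF b])
    have 1: "abelian_group_hom E.S K (\<lambda>t. hK b (J t))"
      by (rule abelian_group_homI') (auto simp: E.S.abelian_group_axioms K.abelian_group_axioms)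
    have 2: "abelian_group_hom E.S K (E.hK b)"
    proof (rule abelian_group_homI'[OF E.S.abelian_group_axioms K.abelian_group_axioms])
      show "E.hK b x \<in> carrier K" if "x \<in> carrier E.S" for x using HE.hom_closed[OF that] Ec by auto
      show "E.hK b (x \<oplus>\<^bsub>E.S\<^esub> y) = E.hK b x \<oplus>\<^bsub>K\<^esub> E.hK b y" if "x \<in> carrier E.S" "y \<in> carrier E.S" for x y
        using HE.hom_add[OF that] by simp
    qed
    show ?thesis
    proof (rule E.additive_eqI[OF 1 2 _ t])
      fix x a assume xa: "x \<in> carrier (K\<lparr>carrier := E\<rparr>)" "a \<in> carrier A"
      then show "hK b (J (E.pure x a)) = E.hK b (E.pure x a)"
        using Ec by (auto simp: Jpure hK_pure[OF b] E.hK_pure[OF b])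
    qed
  qed
  have Jsm: "J (c \<odot>\<^bsub>E.S\<^esub> t) = c \<odot>\<^bsub>S\<^esub> J t" if c: "c \<in> E" and t: "t \<in> carrier E.S" for c t
  proof -
    have cp: "E.pure c \<one>\<^bsub>A\<^esub> \<in> carrier E.S" using c by simp
    have "J (c \<odot>\<^bsub>E.S\<^esub> t) = J (E.pure c \<one>\<^bsub>A\<^esub>) \<otimes>\<^bsub>S\<^esub> J t"
      using ring_hom_mult[OF Jh cp t] by (simp add: E.S_simps(6))
    then show ?thesis using c Jpure by (simp add: S_simps(6))
  qed
  have inj: "inj_on J (carrier E.S)"
  proof (rule inj_onI)
    fix s t assume st: "s \<in> carrier E.S" "t \<in> carrier E.S" "J s = J t"
    show "s = t"
    proof (rule E.S_eqI[OF st(1,2)])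
      fix b assume "b \<in> B"
      then show "E.hK b s = E.hK b t" using hJ[of b s] hJ[of b t] st by simp
    qed
  qed
  have img: "J ` carrier E.S = {x \<in> carrier S. \<forall>b\<in>B. hK b x \<in> E}"
  proof (intro subset_antisym subsetI)
    fix x assume "x \<in> J ` carrier E.S"
    then obtain t where t: "t \<in> carrier E.S" "x = J t" by blast
    then show "x \<in> {x \<in> carrier S. \<forall>b\<in>B. hK b x \<in> E}"
      using J.hom_closed hJ E.hK_closed by auto
  next
    fix x assume "x \<in> {x \<in> carrier S. \<forall>b\<in>B. hK b x \<in> E}"
    then have x: "x \<in> carrier S" "\<And>b. b \<in> B \<Longrightarrow> hK b x \<in> E" by auto
    let ?t = "\<Oplus>\<^bsub>E.S\<^esub>b\<in>B. hK b x \<odot>\<^bsub>E.S\<^esub> E.pure \<one>\<^bsub>K\<^esub> b"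
    have one: "\<one>\<^bsub>K\<^esub> \<in> E" using subringE(3)[OF subfieldE(1)[OF E]] .
    have tc: "hK b x \<odot>\<^bsub>E.S\<^esub> E.pure \<one>\<^bsub>K\<^esub> b \<in> carrier E.S" if "b \<in> B" for b
      by (rule E.SA.smult_closed) (use x that one B_facts(2) in auto)
    have "J ?t = (\<Oplus>\<^bsub>S\<^esub>b\<in>B. J (hK b x \<odot>\<^bsub>E.S\<^esub> E.pure \<one>\<^bsub>K\<^esub> b))" by (rule J.hom_finsum) (use tc in auto)
    also have "\<dots> = (\<Oplus>\<^bsub>S\<^esub>b\<in>B. hK b x \<odot>\<^bsub>S\<^esub> pure \<one>\<^bsub>K\<^esub> b)"
    proof (rule S.finsum_cong')
      fix b assume b: "b \<in> B"
      have "E.pure \<one>\<^bsub>K\<^esub> b \<in> carrier E.S" using one B_facts(2)[OF b] by simp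
      then show "J (hK b x \<odot>\<^bsub>E.S\<^esub> E.pure \<one>\<^bsub>K\<^esub> b) = hK b x \<odot>\<^bsub>S\<^esub> pure \<one>\<^bsub>K\<^esub> b"
        using Jsm[OF x(2)[OF b]] Jpure[OF one B_facts(2)[OF b]] by simp
    qed (use hK_closed[OF _ x(1)] B_facts(2) in auto)
    finally have "J ?t = x" using S_expand[OF x(1)] by simp
    moreover have "?t \<in> carrier E.S" using tc by (auto intro!: E.S.finsum_closed)
    ultimately show "x \<in> J ` carrier E.S" by blast
  qed
  show ?thesis by (rule that[of J]) (use Jh inj img Jsm SE in auto)
qed

end

text \<open>\<open>fin_sep\<close> speaks of subsets of \<open>L\<close>, a splitting of a field in
  its own right. So dimension, subfields and minimal polynomials have to be reconsidered in
  \<open>L\<close> with its carrier restricted to \<open>E\<close>.\<close>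

lemma fin_sep_imp_finite_separable_extension:
  assumes L: "field L" and k: "field k" and hom: "\<iota> \<in> ring_hom k L"
    and k0: "subfield (\<iota> ` carrier k) L" and E: "fin_sep L (\<iota> ` carrier k) p E"
    and p: "(p = 1 \<and> (\<forall>n>0. add_pow L (n::nat) \<one>\<^bsub>L\<^esub> \<noteq> \<zero>\<^bsub>L\<^esub>)) \<or> (Factorial_Ring.prime p \<and> add_pow L p \<one>\<^bsub>L\<^esub> = \<zero>\<^bsub>L\<^esub>)"
  shows "finite_separable_extension k (L\<lparr>carrier := E\<rparr>) \<iota>"
proof -
  interpret L: field L by (rule L)
  let ?k = "\<iota> ` carrier k" and ?E = "L\<lparr>carrier := E\<rparr>"
  have Esf: "subfield E L" and kE: "?k \<subseteq> E" and fd: "L.finite_dimension ?k E"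
    and sep: "\<And>W. subring W L \<Longrightarrow> ?k \<subseteq> W \<Longrightarrow> (\<And>x. x \<in> E \<Longrightarrow> x [^]\<^bsub>L\<^esub> p \<in> W) \<Longrightarrow> E \<subseteq> W"
    using E by (auto simp: fin_sep_def)
  note Esub = subfieldE(1)[OF Esf]
  have FE: "field ?E" by (rule L.subfield_iff(2)[OF Esf])
  interpret E: field ?E by (rule FE)
  have ext: "field_extension k ?E \<iota>"
    using hom kE k FE by (auto simp: field_extension_def ring_hom_def)
  have k0E: "subfield ?k ?E"
  proof (rule E.subfield_iff(1))
    show "field (?E\<lparr>carrier := ?k\<rparr>)" using L.subfield_iff(2)[OF k0] by simp
    show "?k \<subseteq> carrier ?E" using kE by simp
  qed
  \<comment> \<open>Finite dimension is transferred by a basis: its vectors lie in \<open>E\<close>,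
    and their span is the same in both rings.\<close>
  have fdE: "E.finite_dimension ?k E"
  proof -
    obtain n where "L.dimension n ?k E" using fd by blast
    then obtain Us where Us: "set Us \<subseteq> carrier L" "L.independent ?k Us" "L.Span ?k Us = E"
      using L.exists_base[OF k0] by blast
    have "set Us \<subseteq> E" using L.Span_base_incl[OF k0 Us(1)] Us(3) by simp
    then have "E.finite_dimension ?k (E.Span ?k Us)" by (intro E.Span_finite_dimension[OF k0E]) simp
    then show ?thesis using Us(3) L.Span_consistent[OF Esub] by simp
  qed
  have powE: "x [^]\<^bsub>?E\<^esub> (n::nat) = x [^]\<^bsub>L\<^esub> n" for x n by (simp add: nat_pow_def)
  have addE: "add_pow ?E (n::nat) x = add_pow L n x" for x n by (simp add: add_pow_def nat_pow_def)
  have "separable_poly ?E ?k (E.Irr ?k x)" if x: "x \<in> E" for x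
  proof (rule E.separable_Irr[OF k0E])
    show "E.finite_dimension ?k (carrier ?E)" using fdE by simp
    show "x \<in> carrier ?E" using x by simp
    show "(p = 1 \<and> (\<forall>n>0. add_pow ?E (n::nat) \<one>\<^bsub>?E\<^esub> \<noteq> \<zero>\<^bsub>?E\<^esub>)) \<or> (Factorial_Ring.prime p \<and> add_pow ?E p \<one>\<^bsub>?E\<^esub> = \<zero>\<^bsub>?E\<^esub>)"
      using p by (simp add: addE)
    fix W assume W: "subring W ?E" "?k \<subseteq> W" "\<And>y. y \<in> carrier ?E \<Longrightarrow> y [^]\<^bsub>?E\<^esub> p \<in> W"
    have "E \<subseteq> W" by (rule sep[OF L.subring_of_subring[OF Esub W(1)] W(2)]) (use W(3) powE in simp)
    then show "carrier ?E \<subseteq> W" by simp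
  qed
  then show ?thesis unfolding finite_separable_extension_def using ext fdE by simp
qed

text \<open>The semisimplicity assumption applies to the closure and to its subfields alike, since
  restricting the carrier keeps the element type. The matrix units found in the algebra over the
  closure have coordinates in \<open>E\<close>; they are pulled back along \<open>J\<close> to the
  scalar extension to \<open>E\<close>, where they define the isomorphism.\<close>

theorem exists_splitting:
  fixes k :: "('k, 'x) ring_scheme" and A :: "('k, 'a, 'y) module_scheme"
  assumes sepA: "separable_algebra k A" and nontriv: "\<one>\<^bsub>A\<^esub> \<noteq> \<zero>\<^bsub>A\<^esub>"
  shows "\<exists>(E :: 'k ext_elem ring) \<iota> r m \<phi>. splitting k A E \<iota> r m \<phi>"
proof -
  have algA: "unital_algebra k A" and fdA: "finite_dimensional k A"
    and ss: "\<And>(K :: 'k ext_elem ring) \<iota>. field_extension k K \<iota> \<Longrightarrow> semisimple_ring (scalar_extension k A K \<iota>)"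
    using sepA by (auto simp: separable_algebra_def)
  interpret A: unital_algebra k A by (rule algA)
  obtain B h where dual: "is_dual_basis k A B h"
    using exists_dual_basis[OF A.field_axioms A.module_axioms fdA] by blast
  obtain L :: "'k ext_elem ring" where Lc: "algebraic_closure L (ring.indexed_const k ` carrier k)"
    and \<iota>h: "ring.indexed_const k \<in> ring_hom k L" using field.exists_closure[OF A.field_axioms] by blast
  define \<iota> where "\<iota> = (ring.indexed_const k :: 'k \<Rightarrow> 'k ext_elem)"
  let ?k = "\<iota> ` carrier k"
  interpret L: algebraic_closure L ?k using Lc by (simp add: \<iota>_def)
  have \<iota>h: "\<iota> \<in> ring_hom k L" using \<iota>h by (simp add: \<iota>_def)
  have k0: "subfield ?k L" by (rule L.subfield_axioms)
  have ext: "field_extension k L \<iota>" using \<iota>h A.field_axioms L.field_axioms by (simp add: field_extension_def)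
  interpret SL: scalar_ext_basis k A L \<iota> B h
    by (intro scalar_ext_basis.intro scalar_extI scalar_ext_basis_axioms.intro algA ext dual)
  obtain p :: nat where p: "(p = 1 \<and> (\<forall>n>0. add_pow L (n::nat) \<one>\<^bsub>L\<^esub> \<noteq> \<zero>\<^bsub>L\<^esub>)) \<or> (Factorial_Ring.prime p \<and> add_pow L p \<one>\<^bsub>L\<^esub> = \<zero>\<^bsub>L\<^esub>)"
    by (rule exE[OF L.exists_exponential_char]) (rule that, assumption)
  \<comment> \<open>Over \<open>E\<close> the quasi-inverse is found in the scalar extension to
    \<open>E\<close>, and its image under \<open>J\<close> has coordinates in \<open>E\<close>;
    regularity over \<open>L\<close> alone would not give that.\<close>
  have reg: "\<exists>r\<in>carrier SL.S. (\<forall>b\<in>B. SL.hK b r \<in> E) \<and> x \<otimes>\<^bsub>SL.S\<^esub> r \<otimes>\<^bsub>SL.S\<^esub> x = x"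
    if E: "E = carrier L \<or> fin_sep L ?k p E" and x: "x \<in> carrier SL.S" "\<forall>b\<in>B. SL.hK b x \<in> E" for E x
  proof (cases "E = carrier L")
    case True
    then show ?thesis using semisimple_imp_regular[OF SL.ring_S ss[OF ext] x(1)] SL.hK_closed by auto
  next
    case False
    then have Esf: "subfield E L" and kE: "?k \<subseteq> E" using E by (auto simp: fin_sep_def)
    interpret SE: scalar_ext_basis k A "L\<lparr>carrier := E\<rparr>" \<iota> B h by (rule SL.subfield_instance[OF Esf kE])
    obtain J where J: "J \<in> ring_hom SE.S SL.S" "inj_on J (carrier SE.S)"
      "J ` carrier SE.S = {x \<in> carrier SL.S. \<forall>b\<in>B. SL.hK b x \<in> E}"
      "\<And>c t. c \<in> E \<Longrightarrow> t \<in> carrier SE.S \<Longrightarrow> J (c \<odot>\<^bsub>SE.S\<^esub> t) = c \<odot>\<^bsub>SL.S\<^esub> J t"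
      apply (rule SL.base_change[OF Esf kE])
      subgoal premises prems by (rule prems(1)[OF prems(2-)])
      done
    have "x \<in> J ` carrier SE.S" using x J(3) by simp
    then obtain t where t: "t \<in> carrier SE.S" "x = J t" by blast
    obtain s where s: "s \<in> carrier SE.S" "t \<otimes>\<^bsub>SE.S\<^esub> s \<otimes>\<^bsub>SE.S\<^esub> t = t"
      using semisimple_imp_regular[OF SE.ring_S ss[OF SE.ext] t(1)] by blast
    have "J s \<in> {x \<in> carrier SL.S. \<forall>b\<in>B. SL.hK b x \<in> E}" using J(3) s(1) by blast
    moreover have "x \<otimes>\<^bsub>SL.S\<^esub> J s \<otimes>\<^bsub>SL.S\<^esub> x = J (t \<otimes>\<^bsub>SE.S\<^esub> s \<otimes>\<^bsub>SE.S\<^esub> t)"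
      using t s(1) ring_hom_mult[OF J(1)] by simp
    ultimately show ?thesis using s(2) t(2) by auto
  qed
  have nz: "\<one>\<^bsub>SL.S\<^esub> \<noteq> \<zero>\<^bsub>SL.S\<^esub>"
    using SL.pure_inj[OF A.A.one_closed] SL.pure_one nontriv by auto
  interpret C: split_core L SL.S ?k B SL.hK "\<lambda>b. SL.pure \<one>\<^bsub>L\<^esub> b" p
  proof (rule split_core.intro)
    show "algebraically_closed L" by (rule L.algebraically_closed_axioms)
    show "unital_algebra L SL.S" by (rule SL.unital_algebra_S)
    show "subfield ?k L" by (rule k0)
    show "(L.algebraic over ?k) x" if "x \<in> carrier L" for x by (rule L.algebraic_extension[OF that])
    show "finite B" by (rule SL.B_facts(1))
    show "SL.hK b (SL.pure \<one>\<^bsub>L\<^esub> b') \<in> ?k" if "b \<in> B" "b' \<in> B" for b b'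
      using that SL.hK_pure[of b "\<one>\<^bsub>L\<^esub>" b'] SL.B_facts(2,3) by simp
    show "SL.hK b \<one>\<^bsub>SL.S\<^esub> \<in> ?k" if "b \<in> B" for b
      using that SL.hK_pure[of b "\<one>\<^bsub>L\<^esub>" "\<one>\<^bsub>A\<^esub>"] SL.pure_one SL.B_facts(3) by simp
    show "p = 1 \<or> Factorial_Ring.prime p \<and> add_pow L p \<one>\<^bsub>L\<^esub> = \<zero>\<^bsub>L\<^esub>" using p by blast
  qed (use SL.hK_closed SL.hK_add SL.hK_smult SL.B_facts(2) SL.S_expand SL.hK_mult_subring nz reg in auto)
  obtain E and r :: nat and m :: "nat \<Rightarrow> nat" and w where w: "fin_sep L ?k p E" "0 < r" "\<And>l. l < r \<Longrightarrow> 0 < m l"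
    "\<And>l i j. l < r \<Longrightarrow> i < m l \<Longrightarrow> j < m l \<Longrightarrow> w l i j \<in> C.CE E"
    "\<And>l i. l < r \<Longrightarrow> i < m l \<Longrightarrow> w l i i \<noteq> \<zero>\<^bsub>SL.S\<^esub>"
    "\<And>l i j l' i' j'. l < r \<Longrightarrow> i < m l \<Longrightarrow> j < m l \<Longrightarrow> l' < r \<Longrightarrow> i' < m l' \<Longrightarrow> j' < m l' \<Longrightarrow>
       w l i j \<otimes>\<^bsub>SL.S\<^esub> w l' i' j' = (if l = l' \<and> j = i' then w l i j' else \<zero>\<^bsub>SL.S\<^esub>)"
    "(\<Oplus>\<^bsub>SL.S\<^esub>l\<in>{..<r}. \<Oplus>\<^bsub>SL.S\<^esub>i\<in>{..<m l}. w l i i) = \<one>\<^bsub>SL.S\<^esub>"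
    "\<And>x l i j. x \<in> C.CE E \<Longrightarrow> l < r \<Longrightarrow> i < m l \<Longrightarrow> j < m l \<Longrightarrow> \<exists>c\<in>E. w l i i \<otimes>\<^bsub>SL.S\<^esub> x \<otimes>\<^bsub>SL.S\<^esub> w l j j = c \<odot>\<^bsub>SL.S\<^esub> w l i j"
    "\<And>x l i l' j. x \<in> C.CE E \<Longrightarrow> l < r \<Longrightarrow> i < m l \<Longrightarrow> l' < r \<Longrightarrow> j < m l' \<Longrightarrow> l \<noteq> l' \<Longrightarrow>
       w l i i \<otimes>\<^bsub>SL.S\<^esub> x \<otimes>\<^bsub>SL.S\<^esub> w l' j j = \<zero>\<^bsub>SL.S\<^esub>"
    apply (rule C.matrix_units_exist)
    subgoal premises prems by (rule prems(1)[OF prems(2-)])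
    done
  have Esf: "subfield E L" and kE: "?k \<subseteq> E" using w(1) by (auto simp: fin_sep_def)
  interpret SE: scalar_ext_basis k A "L\<lparr>carrier := E\<rparr>" \<iota> B h by (rule SL.subfield_instance[OF Esf kE])
  obtain J where J: "J \<in> ring_hom SE.S SL.S" "inj_on J (carrier SE.S)"
    "J ` carrier SE.S = {x \<in> carrier SL.S. \<forall>b\<in>B. SL.hK b x \<in> E}"
    "\<And>c t. c \<in> E \<Longrightarrow> t \<in> carrier SE.S \<Longrightarrow> J (c \<odot>\<^bsub>SE.S\<^esub> t) = c \<odot>\<^bsub>SL.S\<^esub> J t"
    apply (rule SL.base_change[OF Esf kE])
    subgoal premises prems by (rule prems(1)[OF prems(2-)])
    done
  have JCE: "J ` carrier SE.S = C.CE E" using J(3) by (simp add: C.CE_def)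
  have wS: "w l i j \<in> carrier SL.S" if "l < r" "i < m l" "j < m l" for l i j
    using C.CE_carrier[OF w(4)[OF that]] .
  interpret J: ring_hom_ring SE.S SL.S J by (rule ring_hom_ringI2[OF SE.ring_S SL.ring_S J(1)])
  have Ja: "abelian_group_hom SE.S SL.S J" by (rule ring_hom_abelian_group_hom[OF SE.ring_S SL.ring_S J(1)])
  define u where "u l i j = inv_into (carrier SE.S) J (w l i j)" for l i j
  have u: "u l i j \<in> carrier SE.S" "J (u l i j) = w l i j" if "l < r" "i < m l" "j < m l" for l i j
  proof -
    have "w l i j \<in> J ` carrier SE.S" using w(4)[OF that] JCE by simp
    then show "u l i j \<in> carrier SE.S" "J (u l i j) = w l i j" unfolding u_def by (rule inv_into_into, rule f_inv_into_f)
  qed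
  have Jeq: "x = y" if "J x = J y" "x \<in> carrier SE.S" "y \<in> carrier SE.S" for x y
    by (rule inj_onD[OF J(2) that])
  have JC: "J x \<in> C.CE E" if "x \<in> carrier SE.S" for x using JCE that by blast
  interpret U: mat_units "L\<lparr>carrier := E\<rparr>" SE.S r m u
  proof (rule mat_units.intro)
    show "unital_algebra (L\<lparr>carrier := E\<rparr>) SE.S" by (rule SE.unital_algebra_S)
    show "u l i j \<in> carrier SE.S" if "l < r" "i < m l" "j < m l" for l i j using u that by blast
    show "u l i i \<noteq> \<zero>\<^bsub>SE.S\<^esub>" if "l < r" "i < m l" for l i
      using u(2)[OF that that(2)] w(5)[OF that] J.hom_zero by (intro notI) simp
    show "u l i j \<otimes>\<^bsub>SE.S\<^esub> u l' i' j' = (if l = l' \<and> j = i' then u l i j' else \<zero>\<^bsub>SE.S\<^esub>)"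
      if n: "l < r" "i < m l" "j < m l" "l' < r" "i' < m l'" "j' < m l'" for l i j l' i' j'
    proof (rule Jeq)
      show "J (u l i j \<otimes>\<^bsub>SE.S\<^esub> u l' i' j') = J (if l = l' \<and> j = i' then u l i j' else \<zero>\<^bsub>SE.S\<^esub>)"
        using u[OF n(1-3)] u[OF n(4-6)] u[OF n(1,2), of j'] w(6)[OF n] n J.hom_zero
        by (cases "l = l' \<and> j = i'", simp, simp, blast)
    qed (use u n in auto)
    show "(\<Oplus>\<^bsub>SE.S\<^esub>l\<in>{..<r}. \<Oplus>\<^bsub>SE.S\<^esub>i\<in>{..<m l}. u l i i) = \<one>\<^bsub>SE.S\<^esub>"
    proof (rule Jeq)
      have "J (\<Oplus>\<^bsub>SE.S\<^esub>l\<in>{..<r}. \<Oplus>\<^bsub>SE.S\<^esub>i\<in>{..<m l}. u l i i) = (\<Oplus>\<^bsub>SL.S\<^esub>l\<in>{..<r}. J (\<Oplus>\<^bsub>SE.S\<^esub>i\<in>{..<m l}. u l i i))"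
        by (rule abelian_group_hom.hom_finsum[OF Ja]) (use u in \<open>auto intro!: SE.S.finsum_closed\<close>)
      also have "\<dots> = (\<Oplus>\<^bsub>SL.S\<^esub>l\<in>{..<r}. \<Oplus>\<^bsub>SL.S\<^esub>i\<in>{..<m l}. w l i i)"
      proof (rule SL.S.finsum_cong')
        fix l assume "l \<in> {..<r}"
        then have l: "l < r" by simp
        have "J (\<Oplus>\<^bsub>SE.S\<^esub>i\<in>{..<m l}. u l i i) = (\<Oplus>\<^bsub>SL.S\<^esub>i\<in>{..<m l}. J (u l i i))"
          by (rule abelian_group_hom.hom_finsum[OF Ja]) (use u l in auto)
        also have "\<dots> = (\<Oplus>\<^bsub>SL.S\<^esub>i\<in>{..<m l}. w l i i)"
          by (rule SL.S.finsum_cong') (use u l wS in auto)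
        finally show "J (\<Oplus>\<^bsub>SE.S\<^esub>i\<in>{..<m l}. u l i i) = (\<Oplus>\<^bsub>SL.S\<^esub>i\<in>{..<m l}. w l i i)" .
      qed (use wS in \<open>auto intro!: SL.S.finsum_closed\<close>)
      finally show "J (\<Oplus>\<^bsub>SE.S\<^esub>l\<in>{..<r}. \<Oplus>\<^bsub>SE.S\<^esub>i\<in>{..<m l}. u l i i) = J \<one>\<^bsub>SE.S\<^esub>" using w(7) by simp
    qed (use u in \<open>auto intro!: SE.S.finsum_closed\<close>)
    show "\<exists>c\<in>carrier (L\<lparr>carrier := E\<rparr>). u l i i \<otimes>\<^bsub>SE.S\<^esub> x \<otimes>\<^bsub>SE.S\<^esub> u l j j = c \<odot>\<^bsub>SE.S\<^esub> u l i j"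
      if x: "x \<in> carrier SE.S" and n: "l < r" "i < m l" "j < m l" for x l i j
    proof -
      obtain c where c: "c \<in> E" "w l i i \<otimes>\<^bsub>SL.S\<^esub> J x \<otimes>\<^bsub>SL.S\<^esub> w l j j = c \<odot>\<^bsub>SL.S\<^esub> w l i j"
        using w(8)[OF JC[OF x] n] by blast
      note us = u[OF n(1,2,2)] u[OF n(1,3,3)] u[OF n]
      have "u l i i \<otimes>\<^bsub>SE.S\<^esub> x \<otimes>\<^bsub>SE.S\<^esub> u l j j = c \<odot>\<^bsub>SE.S\<^esub> u l i j"
      proof (rule Jeq)
        show "J (u l i i \<otimes>\<^bsub>SE.S\<^esub> x \<otimes>\<^bsub>SE.S\<^esub> u l j j) = J (c \<odot>\<^bsub>SE.S\<^esub> u l i j)" using us c x J(4) by simp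
        show "c \<odot>\<^bsub>SE.S\<^esub> u l i j \<in> carrier SE.S" by (rule SE.SA.smult_closed) (use c us in auto)
      qed (use us x in auto)
      then show ?thesis using c by auto
    qed
    show "u l i i \<otimes>\<^bsub>SE.S\<^esub> x \<otimes>\<^bsub>SE.S\<^esub> u l' j j = \<zero>\<^bsub>SE.S\<^esub>"
      if x: "x \<in> carrier SE.S" and n: "l < r" "i < m l" "l' < r" "j < m l'" "l \<noteq> l'" for x l i l' j
    proof (rule Jeq)
      note us = u[OF n(1,2,2)] u[OF n(3,4,4)]
      show "J (u l i i \<otimes>\<^bsub>SE.S\<^esub> x \<otimes>\<^bsub>SE.S\<^esub> u l' j j) = J \<zero>\<^bsub>SE.S\<^esub>" using us x w(9)[OF JC[OF x] n] J.hom_zero by simp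
    qed (use u n x in auto)
  qed
  have "splitting k A (L\<lparr>carrier := E\<rparr>) \<iota> r m U.\<Phi>"
    unfolding splitting_def
    using fin_sep_imp_finite_separable_extension[OF L.field_axioms A.field_axioms \<iota>h k0 w(1) p] w(2,3) U.\<Phi>_iso by blast
  then show ?thesis by blast
qed

section \<open>Uniqueness of the trace\<close>

text \<open>A high power of the sum lies in the ideal generated by the squares of the
  \<open>c i\<close>, as some factor must repeat in every monomial; but multiplying \<open>s\<close>
  by the sum changes nothing. The induction removes one summand \<open>c j\<close> at a time and
  applies the hypothesis first to \<open>s \<otimes> c j\<close>, then to \<open>s\<close>.\<close>

lemma (in cring) zero_if_squares_annihilated:
  assumes "finite I" "\<And>i. i \<in> I \<Longrightarrow> c i \<in> carrier R" "s \<in> carrier R"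
    "\<And>i. i \<in> I \<Longrightarrow> s \<otimes> (c i \<otimes> c i) = \<zero>" "s \<otimes> (\<Oplus>i\<in>I. c i) = s"
  shows "s = \<zero>"
  using assms
proof (induction I arbitrary: s rule: finite_induct)
  case empty
  then show ?case by simp
next
  case (insert j I)
  have cI: "c i \<in> carrier R" if "i \<in> I" for i using insert.prems(1) that by simp
  have cj: "c j \<in> carrier R" using insert.prems(1) by simp
  note s = insert.prems(2)
  let ?C = "\<Oplus>i\<in>I. c i"
  have C: "?C \<in> carrier R" by (rule finsum_closed) (use cI in auto)
  have tot: "s \<otimes> c j \<oplus> s \<otimes> ?C = s"
    using insert.prems(4) insert.hyps cI cj s C by (simp add: finsum_insert Pi_def r_distr)
  have "s \<otimes> c j = \<zero>"
  proof (rule insert.IH)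
    show "s \<otimes> c j \<otimes> (c i \<otimes> c i) = \<zero>" if "i \<in> I" for i
    proof -
      have "s \<otimes> c j \<otimes> (c i \<otimes> c i) = c j \<otimes> (s \<otimes> (c i \<otimes> c i))" using cI[OF that] cj s by (simp add: m_ac)
      then show ?thesis using insert.prems(3)[of i] that cj by simp
    qed
    have "s \<otimes> c j = (s \<otimes> c j \<oplus> s \<otimes> ?C) \<otimes> c j" by (simp only: tot)
    also have "\<dots> = s \<otimes> (c j \<otimes> c j) \<oplus> s \<otimes> c j \<otimes> ?C" using cj s C by (simp add: l_distr m_assoc m_comm[of ?C "c j"])
    also have "\<dots> = s \<otimes> c j \<otimes> ?C" using insert.prems(3)[of j] cj s C by simp
    finally show "s \<otimes> c j \<otimes> ?C = s \<otimes> c j" by (rule sym)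
  qed (use cI cj s in auto)
  then have sC: "s \<otimes> ?C = s" using tot s C by simp
  show ?case by (rule insert.IH[OF cI s insert.prems(3)[OF insertI2] sC])
qed

lemma (in abelian_monoid) finsum_Sigma:
  assumes "finite I" "\<And>i. i \<in> I \<Longrightarrow> finite (J i)" "\<And>i j. i \<in> I \<Longrightarrow> j \<in> J i \<Longrightarrow> f (i, j) \<in> carrier G"
  shows "(\<Oplus>p\<in>Sigma I J. f p) = (\<Oplus>i\<in>I. \<Oplus>j\<in>J i. f (i, j))"
  using assms
proof (induction I rule: finite_induct)
  case empty
  then show ?case by simp
next
  case (insert x F)
  have IH: "(\<Oplus>p\<in>Sigma F J. f p) = (\<Oplus>i\<in>F. \<Oplus>j\<in>J i. f (i, j))" by (rule insert.IH) (use insert.prems in auto)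
  have eq: "Sigma (insert x F) J = Pair x ` J x \<union> Sigma F J" by auto
  have "(\<Oplus>p\<in>Sigma (insert x F) J. f p) = (\<Oplus>p\<in>Pair x ` J x. f p) \<oplus> (\<Oplus>p\<in>Sigma F J. f p)"
    unfolding eq by (rule finsum_Un_disjoint) (use insert in auto)
  also have "(\<Oplus>p\<in>Pair x ` J x. f p) = (\<Oplus>j\<in>J x. f (x, j))"
    by (rule finsum_reindex) (use insert in \<open>auto simp: inj_on_def\<close>)
  finally show ?case using IH insert by (simp add: finsum_insert Pi_def)
qed

text \<open>A product of matrix algebras over a commutative ring, seen as one algebra of block
  diagonal matrices: \<open>P\<close> collects the diagonal positions of all blocks,
  \<open>bl\<close> gives the block of a position, \<open>C p q\<close> reads an entry, and
  \<open>F p q\<close> is a matrix unit, set to zero between blocks. Coordinates, unlike an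
  isomorphism onto a product, are easily carried along a change of rings.\<close>

locale matrix_coordinates =
  fixes R :: "('r, 'x) ring_scheme" (structure) and M :: "('r, 'm, 'y) module_scheme"
    and P :: "'p set" and bl :: "'p \<Rightarrow> 'b" and C :: "'p \<Rightarrow> 'p \<Rightarrow> 'm \<Rightarrow> 'r" and F :: "'p \<Rightarrow> 'p \<Rightarrow> 'm"
  assumes cring_R: "cring R" and ring_M: "ring M" and finP: "finite P"
    and smult_closed: "\<And>c x. c \<in> carrier R \<Longrightarrow> x \<in> carrier M \<Longrightarrow> c \<odot>\<^bsub>M\<^esub> x \<in> carrier M"
    and C_closed: "\<And>p q x. p \<in> P \<Longrightarrow> q \<in> P \<Longrightarrow> x \<in> carrier M \<Longrightarrow> C p q x \<in> carrier R"
    and C_add: "\<And>p q x y. p \<in> P \<Longrightarrow> q \<in> P \<Longrightarrow> x \<in> carrier M \<Longrightarrow> y \<in> carrier M \<Longrightarrow>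
      C p q (x \<oplus>\<^bsub>M\<^esub> y) = C p q x \<oplus> C p q y"
    and C_smult: "\<And>p q c x. p \<in> P \<Longrightarrow> q \<in> P \<Longrightarrow> c \<in> carrier R \<Longrightarrow> x \<in> carrier M \<Longrightarrow>
      C p q (c \<odot>\<^bsub>M\<^esub> x) = c \<otimes> C p q x"
    and C_mult: "\<And>p q x y. p \<in> P \<Longrightarrow> q \<in> P \<Longrightarrow> x \<in> carrier M \<Longrightarrow> y \<in> carrier M \<Longrightarrow>
      C p q (x \<otimes>\<^bsub>M\<^esub> y) = (\<Oplus>o'\<in>P. C p o' x \<otimes> C o' q y)"
    and C_one: "\<And>p q. p \<in> P \<Longrightarrow> q \<in> P \<Longrightarrow> C p q \<one>\<^bsub>M\<^esub> = (if p = q then \<one> else \<zero>)"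
    and C_off: "\<And>p q x. p \<in> P \<Longrightarrow> q \<in> P \<Longrightarrow> x \<in> carrier M \<Longrightarrow> bl p \<noteq> bl q \<Longrightarrow> C p q x = \<zero>"
    and C_inj: "\<And>x y. x \<in> carrier M \<Longrightarrow> y \<in> carrier M \<Longrightarrow>
      (\<And>p q. p \<in> P \<Longrightarrow> q \<in> P \<Longrightarrow> C p q x = C p q y) \<Longrightarrow> x = y"
    and F_closed: "\<And>p q. p \<in> P \<Longrightarrow> q \<in> P \<Longrightarrow> F p q \<in> carrier M"
    and F_off: "\<And>p q. p \<in> P \<Longrightarrow> q \<in> P \<Longrightarrow> bl p \<noteq> bl q \<Longrightarrow> F p q = \<zero>\<^bsub>M\<^esub>"
    and C_F: "\<And>p q s t. p \<in> P \<Longrightarrow> q \<in> P \<Longrightarrow> s \<in> P \<Longrightarrow> t \<in> P \<Longrightarrow> bl p = bl q \<Longrightarrow>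
      C s t (F p q) = (if s = p \<and> t = q then \<one> else \<zero>)"
begin

sublocale R: cring R by (rule cring_R)
sublocale M: ring M by (rule ring_M)

lemma C_hom: "p \<in> P \<Longrightarrow> q \<in> P \<Longrightarrow> abelian_group_hom M R (C p q)"
  by (rule abelian_group_homI') (auto simp: M.abelian_group_axioms R.abelian_group_axioms C_closed C_add)

lemma C_zero: "p \<in> P \<Longrightarrow> q \<in> P \<Longrightarrow> C p q \<zero>\<^bsub>M\<^esub> = \<zero>"
  using abelian_group_hom.hom_zero[OF C_hom] .

definition tr :: "'m \<Rightarrow> 'r" where "tr x = (\<Oplus>p\<in>P. C p p x)"

lemma tr_closed: "x \<in> carrier M \<Longrightarrow> tr x \<in> carrier R"
  unfolding tr_def by (rule R.finsum_closed) (auto simp: C_closed)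

lemma tr_add: "x \<in> carrier M \<Longrightarrow> y \<in> carrier M \<Longrightarrow> tr (x \<oplus>\<^bsub>M\<^esub> y) = tr x \<oplus> tr y"
proof -
  assume x: "x \<in> carrier M" and y: "y \<in> carrier M"
  have "tr (x \<oplus>\<^bsub>M\<^esub> y) = (\<Oplus>p\<in>P. C p p x \<oplus> C p p y)"
    unfolding tr_def by (rule R.finsum_cong') (use x y in \<open>auto simp: C_add C_closed\<close>)
  also have "\<dots> = tr x \<oplus> tr y" unfolding tr_def by (rule R.finsum_addf) (use x y in \<open>auto simp: C_closed\<close>)
  finally show ?thesis .
qed

lemma tr_hom: "abelian_group_hom M R tr"
  by (rule abelian_group_homI') (auto simp: M.abelian_group_axioms R.abelian_group_axioms tr_closed tr_add)

lemma tr_smult: "c \<in> carrier R \<Longrightarrow> x \<in> carrier M \<Longrightarrow> tr (c \<odot>\<^bsub>M\<^esub> x) = c \<otimes> tr x"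
  unfolding tr_def using finP by (subst R.finsum_rdistr) (auto simp: C_closed C_smult intro!: R.finsum_cong')

lemma tr_comm:
  assumes x: "x \<in> carrier M" and y: "y \<in> carrier M"
  shows "tr (x \<otimes>\<^bsub>M\<^esub> y) = tr (y \<otimes>\<^bsub>M\<^esub> x)"
proof -
  have "tr (x \<otimes>\<^bsub>M\<^esub> y) = (\<Oplus>p\<in>P. \<Oplus>q\<in>P. C p q x \<otimes> C q p y)"
    unfolding tr_def by (rule R.finsum_cong') (use x y in \<open>auto simp: C_mult C_closed intro!: R.finsum_closed\<close>)
  also have "\<dots> = (\<Oplus>q\<in>P. \<Oplus>p\<in>P. C p q x \<otimes> C q p y)"
    by (rule R.finsum_swap) (use x y in \<open>auto simp: C_closed finP\<close>)
  also have "\<dots> = (\<Oplus>q\<in>P. \<Oplus>p\<in>P. C q p y \<otimes> C p q x)"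
    by (rule R.finsum_cong2) (use x y in \<open>auto simp: C_closed R.m_comm\<close>)
  also have "\<dots> = tr (y \<otimes>\<^bsub>M\<^esub> x)"
    unfolding tr_def by (rule R.finsum_cong') (use x y in \<open>auto simp: C_mult C_closed intro!: R.finsum_closed\<close>)
  finally show ?thesis .
qed

lemma C_mult_F:
  assumes "x \<in> carrier M" "p \<in> P" "q \<in> P" "bl p = bl q" "s \<in> P" "t \<in> P"
  shows "C s t (x \<otimes>\<^bsub>M\<^esub> F p q) = (if t = q then C s p x else \<zero>)"
proof -
  have "C s t (x \<otimes>\<^bsub>M\<^esub> F p q) = (\<Oplus>o'\<in>P. C s o' x \<otimes> C o' t (F p q))"
    by (rule C_mult) (use assms F_closed in auto)
  also have "\<dots> = C s p x \<otimes> C p t (F p q)"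
    by (rule R.finsum_single[OF finP]) (use assms F_closed C_closed C_F in auto)
  finally show ?thesis using assms C_closed C_F by simp
qed

lemma tr_mult_F:
  assumes "x \<in> carrier M" "p \<in> P" "q \<in> P" "bl p = bl q"
  shows "tr (x \<otimes>\<^bsub>M\<^esub> F p q) = C q p x"
proof -
  have "tr (x \<otimes>\<^bsub>M\<^esub> F p q) = C q q (x \<otimes>\<^bsub>M\<^esub> F p q)"
    unfolding tr_def by (rule R.finsum_single[OF finP]) (use assms C_mult_F C_closed F_closed in auto)
  then show ?thesis using assms by (simp add: C_mult_F)
qed

text \<open>Multiplying with a matrix unit and taking the trace reads off any entry within a block
  (\<open>tr_mult_F\<close>); the other entries are zero anyway.\<close>

lemma tr_nondegenerate:
  assumes x: "x \<in> carrier M" and z: "\<And>y. y \<in> carrier M \<Longrightarrow> tr (x \<otimes>\<^bsub>M\<^esub> y) = \<zero>"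
  shows "x = \<zero>\<^bsub>M\<^esub>"
proof (rule C_inj[OF x M.zero_closed])
  fix p q assume pq: "p \<in> P" "q \<in> P"
  have "C p q x = \<zero>"
  proof (cases "bl p = bl q")
    case True
    then show ?thesis using tr_mult_F[OF x pq(2,1)] z[OF F_closed[OF pq(2,1)]] by simp
  qed (use C_off[OF pq x] in simp)
  then show "C p q x = C p q \<zero>\<^bsub>M\<^esub>" using C_zero pq by simp
qed

lemma sum_F: "(\<Oplus>\<^bsub>M\<^esub>p\<in>P. F p p) = \<one>\<^bsub>M\<^esub>"
proof (rule C_inj)
  fix s t assume st: "s \<in> P" "t \<in> P"
  interpret H: abelian_group_hom M R "C s t" by (rule C_hom[OF st])
  have "C s t (\<Oplus>\<^bsub>M\<^esub>p\<in>P. F p p) = (\<Oplus>p\<in>P. C s t (F p p))" by (rule H.hom_finsum) (use F_closed in auto)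
  also have "\<dots> = C s t (F s s)" by (rule R.finsum_single[OF finP]) (use st C_F in auto)
  finally show "C s t (\<Oplus>\<^bsub>M\<^esub>p\<in>P. F p p) = C s t \<one>\<^bsub>M\<^esub>" using st C_F C_one by simp
qed (auto intro!: M.finsum_closed F_closed)

lemma expand:
  assumes x: "x \<in> carrier M"
  shows "x = (\<Oplus>\<^bsub>M\<^esub>p\<in>P. \<Oplus>\<^bsub>M\<^esub>q\<in>P. C p q x \<odot>\<^bsub>M\<^esub> F p q)"
proof (rule C_inj[OF x])
  have cl: "C p q x \<odot>\<^bsub>M\<^esub> F p q \<in> carrier M" if "p \<in> P" "q \<in> P" for p q
    using that x by (intro smult_closed C_closed F_closed)
  then have cl': "(\<Oplus>\<^bsub>M\<^esub>q\<in>P. C p q x \<odot>\<^bsub>M\<^esub> F p q) \<in> carrier M" if "p \<in> P" for p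
    using that by (intro M.finsum_closed) auto
  show "(\<Oplus>\<^bsub>M\<^esub>p\<in>P. \<Oplus>\<^bsub>M\<^esub>q\<in>P. C p q x \<odot>\<^bsub>M\<^esub> F p q) \<in> carrier M" using cl' by (intro M.finsum_closed) auto
  fix s t assume st: "s \<in> P" "t \<in> P"
  interpret H: abelian_group_hom M R "C s t" by (rule C_hom[OF st])
  have c: "C s t (C p q x \<odot>\<^bsub>M\<^esub> F p q) = (if s = p \<and> t = q then C s t x else \<zero>)" if "p \<in> P" "q \<in> P" for p q
  proof (cases "bl p = bl q")
    case True
    then show ?thesis using C_smult[OF st C_closed[OF that x] F_closed[OF that]] C_F[OF that st] C_closed[OF that x] by auto
  next
    case False
    then have "C s t (C p q x \<odot>\<^bsub>M\<^esub> F p q) = \<zero>"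
      using C_smult[OF st C_closed[OF that x] F_closed[OF that]] F_off[OF that] C_zero[OF st] C_closed[OF that x] by simp
    moreover have "s = p \<and> t = q \<Longrightarrow> C s t x = \<zero>" using C_off[OF that x False] by simp
    ultimately show ?thesis by simp
  qed
  have "C s t (\<Oplus>\<^bsub>M\<^esub>p\<in>P. \<Oplus>\<^bsub>M\<^esub>q\<in>P. C p q x \<odot>\<^bsub>M\<^esub> F p q) = (\<Oplus>p\<in>P. C s t (\<Oplus>\<^bsub>M\<^esub>q\<in>P. C p q x \<odot>\<^bsub>M\<^esub> F p q))"
    by (rule H.hom_finsum) (use cl' in auto)
  also have "\<dots> = (\<Oplus>p\<in>P. if p = s then C s t x else \<zero>)"
  proof (rule R.finsum_cong')
    fix p assume p: "p \<in> P"
    have "C s t (\<Oplus>\<^bsub>M\<^esub>q\<in>P. C p q x \<odot>\<^bsub>M\<^esub> F p q) = (\<Oplus>q\<in>P. C s t (C p q x \<odot>\<^bsub>M\<^esub> F p q))"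
      by (rule H.hom_finsum) (use cl p in auto)
    also have "\<dots> = C s t (C p t x \<odot>\<^bsub>M\<^esub> F p t)"
      by (rule R.finsum_single[OF finP]) (use c p st C_closed x in auto)
    finally show "C s t (\<Oplus>\<^bsub>M\<^esub>q\<in>P. C p q x \<odot>\<^bsub>M\<^esub> F p q) = (if p = s then C s t x else \<zero>)" using c p st by simp
  qed (use C_closed st x in auto)
  also have "\<dots> = (if s = s then C s t x else \<zero>)"
    by (rule R.finsum_single[OF finP]) (use C_closed st x in auto)
  finally show "C s t x = C s t (\<Oplus>\<^bsub>M\<^esub>p\<in>P. \<Oplus>\<^bsub>M\<^esub>q\<in>P. C p q x \<odot>\<^bsub>M\<^esub> F p q)" by simp
qed

text \<open>
  Comparing entries in \<open>e F\<^sub>p\<^sub>q e = \<lambda>(F\<^sub>p\<^sub>q) e\<close> gives \<open>e\<^sub>q\<^sub>p = \<lambda>(F\<^sub>p\<^sub>q) t\<close> for \<open>t = tr e\<close>, so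
  \<open>(t\<^sup>2 - t) \<lambda>(F\<^sub>p\<^sub>p)\<^sup>2 = 0\<close>. As the \<open>\<lambda>(F\<^sub>p\<^sub>p)\<close> add up to \<open>1\<close>, \<open>t\<close> is idempotent; and \<open>1 - t\<close>
  annihilates \<open>e\<close>.
\<close>

lemma tr_rank_one_idempotent:
  assumes e: "e \<in> carrier M" and l: "abelian_group_hom M R l"
    and lsm: "\<And>c x. c \<in> carrier R \<Longrightarrow> x \<in> carrier M \<Longrightarrow> l (c \<odot>\<^bsub>M\<^esub> x) = c \<otimes> l x"
    and l1: "l \<one>\<^bsub>M\<^esub> = \<one>" and le: "l e = \<one>" and idem: "e \<otimes>\<^bsub>M\<^esub> e = e"
    and sand: "\<And>y. y \<in> carrier M \<Longrightarrow> e \<otimes>\<^bsub>M\<^esub> y \<otimes>\<^bsub>M\<^esub> e = l y \<odot>\<^bsub>M\<^esub> e"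
  shows "tr e = \<one>"
proof -
  interpret l: abelian_group_hom M R l by (rule l)
  define a where "a p q = C p q e" for p q
  define t where "t = tr e"
  have a: "a p q \<in> carrier R" if "p \<in> P" "q \<in> P" for p q using that e by (simp add: a_def C_closed)
  have t: "t \<in> carrier R" using e by (simp add: t_def tr_closed)
  have lF: "l (F p q) \<in> carrier R" if "p \<in> P" "q \<in> P" for p q using that F_closed l.hom_closed by blast
  have entry: "a s p \<otimes> a q u = l (F p q) \<otimes> a s u"
    if n: "p \<in> P" "q \<in> P" "s \<in> P" "u \<in> P" and b: "bl p = bl q" for p q s u
  proof -
    have eF: "e \<otimes>\<^bsub>M\<^esub> F p q \<in> carrier M" using e F_closed n by simp
    have "C s u (e \<otimes>\<^bsub>M\<^esub> F p q \<otimes>\<^bsub>M\<^esub> e) = (\<Oplus>o'\<in>P. C s o' (e \<otimes>\<^bsub>M\<^esub> F p q) \<otimes> C o' u e)"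
      by (rule C_mult[OF n(3,4) eF e])
    also have "\<dots> = C s q (e \<otimes>\<^bsub>M\<^esub> F p q) \<otimes> C q u e"
      by (rule R.finsum_single[OF finP n(2)]) (use n b e C_closed eF C_mult_F in auto)
    also have "\<dots> = a s p \<otimes> a q u" using C_mult_F[OF e n(1,2) b n(3,2)] by (simp add: a_def)
    finally show ?thesis
      using sand[OF F_closed[OF n(1,2)]] C_smult[OF n(3,4) lF[OF n(1,2)] e] by (simp add: a_def)
  qed
  have at: "a q p = l (F p q) \<otimes> t" if n: "p \<in> P" "q \<in> P" and b: "bl p = bl q" for p q
  proof -
    have "a q p = C q p (e \<otimes>\<^bsub>M\<^esub> e)" by (simp add: idem a_def)
    also have "\<dots> = (\<Oplus>s\<in>P. a q s \<otimes> a s p)" using n e by (simp add: C_mult a_def)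
    also have "\<dots> = (\<Oplus>s\<in>P. l (F p q) \<otimes> a s s)"
    proof (rule R.finsum_cong')
      fix s assume s: "s \<in> P"
      show "a q s \<otimes> a s p = l (F p q) \<otimes> a s s"
        using entry[OF n s s b] R.m_comm[OF a[OF n(2) s] a[OF s n(1)]] by simp
    qed (use n a lF in auto)
    also have "\<dots> = l (F p q) \<otimes> (\<Oplus>s\<in>P. a s s)" by (rule R.finsum_rdistr[symmetric]) (use finP lF n a in auto)
    finally show ?thesis by (simp add: t_def tr_def a_def)
  qed
  define d where "d = t \<otimes> t \<ominus> t"
  have d: "d \<in> carrier R" using t by (simp add: d_def)
  have "d = \<zero>"
  proof (rule R.zero_if_squares_annihilated[where c = "\<lambda>p. l (F p p)", OF finP])
    show "l (F p p) \<in> carrier R" if "p \<in> P" for p using lF that by simp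
    show "d \<otimes> (l (F p p) \<otimes> l (F p p)) = \<zero>" if p: "p \<in> P" for p
    proof -
      let ?c = "l (F p p)"
      have c: "?c \<in> carrier R" using lF p by simp
      have "?c \<otimes> t \<otimes> (?c \<otimes> t) = ?c \<otimes> (?c \<otimes> t)" using entry[OF p p p p refl] at[OF p p refl] by simp
      then have "t \<otimes> t \<otimes> (?c \<otimes> ?c) = t \<otimes> (?c \<otimes> ?c)" using c t by (simp add: R.m_ac)
      then show ?thesis using c t unfolding d_def by (simp add: a_minus_def R.l_distr R.l_minus R.r_neg)
    qed
    have "(\<Oplus>p\<in>P. l (F p p)) = l (\<Oplus>\<^bsub>M\<^esub>p\<in>P. F p p)" by (rule l.hom_finsum[symmetric]) (use F_closed in auto)
    then show "d \<otimes> (\<Oplus>p\<in>P. l (F p p)) = d" using sum_F l1 d by simp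
  qed (rule d)
  then have tt: "t \<otimes> t = t" using R.diff_zero_imp_eq[of "t \<otimes> t" t] t by (simp add: d_def a_minus_def)
  have "(\<one> \<ominus> t) \<odot>\<^bsub>M\<^esub> e = \<zero>\<^bsub>M\<^esub>"
  proof (rule C_inj)
    fix q p assume n: "q \<in> P" "p \<in> P"
    have "(\<one> \<ominus> t) \<otimes> a q p = \<zero>"
    proof (cases "bl p = bl q")
      case True
      have "(\<one> \<ominus> t) \<otimes> (l (F p q) \<otimes> t) = l (F p q) \<otimes> (t \<ominus> t \<otimes> t)"
        using lF[OF n(2,1)] t by (simp add: a_minus_def R.l_distr R.r_distr R.l_minus R.r_minus R.m_ac)
      then show ?thesis using at[OF n(2,1) True] tt lF[OF n(2,1)] t by (simp add: a_minus_def R.r_neg)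
    next
      case False
      then show ?thesis using C_off[OF n e] t by (simp add: a_def)
    qed
    then show "C q p ((\<one> \<ominus> t) \<odot>\<^bsub>M\<^esub> e) = C q p \<zero>\<^bsub>M\<^esub>" using C_smult[OF n _ e, of "\<one> \<ominus> t"] C_zero[OF n] t by (simp add: a_def)
  qed (use t e smult_closed in auto)
  \<comment> \<open>Applying \<open>l\<close>, with \<open>l e = \<one>\<close>, converts the
    annihilation of \<open>e\<close> into \<open>t = \<one>\<close>.\<close>
  then have "(\<one> \<ominus> t) \<otimes> l e = \<zero>" using lsm[of "\<one> \<ominus> t" e] t e l.hom_zero by simp
  then have "\<one> \<ominus> t = \<zero>" using le t by simp
  then have "\<one> = t" using R.diff_zero_imp_eq[of "\<one>" t] t by (simp add: a_minus_def)
  then show ?thesis by (simp add: t_def)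
qed

end

text \<open>The diagonal units of the first system satisfy
  \<open>F p p y F p p = C p p y F p p\<close>, so by \<open>tr_rank_one_idempotent\<close> they
  have trace \<open>1\<close> in the second. The off-diagonal ones have trace \<open>0\<close>,
  since \<open>F p q = F p p F p q\<close> while \<open>F p q F p p = 0\<close>. Linearity over the
  expansion of \<open>x\<close> then compares the traces.\<close>

lemma trace_unique:
  assumes "matrix_coordinates R M P bl C F" "matrix_coordinates R M P' bl' C' F'" and x: "x \<in> carrier M"
  shows "matrix_coordinates.tr R P C x = matrix_coordinates.tr R P' C' x"
proof -
  interpret X1: matrix_coordinates R M P bl C F by fact
  interpret X2: matrix_coordinates R M P' bl' C' F' by fact
  interpret T: abelian_group_hom M R X2.tr by (rule X2.tr_hom)
  have mF: "F p q \<otimes>\<^bsub>M\<^esub> F s u = (if q = s then F p u else \<zero>\<^bsub>M\<^esub>)"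
    if n: "p \<in> P" "q \<in> P" "s \<in> P" "u \<in> P" and b: "bl p = bl q" "bl s = bl u" for p q s u
  proof (rule X1.C_inj)
    fix v w assume vw: "v \<in> P" "w \<in> P"
    show "C v w (F p q \<otimes>\<^bsub>M\<^esub> F s u) = C v w (if q = s then F p u else \<zero>\<^bsub>M\<^esub>)"
      using X1.C_mult_F[OF X1.F_closed[OF n(1,2)] n(3,4) b(2) vw] X1.C_F[OF n(1,2) vw(1) n(3) b(1)]
        X1.C_F[OF n(1,4) vw] b X1.C_zero[OF vw] by auto
  qed (use X1.F_closed n in auto)
  have trF: "X2.tr (F p q) = (if p = q then \<one>\<^bsub>R\<^esub> else \<zero>\<^bsub>R\<^esub>)" if n: "p \<in> P" "q \<in> P" for p q
  proof (cases "p = q")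
    case True
    have "X2.tr (F p p) = \<one>\<^bsub>R\<^esub>"
    proof (rule X2.tr_rank_one_idempotent[where l = "C p p"])
      show "F p p \<otimes>\<^bsub>M\<^esub> y \<otimes>\<^bsub>M\<^esub> F p p = C p p y \<odot>\<^bsub>M\<^esub> F p p" if y: "y \<in> carrier M" for y
      proof (rule X1.C_inj)
        fix v w assume vw: "v \<in> P" "w \<in> P"
        have "C v p (F p p \<otimes>\<^bsub>M\<^esub> y) = (\<Oplus>\<^bsub>R\<^esub>o'\<in>P. C v o' (F p p) \<otimes>\<^bsub>R\<^esub> C o' p y)"
          by (rule X1.C_mult[OF vw(1) n(1) X1.F_closed[OF n(1,1)] y])
        also have "\<dots> = C v p (F p p) \<otimes>\<^bsub>R\<^esub> C p p y"
          by (rule X1.R.finsum_single[OF X1.finP n(1)]) (use X1.C_closed X1.F_closed X1.C_F n vw y in auto)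
        finally have "C v p (F p p \<otimes>\<^bsub>M\<^esub> y) = C v p (F p p) \<otimes>\<^bsub>R\<^esub> C p p y" .
        then show "C v w (F p p \<otimes>\<^bsub>M\<^esub> y \<otimes>\<^bsub>M\<^esub> F p p) = C v w (C p p y \<odot>\<^bsub>M\<^esub> F p p)"
          using n vw y X1.F_closed X1.C_closed by (simp add: X1.C_mult_F X1.C_smult X1.C_F)
      qed (use X1.F_closed X1.C_closed X1.smult_closed n y in auto)
    qed (use X1.F_closed X1.C_hom X1.C_smult X1.C_one X1.C_F mF n in auto)
    then show ?thesis using True by simp
  next
    case False
    show ?thesis
    proof (cases "bl p = bl q")
      case True
      have "X2.tr (F p p \<otimes>\<^bsub>M\<^esub> F p q) = X2.tr (F p q \<otimes>\<^bsub>M\<^esub> F p p)"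
        by (rule X2.tr_comm) (use X1.F_closed n in auto)
      then show ?thesis using mF[OF n(1,1) n] mF[OF n n(1,1)] True False T.hom_zero by simp
    next
      case False
      then show ?thesis using X1.F_off[OF n] T.hom_zero by auto
    qed
  qed
  have cl: "C p q x \<odot>\<^bsub>M\<^esub> F p q \<in> carrier M" if "p \<in> P" "q \<in> P" for p q
    using that x by (intro X1.smult_closed X1.C_closed X1.F_closed)
  then have cl': "(\<Oplus>\<^bsub>M\<^esub>q\<in>P. C p q x \<odot>\<^bsub>M\<^esub> F p q) \<in> carrier M" if "p \<in> P" for p
    using that by (intro X1.M.finsum_closed) auto
  have "X2.tr x = X2.tr (\<Oplus>\<^bsub>M\<^esub>p\<in>P. \<Oplus>\<^bsub>M\<^esub>q\<in>P. C p q x \<odot>\<^bsub>M\<^esub> F p q)" by (simp only: X1.expand[OF x, symmetric])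
  also have "\<dots> = (\<Oplus>\<^bsub>R\<^esub>p\<in>P. X2.tr (\<Oplus>\<^bsub>M\<^esub>q\<in>P. C p q x \<odot>\<^bsub>M\<^esub> F p q))"
    by (rule T.hom_finsum) (use cl' in auto)
  also have "\<dots> = (\<Oplus>\<^bsub>R\<^esub>p\<in>P. C p p x)"
  proof (rule X1.R.finsum_cong')
    fix p assume p: "p \<in> P"
    have tc: "X2.tr (C p q x \<odot>\<^bsub>M\<^esub> F p q) = (if p = q then C p q x else \<zero>\<^bsub>R\<^esub>)" if "q \<in> P" for q
      using X2.tr_smult[OF X1.C_closed[OF p that x] X1.F_closed[OF p that]] trF[OF p that] X1.C_closed[OF p that x] by auto
    have "X2.tr (\<Oplus>\<^bsub>M\<^esub>q\<in>P. C p q x \<odot>\<^bsub>M\<^esub> F p q) = (\<Oplus>\<^bsub>R\<^esub>q\<in>P. X2.tr (C p q x \<odot>\<^bsub>M\<^esub> F p q))"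
      by (rule T.hom_finsum) (use cl p in auto)
    also have "\<dots> = X2.tr (C p p x \<odot>\<^bsub>M\<^esub> F p p)"
      by (rule X1.R.finsum_single[OF X1.finP p]) (use tc p X1.C_closed x in auto)
    finally show "X2.tr (\<Oplus>\<^bsub>M\<^esub>q\<in>P. C p q x \<odot>\<^bsub>M\<^esub> F p q) = C p p x" using tc p by simp
  qed (use X1.C_closed x in auto)
  finally show ?thesis by (simp add: X1.tr_def)
qed

section \<open>Matrix coordinates from a splitting, and their base change\<close>

lemma matrix_algebra_simps:
  "carrier (matrix_algebra E n) = {..<n} \<times> {..<n} \<rightarrow>\<^sub>E carrier E"
  "i < n \<Longrightarrow> j < n \<Longrightarrow> (M \<otimes>\<^bsub>matrix_algebra E n\<^esub> N) (i, j) = (\<Oplus>\<^bsub>E\<^esub>l\<in>{..<n}. M (i, l) \<otimes>\<^bsub>E\<^esub> N (l, j))"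
  "i < n \<Longrightarrow> j < n \<Longrightarrow> \<one>\<^bsub>matrix_algebra E n\<^esub> (i, j) = (if i = j then \<one>\<^bsub>E\<^esub> else \<zero>\<^bsub>E\<^esub>)"
  "i < n \<Longrightarrow> j < n \<Longrightarrow> (M \<oplus>\<^bsub>matrix_algebra E n\<^esub> N) (i, j) = M (i, j) \<oplus>\<^bsub>E\<^esub> N (i, j)"
  "i < n \<Longrightarrow> j < n \<Longrightarrow> (c \<odot>\<^bsub>matrix_algebra E n\<^esub> M) (i, j) = c \<otimes>\<^bsub>E\<^esub> M (i, j)"
  by (simp_all add: matrix_algebra_def)

lemma product_algebra_simps:
  "carrier (product_algebra I B) = (\<Pi>\<^sub>E i\<in>I. carrier (B i))"
  "i \<in> I \<Longrightarrow> (x \<otimes>\<^bsub>product_algebra I B\<^esub> y) i = x i \<otimes>\<^bsub>B i\<^esub> y i"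
  "i \<in> I \<Longrightarrow> \<one>\<^bsub>product_algebra I B\<^esub> i = \<one>\<^bsub>B i\<^esub>"
  "i \<in> I \<Longrightarrow> (x \<oplus>\<^bsub>product_algebra I B\<^esub> y) i = x i \<oplus>\<^bsub>B i\<^esub> y i"
  "i \<in> I \<Longrightarrow> (c \<odot>\<^bsub>product_algebra I B\<^esub> x) i = c \<odot>\<^bsub>B i\<^esub> x i"
  by (simp_all add: product_algebra_def)

text \<open>The entries of the block diagonal matrix assembled from the components of
  \<open>\<phi> s\<close>; a position is a pair of block number and row.\<close>

definition entry :: "('e, 'x) ring_scheme \<Rightarrow> ('s \<Rightarrow> nat \<Rightarrow> nat \<times> nat \<Rightarrow> 'e) \<Rightarrow> nat \<times> nat \<Rightarrow> nat \<times> nat \<Rightarrow> 's \<Rightarrow> 'e" where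
  "entry E \<phi> p q s = (if fst p = fst q then \<phi> s (fst p) (snd p, snd q) else \<zero>\<^bsub>E\<^esub>)"

lemma (in scalar_ext) iso_matrix_coordinates:
  assumes iso: "\<phi> \<in> algebra_iso K S (product_algebra {..<r} (\<lambda>i. matrix_algebra K (m i)))"
  shows "\<exists>f. matrix_coordinates K S (Sigma {..<r} (\<lambda>l. {..<m l})) fst (entry K \<phi>) f"
proof -
  let ?B = "product_algebra {..<r} (\<lambda>i. matrix_algebra K (m i))" and ?P = "Sigma {..<r} (\<lambda>l. {..<m l})"
  have hom: "\<phi> \<in> ring_hom S ?B" and bij: "bij_betw \<phi> (carrier S) (carrier ?B)"
    and sm: "\<And>c x. c \<in> carrier K \<Longrightarrow> x \<in> carrier S \<Longrightarrow> \<phi> (c \<odot>\<^bsub>S\<^esub> x) = c \<odot>\<^bsub>?B\<^esub> \<phi> x"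
    using iso by (auto simp: algebra_iso_def ring_iso_def)
  have cl: "\<phi> s l (i, j) \<in> carrier K" if "s \<in> carrier S" "l < r" "i < m l" "j < m l" for s l i j
  proof -
    have "\<phi> s l \<in> carrier (matrix_algebra K (m l))"
      using ring_hom_closed[OF hom that(1)] that(2) by (auto simp: product_algebra_simps)
    then show ?thesis using that by (auto simp: matrix_algebra_simps)
  qed
  \<comment> \<open>Elementary matrices in the product algebra; their preimages under \<phi> become
    the matrix units.\<close>
  define u :: "nat \<times> nat \<Rightarrow> nat \<times> nat \<Rightarrow> nat \<Rightarrow> nat \<times> nat \<Rightarrow> 'e" where
    "u p q = (\<lambda>l\<in>{..<r}. \<lambda>(i, j)\<in>{..<m l} \<times> {..<m l}. if (l, i) = p \<and> (l, j) = q then \<one>\<^bsub>K\<^esub> else \<zero>\<^bsub>K\<^esub>)" for p q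
  have uB: "u p q \<in> carrier ?B" for p q
    by (auto simp: u_def product_algebra_simps matrix_algebra_simps split: if_splits)
  define f where "f p q = (if fst p = fst q then inv_into (carrier S) \<phi> (u p q) else \<zero>\<^bsub>S\<^esub>)" for p q
  have f: "inv_into (carrier S) \<phi> (u p q) \<in> carrier S" "\<phi> (inv_into (carrier S) \<phi> (u p q)) = u p q" for p q
    using bij uB[of p q] by (auto simp: bij_betw_def inv_into_into f_inv_into_f)
  have ec: "entry K \<phi> p q s \<in> carrier K" if "p \<in> ?P" "q \<in> ?P" "s \<in> carrier S" for p q s
    using that cl by (auto simp: entry_def)
  have "matrix_coordinates K S ?P fst (entry K \<phi>) f"
  proof (rule matrix_coordinates.intro)
    show "cring K" by (rule K.is_cring)
    show "ring S" by (rule ring_S)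
    show "finite ?P" by auto
    show "c \<odot>\<^bsub>S\<^esub> x \<in> carrier S" if "c \<in> carrier K" "x \<in> carrier S" for c x using that by simp
    show "entry K \<phi> p q s \<in> carrier K" if "p \<in> ?P" "q \<in> ?P" "s \<in> carrier S" for p q s using that by (rule ec)
    show "entry K \<phi> p q (x \<oplus>\<^bsub>S\<^esub> y) = entry K \<phi> p q x \<oplus>\<^bsub>K\<^esub> entry K \<phi> p q y"
      if "p \<in> ?P" "q \<in> ?P" "x \<in> carrier S" "y \<in> carrier S" for p q x y
      using that ring_hom_add[OF hom] by (auto simp: entry_def product_algebra_simps matrix_algebra_simps)
    show "entry K \<phi> p q (c \<odot>\<^bsub>S\<^esub> x) = c \<otimes>\<^bsub>K\<^esub> entry K \<phi> p q x"
      if "p \<in> ?P" "q \<in> ?P" "c \<in> carrier K" "x \<in> carrier S" for p q c x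
      using that sm by (auto simp: entry_def product_algebra_simps matrix_algebra_simps)
    show "entry K \<phi> p q \<one>\<^bsub>S\<^esub> = (if p = q then \<one>\<^bsub>K\<^esub> else \<zero>\<^bsub>K\<^esub>)" if "p \<in> ?P" "q \<in> ?P" for p q
      using that ring_hom_one[OF hom] by (auto simp: entry_def product_algebra_simps matrix_algebra_simps split: if_splits)
    show "entry K \<phi> p q x = \<zero>\<^bsub>K\<^esub>" if "fst p \<noteq> fst q" for p q x using that by (simp add: entry_def)
    show "f p q \<in> carrier S" for p q using f by (simp add: f_def)
    show "f p q = \<zero>\<^bsub>S\<^esub>" if "fst p \<noteq> fst q" for p q using that by (simp add: f_def)
    show "entry K \<phi> s t (f p q) = (if s = p \<and> t = q then \<one>\<^bsub>K\<^esub> else \<zero>\<^bsub>K\<^esub>)"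
      if "p \<in> ?P" "q \<in> ?P" "s \<in> ?P" "t \<in> ?P" "fst p = fst q" for p q s t
    proof -
      have \<phi>f: "\<phi> (f p q) = u p q" by (simp only: f_def that(5) if_True simp_thms f(2))
      have st: "fst s < r" "snd s < m (fst s)" "snd t < m (fst t)" using that by auto
      show ?thesis
      proof (cases "fst s = fst t")
        case True
        have tt: "(fst s, snd t) = t" unfolding True by (rule prod.collapse)
        have "u p q (fst s) (snd s, snd t) = (if (fst s, snd s) = p \<and> (fst s, snd t) = q then \<one>\<^bsub>K\<^esub> else \<zero>\<^bsub>K\<^esub>)"
          using st True by (simp add: u_def)
        then show ?thesis unfolding entry_def \<phi>f if_P[OF True] tt prod.collapse .
      next
        case False
        then have "\<not> (s = p \<and> t = q)" using that(5) by auto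
        then show ?thesis using False by (simp only: entry_def if_False)
      qed
    qed
    show "x = y" if x: "x \<in> carrier S" and y: "y \<in> carrier S"
      and eq: "\<And>p q. p \<in> ?P \<Longrightarrow> q \<in> ?P \<Longrightarrow> entry K \<phi> p q x = entry K \<phi> p q y" for x y
    proof -
      have "\<phi> x l i = \<phi> y l i" if "l < r" "i \<in> {..<m l} \<times> {..<m l}" for l i
        using eq[of "(l, fst i)" "(l, snd i)"] that by (auto simp: entry_def)
      moreover have "\<phi> z l \<in> extensional ({..<m l} \<times> {..<m l})" if "z \<in> carrier S" "l < r" for z l
        using ring_hom_closed[OF hom that(1)] that(2)
        by (auto simp: product_algebra_simps matrix_algebra_simps PiE_def Pi_def)
      ultimately have "\<phi> x l = \<phi> y l" if "l < r" for l
        using x y that by (intro extensionalityI[where A = "{..<m l} \<times> {..<m l}"]) auto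
      moreover have "\<phi> z \<in> extensional {..<r}" if "z \<in> carrier S" for z
        using ring_hom_closed[OF hom that] by (simp add: product_algebra_simps PiE_def)
      ultimately have "\<phi> x = \<phi> y" using x y by (intro extensionalityI[where A = "{..<r}"]) auto
      then show ?thesis using bij x y by (intro inj_onD[of \<phi> "carrier S"]) (simp_all add: bij_betw_def)
    qed
    show "entry K \<phi> p q (x \<otimes>\<^bsub>S\<^esub> y) = (\<Oplus>\<^bsub>K\<^esub>o'\<in>?P. entry K \<phi> p o' x \<otimes>\<^bsub>K\<^esub> entry K \<phi> o' q y)"
      if n: "p \<in> ?P" "q \<in> ?P" and xy: "x \<in> carrier S" "y \<in> carrier S" for p q x y
    proof (cases "fst p = fst q")
      case False
      have "(\<Oplus>\<^bsub>K\<^esub>o'\<in>?P. entry K \<phi> p o' x \<otimes>\<^bsub>K\<^esub> entry K \<phi> o' q y) = \<zero>\<^bsub>K\<^esub>"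
      proof (rule K.finsum_all_zero)
        fix o' assume o': "o' \<in> ?P"
        have "fst p \<noteq> fst o' \<or> fst o' \<noteq> fst q" using False by auto
        then have "entry K \<phi> p o' x = \<zero>\<^bsub>K\<^esub> \<or> entry K \<phi> o' q y = \<zero>\<^bsub>K\<^esub>" by (auto simp: entry_def)
        then show "entry K \<phi> p o' x \<otimes>\<^bsub>K\<^esub> entry K \<phi> o' q y = \<zero>\<^bsub>K\<^esub>"
          using ec[OF n(1) o' xy(1)] ec[OF o' n(2) xy(2)] by auto
      qed
      then show ?thesis using False by (simp add: entry_def)
    next
      case True
      then obtain l i j where pq: "p = (l, i)" "q = (l, j)" "l < r" "i < m l" "j < m l" using n by auto
      have "(\<Oplus>\<^bsub>K\<^esub>o'\<in>?P. entry K \<phi> p o' x \<otimes>\<^bsub>K\<^esub> entry K \<phi> o' q y)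
          = (\<Oplus>\<^bsub>K\<^esub>a\<in>{..<r}. \<Oplus>\<^bsub>K\<^esub>b\<in>{..<m a}. entry K \<phi> p (a, b) x \<otimes>\<^bsub>K\<^esub> entry K \<phi> (a, b) q y)"
        by (rule K.finsum_Sigma) (use ec n xy in auto)
      also have "\<dots> = (\<Oplus>\<^bsub>K\<^esub>b\<in>{..<m l}. entry K \<phi> p (l, b) x \<otimes>\<^bsub>K\<^esub> entry K \<phi> (l, b) q y)"
      proof (rule K.finsum_single)
        show "(\<Oplus>\<^bsub>K\<^esub>b\<in>{..<m l}. entry K \<phi> p (l, b) x \<otimes>\<^bsub>K\<^esub> entry K \<phi> (l, b) q y) \<in> carrier K"
          by (rule K.finsum_closed) (use ec n xy pq in auto)
        show "(\<Oplus>\<^bsub>K\<^esub>b\<in>{..<m a}. entry K \<phi> p (a, b) x \<otimes>\<^bsub>K\<^esub> entry K \<phi> (a, b) q y) = \<zero>\<^bsub>K\<^esub>" if "a \<noteq> l" for a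
          by (rule K.finsum_all_zero) (use pq that in \<open>simp add: entry_def\<close>)
      qed (use pq in auto)
      also have "\<dots> = (\<Oplus>\<^bsub>K\<^esub>b\<in>{..<m l}. \<phi> x l (i, b) \<otimes>\<^bsub>K\<^esub> \<phi> y l (b, j))"
        by (rule K.finsum_cong') (use pq cl xy in \<open>auto simp: entry_def\<close>)
      finally show ?thesis using pq ring_hom_mult[OF hom xy]
        by (simp add: entry_def product_algebra_simps matrix_algebra_simps)
    qed
  qed
  then show ?thesis by blast
qed

text \<open>The coordinates are extended \<open>R\<close>-linearly from the elements
  \<open>1 \<otimes> a\<close>, and the matrix units are the images under the induced ring
  homomorphism \<open>J\<close>. The structure map \<kappa> is a separate parameter that agrees with
  \<open>j \<circ> \<iota>\<close> on the ground field, because two different splittings must lead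
  to literally the same scalar extension over \<open>R\<close>.\<close>

lemma (in scalar_ext) base_change_coordinates:
  fixes R :: "('r, 'w) ring_scheme" and \<kappa> :: "'k \<Rightarrow> 'r"
  assumes mc: "matrix_coordinates K S P bl c f" and R: "cring R" and j: "j \<in> ring_hom K R"
    and \<kappa>: "\<And>a. a \<in> carrier k \<Longrightarrow> \<kappa> a = j (\<iota> a)"
  shows "\<exists>C F. matrix_coordinates R (scalar_extension k A R \<kappa>) P bl C F \<and>
    (\<forall>p\<in>P. \<forall>q\<in>P. \<forall>a\<in>carrier A. C p q (pure_tensor k A R \<kappa> \<one>\<^bsub>R\<^esub> a) = j (c p q (pure \<one>\<^bsub>K\<^esub> a)))"
proof -
  interpret c: matrix_coordinates K S P bl c f by (rule mc)
  interpret R: cring R by (rule R)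
  interpret j: ring_hom_ring K R j by (rule ring_hom_ringI2[OF K.ring_axioms R.ring_axioms j])
  have \<kappa>_hom: "\<kappa> \<in> ring_hom k R"
    using \<iota>.homh by (intro ring_hom_memI) (auto simp: \<kappa>)
  interpret T: scalar_ext_cring k A R \<kappa>
    by (intro scalar_ext_cring.intro alg R \<kappa>_hom)
  have cc: "c p q (pure \<one>\<^bsub>K\<^esub> a) \<in> carrier K" if "p \<in> P" "q \<in> P" "a \<in> carrier A" for p q a
    using that c.C_closed by simp
  define Q where "Q p q G \<longleftrightarrow> abelian_group_hom T.S R G \<and>
    (\<forall>y\<in>carrier R. \<forall>a\<in>carrier A. G (T.pure y a) = y \<otimes>\<^bsub>R\<^esub> j (c p q (pure \<one>\<^bsub>K\<^esub> a)))" for p q G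
  have Qex: "\<exists>G. Q p q G" if pq: "p \<in> P" "q \<in> P" for p q
  proof (rule T.lift_exists[of R "\<lambda>y a. y \<otimes>\<^bsub>R\<^esub> j (c p q (pure \<one>\<^bsub>K\<^esub> a))"])
    show "abelian_group R" by (rule R.abelian_group_axioms)
    show "y \<otimes>\<^bsub>R\<^esub> j (c p q (pure \<one>\<^bsub>K\<^esub> (a \<oplus>\<^bsub>A\<^esub> b))) = y \<otimes>\<^bsub>R\<^esub> j (c p q (pure \<one>\<^bsub>K\<^esub> a)) \<oplus>\<^bsub>R\<^esub> y \<otimes>\<^bsub>R\<^esub> j (c p q (pure \<one>\<^bsub>K\<^esub> b))"
      if "y \<in> carrier R" "a \<in> carrier A" "b \<in> carrier A" for y a b
      using that pq cc by (simp add: pure_add_right c.C_add R.r_distr)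
    show "y \<otimes>\<^bsub>R\<^esub> \<kappa> d \<otimes>\<^bsub>R\<^esub> j (c p q (pure \<one>\<^bsub>K\<^esub> a)) = y \<otimes>\<^bsub>R\<^esub> j (c p q (pure \<one>\<^bsub>K\<^esub> (d \<odot>\<^bsub>A\<^esub> a)))"
      if "y \<in> carrier R" "d \<in> carrier k" "a \<in> carrier A" for y d a
    proof -
      have "pure \<one>\<^bsub>K\<^esub> (d \<odot>\<^bsub>A\<^esub> a) = \<iota> d \<odot>\<^bsub>S\<^esub> pure \<one>\<^bsub>K\<^esub> a" using that by (simp add: pure_smult smult_pure)
      then show ?thesis using that pq cc by (simp add: c.C_smult \<kappa> R.m_assoc)
    qed
    show "\<exists>G. Q p q G" if "abelian_group_hom T.S R G"
      "\<And>y a. y \<in> carrier R \<Longrightarrow> a \<in> carrier A \<Longrightarrow> G (T.pure y a) = y \<otimes>\<^bsub>R\<^esub> j (c p q (pure \<one>\<^bsub>K\<^esub> a))" for G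
      unfolding Q_def using that by (intro exI[of _ G]) simp
  qed (use cc pq in \<open>auto simp: R.l_distr\<close>)
  define C where "C p q = (SOME G. Q p q G)" for p q
  have Q: "Q p q (C p q)" if "p \<in> P" "q \<in> P" for p q unfolding C_def by (rule someI_ex[OF Qex[OF that]])
  have C_hom: "abelian_group_hom T.S R (C p q)" if "p \<in> P" "q \<in> P" for p q using Q[OF that] by (simp add: Q_def)
  have C_pure: "C p q (T.pure y a) = y \<otimes>\<^bsub>R\<^esub> j (c p q (pure \<one>\<^bsub>K\<^esub> a))"
    if "p \<in> P" "q \<in> P" "y \<in> carrier R" "a \<in> carrier A" for p q y a using Q[OF that(1,2)] that(3,4) by (simp add: Q_def)
  have C_cl: "C p q x \<in> carrier R" if "p \<in> P" "q \<in> P" "x \<in> carrier T.S" for p q x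
    using abelian_group_hom.hom_closed[OF C_hom[OF that(1,2)] that(3)] .
  have C_add: "C p q (x \<oplus>\<^bsub>T.S\<^esub> y) = C p q x \<oplus>\<^bsub>R\<^esub> C p q y" if "p \<in> P" "q \<in> P" "x \<in> carrier T.S" "y \<in> carrier T.S" for p q x y
    using abelian_group_hom.hom_add[OF C_hom[OF that(1,2)] that(3,4)] .
  have "\<exists>J. J \<in> ring_hom S T.S \<and> (\<forall>x\<in>carrier K. \<forall>a\<in>carrier A.
    J (pure x a) = T.pure (j x) \<one>\<^bsub>A\<^esub> \<otimes>\<^bsub>T.S\<^esub> T.pure \<one>\<^bsub>R\<^esub> a)"
  proof (rule ring_lift_exists[of T.S "\<lambda>x. T.pure (j x) \<one>\<^bsub>A\<^esub>" "\<lambda>a. T.pure \<one>\<^bsub>R\<^esub> a"])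
    show "ring T.S" by (rule T.ring_S)
    show "(\<lambda>x. T.pure (j x) \<one>\<^bsub>A\<^esub>) \<in> ring_hom K T.S"
      by (rule ring_hom_memI) (simp_all add: T.pure_mult T.pure_add_left T.pure_one)
    show "(\<lambda>a. T.pure \<one>\<^bsub>R\<^esub> a) \<in> ring_hom A T.S"
      by (rule ring_hom_memI) (simp_all add: T.pure_mult T.pure_add_right T.pure_one)
    show "T.pure \<one>\<^bsub>R\<^esub> a \<otimes>\<^bsub>T.S\<^esub> T.pure (j x) \<one>\<^bsub>A\<^esub> = T.pure (j x) \<one>\<^bsub>A\<^esub> \<otimes>\<^bsub>T.S\<^esub> T.pure \<one>\<^bsub>R\<^esub> a"
      if "x \<in> carrier K" "a \<in> carrier A" for x a using that by (simp add: T.pure_mult)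
    show "T.pure \<one>\<^bsub>R\<^esub> (d \<odot>\<^bsub>A\<^esub> a) = T.pure (j (\<iota> d)) \<one>\<^bsub>A\<^esub> \<otimes>\<^bsub>T.S\<^esub> T.pure \<one>\<^bsub>R\<^esub> a"
      if "d \<in> carrier k" "a \<in> carrier A" for d a using that by (simp add: T.pure_mult T.pure_smult \<kappa>)
    fix J assume "J \<in> ring_hom S T.S" "\<And>x a. x \<in> carrier K \<Longrightarrow> a \<in> carrier A \<Longrightarrow>
      J (pure x a) = T.pure (j x) \<one>\<^bsub>A\<^esub> \<otimes>\<^bsub>T.S\<^esub> T.pure \<one>\<^bsub>R\<^esub> a"
    then show ?thesis by blast
  qed
  then obtain J where J: "J \<in> ring_hom S T.S"
    and Jp: "\<And>x a. x \<in> carrier K \<Longrightarrow> a \<in> carrier A \<Longrightarrow> J (pure x a) = T.pure (j x) \<one>\<^bsub>A\<^esub> \<otimes>\<^bsub>T.S\<^esub> T.pure \<one>\<^bsub>R\<^esub> a"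
    by blast
  have Jh: "abelian_group_hom S T.S J" by (rule ring_hom_abelian_group_hom[OF ring_S T.ring_S J])
  note Jcl = ring_hom_closed[OF J]
  have Jp: "J (pure x a) = T.pure (j x) a" if "x \<in> carrier K" "a \<in> carrier A" for x a
    using Jp[OF that] that by (simp add: T.pure_mult)
  have Jsm: "J (x \<odot>\<^bsub>S\<^esub> s) = j x \<odot>\<^bsub>T.S\<^esub> J s" if "x \<in> carrier K" "s \<in> carrier S" for x s
    using that ring_hom_mult[OF J] Jp by (simp add: S_simps(6) T.S_simps(6))
  \<comment> \<open>On the image of \<open>J\<close> the new coordinates are the old ones mapped by
    \<open>j\<close>; this transfers the values on the unit and on the matrix units.\<close>
  have CJ: "C p q (J s) = j (c p q s)" if pq: "p \<in> P" "q \<in> P" and s: "s \<in> carrier S" for p q s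
  proof (rule additive_eqI[of R "\<lambda>s. C p q (J s)" "\<lambda>s. j (c p q s)"])
    show "abelian_group_hom S R (\<lambda>s. C p q (J s))"
      by (rule abelian_group_homI') (use pq C_cl C_add Jcl ring_hom_add[OF J] S.abelian_group_axioms R.abelian_group_axioms in auto)
    show "abelian_group_hom S R (\<lambda>s. j (c p q s))"
      by (rule abelian_group_homI') (use pq c.C_closed c.C_add S.abelian_group_axioms R.abelian_group_axioms in auto)
    show "C p q (J (pure x a)) = j (c p q (pure x a))" if "x \<in> carrier K" "a \<in> carrier A" for x a
    proof -
      have "c p q (pure x a) = x \<otimes>\<^bsub>K\<^esub> c p q (pure \<one>\<^bsub>K\<^esub> a)"
        unfolding pure_eq_smult[OF that] by (rule c.C_smult[OF pq that(1)]) (use that in simp)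
      then show ?thesis using that pq cc by (simp add: Jp C_pure)
    qed
  qed (rule s)
  define F where "F p q = J (f p q)" for p q
  have F_cl: "F p q \<in> carrier T.S" if "p \<in> P" "q \<in> P" for p q using that c.F_closed Jcl by (simp add: F_def)
  have smc: "y \<odot>\<^bsub>T.S\<^esub> x \<in> carrier T.S" if "y \<in> carrier R" "x \<in> carrier T.S" for x y
    using that by (simp add: T.S_simps(6))
  interpret TM: module R T.S by (rule T.module_S)
  \<comment> \<open>Both sides are additive in \<open>x\<close>, and \<open>y \<otimes> a\<close> is
    \<open>y\<close> times \<open>J (1 \<otimes> a)\<close>, so the expansion of
    \<open>1 \<otimes> a\<close> over \<open>K\<close> is transported by \<open>J\<close>.
    Injectivity of the coordinates follows from this expansion.\<close>
  have expand: "x = (\<Oplus>\<^bsub>T.S\<^esub>p\<in>P. \<Oplus>\<^bsub>T.S\<^esub>q\<in>P. C p q x \<odot>\<^bsub>T.S\<^esub> F p q)" if x: "x \<in> carrier T.S" for x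
  proof (rule T.additive_eqI[of T.S "\<lambda>x. x" "\<lambda>x. \<Oplus>\<^bsub>T.S\<^esub>p\<in>P. \<Oplus>\<^bsub>T.S\<^esub>q\<in>P. C p q x \<odot>\<^bsub>T.S\<^esub> F p q"])
    show "abelian_group_hom T.S T.S (\<lambda>x. x)" by (rule abelian_group_homI') (auto simp: T.S.abelian_group_axioms)
    show "abelian_group_hom T.S T.S (\<lambda>x. \<Oplus>\<^bsub>T.S\<^esub>p\<in>P. \<Oplus>\<^bsub>T.S\<^esub>q\<in>P. C p q x \<odot>\<^bsub>T.S\<^esub> F p q)"
    proof (rule abelian_group_homI')
      fix x y assume xy: "x \<in> carrier T.S" "y \<in> carrier T.S"
      have "(\<Oplus>\<^bsub>T.S\<^esub>p\<in>P. \<Oplus>\<^bsub>T.S\<^esub>q\<in>P. C p q (x \<oplus>\<^bsub>T.S\<^esub> y) \<odot>\<^bsub>T.S\<^esub> F p q)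
          = (\<Oplus>\<^bsub>T.S\<^esub>p\<in>P. \<Oplus>\<^bsub>T.S\<^esub>q\<in>P. C p q x \<odot>\<^bsub>T.S\<^esub> F p q \<oplus>\<^bsub>T.S\<^esub> C p q y \<odot>\<^bsub>T.S\<^esub> F p q)"
        by (rule T.S.finsum_cong2) (use xy in \<open>auto simp: C_add C_cl F_cl smc TM.smult_l_distr\<close>)
      also have "\<dots> = (\<Oplus>\<^bsub>T.S\<^esub>p\<in>P. (\<Oplus>\<^bsub>T.S\<^esub>q\<in>P. C p q x \<odot>\<^bsub>T.S\<^esub> F p q) \<oplus>\<^bsub>T.S\<^esub> (\<Oplus>\<^bsub>T.S\<^esub>q\<in>P. C p q y \<odot>\<^bsub>T.S\<^esub> F p q))"
        by (rule T.S.finsum_cong') (use xy in \<open>auto simp: C_cl F_cl smc intro!: T.S.finsum_addf T.S.finsum_closed T.S.a_closed\<close>)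
      also have "\<dots> = (\<Oplus>\<^bsub>T.S\<^esub>p\<in>P. \<Oplus>\<^bsub>T.S\<^esub>q\<in>P. C p q x \<odot>\<^bsub>T.S\<^esub> F p q) \<oplus>\<^bsub>T.S\<^esub> (\<Oplus>\<^bsub>T.S\<^esub>p\<in>P. \<Oplus>\<^bsub>T.S\<^esub>q\<in>P. C p q y \<odot>\<^bsub>T.S\<^esub> F p q)"
        by (rule T.S.finsum_addf) (use xy in \<open>auto simp: C_cl F_cl smc intro!: T.S.finsum_closed\<close>)
      finally show "(\<Oplus>\<^bsub>T.S\<^esub>p\<in>P. \<Oplus>\<^bsub>T.S\<^esub>q\<in>P. C p q (x \<oplus>\<^bsub>T.S\<^esub> y) \<odot>\<^bsub>T.S\<^esub> F p q)
        = (\<Oplus>\<^bsub>T.S\<^esub>p\<in>P. \<Oplus>\<^bsub>T.S\<^esub>q\<in>P. C p q x \<odot>\<^bsub>T.S\<^esub> F p q) \<oplus>\<^bsub>T.S\<^esub> (\<Oplus>\<^bsub>T.S\<^esub>p\<in>P. \<Oplus>\<^bsub>T.S\<^esub>q\<in>P. C p q y \<odot>\<^bsub>T.S\<^esub> F p q)" .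
    qed (auto simp: T.S.abelian_group_axioms C_cl F_cl smc intro!: T.S.finsum_closed)
    fix y a assume ya: "y \<in> carrier R" "a \<in> carrier A"
    let ?s = "pure \<one>\<^bsub>K\<^esub> a" and ?y = "T.pure y \<one>\<^bsub>A\<^esub>"
    let ?g = "\<lambda>p q. c p q ?s \<odot>\<^bsub>S\<^esub> f p q"
    have g: "?g p q \<in> carrier S" if "p \<in> P" "q \<in> P" for p q using that cc ya c.F_closed c.smult_closed by simp
    have yc: "?y \<in> carrier T.S" using ya by simp
    have "T.pure y a = ?y \<otimes>\<^bsub>T.S\<^esub> J ?s" using ya by (simp add: Jp T.pure_mult)
    also have "J ?s = J (\<Oplus>\<^bsub>S\<^esub>p\<in>P. \<Oplus>\<^bsub>S\<^esub>q\<in>P. ?g p q)"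
      by (rule arg_cong[of _ _ J], rule c.expand) (use ya in simp)
    also have "\<dots> = (\<Oplus>\<^bsub>T.S\<^esub>p\<in>P. J (\<Oplus>\<^bsub>S\<^esub>q\<in>P. ?g p q))"
      by (rule abelian_group_hom.hom_finsum[OF Jh]) (use g in \<open>auto intro!: S.finsum_closed\<close>)
    also have "\<dots> = (\<Oplus>\<^bsub>T.S\<^esub>p\<in>P. \<Oplus>\<^bsub>T.S\<^esub>q\<in>P. J (?g p q))"
      by (rule T.S.finsum_cong') (use g Jcl in \<open>auto intro!: abelian_group_hom.hom_finsum[OF Jh] T.S.finsum_closed\<close>)
    also have "?y \<otimes>\<^bsub>T.S\<^esub> \<dots> = (\<Oplus>\<^bsub>T.S\<^esub>p\<in>P. ?y \<otimes>\<^bsub>T.S\<^esub> (\<Oplus>\<^bsub>T.S\<^esub>q\<in>P. J (?g p q)))"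
      by (rule T.S.finsum_rdistr) (use g Jcl yc c.finP in \<open>auto intro!: T.S.finsum_closed\<close>)
    also have "\<dots> = (\<Oplus>\<^bsub>T.S\<^esub>p\<in>P. \<Oplus>\<^bsub>T.S\<^esub>q\<in>P. ?y \<otimes>\<^bsub>T.S\<^esub> J (?g p q))"
    proof (rule T.S.finsum_cong'[OF refl])
      have gJ: "?y \<otimes>\<^bsub>T.S\<^esub> J (?g p q) \<in> carrier T.S" "J (?g p q) \<in> carrier T.S" if "p \<in> P" "q \<in> P" for p q
        using g[OF that] Jcl yc by simp_all
      show "(\<lambda>p. \<Oplus>\<^bsub>T.S\<^esub>q\<in>P. ?y \<otimes>\<^bsub>T.S\<^esub> J (?g p q)) \<in> P \<rightarrow> carrier T.S"
        using gJ by (intro Pi_I T.S.finsum_closed) simp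
      show "?y \<otimes>\<^bsub>T.S\<^esub> (\<Oplus>\<^bsub>T.S\<^esub>q\<in>P. J (?g p q)) = (\<Oplus>\<^bsub>T.S\<^esub>q\<in>P. ?y \<otimes>\<^bsub>T.S\<^esub> J (?g p q))" if "p \<in> P" for p
        by (rule T.S.finsum_rdistr[OF c.finP yc]) (use gJ that in simp)
    qed
    also have "\<dots> = (\<Oplus>\<^bsub>T.S\<^esub>p\<in>P. \<Oplus>\<^bsub>T.S\<^esub>q\<in>P. C p q (T.pure y a) \<odot>\<^bsub>T.S\<^esub> F p q)"
    proof (rule T.S.finsum_cong2)
      fix p q assume pq: "p \<in> P" "q \<in> P"
      show "C p q (T.pure y a) \<odot>\<^bsub>T.S\<^esub> F p q \<in> carrier T.S" using pq ya by (intro smc C_cl F_cl) auto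
      have jc: "j (c p q ?s) \<in> carrier R" using cc[OF pq ya(2)] by simp
      have "?y \<otimes>\<^bsub>T.S\<^esub> J (?g p q) = y \<odot>\<^bsub>T.S\<^esub> (j (c p q ?s) \<odot>\<^bsub>T.S\<^esub> F p q)"
        using Jsm[OF cc[OF pq ya(2)] c.F_closed[OF pq]] by (simp add: F_def T.S_simps(6))
      also have "\<dots> = (y \<otimes>\<^bsub>R\<^esub> j (c p q ?s)) \<odot>\<^bsub>T.S\<^esub> F p q" by (rule TM.smult_assoc1[symmetric, OF ya(1) jc F_cl[OF pq]])
      finally show "?y \<otimes>\<^bsub>T.S\<^esub> J (?g p q) = C p q (T.pure y a) \<odot>\<^bsub>T.S\<^esub> F p q" by (simp add: C_pure[OF pq ya])
    qed
    finally show "T.pure y a = (\<Oplus>\<^bsub>T.S\<^esub>p\<in>P. \<Oplus>\<^bsub>T.S\<^esub>q\<in>P. C p q (T.pure y a) \<odot>\<^bsub>T.S\<^esub> F p q)" .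
  qed (rule x)
  \<comment> \<open>Both sides are additive in each factor, so it is enough to compare pure tensors,
    where the product formula over \<open>K\<close> is mapped by \<open>j\<close> and multiplied by
    the scalars.\<close>
  have C_mult: "C p q (x \<otimes>\<^bsub>T.S\<^esub> y) = (\<Oplus>\<^bsub>R\<^esub>o'\<in>P. C p o' x \<otimes>\<^bsub>R\<^esub> C o' q y)"
    if pq: "p \<in> P" "q \<in> P" and x: "x \<in> carrier T.S" and y: "y \<in> carrier T.S" for p q x y
  proof -
    have left: "abelian_group_hom T.S R (\<lambda>x. C p q (x \<otimes>\<^bsub>T.S\<^esub> y))" if "y \<in> carrier T.S" for y
      by (rule abelian_group_homI') (use pq that C_cl C_add T.S.abelian_group_axioms R.abelian_group_axioms in \<open>auto simp: T.S.l_distr\<close>)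
    have right: "abelian_group_hom T.S R (\<lambda>y. C p q (x \<otimes>\<^bsub>T.S\<^esub> y))" if "x \<in> carrier T.S" for x
      by (rule abelian_group_homI') (use pq that C_cl C_add T.S.abelian_group_axioms R.abelian_group_axioms in \<open>auto simp: T.S.r_distr\<close>)
    have lefts: "abelian_group_hom T.S R (\<lambda>x. \<Oplus>\<^bsub>R\<^esub>o'\<in>P. C p o' x \<otimes>\<^bsub>R\<^esub> C o' q y)" if y: "y \<in> carrier T.S" for y
    proof (rule abelian_group_homI')
      fix x z assume xz: "x \<in> carrier T.S" "z \<in> carrier T.S"
      have "(\<Oplus>\<^bsub>R\<^esub>o'\<in>P. C p o' (x \<oplus>\<^bsub>T.S\<^esub> z) \<otimes>\<^bsub>R\<^esub> C o' q y) = (\<Oplus>\<^bsub>R\<^esub>o'\<in>P. C p o' x \<otimes>\<^bsub>R\<^esub> C o' q y \<oplus>\<^bsub>R\<^esub> C p o' z \<otimes>\<^bsub>R\<^esub> C o' q y)"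
        by (rule R.finsum_cong') (use xz y pq in \<open>auto simp: C_add C_cl R.l_distr\<close>)
      also have "\<dots> = (\<Oplus>\<^bsub>R\<^esub>o'\<in>P. C p o' x \<otimes>\<^bsub>R\<^esub> C o' q y) \<oplus>\<^bsub>R\<^esub> (\<Oplus>\<^bsub>R\<^esub>o'\<in>P. C p o' z \<otimes>\<^bsub>R\<^esub> C o' q y)"
        by (rule R.finsum_addf) (use xz y pq in \<open>auto simp: C_cl\<close>)
      finally show "(\<Oplus>\<^bsub>R\<^esub>o'\<in>P. C p o' (x \<oplus>\<^bsub>T.S\<^esub> z) \<otimes>\<^bsub>R\<^esub> C o' q y)
        = (\<Oplus>\<^bsub>R\<^esub>o'\<in>P. C p o' x \<otimes>\<^bsub>R\<^esub> C o' q y) \<oplus>\<^bsub>R\<^esub> (\<Oplus>\<^bsub>R\<^esub>o'\<in>P. C p o' z \<otimes>\<^bsub>R\<^esub> C o' q y)" .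
    qed (use y pq C_cl in \<open>auto simp: T.S.abelian_group_axioms R.abelian_group_axioms intro!: R.finsum_closed\<close>)
    have rights: "abelian_group_hom T.S R (\<lambda>y. \<Oplus>\<^bsub>R\<^esub>o'\<in>P. C p o' x \<otimes>\<^bsub>R\<^esub> C o' q y)" if y: "x \<in> carrier T.S" for x
    proof (rule abelian_group_homI')
      fix z w assume xz: "z \<in> carrier T.S" "w \<in> carrier T.S"
      have "(\<Oplus>\<^bsub>R\<^esub>o'\<in>P. C p o' x \<otimes>\<^bsub>R\<^esub> C o' q (z \<oplus>\<^bsub>T.S\<^esub> w)) = (\<Oplus>\<^bsub>R\<^esub>o'\<in>P. C p o' x \<otimes>\<^bsub>R\<^esub> C o' q z \<oplus>\<^bsub>R\<^esub> C p o' x \<otimes>\<^bsub>R\<^esub> C o' q w)"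
        by (rule R.finsum_cong') (use xz y pq in \<open>auto simp: C_add C_cl R.r_distr\<close>)
      also have "\<dots> = (\<Oplus>\<^bsub>R\<^esub>o'\<in>P. C p o' x \<otimes>\<^bsub>R\<^esub> C o' q z) \<oplus>\<^bsub>R\<^esub> (\<Oplus>\<^bsub>R\<^esub>o'\<in>P. C p o' x \<otimes>\<^bsub>R\<^esub> C o' q w)"
        by (rule R.finsum_addf) (use xz y pq in \<open>auto simp: C_cl\<close>)
      finally show "(\<Oplus>\<^bsub>R\<^esub>o'\<in>P. C p o' x \<otimes>\<^bsub>R\<^esub> C o' q (z \<oplus>\<^bsub>T.S\<^esub> w))
        = (\<Oplus>\<^bsub>R\<^esub>o'\<in>P. C p o' x \<otimes>\<^bsub>R\<^esub> C o' q z) \<oplus>\<^bsub>R\<^esub> (\<Oplus>\<^bsub>R\<^esub>o'\<in>P. C p o' x \<otimes>\<^bsub>R\<^esub> C o' q w)" .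
    qed (use y pq C_cl in \<open>auto simp: T.S.abelian_group_axioms R.abelian_group_axioms intro!: R.finsum_closed\<close>)
    have pp: "C p q (T.pure z a \<otimes>\<^bsub>T.S\<^esub> T.pure w b) = (\<Oplus>\<^bsub>R\<^esub>o'\<in>P. C p o' (T.pure z a) \<otimes>\<^bsub>R\<^esub> C o' q (T.pure w b))"
      if za: "z \<in> carrier R" "a \<in> carrier A" and wb: "w \<in> carrier R" "b \<in> carrier A" for z a w b
    proof -
      let ?a = "pure \<one>\<^bsub>K\<^esub> a" and ?b = "pure \<one>\<^bsub>K\<^esub> b"
      have "pure \<one>\<^bsub>K\<^esub> (a \<otimes>\<^bsub>A\<^esub> b) = ?a \<otimes>\<^bsub>S\<^esub> ?b" using za wb by (simp add: pure_mult)
      then have "j (c p q (pure \<one>\<^bsub>K\<^esub> (a \<otimes>\<^bsub>A\<^esub> b))) = j (\<Oplus>\<^bsub>K\<^esub>o'\<in>P. c p o' ?a \<otimes>\<^bsub>K\<^esub> c o' q ?b)"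
        using c.C_mult[OF pq, of ?a ?b] za wb by simp
      also have "\<dots> = (\<Oplus>\<^bsub>R\<^esub>o'\<in>P. j (c p o' ?a \<otimes>\<^bsub>K\<^esub> c o' q ?b))"
        by (rule abelian_group_hom.hom_finsum[OF ring_hom_abelian_group_hom[OF K.ring_axioms R.ring_axioms j]])
           (use cc pq za wb in auto)
      finally have "z \<otimes>\<^bsub>R\<^esub> w \<otimes>\<^bsub>R\<^esub> j (c p q (pure \<one>\<^bsub>K\<^esub> (a \<otimes>\<^bsub>A\<^esub> b))) = z \<otimes>\<^bsub>R\<^esub> w \<otimes>\<^bsub>R\<^esub> (\<Oplus>\<^bsub>R\<^esub>o'\<in>P. j (c p o' ?a \<otimes>\<^bsub>K\<^esub> c o' q ?b))" by simp
      also have "\<dots> = (\<Oplus>\<^bsub>R\<^esub>o'\<in>P. z \<otimes>\<^bsub>R\<^esub> w \<otimes>\<^bsub>R\<^esub> j (c p o' ?a \<otimes>\<^bsub>K\<^esub> c o' q ?b))"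
        by (rule R.finsum_rdistr) (use cc pq za wb c.finP in auto)
      also have "\<dots> = (\<Oplus>\<^bsub>R\<^esub>o'\<in>P. C p o' (T.pure z a) \<otimes>\<^bsub>R\<^esub> C o' q (T.pure w b))"
        by (rule R.finsum_cong') (use cc pq za wb C_pure in \<open>auto simp: R.m_ac\<close>)
      finally show ?thesis using za wb pq by (simp add: T.pure_mult C_pure)
    qed
    show ?thesis
    proof (rule T.additive_eqI[OF left[OF y] lefts[OF y] _ x])
      fix z a assume za: "z \<in> carrier R" "a \<in> carrier A"
      show "C p q (T.pure z a \<otimes>\<^bsub>T.S\<^esub> y) = (\<Oplus>\<^bsub>R\<^esub>o'\<in>P. C p o' (T.pure z a) \<otimes>\<^bsub>R\<^esub> C o' q y)"
        by (rule T.additive_eqI[OF right[OF T.pure_closed[OF za]] rights[OF T.pure_closed[OF za]] pp[OF za] y])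
    qed
  qed
  have "matrix_coordinates R T.S P bl C F"
  proof (rule matrix_coordinates.intro[OF R T.ring_S c.finP smc C_cl C_add])
    show "C p q (y \<odot>\<^bsub>T.S\<^esub> x) = y \<otimes>\<^bsub>R\<^esub> C p q x" if pq: "p \<in> P" "q \<in> P" and y: "y \<in> carrier R" and x: "x \<in> carrier T.S" for p q y x
    proof (rule T.additive_eqI[of R "\<lambda>x. C p q (y \<odot>\<^bsub>T.S\<^esub> x)" "\<lambda>x. y \<otimes>\<^bsub>R\<^esub> C p q x"])
      show "abelian_group_hom T.S R (\<lambda>x. C p q (y \<odot>\<^bsub>T.S\<^esub> x))"
        by (rule abelian_group_homI') (use pq y C_cl C_add smc T.S.abelian_group_axioms R.abelian_group_axioms in \<open>auto simp: TM.smult_r_distr\<close>)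
      show "abelian_group_hom T.S R (\<lambda>x. y \<otimes>\<^bsub>R\<^esub> C p q x)"
        by (rule abelian_group_homI') (use pq y C_cl C_add T.S.abelian_group_axioms R.abelian_group_axioms in \<open>auto simp: R.r_distr\<close>)
      show "C p q (y \<odot>\<^bsub>T.S\<^esub> T.pure z a) = y \<otimes>\<^bsub>R\<^esub> C p q (T.pure z a)" if "z \<in> carrier R" "a \<in> carrier A" for z a
        using that y pq cc by (simp add: T.smult_pure C_pure R.m_assoc)
    qed (rule x)
    show "C p q (x \<otimes>\<^bsub>T.S\<^esub> y) = (\<Oplus>\<^bsub>R\<^esub>o'\<in>P. C p o' x \<otimes>\<^bsub>R\<^esub> C o' q y)"
      if "p \<in> P" "q \<in> P" "x \<in> carrier T.S" "y \<in> carrier T.S" for p q x y using that by (rule C_mult)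
    show "C p q \<one>\<^bsub>T.S\<^esub> = (if p = q then \<one>\<^bsub>R\<^esub> else \<zero>\<^bsub>R\<^esub>)" if "p \<in> P" "q \<in> P" for p q
      using CJ[OF that S.one_closed] ring_hom_one[OF J] c.C_one[OF that] by simp
    show "C p q x = \<zero>\<^bsub>R\<^esub>" if pq: "p \<in> P" "q \<in> P" and x: "x \<in> carrier T.S" and b: "bl p \<noteq> bl q" for p q x
    proof (rule T.additive_eqI[of R "C p q" "\<lambda>_. \<zero>\<^bsub>R\<^esub>", OF C_hom[OF pq]])
      show "abelian_group_hom T.S R (\<lambda>_. \<zero>\<^bsub>R\<^esub>)" by (rule abelian_group_homI') (auto simp: T.S.abelian_group_axioms R.abelian_group_axioms)
      show "C p q (T.pure z a) = \<zero>\<^bsub>R\<^esub>" if "z \<in> carrier R" "a \<in> carrier A" for z a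
        using that pq b by (simp add: C_pure c.C_off)
    qed (rule x)
    show "x = y" if x: "x \<in> carrier T.S" and y: "y \<in> carrier T.S"
      and eq: "\<And>p q. p \<in> P \<Longrightarrow> q \<in> P \<Longrightarrow> C p q x = C p q y" for x y
    proof -
      have "(\<Oplus>\<^bsub>T.S\<^esub>p\<in>P. \<Oplus>\<^bsub>T.S\<^esub>q\<in>P. C p q x \<odot>\<^bsub>T.S\<^esub> F p q) = (\<Oplus>\<^bsub>T.S\<^esub>p\<in>P. \<Oplus>\<^bsub>T.S\<^esub>q\<in>P. C p q y \<odot>\<^bsub>T.S\<^esub> F p q)"
        by (rule T.S.finsum_cong2) (simp_all add: eq smc C_cl F_cl y)
      then show ?thesis by (simp only: expand[OF x, symmetric] expand[OF y, symmetric])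
    qed
    show "F p q \<in> carrier T.S" if "p \<in> P" "q \<in> P" for p q using that by (rule F_cl)
    show "F p q = \<zero>\<^bsub>T.S\<^esub>" if "p \<in> P" "q \<in> P" "bl p \<noteq> bl q" for p q
      unfolding F_def c.F_off[OF that] by (rule abelian_group_hom.hom_zero[OF Jh])
    show "C s t (F p q) = (if s = p \<and> t = q then \<one>\<^bsub>R\<^esub> else \<zero>\<^bsub>R\<^esub>)"
      if "p \<in> P" "q \<in> P" "s \<in> P" "t \<in> P" "bl p = bl q" for p q s t
      unfolding F_def using CJ[OF that(3,4) c.F_closed[OF that(1,2)]] c.C_F[OF that] by simp
  qed
  moreover have "C p q (T.pure \<one>\<^bsub>R\<^esub> a) = j (c p q (pure \<one>\<^bsub>K\<^esub> a))" if "p \<in> P" "q \<in> P" "a \<in> carrier A" for p q a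
    using that cc by (simp add: C_pure)
  ultimately show ?thesis by blast
qed

section \<open>The reduced trace\<close>

text \<open>The field \<open>E\<close> as a \<open>k\<close>-algebra, so that \<open>scalar_extension\<close> also provides tensor products of two fields.\<close>

definition ext_algebra :: "('k \<Rightarrow> 'e) \<Rightarrow> ('e, 'z) ring_scheme \<Rightarrow> ('k, 'e) module" where
  "ext_algebra \<iota> E = \<lparr>carrier = carrier E, monoid.mult = monoid.mult E, one = one E,
    ring.zero = ring.zero E, add = add E, smult = (\<lambda>c x. \<iota> c \<otimes>\<^bsub>E\<^esub> x)\<rparr>"

lemma ext_algebra_simps [simp]:
  "carrier (ext_algebra \<iota> E) = carrier E" "monoid.mult (ext_algebra \<iota> E) = monoid.mult E"
  "one (ext_algebra \<iota> E) = one E" "ring.zero (ext_algebra \<iota> E) = ring.zero E"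
  "add (ext_algebra \<iota> E) = add E" "c \<odot>\<^bsub>ext_algebra \<iota> E\<^esub> x = \<iota> c \<otimes>\<^bsub>E\<^esub> x"
  "finsum (ext_algebra \<iota> E) = finsum E"
  by (simp_all add: ext_algebra_def finsum_def finprod_def fun_eq_iff)

lemma unital_algebra_ext_algebra:
  assumes "field_extension k E \<iota>" shows "unital_algebra k (ext_algebra \<iota> E)"
proof -
  interpret k: field k using assms by (simp add: field_extension_def)
  interpret E: field E using assms by (simp add: field_extension_def)
  have \<iota>: "\<iota> \<in> ring_hom k E" using assms by (simp add: field_extension_def)
  note h = ring_hom_closed[OF \<iota>] ring_hom_add[OF \<iota>] ring_hom_mult[OF \<iota>] ring_hom_one[OF \<iota>]
  have r: "ring (ext_algebra \<iota> E)"
    by (intro ringI abelian_groupI monoidI)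
       (auto simp: E.a_ac E.m_assoc E.l_distr E.r_distr intro: E.l_neg bexI[of _ "\<ominus>\<^bsub>E\<^esub> x" for x])
  have "module k (ext_algebra \<iota> E)"
    by (intro moduleI k.is_cring ring.is_abelian_group r) (auto simp: h E.l_distr E.r_distr E.m_assoc)
  then show ?thesis using r
    by (intro unital_algebra.intro unital_algebra_axioms.intro k.field_axioms) (auto simp: h E.m_assoc E.m_lcomm)
qed

lemma finite_dimensional_ext_algebra:
  assumes ext: "field_extension k E \<iota>" and fd: "ring.finite_dimension E (\<iota> ` carrier k) (carrier E)"
  shows "finite_dimensional k (ext_algebra \<iota> E)"
proof -
  interpret k: field k using ext by (simp add: field_extension_def)
  interpret E: field E using ext by (simp add: field_extension_def)
  have \<iota>: "\<iota> \<in> ring_hom k E" using ext by (simp add: field_extension_def)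
  interpret \<iota>: ring_hom_ring k E \<iota> by (rule ring_hom_ringI2[OF k.ring_axioms E.ring_axioms \<iota>])
  let ?k = "\<iota> ` carrier k"
  have sf: "subfield ?k E" using \<iota>.img_is_subfield(2)[OF k.carrier_is_subfield] by simp
  obtain n where "E.dimension n ?k (carrier E)" using fd by blast
  then obtain Us where Us: "set Us \<subseteq> carrier E" "E.independent ?k Us" "E.Span ?k Us = carrier E"
    using E.exists_base[OF sf] by blast
  \<comment> \<open>The list must be distinct: changing the coefficient function at \<open>v\<close>
    may not disturb the other summands, and a sum over \<open>set Us\<close> counts a repeated
    vector only once.\<close>
  have span: "x \<in> E.Span ?k Us \<Longrightarrow> \<exists>c\<in>set Us \<rightarrow> carrier k. x = (\<Oplus>\<^bsub>E\<^esub>s\<in>set Us. \<iota> (c s) \<otimes>\<^bsub>E\<^esub> s)"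
    if "set Us \<subseteq> carrier E" "distinct Us" for x Us
    using that
  proof (induction Us arbitrary: x)
    case Nil
    then show ?case by simp
  next
    case (Cons v Us)
    obtain d y where d: "d \<in> carrier k" and y: "y \<in> E.Span ?k Us" and x: "x = \<iota> d \<otimes>\<^bsub>E\<^esub> v \<oplus>\<^bsub>E\<^esub> y"
      using Cons.prems(1) by (auto simp: E.line_extension_mem_iff)
    obtain c where c: "c \<in> set Us \<rightarrow> carrier k" and yc: "y = (\<Oplus>\<^bsub>E\<^esub>s\<in>set Us. \<iota> (c s) \<otimes>\<^bsub>E\<^esub> s)"
      using Cons.IH[OF y] Cons.prems by auto
    let ?c = "c(v := d)"
    have v: "v \<notin> set Us" "v \<in> carrier E" "set Us \<subseteq> carrier E" using Cons.prems by auto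
    have cl: "(\<lambda>s. \<iota> (?c s) \<otimes>\<^bsub>E\<^esub> s) \<in> set Us \<rightarrow> carrier E" using c v by (auto simp: Pi_iff)
    have "(\<Oplus>\<^bsub>E\<^esub>s\<in>set Us. \<iota> (?c s) \<otimes>\<^bsub>E\<^esub> s) = y"
      unfolding yc by (rule E.finsum_cong') (use c v in \<open>auto simp: Pi_iff\<close>)
    then have "(\<Oplus>\<^bsub>E\<^esub>s\<in>set (v # Us). \<iota> (?c s) \<otimes>\<^bsub>E\<^esub> s) = x"
      using E.finsum_insert[OF _ v(1) cl] v d x by simp
    then show ?case using c d by (intro bexI[of _ ?c]) auto
  qed
  show ?thesis unfolding finite_dimensional_def
    using span[OF Us(1) E.independent_distinct[OF sf Us(2)]] Us by (intro exI[of _ "set Us"]) auto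
qed

text \<open>Some coordinate function is nonzero on \<open>1\<close>, as otherwise the expansion of
  \<open>1\<close> would vanish. Divided by that value it is a linear map that is the identity on
  the ground field.\<close>

lemma exists_retraction:
  assumes ext: "field_extension k E \<iota>" and fd: "ring.finite_dimension E (\<iota> ` carrier k) (carrier E)"
  obtains g where "\<And>x. x \<in> carrier E \<Longrightarrow> g x \<in> carrier k"
    "\<And>x y. x \<in> carrier E \<Longrightarrow> y \<in> carrier E \<Longrightarrow> g (x \<oplus>\<^bsub>E\<^esub> y) = g x \<oplus>\<^bsub>k\<^esub> g y"
    "\<And>c x. c \<in> carrier k \<Longrightarrow> x \<in> carrier E \<Longrightarrow> g (\<iota> c \<otimes>\<^bsub>E\<^esub> x) = c \<otimes>\<^bsub>k\<^esub> g x"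
    "\<And>c. c \<in> carrier k \<Longrightarrow> g (\<iota> c) = c"
proof -
  let ?E = "ext_algebra \<iota> E"
  interpret k: field k using ext by (simp add: field_extension_def)
  interpret E: field E using ext by (simp add: field_extension_def)
  have \<iota>: "\<iota> \<in> ring_hom k E" using ext by (simp add: field_extension_def)
  interpret U: unital_algebra k ?E by (rule unital_algebra_ext_algebra[OF ext])
  obtain B h where "is_dual_basis k ?E B h"
    using exists_dual_basis[OF k.field_axioms U.module_axioms finite_dimensional_ext_algebra[OF ext fd]] by blast
  then have B: "finite B" "B \<subseteq> carrier E"
    and h: "\<And>b x. b \<in> B \<Longrightarrow> x \<in> carrier E \<Longrightarrow> h b x \<in> carrier k"
    and ha: "\<And>b x y. b \<in> B \<Longrightarrow> x \<in> carrier E \<Longrightarrow> y \<in> carrier E \<Longrightarrow> h b (x \<oplus>\<^bsub>E\<^esub> y) = h b x \<oplus>\<^bsub>k\<^esub> h b y"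
    and hs: "\<And>b c x. b \<in> B \<Longrightarrow> c \<in> carrier k \<Longrightarrow> x \<in> carrier E \<Longrightarrow> h b (\<iota> c \<otimes>\<^bsub>E\<^esub> x) = c \<otimes>\<^bsub>k\<^esub> h b x"
    and ex: "(\<Oplus>\<^bsub>E\<^esub>b\<in>B. \<iota> (h b \<one>\<^bsub>E\<^esub>) \<otimes>\<^bsub>E\<^esub> b) = \<one>\<^bsub>E\<^esub>"
    by (simp_all add: is_dual_basis_def)
  have "\<exists>b\<in>B. h b \<one>\<^bsub>E\<^esub> \<noteq> \<zero>\<^bsub>k\<^esub>"
  proof (rule ccontr)
    assume "\<not> ?thesis"
    then have "(\<Oplus>\<^bsub>E\<^esub>b\<in>B. \<iota> (h b \<one>\<^bsub>E\<^esub>) \<otimes>\<^bsub>E\<^esub> b) = \<zero>\<^bsub>E\<^esub>"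
      using B(2) ring_hom_zero[OF \<iota> k.ring_axioms E.ring_axioms] by (intro E.finsum_all_zero) auto
    then show False using ex by simp
  qed
  then obtain b where b: "b \<in> B" "h b \<one>\<^bsub>E\<^esub> \<noteq> \<zero>\<^bsub>k\<^esub>" by blast
  let ?i = "inv\<^bsub>k\<^esub> h b \<one>\<^bsub>E\<^esub>" and ?h = "h b \<one>\<^bsub>E\<^esub>"
  have h1: "?h \<in> carrier k" using h b by simp
  have u: "?h \<in> Units k" using b h1 by (simp add: k.field_Units)
  have i: "?i \<in> carrier k" "?i \<otimes>\<^bsub>k\<^esub> ?h = \<one>\<^bsub>k\<^esub>" using u by auto
  show ?thesis
  proof (rule that[of "\<lambda>x. ?i \<otimes>\<^bsub>k\<^esub> h b x"])
    fix c assume c: "c \<in> carrier k"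
    have "h b (\<iota> c) = c \<otimes>\<^bsub>k\<^esub> ?h" using hs[OF b(1) c E.one_closed] ring_hom_closed[OF \<iota> c] by simp
    then have "?i \<otimes>\<^bsub>k\<^esub> h b (\<iota> c) = c \<otimes>\<^bsub>k\<^esub> (?i \<otimes>\<^bsub>k\<^esub> ?h)" using c i(1) h1 by (simp add: k.m_lcomm)
    then show "?i \<otimes>\<^bsub>k\<^esub> h b (\<iota> c) = c" using i(2) c by simp
  qed (use b h ha hs i in \<open>auto simp: k.r_distr k.m_lcomm\<close>)
qed

text \<open>The sum in the definition of \<open>reduced_trace\<close> for a given splitting, before
  its value is known to come from the ground field.\<close>

definition split_trace ::
    "('k, 'x) ring_scheme \<Rightarrow> ('k, 'a, 'y) module_scheme \<Rightarrow> ('e, 'z) ring_scheme \<Rightarrow> ('k \<Rightarrow> 'e)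
      \<Rightarrow> nat \<Rightarrow> (nat \<Rightarrow> nat) \<Rightarrow> (('e \<times> 'a \<Rightarrow>\<^sub>0 int) set \<Rightarrow> nat \<Rightarrow> nat \<times> nat \<Rightarrow> 'e) \<Rightarrow> 'a \<Rightarrow> 'e" where
  "split_trace k A E \<iota> r m \<phi> a =
    (\<Oplus>\<^bsub>E\<^esub>i\<in>{..<r}. matrix_trace E (m i) (\<phi> (pure_tensor k A E \<iota> \<one>\<^bsub>E\<^esub> a) i))"

lemma splittingD:
  assumes "splitting k A E \<iota> r m \<phi>"
  shows "field_extension k E \<iota>" "ring.finite_dimension E (\<iota> ` carrier k) (carrier E)"
    "\<phi> \<in> algebra_iso E (scalar_extension k A E \<iota>) (product_algebra {..<r} (\<lambda>i. matrix_algebra E (m i)))"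
  using assms by (auto simp: splitting_def finite_separable_extension_def)

lemma split_trace_eq_tr:
  assumes alg: "unital_algebra k A" and spl: "splitting k A E \<iota> r m \<phi>" and a: "a \<in> carrier A"
  shows "split_trace k A E \<iota> r m \<phi> a =
    matrix_coordinates.tr E (Sigma {..<r} (\<lambda>l. {..<m l})) (entry E \<phi>) (pure_tensor k A E \<iota> \<one>\<^bsub>E\<^esub> a)"
proof -
  interpret X: scalar_ext k A E \<iota> by (rule scalar_extI[OF alg splittingD(1)[OF spl]])
  obtain f where "matrix_coordinates E X.S (Sigma {..<r} (\<lambda>l. {..<m l})) fst (entry E \<phi>) f"
    using X.iso_matrix_coordinates[OF splittingD(3)[OF spl]] by blast
  then interpret C: matrix_coordinates E X.S "Sigma {..<r} (\<lambda>l. {..<m l})" fst "entry E \<phi>" f .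
  have "C.tr (X.pure \<one>\<^bsub>E\<^esub> a) = (\<Oplus>\<^bsub>E\<^esub>l\<in>{..<r}. \<Oplus>\<^bsub>E\<^esub>i\<in>{..<m l}. entry E \<phi> (l, i) (l, i) (X.pure \<one>\<^bsub>E\<^esub> a))"
    unfolding C.tr_def by (rule X.K.finsum_Sigma) (use C.C_closed a in auto)
  then show ?thesis by (simp add: split_trace_def matrix_trace_def entry_def)
qed

text \<open>
  Over \<open>R = E \<otimes> E'\<close> both splittings give matrix coordinates on \<open>R \<otimes> A\<close>, whence
  \<open>T \<otimes> 1 = 1 \<otimes> T'\<close> in \<open>R\<close>. A \<open>k\<close>-linear retraction of \<open>E'\<close> onto \<open>k\<close> then puts \<open>T\<close> into \<open>k\<close>.
\<close>

lemma split_trace_retract: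
  assumes alg: "unital_algebra k A" and spl: "splitting k A E \<iota> r m \<phi>" and spl': "splitting k A E' \<iota>' r' m' \<phi>'"
    and a: "a \<in> carrier A"
    and g: "\<And>x. x \<in> carrier E' \<Longrightarrow> g x \<in> carrier k"
    and ga: "\<And>x y. x \<in> carrier E' \<Longrightarrow> y \<in> carrier E' \<Longrightarrow> g (x \<oplus>\<^bsub>E'\<^esub> y) = g x \<oplus>\<^bsub>k\<^esub> g y"
    and gs: "\<And>c x. c \<in> carrier k \<Longrightarrow> x \<in> carrier E' \<Longrightarrow> g (\<iota>' c \<otimes>\<^bsub>E'\<^esub> x) = c \<otimes>\<^bsub>k\<^esub> g x"
    and g1: "g \<one>\<^bsub>E'\<^esub> = \<one>\<^bsub>k\<^esub>"
  shows "split_trace k A E \<iota> r m \<phi> a = \<iota> (g (split_trace k A E' \<iota>' r' m' \<phi>' a))"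
proof -
  note D = splittingD[OF spl] and D' = splittingD[OF spl']
  interpret X: scalar_ext k A E \<iota> by (rule scalar_extI[OF alg D(1)])
  interpret X': scalar_ext k A E' \<iota>' by (rule scalar_extI[OF alg D'(1)])
  interpret R: scalar_ext k "ext_algebra \<iota>' E'" E \<iota> by (rule scalar_extI[OF unital_algebra_ext_algebra[OF D'(1)] D(1)])
  let ?P = "Sigma {..<r} (\<lambda>l. {..<m l})" and ?P' = "Sigma {..<r'} (\<lambda>l. {..<m' l})"
  \<comment> \<open>The ring \<open>R = E \<otimes> E'\<close> is realised as the scalar extension
    to \<open>E\<close> of \<open>E'\<close>, viewed as a \<open>k\<close>-algebra; its
    commutativity is checked on pure tensors, one factor at a time.\<close>
  have comm: "s \<otimes>\<^bsub>R.S\<^esub> t = t \<otimes>\<^bsub>R.S\<^esub> s" if s: "s \<in> carrier R.S" and t: "t \<in> carrier R.S" for s t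
  proof (rule R.additive_eqI[of R.S "\<lambda>s. s \<otimes>\<^bsub>R.S\<^esub> t" "\<lambda>s. t \<otimes>\<^bsub>R.S\<^esub> s"])
    show "abelian_group_hom R.S R.S (\<lambda>s. s \<otimes>\<^bsub>R.S\<^esub> t)" "abelian_group_hom R.S R.S (\<lambda>s. t \<otimes>\<^bsub>R.S\<^esub> s)"
      by (rule abelian_group_homI'; use t in \<open>simp add: R.S.abelian_group_axioms R.S.l_distr R.S.r_distr\<close>)+
    fix x y assume xy: "x \<in> carrier E" "y \<in> carrier (ext_algebra \<iota>' E')"
    show "R.pure x y \<otimes>\<^bsub>R.S\<^esub> t = t \<otimes>\<^bsub>R.S\<^esub> R.pure x y"
    proof (rule R.additive_eqI[of R.S "\<lambda>t. R.pure x y \<otimes>\<^bsub>R.S\<^esub> t" "\<lambda>t. t \<otimes>\<^bsub>R.S\<^esub> R.pure x y"])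
      show "abelian_group_hom R.S R.S (\<lambda>t. t \<otimes>\<^bsub>R.S\<^esub> R.pure x y)" "abelian_group_hom R.S R.S (\<lambda>t. R.pure x y \<otimes>\<^bsub>R.S\<^esub> t)"
        by (rule abelian_group_homI'; use xy in \<open>simp add: R.S.abelian_group_axioms R.S.l_distr R.S.r_distr\<close>)+
      show "R.pure x y \<otimes>\<^bsub>R.S\<^esub> R.pure z w = R.pure z w \<otimes>\<^bsub>R.S\<^esub> R.pure x y" if "z \<in> carrier E" "w \<in> carrier (ext_algebra \<iota>' E')" for z w
        using xy that by (simp add: R.pure_mult X.K.m_comm X'.K.m_comm)
    qed (rule t)
  qed (rule s)
  have cR: "cring R.S"
    using comm by (intro cring.intro R.ring_S comm_monoid.intro R.S.monoid_axioms comm_monoid_axioms.intro)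
  interpret RC: cring R.S by (rule cR)
  define j where "j x = R.pure x \<one>\<^bsub>E'\<^esub>" for x
  define j' where "j' y = R.pure \<one>\<^bsub>E\<^esub> y" for y
  have j: "j \<in> ring_hom E R.S"
    unfolding j_def using R.pure_one by (intro ring_hom_memI) (simp_all add: R.pure_mult R.pure_add_left)
  have j': "j' \<in> ring_hom E' R.S"
    unfolding j'_def using R.pure_one R.pure_add_right by (intro ring_hom_memI) (simp_all add: R.pure_mult)
  \<comment> \<open>The two maps from \<open>k\<close> into \<open>R\<close> agree by balancedness,
    so that both systems of coordinates live on the same algebra \<open>?M\<close>.\<close>
  have jj: "j' (\<iota>' c) = j (\<iota> c)" if "c \<in> carrier k" for c
    using R.pure_smult[of "\<one>\<^bsub>E\<^esub>" "\<one>\<^bsub>E'\<^esub>" c] that by (simp add: j_def j'_def)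
  define \<kappa> where "\<kappa> c = j (\<iota> c)" for c
  obtain f where f: "matrix_coordinates E X.S ?P fst (entry E \<phi>) f" using X.iso_matrix_coordinates[OF D(3)] by blast
  obtain f' where f': "matrix_coordinates E' X'.S ?P' fst (entry E' \<phi>') f'" using X'.iso_matrix_coordinates[OF D'(3)] by blast
  let ?M = "scalar_extension k A R.S \<kappa>" and ?a = "pure_tensor k A R.S \<kappa> \<one>\<^bsub>R.S\<^esub> a"
  interpret T: scalar_ext_cring k A R.S \<kappa>
    by (intro scalar_ext_cring.intro alg cR)
       (use X.\<iota>.homh j in \<open>auto simp: \<kappa>_def ring_hom_def\<close>)
  obtain C F where C: "matrix_coordinates R.S ?M ?P fst C F"
    and Cp: "\<And>p q. p \<in> ?P \<Longrightarrow> q \<in> ?P \<Longrightarrow> C p q ?a = j (entry E \<phi> p q (X.pure \<one>\<^bsub>E\<^esub> a))"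
    using X.base_change_coordinates[OF f cR j, of \<kappa>] a \<kappa>_def by blast
  obtain C' F' where C': "matrix_coordinates R.S ?M ?P' fst C' F'"
    and Cp': "\<And>p q. p \<in> ?P' \<Longrightarrow> q \<in> ?P' \<Longrightarrow> C' p q ?a = j' (entry E' \<phi>' p q (X'.pure \<one>\<^bsub>E'\<^esub> a))"
    using X'.base_change_coordinates[OF f' cR j', of \<kappa>] a jj \<kappa>_def by metis
  interpret f: matrix_coordinates E X.S ?P fst "entry E \<phi>" f by (rule f)
  interpret f': matrix_coordinates E' X'.S ?P' fst "entry E' \<phi>'" f' by (rule f')
  interpret C: matrix_coordinates R.S ?M ?P fst C F by (rule C)
  interpret C': matrix_coordinates R.S ?M ?P' fst C' F' by (rule C')
  let ?t = "f.tr (X.pure \<one>\<^bsub>E\<^esub> a)" and ?t' = "f'.tr (X'.pure \<one>\<^bsub>E'\<^esub> a)"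
  have pa: "X.pure \<one>\<^bsub>E\<^esub> a \<in> carrier X.S" "X'.pure \<one>\<^bsub>E'\<^esub> a \<in> carrier X'.S" using a by simp_all
  have t: "?t \<in> carrier E" "?t' \<in> carrier E'" using f.tr_closed f'.tr_closed pa by auto
  have "j ?t = (\<Oplus>\<^bsub>R.S\<^esub>p\<in>?P. j (entry E \<phi> p p (X.pure \<one>\<^bsub>E\<^esub> a)))"
    unfolding f.tr_def
    by (rule abelian_group_hom.hom_finsum[OF ring_hom_abelian_group_hom[OF X.K.ring_axioms R.ring_S j]])
       (use f.C_closed pa in blast)
  also have "\<dots> = C.tr ?a"
    unfolding C.tr_def by (rule R.S.finsum_cong') (use Cp f.C_closed pa ring_hom_closed[OF j] in auto)
  also have "\<dots> = C'.tr ?a" by (rule trace_unique[OF C C']) (use a in simp)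
  also have "\<dots> = (\<Oplus>\<^bsub>R.S\<^esub>p\<in>?P'. j' (entry E' \<phi>' p p (X'.pure \<one>\<^bsub>E'\<^esub> a)))"
    unfolding C'.tr_def by (rule R.S.finsum_cong') (use Cp' f'.C_closed pa ring_hom_closed[OF j'] in auto)
  also have "\<dots> = j' ?t'"
    unfolding f'.tr_def
    by (rule abelian_group_hom.hom_finsum[OF ring_hom_abelian_group_hom[OF X'.K.ring_axioms R.ring_S j'], symmetric])
       (use f'.C_closed pa in blast)
  finally have eq: "R.pure ?t \<one>\<^bsub>E'\<^esub> = R.pure \<one>\<^bsub>E\<^esub> ?t'" by (simp only: j_def j'_def)
  \<comment> \<open>\<open>G\<close> is the \<open>E\<close>-linear map from \<open>R\<close> to
    \<open>E\<close> given by \<open>g\<close> on the right factor. On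
    \<open>T \<otimes> 1 = 1 \<otimes> T'\<close> it gives \<open>T\<close> on one side, by
    \<open>g1\<close>, and \<open>\<iota> (g T')\<close> on the other.\<close>
  obtain G where G: "\<And>x y. \<lbrakk>x \<in> carrier E; y \<in> carrier (ext_algebra \<iota>' E')\<rbrakk> \<Longrightarrow> G (R.pure x y) = x \<otimes>\<^bsub>E\<^esub> \<iota> (g y)"
    apply (rule R.functional_lift[of g])
    subgoal using g by simp
    subgoal using ga by simp
    subgoal using gs by simp
    subgoal premises prems by (rule prems(1)[OF prems(3)])
    done
  have "?t = G (R.pure ?t \<one>\<^bsub>E'\<^esub>)" using G[of ?t "\<one>\<^bsub>E'\<^esub>"] t g1 by simp
  also have "\<dots> = \<iota> (g ?t')" using G[of "\<one>\<^bsub>E\<^esub>" ?t'] t g eq by simp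
  finally show ?thesis using split_trace_eq_tr[OF alg spl a] split_trace_eq_tr[OF alg spl' a] by simp
qed

text \<open>Apply \<open>split_trace_retract\<close> with one retraction \<open>g\<close> of
  \<open>E'\<close>, once to the pair of \<open>E\<close> and \<open>E'\<close> and once to
  \<open>E'\<close> with itself: both traces are images of the same element
  \<open>g T'\<close>.\<close>

lemma split_trace_rational:
  assumes alg: "unital_algebra k A" and spl: "splitting k A E \<iota> r m \<phi>" and spl': "splitting k A E' \<iota>' r' m' \<phi>'"
    and a: "a \<in> carrier A"
  shows "\<exists>t\<in>carrier k. split_trace k A E \<iota> r m \<phi> a = \<iota> t \<and> split_trace k A E' \<iota>' r' m' \<phi>' a = \<iota>' t"
proof -
  note D' = splittingD[OF spl']
  interpret k: field k using D'(1) by (simp add: field_extension_def)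
  obtain g where g: "\<And>x. x \<in> carrier E' \<Longrightarrow> g x \<in> carrier k"
    "\<And>x y. x \<in> carrier E' \<Longrightarrow> y \<in> carrier E' \<Longrightarrow> g (x \<oplus>\<^bsub>E'\<^esub> y) = g x \<oplus>\<^bsub>k\<^esub> g y"
    "\<And>c x. c \<in> carrier k \<Longrightarrow> x \<in> carrier E' \<Longrightarrow> g (\<iota>' c \<otimes>\<^bsub>E'\<^esub> x) = c \<otimes>\<^bsub>k\<^esub> g x"
    "\<And>c. c \<in> carrier k \<Longrightarrow> g (\<iota>' c) = c"
    apply (rule exists_retraction[OF D'(1,2)])
    subgoal premises prems by (rule prems(1)[OF prems(2-)])
    done
  have "\<iota>' \<in> ring_hom k E'" using D'(1) by (simp add: field_extension_def)
  then have g1: "g \<one>\<^bsub>E'\<^esub> = \<one>\<^bsub>k\<^esub>" using g(4)[OF k.one_closed] ring_hom_one[of \<iota>' k E'] by simp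
  interpret X': scalar_ext k A E' \<iota>' by (rule scalar_extI[OF alg D'(1)])
  obtain f where "matrix_coordinates E' X'.S (Sigma {..<r'} (\<lambda>l. {..<m' l})) fst (entry E' \<phi>') f"
    using X'.iso_matrix_coordinates[OF D'(3)] by blast
  then interpret C: matrix_coordinates E' X'.S "Sigma {..<r'} (\<lambda>l. {..<m' l})" fst "entry E' \<phi>'" f .
  let ?T = "split_trace k A E' \<iota>' r' m' \<phi>' a"
  have "?T \<in> carrier E'" using split_trace_eq_tr[OF alg spl' a] C.tr_closed a by simp
  then show ?thesis
    using split_trace_retract[OF alg spl spl' a g(1-3) g1] split_trace_retract[OF alg spl' spl' a g(1-3) g1] g(1) by blast
qed

section \<open>Invariance, well-definedness and non-degeneracy of the reduced trace\<close>

lemma (in scalar_ext) automorphism_extends: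
  assumes u: "u \<in> algebra_iso k A A"
  shows "\<exists>U. U \<in> algebra_iso K S S \<and> (\<forall>x\<in>carrier K. \<forall>a\<in>carrier A. U (pure x a) = pure x (u a))"
proof -
  have hom: "u \<in> ring_hom A A" and bij: "bij_betw u (carrier A) (carrier A)"
    and sm: "\<And>c x. c \<in> carrier k \<Longrightarrow> x \<in> carrier A \<Longrightarrow> u (c \<odot>\<^bsub>A\<^esub> x) = c \<odot>\<^bsub>A\<^esub> u x"
    using u by (auto simp: algebra_iso_def ring_iso_def)
  define v where "v = inv_into (carrier A) u"
  have vu: "v (u x) = x" if "x \<in> carrier A" for x using bij that by (simp add: v_def bij_betw_def)
  have uv: "u (v x) = x" "v x \<in> carrier A" if "x \<in> carrier A" for x
    using bij that by (auto simp: v_def bij_betw_def f_inv_into_f inv_into_into)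
  note uc = ring_hom_closed[OF hom]
  have vhom: "v \<in> ring_hom A A"
  proof (rule ring_hom_memI)
    show "v (x \<otimes>\<^bsub>A\<^esub> y) = v x \<otimes>\<^bsub>A\<^esub> v y" if "x \<in> carrier A" "y \<in> carrier A" for x y
      using vu[of "v x \<otimes>\<^bsub>A\<^esub> v y"] ring_hom_mult[OF hom, of "v x" "v y"] uv that by simp
    show "v (x \<oplus>\<^bsub>A\<^esub> y) = v x \<oplus>\<^bsub>A\<^esub> v y" if "x \<in> carrier A" "y \<in> carrier A" for x y
      using vu[of "v x \<oplus>\<^bsub>A\<^esub> v y"] ring_hom_add[OF hom, of "v x" "v y"] uv that by simp
    show "v \<one>\<^bsub>A\<^esub> = \<one>\<^bsub>A\<^esub>" using vu[of "\<one>\<^bsub>A\<^esub>"] ring_hom_one[OF hom] by simp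
  qed (rule uv)
  have vsm: "v (c \<odot>\<^bsub>A\<^esub> x) = c \<odot>\<^bsub>A\<^esub> v x" if "c \<in> carrier k" "x \<in> carrier A" for c x
    using vu[of "c \<odot>\<^bsub>A\<^esub> v x"] sm[of c "v x"] uv that by simp
  \<comment> \<open>Formulated for any linear ring endomorphism \<open>w\<close>, as it is needed
    for \<open>u\<close> and for its inverse.\<close>
  have lift: "\<exists>U. U \<in> ring_hom S S \<and> (\<forall>x\<in>carrier K. \<forall>a\<in>carrier A. U (pure x a) = pure x (w a))"
    if w: "w \<in> ring_hom A A" and wsm: "\<And>c x. c \<in> carrier k \<Longrightarrow> x \<in> carrier A \<Longrightarrow> w (c \<odot>\<^bsub>A\<^esub> x) = c \<odot>\<^bsub>A\<^esub> w x" for w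
  proof (rule ring_lift_exists[of S "\<lambda>x. pure x \<one>\<^bsub>A\<^esub>" "\<lambda>a. pure \<one>\<^bsub>K\<^esub> (w a)"])
    note w' = ring_hom_closed[OF w] ring_hom_mult[OF w] ring_hom_add[OF w] ring_hom_one[OF w]
    show "ring S" by (rule ring_S)
    show "(\<lambda>x. pure x \<one>\<^bsub>A\<^esub>) \<in> ring_hom K S"
      by (rule ring_hom_memI) (simp_all add: pure_mult pure_add_left pure_one)
    show "(\<lambda>a. pure \<one>\<^bsub>K\<^esub> (w a)) \<in> ring_hom A S"
      by (rule ring_hom_memI) (simp_all add: w' pure_mult pure_add_right pure_one)
    show "pure \<one>\<^bsub>K\<^esub> (w a) \<otimes>\<^bsub>S\<^esub> pure x \<one>\<^bsub>A\<^esub> = pure x \<one>\<^bsub>A\<^esub> \<otimes>\<^bsub>S\<^esub> pure \<one>\<^bsub>K\<^esub> (w a)"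
      if "x \<in> carrier K" "a \<in> carrier A" for x a using that w' by (simp add: pure_mult)
    show "pure \<one>\<^bsub>K\<^esub> (w (c \<odot>\<^bsub>A\<^esub> a)) = pure (\<iota> c) \<one>\<^bsub>A\<^esub> \<otimes>\<^bsub>S\<^esub> pure \<one>\<^bsub>K\<^esub> (w a)"
      if "c \<in> carrier k" "a \<in> carrier A" for c a using that w' wsm by (simp add: pure_mult pure_smult)
    fix U assume U: "U \<in> ring_hom S S"
      "\<And>x a. x \<in> carrier K \<Longrightarrow> a \<in> carrier A \<Longrightarrow> U (pure x a) = pure x \<one>\<^bsub>A\<^esub> \<otimes>\<^bsub>S\<^esub> pure \<one>\<^bsub>K\<^esub> (w a)"
    have "U (pure x a) = pure x (w a)" if "x \<in> carrier K" "a \<in> carrier A" for x a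
      using U(2)[OF that] that w' by (simp add: pure_mult)
    then show ?thesis using U(1) by blast
  qed
  obtain U where U: "U \<in> ring_hom S S" and Up: "\<And>x a. x \<in> carrier K \<Longrightarrow> a \<in> carrier A \<Longrightarrow> U (pure x a) = pure x (u a)"
    using lift[OF hom sm] by blast
  obtain V where V: "V \<in> ring_hom S S" and Vp: "\<And>x a. x \<in> carrier K \<Longrightarrow> a \<in> carrier A \<Longrightarrow> V (pure x a) = pure x (v a)"
    using lift[OF vhom vsm] by blast
  have id: "abelian_group_hom S S (\<lambda>s. s)" by (rule abelian_group_homI') (simp_all add: S.abelian_group_axioms)
  have VU: "V (U s) = s" if s: "s \<in> carrier S" for s
    by (rule additive_eqI[OF _ id _ s, of "\<lambda>s. V (U s)"])
       (use ring_hom_closed[OF U] ring_hom_closed[OF V] ring_hom_add[OF U] ring_hom_add[OF V] Up Vp uc vu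
         in \<open>simp_all add: abelian_group_homI' S.abelian_group_axioms\<close>)
  have UV: "U (V s) = s" if s: "s \<in> carrier S" for s
    by (rule additive_eqI[OF _ id _ s, of "\<lambda>s. U (V s)"])
       (use ring_hom_closed[OF U] ring_hom_closed[OF V] ring_hom_add[OF U] ring_hom_add[OF V] Up Vp uv
         in \<open>simp_all add: abelian_group_homI' S.abelian_group_axioms\<close>)
  have "bij_betw U (carrier S) (carrier S)"
    by (rule bij_betw_byWitness[of _ V]) (use VU UV ring_hom_closed[OF U] ring_hom_closed[OF V] in blast)+
  moreover have "U (x \<odot>\<^bsub>S\<^esub> s) = x \<odot>\<^bsub>S\<^esub> U s" if "x \<in> carrier K" "s \<in> carrier S" for x s
    using that ring_hom_mult[OF U] Up[of x "\<one>\<^bsub>A\<^esub>"] ring_hom_one[OF hom] by (simp add: S_simps(6))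
  ultimately have "U \<in> algebra_iso K S S" using U by (simp add: algebra_iso_def ring_iso_def)
  then show ?thesis using Up by blast
qed

lemma algebra_iso_comp:
  assumes U: "U \<in> algebra_iso K S T" and phi: "\<phi> \<in> algebra_iso K T B"
  shows "\<phi> \<circ> U \<in> algebra_iso K S B"
proof -
  have U': "U \<in> ring_hom S T" "bij_betw U (carrier S) (carrier T)"
    and \<phi>': "\<phi> \<in> ring_hom T B" "bij_betw \<phi> (carrier T) (carrier B)"
    using U phi by (auto simp: algebra_iso_def ring_iso_def)
  show ?thesis
    using U phi ring_hom_trans[OF U'(1) \<phi>'(1)] bij_betw_trans[OF U'(2) \<phi>'(2)] ring_hom_closed[OF U'(1)]
    by (simp add: algebra_iso_def ring_iso_def)
qed

text \<open>The description in \<open>reduced_trace\<close> has a solution because the split trace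
  is rational, and only one: the splitting that witnesses another solution is compared with the
  given one, and the embeddings of \<open>k\<close> are injective.\<close>

lemma reduced_trace_eq:
  fixes E :: "'k ext_elem ring" and k :: "('k, 'x) ring_scheme"
  assumes alg: "unital_algebra k A" and spl: "splitting k A E \<iota> r m \<phi>" and a: "a \<in> carrier A"
  shows "reduced_trace k A a \<in> carrier k" "\<iota> (reduced_trace k A a) = split_trace k A E \<iota> r m \<phi> a"
proof -
  have inj: "inj_on i (carrier k)" if "splitting k A F i r' m' \<psi>" for F :: "'k ext_elem ring" and i r' m' \<psi>
    using splittingD(1)[OF that] by (auto simp: field_extension_def intro: non_trivial_field_hom_is_inj)
  obtain t where t: "t \<in> carrier k" "split_trace k A E \<iota> r m \<phi> a = \<iota> t"
    using split_trace_rational[OF alg spl spl a] by blast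
  have "reduced_trace k A a = t"
    unfolding reduced_trace_def split_trace_def[symmetric]
  proof (rule the_equality)
    show "t \<in> carrier k \<and> (\<exists>(E :: 'k ext_elem ring) \<iota> r m \<phi>. splitting k A E \<iota> r m \<phi> \<and> \<iota> t = split_trace k A E \<iota> r m \<phi> a)"
      using t spl by metis
    fix s assume "s \<in> carrier k \<and> (\<exists>(E :: 'k ext_elem ring) \<iota> r m \<phi>. splitting k A E \<iota> r m \<phi> \<and> \<iota> s = split_trace k A E \<iota> r m \<phi> a)"
    then obtain F :: "'k ext_elem ring" and i r' m' \<psi> where s: "s \<in> carrier k" "splitting k A F i r' m' \<psi>" "i s = split_trace k A F i r' m' \<psi> a"
      by blast
    obtain t' where t': "t' \<in> carrier k" "split_trace k A E \<iota> r m \<phi> a = \<iota> t'" "split_trace k A F i r' m' \<psi> a = i t'"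
      using split_trace_rational[OF alg spl s(2) a] by blast
    have "t = t'" using inj_onD[OF inj[OF spl]] t t' by simp
    moreover have "s = t'" using inj_onD[OF inj[OF s(2)]] s t' by simp
    ultimately show "s = t" by simp
  qed
  then show "reduced_trace k A a \<in> carrier k" "\<iota> (reduced_trace k A a) = split_trace k A E \<iota> r m \<phi> a" using t by auto
qed

lemma reduced_trace_automorphism:
  fixes E :: "'k ext_elem ring" and k :: "('k, 'x) ring_scheme"
  assumes alg: "unital_algebra k A" and spl: "splitting k A E \<iota> r m \<phi>" and u: "u \<in> algebra_iso k A A" and a: "a \<in> carrier A"
  shows "reduced_trace k A (u a) = reduced_trace k A a"
proof -
  note D = splittingD[OF spl]
  interpret X: scalar_ext k A E \<iota> by (rule scalar_extI[OF alg D(1)])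
  obtain U where U: "U \<in> algebra_iso E X.S X.S" "\<And>x a. x \<in> carrier E \<Longrightarrow> a \<in> carrier A \<Longrightarrow> U (X.pure x a) = X.pure x (u a)"
    using X.automorphism_extends[OF u] by blast
  have spl': "splitting k A E \<iota> r m (\<phi> \<circ> U)"
    using spl algebra_iso_comp[OF U(1) D(3)] by (simp add: splitting_def)
  have ua: "u a \<in> carrier A" using u a by (auto simp: algebra_iso_def ring_iso_def intro: ring_hom_closed)
  have "\<iota> (reduced_trace k A a) = \<iota> (reduced_trace k A (u a))"
    using reduced_trace_eq(2)[OF alg spl' a] reduced_trace_eq(2)[OF alg spl ua] U(2)[OF X.K.one_closed a]
    by (simp add: split_trace_def)
  moreover have "inj_on \<iota> (carrier k)" using D(1) by (auto simp: field_extension_def intro: non_trivial_field_hom_is_inj)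
  ultimately show ?thesis using reduced_trace_eq(1)[OF alg spl a] reduced_trace_eq(1)[OF alg spl ua] by (metis inj_onD)
qed

text \<open>The hypothesis compares two elements because \<open>reduced_trace\<close> is a
  description, whose additivity becomes visible only after applying \<iota>; the difference is
  therefore formed in the trace over \<open>E\<close>. There \<open>b = c - d\<close> is orthogonal
  to all pure tensors by \<open>E\<close>-linearity, hence to everything, and it vanishes by
  injectivity of \<open>a \<mapsto> 1 \<otimes> a\<close>.\<close>

lemma reduced_trace_nondegenerate:
  fixes E :: "'k ext_elem ring" and k :: "('k, 'x) ring_scheme"
  assumes alg: "unital_algebra k A" and fd: "finite_dimensional k A" and spl: "splitting k A E \<iota> r m \<phi>"
    and c: "c \<in> carrier A" and d: "d \<in> carrier A"
    and eq: "\<And>x. x \<in> carrier A \<Longrightarrow> reduced_trace k A (c \<otimes>\<^bsub>A\<^esub> x) = reduced_trace k A (d \<otimes>\<^bsub>A\<^esub> x)"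
  shows "c = d"
proof -
  note D = splittingD[OF spl]
  interpret A: unital_algebra k A by (rule alg)
  obtain B h where dual: "is_dual_basis k A B h"
    using exists_dual_basis[OF A.field_axioms A.module_axioms fd] by blast
  interpret X: scalar_ext_basis k A E \<iota> B h
    by (intro scalar_ext_basis.intro scalar_extI scalar_ext_basis_axioms.intro alg D(1) dual)
  obtain f where "matrix_coordinates E X.S (Sigma {..<r} (\<lambda>l. {..<m l})) fst (entry E \<phi>) f"
    using X.iso_matrix_coordinates[OF D(3)] by blast
  then interpret C: matrix_coordinates E X.S "Sigma {..<r} (\<lambda>l. {..<m l})" fst "entry E \<phi>" f .
  define b where "b = c \<ominus>\<^bsub>A\<^esub> d"
  have b: "b \<in> carrier A" using c d by (simp add: b_def)
  have cb: "c = b \<oplus>\<^bsub>A\<^esub> d" using c d by (simp add: b_def a_minus_def A.M.a_assoc A.M.l_neg)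
  have z: "C.tr (X.pure \<one>\<^bsub>E\<^esub> (b \<otimes>\<^bsub>A\<^esub> x)) = \<zero>\<^bsub>E\<^esub>" if x: "x \<in> carrier A" for x
  proof -
    have trd: "C.tr (X.pure \<one>\<^bsub>E\<^esub> y) = \<iota> (reduced_trace k A y)" if "y \<in> carrier A" for y
      using reduced_trace_eq(2)[OF alg spl that] split_trace_eq_tr[OF alg spl that] by simp
    have "C.tr (X.pure \<one>\<^bsub>E\<^esub> (c \<otimes>\<^bsub>A\<^esub> x)) = C.tr (X.pure \<one>\<^bsub>E\<^esub> (b \<otimes>\<^bsub>A\<^esub> x)) \<oplus>\<^bsub>E\<^esub> C.tr (X.pure \<one>\<^bsub>E\<^esub> (d \<otimes>\<^bsub>A\<^esub> x))"
      using x b d by (simp add: cb A.A.l_distr X.pure_add_right C.tr_add)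
    moreover have "C.tr (X.pure \<one>\<^bsub>E\<^esub> (c \<otimes>\<^bsub>A\<^esub> x)) = C.tr (X.pure \<one>\<^bsub>E\<^esub> (d \<otimes>\<^bsub>A\<^esub> x))"
      using x c d eq by (simp add: trd)
    ultimately show ?thesis
      using X.K.add.r_cancel_one'[of "C.tr (X.pure \<one>\<^bsub>E\<^esub> (d \<otimes>\<^bsub>A\<^esub> x))" "C.tr (X.pure \<one>\<^bsub>E\<^esub> (b \<otimes>\<^bsub>A\<^esub> x))"] x b d
      by (simp add: C.tr_closed)
  qed
  have "X.pure \<one>\<^bsub>E\<^esub> b = \<zero>\<^bsub>X.S\<^esub>"
  proof (rule C.tr_nondegenerate)
    show "X.pure \<one>\<^bsub>E\<^esub> b \<in> carrier X.S" using b by simp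
    show "C.tr (X.pure \<one>\<^bsub>E\<^esub> b \<otimes>\<^bsub>X.S\<^esub> s) = \<zero>\<^bsub>E\<^esub>" if s: "s \<in> carrier X.S" for s
    proof (rule X.additive_eqI[of E "\<lambda>s. C.tr (X.pure \<one>\<^bsub>E\<^esub> b \<otimes>\<^bsub>X.S\<^esub> s)" "\<lambda>_. \<zero>\<^bsub>E\<^esub>"])
      show "abelian_group_hom X.S E (\<lambda>s. C.tr (X.pure \<one>\<^bsub>E\<^esub> b \<otimes>\<^bsub>X.S\<^esub> s))"
        by (rule abelian_group_homI') (use b in \<open>simp_all add: C.tr_closed C.tr_add X.S.r_distr X.S.abelian_group_axioms X.K.abelian_group_axioms\<close>)
      show "abelian_group_hom X.S E (\<lambda>_. \<zero>\<^bsub>E\<^esub>)"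
        by (rule abelian_group_homI') (simp_all add: X.S.abelian_group_axioms X.K.abelian_group_axioms)
      fix y x assume yx: "y \<in> carrier E" "x \<in> carrier A"
      have "X.pure \<one>\<^bsub>E\<^esub> b \<otimes>\<^bsub>X.S\<^esub> X.pure y x = y \<odot>\<^bsub>X.S\<^esub> X.pure \<one>\<^bsub>E\<^esub> (b \<otimes>\<^bsub>A\<^esub> x)"
        using yx b by (simp add: X.pure_mult X.smult_pure)
      then show "C.tr (X.pure \<one>\<^bsub>E\<^esub> b \<otimes>\<^bsub>X.S\<^esub> X.pure y x) = \<zero>\<^bsub>E\<^esub>"
        using C.tr_smult[of y "X.pure \<one>\<^bsub>E\<^esub> (b \<otimes>\<^bsub>A\<^esub> x)"] yx b z by simp
    qed (rule s)
  qed
  then have "b = \<zero>\<^bsub>A\<^esub>" by (rule X.pure_inj[OF b])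
  then show ?thesis using cb d by simp
qed

theorem lemma34:
  fixes k :: "('k, 'x) ring_scheme"
    and A :: "('k, 'a, 'y) module_scheme"
    and u :: "'a \<Rightarrow> 'a"
  assumes "separable_algebra k A"
    and "u \<in> algebra_iso k A A"
  shows "nakayama_jacobian A (reduced_trace_form k A) u = \<one>\<^bsub>A\<^esub>"
proof -
  have alg: "unital_algebra k A" and fd: "finite_dimensional k A"
    using assms(1) by (auto simp: separable_algebra_def)
  interpret A: unital_algebra k A by (rule alg)
  have hom: "u \<in> ring_hom A A" using assms(2) by (simp add: algebra_iso_def ring_iso_def)
  note uc = ring_hom_closed[OF hom]
  show ?thesis
  proof (cases "\<one>\<^bsub>A\<^esub> = \<zero>\<^bsub>A\<^esub>")
    \<comment> \<open>The zero algebra has no splitting, as \<open>r\<close> and the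
      \<open>m i\<close> are positive, so \<open>reduced_trace\<close> is an unspecified value here.
      But all products are the same element, which makes both sides of the equation
      identical.\<close>
    case True
    have triv: "x = \<zero>\<^bsub>A\<^esub>" if "x \<in> carrier A" for x
      using A.A.l_one[OF that] A.A.l_null[OF that] True by simp
    show ?thesis unfolding nakayama_jacobian_def reduced_trace_form_def
    proof (rule the_equality)
      show "\<one>\<^bsub>A\<^esub> \<in> carrier A \<and> (\<forall>a\<in>carrier A. \<forall>b\<in>carrier A.
          reduced_trace k A (u a \<otimes>\<^bsub>A\<^esub> u b) = reduced_trace k A (\<one>\<^bsub>A\<^esub> \<otimes>\<^bsub>A\<^esub> a \<otimes>\<^bsub>A\<^esub> b))"
      proof (intro conjI ballI)
        fix a b assume "a \<in> carrier A" "b \<in> carrier A"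
        then have "u a \<otimes>\<^bsub>A\<^esub> u b \<in> carrier A" "\<one>\<^bsub>A\<^esub> \<otimes>\<^bsub>A\<^esub> a \<otimes>\<^bsub>A\<^esub> b \<in> carrier A" using uc by auto
        from this[THEN triv] show "reduced_trace k A (u a \<otimes>\<^bsub>A\<^esub> u b) = reduced_trace k A (\<one>\<^bsub>A\<^esub> \<otimes>\<^bsub>A\<^esub> a \<otimes>\<^bsub>A\<^esub> b)"
          by (simp only:)
      qed simp
    next
      fix j assume "j \<in> carrier A \<and> (\<forall>a\<in>carrier A. \<forall>b\<in>carrier A.
          reduced_trace k A (u a \<otimes>\<^bsub>A\<^esub> u b) = reduced_trace k A (j \<otimes>\<^bsub>A\<^esub> a \<otimes>\<^bsub>A\<^esub> b))"
      then show "j = \<one>\<^bsub>A\<^esub>" using triv[of j] True by simp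
    qed
  next
    case False
    obtain E :: "'k ext_elem ring" and \<iota> r m \<phi> where spl: "splitting k A E \<iota> r m \<phi>"
      using exists_splitting[OF assms(1) False] by blast
    have inv: "reduced_trace k A (u a \<otimes>\<^bsub>A\<^esub> u b) = reduced_trace k A (a \<otimes>\<^bsub>A\<^esub> b)"
      if "a \<in> carrier A" "b \<in> carrier A" for a b
      using reduced_trace_automorphism[OF alg spl assms(2), of "a \<otimes>\<^bsub>A\<^esub> b"] that ring_hom_mult[OF hom that] by simp
    show ?thesis unfolding nakayama_jacobian_def reduced_trace_form_def
    proof (rule the_equality)
      show "\<one>\<^bsub>A\<^esub> \<in> carrier A \<and> (\<forall>a\<in>carrier A. \<forall>b\<in>carrier A.
          reduced_trace k A (u a \<otimes>\<^bsub>A\<^esub> u b) = reduced_trace k A (\<one>\<^bsub>A\<^esub> \<otimes>\<^bsub>A\<^esub> a \<otimes>\<^bsub>A\<^esub> b))"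
        using inv by simp
    next
      fix j assume j: "j \<in> carrier A \<and> (\<forall>a\<in>carrier A. \<forall>b\<in>carrier A.
          reduced_trace k A (u a \<otimes>\<^bsub>A\<^esub> u b) = reduced_trace k A (j \<otimes>\<^bsub>A\<^esub> a \<otimes>\<^bsub>A\<^esub> b))"
      show "j = \<one>\<^bsub>A\<^esub>"
      proof (rule reduced_trace_nondegenerate[OF alg fd spl])
        fix x assume x: "x \<in> carrier A"
        \<comment> \<open>The equation of \<open>j\<close> at \<open>a = 1\<close> pairs
          \<open>j\<close> with an arbitrary \<open>x\<close>, and invariance gives the same value
          for \<open>1\<close>.\<close>
        have "reduced_trace k A (u \<one>\<^bsub>A\<^esub> \<otimes>\<^bsub>A\<^esub> u x) = reduced_trace k A (j \<otimes>\<^bsub>A\<^esub> \<one>\<^bsub>A\<^esub> \<otimes>\<^bsub>A\<^esub> x)" using j x by blast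
        then show "reduced_trace k A (j \<otimes>\<^bsub>A\<^esub> x) = reduced_trace k A (\<one>\<^bsub>A\<^esub> \<otimes>\<^bsub>A\<^esub> x)" using inv[OF A.A.one_closed x] j by simp
      qed (use j in auto)
    qed
  qed
qed



end
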